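(* Consider the discrete memoryless state-dependent multiple access channel $p_{Y|X_1,X_2,S_1,S_2}$ with two state components, where Encoder 1 knows $S_1^n$ non-causally, Encoder 2 knows $S_2^n$ non-causally, the decoder knows $(S_1^n,S_2^n)$, and Encoder 2 observes in a strictly causal manner the partial cribbing signal $Z_i=z(X_{1,i},S_{1,i})$. Its capacity region is the set of rate pairs $(R_1,R_2)$ that satisfy \begin{align*} R_1&\le I(X_1;Y|X_2,Z,S_1,S_2,U)+H(Z|S_1,U)-I(U;S_1|S_2),\\ R_2&\le I(X_2;Y|X_1,S_1,S_2,U),\\ R_1+R_2&\le I(X_1,X_2;Y|Z,S_1,S_2,U)+H(Z|S_1,U)-I(U;S_1|S_2),\\ R_1+R_2&\le I(X_1,X_2;Y|S_1,S_2) \end{align*} for some PMF of the form $p_{X_1,U|S_1}\,p_{X_2|U,S_2}$, with $Z=z(X_1,S_1)$, that satisfies $$I(U;S_1|S_2)\le H(Z|S_1,U),$$ and with $|\mathcal{U}|\le\min\{|\mathcal{S}_2||\mathcal{S}_1||\mathcal{X}_1||\mathcal{X}_2|+2,\ |\mathcal{S}_1||\mathcal{S}_2||\mathcal{Y}|+3\}$. Here all information quantities are computed under $p_{S_1,S_2}\,p_{X_1,U|S_1}\,\mathbf{1}[Z=z(X_1,S_1)]\,p_{X_2|U,S_2}\,p_{Y|X_1,X_2,S_1,S_2}$.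
   Context: All alphabets $\mathcal{X}_1,\mathcal{X}_2,\mathcal{S}_1,\mathcal{S}_2,\mathcal{Z},\mathcal{Y}$ are finite; $U$ is an auxiliary random variable with alphabet $\mathcal{U}$; logarithms are base 2; $x^n=(x_1,\dots,x_n)$; $[1:2^{nR}]$ denotes the set of integers from $1$ to $2^{nR}$ (with $2^{nR}$ treated as an integer). Channel model. The state pairs $(S_{1,i},S_{2,i})$, $i=1,\dots,n$, are i.i.d. with PMF $p_{S_1,S_2}$ (the two components may be dependent). The messages $M_1,M_2$ are uniform on $[1:2^{nR_1}]$ and $[1:2^{nR_2}]$, independent of each other and of the states. The function $z:\mathcal{X}_1\times\mathcal{S}_1\to\mathcal{Z}$ is fixed. The channel is memoryless and without feedback: given the inputs and states at time $i$, $Y_i$ is drawn from $p_{Y|X_1,X_2,S_1,S_2}(\cdot|x_{1,i},x_{2,i},s_{1,i},s_{2,i})$ independently of everything else up to time $i$. An $(R_1,R_2,n)$ code $\mathcal{C}_n$ (strictly causal cribbing) consists of: $x_1^n:[1:2^{nR_1}]\times\mathcal{S}_1^n\to\mathcal{X}_1^n$; $x_{2,i}:[1:2^{nR_2}]\times\mathcal{S}_2^n\times\mathcal{Z}^{i-1}\to\mathcal{X}_2$ for $1\le i\le n$; decoders $\hat m_w:\mathcal{Y}^n\times\mathcal{S}_1^n\times\mathcal{S}_2^n\to[1:2^{nR_w}]$, $w=1,2$. Encoder 2 transmits $X_{2,i}=x_{2,i}(M_2,S_2^n,Z^{i-1})$. A rate pair $(R_1,R_2)$ is achievable if for any $\epsilon>0$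 and some sufficiently large $n$ there exists an $(R_1,R_2,n)$ code with $\Pr[(\hat m_1(Y^n,S_1^n,S_2^n),\hat m_2(Y^n,S_1^n,S_2^n))\ne(M_1,M_2)]\le\epsilon$. The capacity region is defined to be the union of all achievable rate pairs, that is, the set of all achievable rate pairs.
   Formalization: The capacity region is taken to be the closure of the set of achievable rate pairs (nonnegative rates); without closure the claim fails, e.g. for a binary symmetric channel at rate exactly its capacity. *)

theory Defs
  imports "HOL-Probability.Probability"
begin

text \<open>
  Finite alphabets are types of class \<^class>\<open>finite\<close>.  A sequence \<open>x\<^sup>n\<close> is a function on
  \<^typ>\<open>nat\<close> of which only the values on \<open>{1..n}\<close> matter.
\<close>

text \<open>The integers from \<open>1\<close> to \<open>2\<^sup>n\<^sup>R\<close>; nonempty for \<open>R \<ge> 0\<close>.\<close>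

definition messages :: "nat \<Rightarrow> real \<Rightarrow> nat set" where
  "messages n R = {1..nat \<lfloor>2 powr (real n * R)\<rfloor>}"

text \<open>
  Encoder 2 at time \<open>i\<close> is handed the cribbing sequence cut down to \<open>{1..<i}\<close>, so it sees
  exactly \<open>z\<^sup>i\<^sup>-\<^sup>1\<close>.
\<close>

definition input2 ::
  "('x1 \<Rightarrow> 's1 \<Rightarrow> 'z) \<Rightarrow> (nat \<Rightarrow> (nat \<Rightarrow> 's1) \<Rightarrow> nat \<Rightarrow> 'x1)
    \<Rightarrow> (nat \<Rightarrow> nat \<Rightarrow> (nat \<Rightarrow> 's2) \<Rightarrow> (nat \<Rightarrow> 'z) \<Rightarrow> 'x2)
    \<Rightarrow> nat \<Rightarrow> nat \<Rightarrow> (nat \<Rightarrow> 's1) \<Rightarrow> (nat \<Rightarrow> 's2) \<Rightarrow> nat \<Rightarrow> 'x2" where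
  "input2 z enc1 enc2 m1 m2 s1 s2 i =
     enc2 i m2 s2 (restrict (\<lambda>j. z (enc1 m1 s1 j) (s1 j)) {1..<i})"

text \<open>
  The joint law of \<open>(M\<^sub>1, M\<^sub>2, S\<^sub>1\<^sup>n, S\<^sub>2\<^sup>n, Y\<^sup>n)\<close>.  Since the cribbing signal depends on the first
  input and state only, both input sequences are determined by the messages and states, and
  without feedback the outputs are then independent across time.
\<close>

definition transmission ::
  "('s1 \<times> 's2) pmf \<Rightarrow> ('x1 \<Rightarrow> 'x2 \<Rightarrow> 's1 \<Rightarrow> 's2 \<Rightarrow> 'y pmf) \<Rightarrow> ('x1 \<Rightarrow> 's1 \<Rightarrow> 'z)
    \<Rightarrow> real \<Rightarrow> real \<Rightarrow> nat
    \<Rightarrow> (nat \<Rightarrow> (nat \<Rightarrow> 's1) \<Rightarrow> nat \<Rightarrow> 'x1)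
    \<Rightarrow> (nat \<Rightarrow> nat \<Rightarrow> (nat \<Rightarrow> 's2) \<Rightarrow> (nat \<Rightarrow> 'z) \<Rightarrow> 'x2)
    \<Rightarrow> (nat \<times> nat \<times> (nat \<Rightarrow> 's1) \<times> (nat \<Rightarrow> 's2) \<times> (nat \<Rightarrow> 'y)) pmf" where
  "transmission pS W z R1 R2 n enc1 enc2 =
     do {
       m1 \<leftarrow> pmf_of_set (messages n R1);
       m2 \<leftarrow> pmf_of_set (messages n R2);
       s \<leftarrow> Pi_pmf {1..n} undefined (\<lambda>_. pS);
       let s1 = fst \<circ> s;
       let s2 = snd \<circ> s;
       y \<leftarrow> Pi_pmf {1..n} undefined
              (\<lambda>i. W (enc1 m1 s1 i) (input2 z enc1 enc2 m1 m2 s1 s2 i) (s1 i) (s2 i));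
       return_pmf (m1, m2, s1, s2, y)
     }"

text \<open>
  The last clause asks for good codes at arbitrarily large block lengths.  Asking for a single
  block length would be vacuous, since \<open>n = 0\<close> has one message per user.
\<close>

definition achievable ::
  "('s1 \<times> 's2) pmf \<Rightarrow> ('x1 \<Rightarrow> 'x2 \<Rightarrow> 's1 \<Rightarrow> 's2 \<Rightarrow> 'y pmf) \<Rightarrow> ('x1 \<Rightarrow> 's1 \<Rightarrow> 'z)
    \<Rightarrow> real \<Rightarrow> real \<Rightarrow> bool" where
  "achievable pS W z R1 R2 \<longleftrightarrow>
     0 \<le> R1 \<and> 0 \<le> R2 \<and>
     (\<forall>\<epsilon>>0. \<forall>N. \<exists>n\<ge>N. \<exists>enc1 enc2 dec1 dec2.
        (\<forall>y s1 s2. dec1 y s1 s2 \<in> messages n R1 \<and> dec2 y s1 s2 \<in> messages n R2) \<and>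
        measure_pmf.prob (transmission pS W z R1 R2 n enc1 enc2)
          {(m1, m2, s1, s2, y). (dec1 y s1 s2, dec2 y s1 s2) \<noteq> (m1, m2)} \<le> \<epsilon>)"

text \<open>
  The closure is essential: at a boundary pair the number of messages is (up to rounding)
  \<open>2\<^sup>n\<^sup>C\<close>, and for instance over a binary symmetric channel with crossover probability strictly
  between \<open>0\<close> and \<open>1/2\<close> the error probability at rate exactly \<open>C\<close> does not tend to \<open>0\<close>.
\<close>

definition capacity_region ::
  "('s1 \<times> 's2) pmf \<Rightarrow> ('x1 \<Rightarrow> 'x2 \<Rightarrow> 's1 \<Rightarrow> 's2 \<Rightarrow> 'y pmf) \<Rightarrow> ('x1 \<Rightarrow> 's1 \<Rightarrow> 'z)
    \<Rightarrow> (real \<times> real) set" where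
  "capacity_region pS W z = closure {(R1, R2). achievable pS W z R1 R2}"

text \<open>
  The law of \<open>(S\<^sub>1, S\<^sub>2, U, X\<^sub>1, X\<^sub>2, Y)\<close> with \<open>Q = p\<^sub>X\<^sub>1\<^sub>U\<^sub>|\<^sub>S\<^sub>1\<close> and \<open>T = p\<^sub>X\<^sub>2\<^sub>|\<^sub>U\<^sub>S\<^sub>2\<close>.
\<close>

definition joint_pmf ::
  "('s1 \<times> 's2) pmf \<Rightarrow> ('s1 \<Rightarrow> ('x1 \<times> 'u) pmf) \<Rightarrow> ('u \<Rightarrow> 's2 \<Rightarrow> 'x2 pmf)
    \<Rightarrow> ('x1 \<Rightarrow> 'x2 \<Rightarrow> 's1 \<Rightarrow> 's2 \<Rightarrow> 'y pmf)
    \<Rightarrow> ('s1 \<times> 's2 \<times> 'u \<times> 'x1 \<times> 'x2 \<times> 'y) pmf" where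
  "joint_pmf pS Q T W =
     do {
       (s1, s2) \<leftarrow> pS;
       (x1, u) \<leftarrow> Q s1;
       x2 \<leftarrow> T u s2;
       y \<leftarrow> W x1 x2 s1 s2;
       return_pmf (s1, s2, u, x1, x2, y)
     }"

text \<open>
  Conditional mutual information and conditional entropy in bits.  The reference measures are
  counting measures on the whole type rather than on the range over the sample space, which is
  infinite for \<open>U\<close>; atoms of probability zero contribute nothing.
\<close>

abbreviation cond_mutual_info ::
  "'w pmf \<Rightarrow> ('w \<Rightarrow> 'a) \<Rightarrow> ('w \<Rightarrow> 'b) \<Rightarrow> ('w \<Rightarrow> 'c) \<Rightarrow> real" where
  "cond_mutual_info P X Y Z \<equiv>
     prob_space.conditional_mutual_information (measure_pmf P) 2
       (count_space UNIV) (count_space UNIV) (count_space UNIV) X Y Z"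

abbreviation cond_entropy :: "'w pmf \<Rightarrow> ('w \<Rightarrow> 'a) \<Rightarrow> ('w \<Rightarrow> 'b) \<Rightarrow> real" where
  "cond_entropy P X Y \<equiv>
     prob_space.conditional_entropy (measure_pmf P) 2 (count_space UNIV) (count_space UNIV) X Y"

end

theory Submission
  imports Defs "HOL-Real_Asymp.Real_Asymp"
begin

text \<open>
  Converse: the auxiliary variable at time $i$ is $U_i = (Z^{i-1}, S_2^{n \setminus i})$, on which
  $X_{2,i}$ depends only through $U_i$, $S_{2,i}$ and the independent message 2. Fano's inequality and
  the chain rule put every achievable pair, up to a vanishing loss, into the region with a large
  auxiliary alphabet. Each value of $U$ contributes an atom to the joint law, and scaling the atoms by
  nonnegative weights is a linear problem, so Caratheodory's argument reduces their number. The first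
  three bounds cost two linear constraints instead of three: on each atom the sum bound is at most the
  sum of the individual bounds, and a suitable share of the slack is subtracted from each of these.
  The term $H(Z|S_1,U) - I(U;S_1|S_2)$ is kept nondecreasing by choosing the sign of the direction.
  With the cardinality fixed, compactness removes the loss.

  Achievability: in a block, encoder 1 covers $S_1^N$ by a codeword $U^N$ chosen from bins, covers
  $(U^N,S_1^N)$ by a codeword $Z^N$ whose index $k$ encoder 2 reads off the cribbing signal, and
  superimposes $X_1^N$. The index $k$ carries the part of message 1 and the bin index that encoder 2
  needs in the next block; given the bin index, encoder 2 finds $U^N$ by means of $S_2^N$. The decoder
  proceeds backwards through the blocks. Codewords are accepted by likelihood-ratio tests, whose error
  probabilities decay exponentially while the acceptance test bounds the drawn law by the ideal law
  up to a small exponent. This gives every rate pair in the interior when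
  $H(Z|S_1,U) > I(U;S_1|S_2)$. In the case of equality, if $H(Z|S_1,U)$ can be made positive, a small
  share of a value of $U$ with uniform inputs restores strictness. Otherwise $Z$ is a function of
  $S_1$ and $I(U;S_1|S_2) = 0$, so that both encoders know the conditional law of $U$ from their own
  states and can use it as common label of the codebook without any cribbing.
\<close>

text \<open>Two obstacles shape the coding part. First, the index read off the crib in a block
  contains the bin index of the next block, hence depends on later states, while the error of a
  block is bounded only for uniform indices independent of its states. A dither known to all parties
  is therefore added cyclically to every index, and one fixed dither is selected at the end. Second,
  the codewords for U and Z are chosen by acceptance from a list, so they do not follow their ideal
  law: each later error term is multiplied by list size times likelihood ratio, a factor of exponent
  at most 3 e for a test slack e. Hence the slacks have to be chosen one after the other, each small
  against the error exponent of what follows the selection. In the converse and in the reduction of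
  the alphabet, entropies with U in the condition are sums over atoms, whereas I(X1,X2;Y|S1,S2) is a
  function of the total law alone. It is the term that needs concavity in the converse; in the
  reduction it has to be pinned down by linear constraints, and the two ways of doing so give the
  two cardinality bounds.\<close>

abbreviation mean :: "'a pmf \<Rightarrow> ('a \<Rightarrow> ennreal) \<Rightarrow> ennreal" where
  "mean p f \<equiv> \<integral>\<^sup>+x. f x \<partial>measure_pmf p"

abbreviation seq_pmf :: "nat \<Rightarrow> (nat \<Rightarrow> 'a pmf) \<Rightarrow> (nat \<Rightarrow> 'a) pmf" where
  "seq_pmf n \<equiv> Pi_pmf {1..n} undefined"

type_synonym ('s1, 's2, 'x1, 'x2, 'y) letter = "'s1 \<times> 's2 \<times> 'x1 \<times> 'x2 \<times> 'y"
type_synonym ('s1, 's2, 'y) transcript = "nat \<times> nat \<times> (nat \<Rightarrow> 's1) \<times> (nat \<Rightarrow> 's2) \<times> (nat \<Rightarrow> 'y)"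

abbreviation wrong :: "('a \<Rightarrow> 'b \<Rightarrow> 'c \<Rightarrow> 'd) \<Rightarrow> ('a \<Rightarrow> 'b \<Rightarrow> 'c \<Rightarrow> 'e) \<Rightarrow> ('d \<times> 'e \<times> 'b \<times> 'c \<times> 'a) set" where
  "wrong dec1 dec2 \<equiv> {(m1, m2, s1, s2, y). (dec1 y s1 s2, dec2 y s1 s2) \<noteq> (m1, m2)}"

abbreviation indices :: "nat \<Rightarrow> nat \<Rightarrow> nat \<Rightarrow> nat \<Rightarrow> (nat \<times> nat \<times> nat \<times> nat) set" where
  "indices J L A C \<equiv> {..<J} \<times> {..<J * L} \<times> {..<A} \<times> {..<C}"

abbreviation law_US2 :: "('a \<times> 'b) pmf \<Rightarrow> ('a \<Rightarrow> 'u pmf) \<Rightarrow> ('u \<times> 'b) pmf" where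
  "law_US2 p Q \<equiv> bind_pmf p (\<lambda>s. bind_pmf (Q (fst s)) (\<lambda>u. return_pmf (u, snd s)))"

subsection \<open>Entropy of finite weights\<close>

text \<open>
  The weights need not sum to 1, so that a joint law can be cut into the parts belonging to the
  values of the auxiliary variable; all functionals below are homogeneous. Null weights drop out
  because \<open>0 * log 2 0 = 0\<close>.
\<close>

definition mass :: "'w set \<Rightarrow> ('w \<Rightarrow> real) \<Rightarrow> ('w \<Rightarrow> 'v) \<Rightarrow> 'v \<Rightarrow> real" where
  "mass A \<mu> f v = (\<Sum>w\<in>{w\<in>A. f w = v}. \<mu> w)"

definition ent :: "'w set \<Rightarrow> ('w \<Rightarrow> real) \<Rightarrow> ('w \<Rightarrow> 'v) \<Rightarrow> real" where
  "ent A \<mu> f = - (\<Sum>w\<in>A. \<mu> w * log 2 (mass A \<mu> f (f w)))"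

definition hc :: "'w set \<Rightarrow> ('w \<Rightarrow> real) \<Rightarrow> ('w \<Rightarrow> 'x) \<Rightarrow> ('w \<Rightarrow> 'v) \<Rightarrow> real" where
  "hc A \<mu> X V = ent A \<mu> (\<lambda>w. (X w, V w)) - ent A \<mu> V"

lemma mass_kernel_cong:
  assumes "\<And>w w'. w \<in> A \<Longrightarrow> w' \<in> A \<Longrightarrow> f w = f w' \<longleftrightarrow> g w = g w'" "w \<in> A"
  shows "mass A \<mu> f (f w) = mass A \<mu> g (g w)"
  unfolding mass_def by (intro sum.cong refl Collect_cong conj_cong) (use assms in blast)

lemma ent_kernel_cong:
  assumes "\<And>w w'. w \<in> A \<Longrightarrow> w' \<in> A \<Longrightarrow> f w = f w' \<longleftrightarrow> g w = g w'"
  shows "ent A \<mu> f = ent A \<mu> g"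
proof -
  have "mass A \<mu> f (f w) = mass A \<mu> g (g w)" if "w \<in> A" for w
    by (rule mass_kernel_cong[OF _ that]) (use assms in blast)
  then show ?thesis unfolding ent_def by simp
qed

text \<open>An entropy sees a variable only through the partition it induces, and under a condition
  \<open>V\<close> the variable \<open>X\<close> counts only inside the classes of \<open>V\<close>.
  Permuting tuples and dropping determined components are instances.\<close>

lemma hc_kernel_cong:
  fixes X :: "'w \<Rightarrow> 'x" and X' :: "'w \<Rightarrow> 'x2" and V :: "'w \<Rightarrow> 'v" and V' :: "'w \<Rightarrow> 'v2"
  assumes "\<And>w w'. w \<in> A \<Longrightarrow> w' \<in> A \<Longrightarrow> V w = V w' \<longleftrightarrow> V' w = V' w'"
    and "\<And>w w'. w \<in> A \<Longrightarrow> w' \<in> A \<Longrightarrow> V w = V w' \<Longrightarrow> X w = X w' \<longleftrightarrow> X' w = X' w'"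
  shows "hc A \<mu> X V = hc A \<mu> X' V'"
proof -
  have "ent A \<mu> (\<lambda>w. (X w, V w)) = ent A \<mu> (\<lambda>w. (X' w, V' w))"
  proof (rule ent_kernel_cong)
    fix w w' assume "w \<in> A" "w' \<in> A"
    then show "((X w, V w) = (X w', V w')) = ((X' w, V' w) = (X' w', V' w'))"
      using assms[of w w'] by blast
  qed
  moreover have "ent A \<mu> V = ent A \<mu> V'" by (rule ent_kernel_cong) (rule assms(1))
  ultimately show ?thesis unfolding hc_def by simp
qed

lemma mass_ge:
  assumes "finite A" "\<forall>w\<in>A. 0 \<le> \<mu> w" "w \<in> A"
  shows "\<mu> w \<le> mass A \<mu> f (f w)"
  unfolding mass_def using assms by (intro member_le_sum) auto

lemma mass_nonneg:
  assumes "\<forall>w\<in>A. 0 \<le> \<mu> w"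
  shows "0 \<le> mass A \<mu> f v"
  unfolding mass_def using assms by (intro sum_nonneg) auto

lemma mass_mono:
  assumes "finite A" "\<forall>w\<in>A. 0 \<le> \<mu> w" "w \<in> A"
    and "\<And>w'. w' \<in> A \<Longrightarrow> f w' = f w \<Longrightarrow> g w' = g w"
  shows "mass A \<mu> f (f w) \<le> mass A \<mu> g (g w)"
  unfolding mass_def using assms(1,2) by (intro sum_mono2) (auto dest: assms(4))

lemma sum_by_values:
  assumes "finite A"
  shows "(\<Sum>w\<in>A. \<mu> w * \<phi> (f w)) = (\<Sum>v\<in>f ` A. mass A \<mu> f v * \<phi> v)"
  unfolding mass_def sum_distrib_right by (subst sum.image_gen[OF assms, of _ f]) (auto intro!: sum.cong)

lemma sum_mass: "finite A \<Longrightarrow> (\<Sum>v\<in>f ` A. mass A \<mu> f v) = (\<Sum>w\<in>A. \<mu> w)"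
  using sum_by_values[of A \<mu> "\<lambda>_. 1" f] by simp

lemma hc_eq_sum:
  assumes "finite A" "\<forall>w\<in>A. 0 \<le> \<mu> w"
  shows "hc A \<mu> X V = - (\<Sum>w\<in>A. \<mu> w *
           log 2 (mass A \<mu> (\<lambda>w. (X w, V w)) (X w, V w) / mass A \<mu> V (V w)))"
proof -
  have "\<mu> w * log 2 (mass A \<mu> (\<lambda>w. (X w, V w)) (X w, V w) / mass A \<mu> V (V w)) =
        \<mu> w * log 2 (mass A \<mu> (\<lambda>w. (X w, V w)) (X w, V w)) - \<mu> w * log 2 (mass A \<mu> V (V w))"
    if "w \<in> A" for w
  proof (cases "\<mu> w = 0")
    case False
    then have "\<mu> w > 0" using assms(2) that by force
    then have "0 < mass A \<mu> (\<lambda>w. (X w, V w)) (X w, V w)" "0 < mass A \<mu> V (V w)"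
      using mass_ge[OF assms that, where f="\<lambda>w. (X w, V w)"] mass_ge[OF assms that, where f=V] by simp_all
    then show ?thesis by (simp add: log_divide algebra_simps)
  qed simp
  then show ?thesis unfolding hc_def ent_def by (simp add: sum_subtractf)
qed

text \<open>Every entropy inequality below is an instance of this form of Gibbs' inequality.\<close>

lemma hc_le_cross:
  fixes q :: "'x \<Rightarrow> 'v \<Rightarrow> real"
  assumes A: "finite A" and \<mu>: "\<forall>w\<in>A. 0 \<le> \<mu> w"
    and q0: "\<And>x v. x \<in> X ` A \<Longrightarrow> v \<in> V ` A \<Longrightarrow> 0 \<le> q x v"
    and qpos: "\<And>w. w \<in> A \<Longrightarrow> 0 < \<mu> w \<Longrightarrow> 0 < q (X w) (V w)"
    and qle: "\<And>v. v \<in> V ` A \<Longrightarrow> (\<Sum>x\<in>X ` A. q x v) \<le> 1"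
  shows "hc A \<mu> X V \<le> - (\<Sum>w\<in>A. \<mu> w * log 2 (q (X w) (V w)))"
proof -
  define XV where "XV = (\<lambda>w. (X w, V w))"
  let ?m = "mass A \<mu> V" and ?n = "mass A \<mu> XV"
  \<comment> \<open>\<open>\<rho>\<close> is the likelihood ratio of the comparison law to the true
    one. Its weighted sum is at most the total mass, and log t is at most (t - 1) / ln 2.\<close>
  define \<rho> where "\<rho> w = ?m (V w) * q (X w) (V w) / ?n (XV w)" for w
  have m0: "0 \<le> ?m v" "0 \<le> ?n u" for u v using mass_nonneg \<mu> by metis+
  have tm: "\<mu> w * log 2 (q (X w) (V w)) - \<mu> w * log 2 (?n (XV w) / ?m (V w))
      \<le> (\<mu> w * \<rho> w - \<mu> w) / ln 2" if w: "w \<in> A" for w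
  proof (cases "\<mu> w = 0")
    case False
    then have p: "\<mu> w > 0" using \<mu> w by force
    have pos: "0 < ?n (XV w)" "0 < ?m (V w)" "0 < q (X w) (V w)"
      using mass_ge[OF A \<mu> w, where f=XV] mass_ge[OF A \<mu> w, where f=V] p qpos[OF w p] by simp_all
    then have \<rho>: "\<rho> w > 0" unfolding \<rho>_def by simp
    have "log 2 (q (X w) (V w)) - log 2 (?n (XV w) / ?m (V w)) = log 2 (\<rho> w)"
      using pos unfolding \<rho>_def by (simp add: log_divide log_mult)
    also have "\<dots> \<le> (\<rho> w - 1) / ln 2"
      unfolding log_def using ln_le_minus_one[OF \<rho>] by (simp add: divide_right_mono)
    finally have "\<mu> w * (log 2 (q (X w) (V w)) - log 2 (?n (XV w) / ?m (V w)))
        \<le> \<mu> w * ((\<rho> w - 1) / ln 2)" using p by (intro mult_left_mono) auto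
    then show ?thesis by (simp add: algebra_simps diff_divide_distrib)
  qed simp
  have "(\<Sum>w\<in>A. \<mu> w * \<rho> w) = (\<Sum>w\<in>A. \<mu> w * (\<lambda>u. ?m (snd u) * q (fst u) (snd u) / ?n u) (XV w))"
    unfolding \<rho>_def XV_def by simp
  also have "\<dots> = (\<Sum>u\<in>XV ` A. ?n u * (?m (snd u) * q (fst u) (snd u) / ?n u))"
    by (rule sum_by_values[OF A])
  also have "\<dots> \<le> (\<Sum>u\<in>XV ` A. ?m (snd u) * q (fst u) (snd u))"
  proof (rule sum_mono)
    fix u assume "u \<in> XV ` A"
    then have "0 \<le> ?m (snd u) * q (fst u) (snd u)"
      using m0 q0 unfolding XV_def by (auto intro!: mult_nonneg_nonneg)
    then show "?n u * (?m (snd u) * q (fst u) (snd u) / ?n u) \<le> ?m (snd u) * q (fst u) (snd u)"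
      by simp
  qed
  also have "\<dots> \<le> (\<Sum>u\<in>X ` A \<times> V ` A. ?m (snd u) * q (fst u) (snd u))"
    using A m0 q0 unfolding XV_def by (intro sum_mono2) (auto intro!: mult_nonneg_nonneg)
  also have "\<dots> = (\<Sum>x\<in>X ` A. \<Sum>v\<in>V ` A. ?m v * q x v)"
    by (simp add: sum.cartesian_product case_prod_unfold)
  also have "\<dots> = (\<Sum>v\<in>V ` A. ?m v * (\<Sum>x\<in>X ` A. q x v))"
    by (subst sum.swap) (simp add: sum_distrib_left)
  also have "\<dots> \<le> (\<Sum>v\<in>V ` A. ?m v * 1)"
    using qle m0 by (intro sum_mono mult_left_mono) auto
  also have "\<dots> = (\<Sum>w\<in>A. \<mu> w)" using sum_mass[OF A] by simp
  finally have key: "(\<Sum>w\<in>A. \<mu> w * \<rho> w) \<le> (\<Sum>w\<in>A. \<mu> w)" .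
  have "(\<Sum>w\<in>A. \<mu> w * log 2 (q (X w) (V w))) - (\<Sum>w\<in>A. \<mu> w * log 2 (?n (XV w) / ?m (V w)))
      \<le> (\<Sum>w\<in>A. (\<mu> w * \<rho> w - \<mu> w) / ln 2)"
    unfolding sum_subtractf[symmetric] by (intro sum_mono tm)
  also have "\<dots> \<le> 0"
    unfolding sum_divide_distrib[symmetric] sum_subtractf using key by (simp add: divide_nonpos_pos)
  finally show ?thesis using hc_eq_sum[OF A \<mu>, where X=X and V=V] unfolding XV_def by simp
qed

text \<open>Gibbs' inequality against the conditional law of \<open>X\<close> given the coarser
  \<open>U\<close> under the larger weights \<open>\<nu>\<close>. With \<open>\<nu> = \<mu>\<close>
  it says that conditioning lowers entropy; with \<open>\<nu>\<close> a sum of weights it yields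
  concavity.\<close>

lemma hc_le_hc_sub:
  assumes A: "finite A" and \<mu>: "\<forall>w\<in>A. 0 \<le> \<mu> w" "\<forall>w\<in>A. \<mu> w \<le> \<nu> w"
    and g: "\<And>w w'. w \<in> A \<Longrightarrow> w' \<in> A \<Longrightarrow> V w = V w' \<Longrightarrow> U w = U w'"
  shows "hc A \<mu> X V \<le> - (\<Sum>w\<in>A. \<mu> w * log 2 (mass A \<nu> (\<lambda>w. (X w, U w)) (X w, U w) / mass A \<nu> U (U w)))"
proof -
  obtain h where h: "\<And>w. w \<in> A \<Longrightarrow> U w = h (V w)"
  proof
    fix w assume w: "w \<in> A"
    have "(SOME w'. w' \<in> A \<and> V w' = V w) \<in> A \<and> V (SOME w'. w' \<in> A \<and> V w' = V w) = V w"
      by (rule someI[of _ w]) (use w in simp)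
    then show "U w = (\<lambda>v. U (SOME w'. w' \<in> A \<and> V w' = v)) (V w)" using g[OF w] by simp
  qed
  let ?q = "\<lambda>x v. mass A \<nu> (\<lambda>w. (X w, U w)) (x, h v) / mass A \<nu> U (h v)"
  have \<nu>: "\<forall>w\<in>A. 0 \<le> \<nu> w" by (intro ballI order_trans[OF bspec[OF \<mu>(1)] bspec[OF \<mu>(2)]])
  have "hc A \<mu> X V \<le> - (\<Sum>w\<in>A. \<mu> w * log 2 (?q (X w) (V w)))"
  proof (rule hc_le_cross[OF A \<mu>(1), where q="?q" and X=X and V=V])
    fix x v show "0 \<le> ?q x v" by (intro divide_nonneg_nonneg mass_nonneg \<nu>)
  next
    fix w assume w: "w \<in> A" "0 < \<mu> w"
    then have p: "0 < \<nu> w" using \<mu>(2) by fastforce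
    have "mass A \<nu> (\<lambda>w. (X w, U w)) (X w, U w) > 0"
      using p mass_ge[OF A \<nu> w(1), where f="\<lambda>w. (X w, U w)"] by linarith
    moreover have "mass A \<nu> U (U w) > 0" using p mass_ge[OF A \<nu> w(1), where f=U] by linarith
    ultimately show "0 < ?q (X w) (V w)" using w h by simp
  next
    fix v assume "v \<in> V ` A"
    have "(\<Sum>x\<in>X ` A. mass A \<nu> (\<lambda>w. (X w, U w)) (x, h v)) = mass A \<nu> U (h v)"
    proof -
      have "(\<Sum>x\<in>X ` A. mass A \<nu> (\<lambda>w. (X w, U w)) (x, h v)) =
        (\<Sum>x\<in>X ` A. \<Sum>w\<in>{w \<in> {w\<in>A. U w = h v}. X w = x}. \<nu> w)"
        unfolding mass_def by (intro sum.cong) auto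
      also have "\<dots> = (\<Sum>w\<in>{w\<in>A. U w = h v}. \<nu> w)"
        using A by (intro sum.group) auto
      finally show ?thesis unfolding mass_def .
    qed
    then show "(\<Sum>x\<in>X ` A. ?q x v) \<le> 1" by (simp add: sum_divide_distrib[symmetric])
  qed
  also have "(\<Sum>w\<in>A. \<mu> w * log 2 (?q (X w) (V w))) =
      (\<Sum>w\<in>A. \<mu> w * log 2 (mass A \<nu> (\<lambda>w. (X w, U w)) (X w, U w) / mass A \<nu> U (U w)))"
    by (rule sum.cong[OF refl]) (simp only: h)
  finally show ?thesis .
qed

lemma hc_mono:
  assumes A: "finite A" and \<mu>: "\<forall>w\<in>A. 0 \<le> \<mu> w"
    and g: "\<And>w w'. w \<in> A \<Longrightarrow> w' \<in> A \<Longrightarrow> V w = V w' \<Longrightarrow> U w = U w'"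
  shows "hc A \<mu> X V \<le> hc A \<mu> X U"
proof -
  have "hc A \<mu> X V \<le> - (\<Sum>w\<in>A. \<mu> w * log 2 (mass A \<mu> (\<lambda>w. (X w, U w)) (X w, U w) / mass A \<mu> U (U w)))"
    by (rule hc_le_hc_sub[OF A \<mu>, where \<nu>=\<mu> and U=U and V=V and X=X]) (simp, rule g)
  also have "\<dots> = hc A \<mu> X U" by (rule hc_eq_sum[OF A \<mu>, symmetric])
  finally show ?thesis .
qed

lemma hc_nonneg:
  assumes A: "finite A" and \<mu>: "\<forall>w\<in>A. 0 \<le> \<mu> w"
  shows "0 \<le> hc A \<mu> X V"
proof -
  have "\<mu> w * log 2 (mass A \<mu> (\<lambda>w. (X w, V w)) (X w, V w) / mass A \<mu> V (V w)) \<le> 0" if w: "w \<in> A" for w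
  proof (cases "\<mu> w = 0")
    case False
    then have p: "\<mu> w > 0" using \<mu> w by force
    have "0 < mass A \<mu> (\<lambda>w. (X w, V w)) (X w, V w)"
      using p mass_ge[OF A \<mu> w, where f="\<lambda>w. (X w, V w)"] by simp
    moreover have "mass A \<mu> (\<lambda>w. (X w, V w)) (X w, V w) \<le> mass A \<mu> V (V w)"
      by (rule mass_mono[OF A \<mu> w]) auto
    ultimately show ?thesis using p by (intro mult_nonneg_nonpos) auto
  qed simp
  then have "(\<Sum>w\<in>A. \<mu> w * log 2 (mass A \<mu> (\<lambda>w. (X w, V w)) (X w, V w) / mass A \<mu> V (V w))) \<le> 0"
    by (intro sum_nonpos)
  then show ?thesis using hc_eq_sum[OF A \<mu>, where X=X and V=V] by simp
qed

text \<open>Concavity of conditional entropy in homogeneous form: each summand is dominated by the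
  sum and is compared with the conditional law of the sum.\<close>

lemma hc_add_ge:
  assumes A: "finite A" and \<mu>: "\<forall>w\<in>A. 0 \<le> \<mu> w" and \<nu>: "\<forall>w\<in>A. 0 \<le> \<nu> w"
  shows "hc A \<mu> X V + hc A \<nu> X V \<le> hc A (\<lambda>w. \<mu> w + \<nu> w) X V"
proof -
  define \<sigma> where "\<sigma> w = \<mu> w + \<nu> w" for w
  define L where "L w = log 2 (mass A \<sigma> (\<lambda>w. (X w, V w)) (X w, V w) / mass A \<sigma> V (V w))" for w
  have a: "\<forall>w\<in>A. \<mu> w \<le> \<sigma> w" "\<forall>w\<in>A. \<nu> w \<le> \<sigma> w" "\<forall>w\<in>A. 0 \<le> \<sigma> w"
    using \<mu> \<nu> by (auto simp: \<sigma>_def)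
  have "hc A \<mu> X V \<le> - (\<Sum>w\<in>A. \<mu> w * L w)" unfolding L_def
    by (rule hc_le_hc_sub[OF A \<mu> a(1)])
  moreover have "hc A \<nu> X V \<le> - (\<Sum>w\<in>A. \<nu> w * L w)" unfolding L_def
    by (rule hc_le_hc_sub[OF A \<nu> a(2)])
  moreover have "hc A \<sigma> X V = - (\<Sum>w\<in>A. \<sigma> w * L w)" unfolding L_def
    by (rule hc_eq_sum[OF A a(3)])
  moreover have "(\<Sum>w\<in>A. \<sigma> w * L w) = (\<Sum>w\<in>A. \<mu> w * L w) + (\<Sum>w\<in>A. \<nu> w * L w)"
    unfolding \<sigma>_def by (simp add: distrib_right sum.distrib)
  ultimately have "hc A \<mu> X V + hc A \<nu> X V \<le> hc A \<sigma> X V" by linarith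
  then show ?thesis unfolding \<sigma>_def .
qed

lemma mass_scale: "mass A (\<lambda>w. c * \<mu> w) f v = c * mass A \<mu> f v"
  unfolding mass_def by (simp add: sum_distrib_left)

lemma hc_scale:
  assumes A: "finite A" and \<mu>: "\<forall>w\<in>A. 0 \<le> \<mu> w" and c: "0 \<le> c"
  shows "hc A (\<lambda>w. c * \<mu> w) X V = c * hc A \<mu> X V"
proof (cases "c = 0")
  case False
  then have "hc A (\<lambda>w. c * \<mu> w) X V = - (\<Sum>w\<in>A. c * (\<mu> w *
           log 2 (mass A \<mu> (\<lambda>w. (X w, V w)) (X w, V w) / mass A \<mu> V (V w))))"
    by (subst hc_eq_sum[OF A]) (use \<mu> c in \<open>auto simp: mass_scale mult.assoc\<close>)
  also have "\<dots> = c * hc A \<mu> X V"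
    unfolding sum_distrib_left[symmetric] by (subst hc_eq_sum[OF A \<mu>]) simp_all
  finally show ?thesis .
qed (simp add: hc_def ent_def mass_scale)

lemma hc_chain:
  "hc A \<mu> (\<lambda>w. (X w, Y w)) V = hc A \<mu> X V + hc A \<mu> Y (\<lambda>w. (X w, V w))"
proof -
  have "ent A \<mu> (\<lambda>w. ((X w, Y w), V w)) = ent A \<mu> (\<lambda>w. (Y w, (X w, V w)))"
    by (rule ent_kernel_cong) auto
  then show ?thesis unfolding hc_def by simp
qed

lemma hc_determined:
  assumes "\<And>w w'. w \<in> A \<Longrightarrow> w' \<in> A \<Longrightarrow> V w = V w' \<Longrightarrow> X w = X w'"
  shows "hc A \<mu> X V = 0"
proof -
  have "ent A \<mu> (\<lambda>w. (X w, V w)) = ent A \<mu> V"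
  proof (rule ent_kernel_cong)
    fix w w' assume "w \<in> A" "w' \<in> A"
    then show "((X w, V w) = (X w', V w')) = (V w = V w')" using assms[of w w'] by auto
  qed
  then show ?thesis unfolding hc_def by simp
qed

lemma mass_superset:
  assumes "finite B" "A \<subseteq> B" "\<forall>w\<in>B - A. \<mu> w = 0"
  shows "mass B \<mu> f v = mass A \<mu> f v"
  unfolding mass_def using assms by (intro sum.mono_neutral_right) auto

lemma ent_superset:
  assumes "finite B" "A \<subseteq> B" "\<forall>w\<in>B - A. \<mu> w = 0"
  shows "ent B \<mu> f = ent A \<mu> f"
proof -
  have "(\<Sum>w\<in>B. \<mu> w * log 2 (mass A \<mu> f (f w))) = (\<Sum>w\<in>A. \<mu> w * log 2 (mass A \<mu> f (f w)))"
    using assms by (intro sum.mono_neutral_right) auto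
  then show ?thesis unfolding ent_def mass_superset[OF assms] by simp
qed

lemma hc_superset:
  assumes "finite B" "A \<subseteq> B" "\<forall>w\<in>B - A. \<mu> w = 0"
  shows "hc B \<mu> X V = hc A \<mu> X V"
  unfolding hc_def
  using ent_superset[OF assms, of "\<lambda>w. (X w, V w)"] ent_superset[OF assms, of V] by linarith

lemma mass_cong_measure: "\<forall>w\<in>A. \<mu> w = \<nu> w \<Longrightarrow> mass A \<mu> f v = mass A \<nu> f v"
  unfolding mass_def by (intro sum.cong) auto

lemma ent_cong_measure:
  assumes "\<forall>w\<in>A. \<mu> w = \<nu> w"
  shows "ent A \<mu> f = ent A \<nu> f"
proof -
  have "(\<Sum>w\<in>A. \<mu> w * log 2 (mass A \<mu> f (f w))) = (\<Sum>w\<in>A. \<nu> w * log 2 (mass A \<nu> f (f w)))"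
    by (rule sum.cong[OF refl]) (use assms mass_cong_measure[OF assms, of f] in simp)
  then show ?thesis unfolding ent_def by simp
qed

lemma hc_cong_measure:
  assumes "\<forall>w\<in>A. \<mu> w = \<nu> w"
  shows "hc A \<mu> X V = hc A \<nu> X V"
  unfolding hc_def
  using ent_cong_measure[OF assms, of "\<lambda>w. (X w, V w)"] ent_cong_measure[OF assms, of V] by linarith

section \<open>Translation of the information quantities of pmfs into entropies of weights\<close>

lemma mass_pmf:
  assumes "finite (set_pmf P)"
  shows "mass (set_pmf P) (pmf P) f v = pmf (map_pmf f P) v"
proof -
  have "pmf (map_pmf f P) v = measure (measure_pmf P) (f -` {v})" by (rule pmf_map)
  also have "\<dots> = measure (measure_pmf P) ((f -` {v}) \<inter> set_pmf P)"
    by (rule measure_Int_set_pmf[symmetric])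
  also have "\<dots> = sum (pmf P) ((f -` {v}) \<inter> set_pmf P)"
    using assms by (intro measure_measure_pmf_finite) auto
  also have "(f -` {v}) \<inter> set_pmf P = {w \<in> set_pmf P. f w = v}" by auto
  finally show ?thesis unfolding mass_def by simp
qed

lemma expectation_finite_support:
  fixes \<phi> :: "'a \<Rightarrow> real"
  assumes "finite (set_pmf P)"
  shows "measure_pmf.expectation P \<phi> = (\<Sum>w\<in>set_pmf P. pmf P w * \<phi> w)"
  by (subst integral_measure_pmf[OF assms]) auto

lemma distributed_map_pmf:
  "distributed (measure_pmf P) (count_space UNIV) X (\<lambda>x. ennreal (pmf (map_pmf X P) x))"
  unfolding distributed_def
  by (simp add: measure_pmf_eq_density[symmetric] map_pmf_rep_eq[symmetric])

lemma sigma_finite_count: "sigma_finite_measure (count_space (UNIV :: 'a::countable set))"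
  by (rule sigma_finite_measure_count_space)

lemma information_space_pmf: "information_space (measure_pmf P) 2"
  by unfold_locales auto

lemma integral_count_map_pmf:
  fixes \<phi> :: "'b \<Rightarrow> real"
  assumes "finite (set_pmf P)"
  shows "(\<integral>v. pmf (map_pmf F P) v * \<phi> v \<partial>count_space UNIV) = (\<Sum>w\<in>set_pmf P. pmf P w * \<phi> (F w))"
proof -
  have "(\<integral>v. pmf (map_pmf F P) v * \<phi> v \<partial>count_space UNIV)
      = measure_pmf.expectation (map_pmf F P) \<phi>"
    by (subst measure_pmf_eq_density) (simp add: integral_density)
  also have "\<dots> = measure_pmf.expectation P (\<lambda>w. \<phi> (F w))" by simp
  finally show ?thesis using expectation_finite_support[OF assms] by metis
qed

lemma count_pair: "count_space (UNIV :: 'a::countable set) \<Otimes>\<^sub>M count_space (UNIV :: 'b::countable set)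
   = count_space UNIV"
  by (subst pair_measure_countable) auto

lemma mutual_information_ent:
  fixes X :: "'w \<Rightarrow> 'a::countable" and Y :: "'w \<Rightarrow> 'b::countable"
  assumes fin: "finite (set_pmf P)"
  shows "prob_space.mutual_information (measure_pmf P) 2 (count_space UNIV) (count_space UNIV) X Y =
    ent (set_pmf P) (pmf P) X + ent (set_pmf P) (pmf P) Y - ent (set_pmf P) (pmf P) (\<lambda>w. (X w, Y w))"
proof -
  interpret info: information_space "measure_pmf P" 2 by (rule information_space_pmf)
  let ?XY = "\<lambda>w. (X w, Y w)"
  let ?x = "pmf (map_pmf X P)" and ?y = "pmf (map_pmf Y P)" and ?xy = "pmf (map_pmf ?XY P)"
  have "prob_space.mutual_information (measure_pmf P) 2 (count_space UNIV) (count_space UNIV) X Y =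
     (\<integral>v. ?xy v * log 2 (?xy v / (?x (fst v) * ?y (snd v))) \<partial>(count_space UNIV \<Otimes>\<^sub>M count_space UNIV))"
    by (rule info.mutual_information_distr[OF sigma_finite_count sigma_finite_count])
       (auto simp: count_pair intro: distributed_map_pmf)
  also have "\<dots> = (\<Sum>w\<in>set_pmf P. pmf P w * log 2 (?xy (?XY w) / (?x (X w) * ?y (Y w))))"
    unfolding count_pair by (subst integral_count_map_pmf[OF fin]) simp
  also have "\<dots> = (\<Sum>w\<in>set_pmf P. pmf P w * log 2 (?xy (?XY w)) - pmf P w * log 2 (?x (X w))
      - pmf P w * log 2 (?y (Y w)))"
  proof (rule sum.cong[OF refl])
    fix w assume w: "w \<in> set_pmf P"
    have "pmf P w > 0" using w by (simp add: pmf_positive)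
    then have "?xy (?XY w) > 0" "?x (X w) > 0" "?y (Y w) > 0"
      using w by (auto intro!: pmf_positive)
    then show "pmf P w * log 2 (?xy (?XY w) / (?x (X w) * ?y (Y w))) =
      pmf P w * log 2 (?xy (?XY w)) - pmf P w * log 2 (?x (X w)) - pmf P w * log 2 (?y (Y w))"
      by (simp add: log_divide log_mult algebra_simps)
  qed
  finally show ?thesis unfolding ent_def by (simp add: mass_pmf[OF fin] sum_subtractf)
qed

text \<open>The library defines I(X;Y|Z) as I(X;(Y,Z)) - I(X;Z). The entropy of \<open>X\<close>
  cancels, and what remains is a difference of conditional entropies of \<open>Y\<close>.\<close>

lemma cond_mutual_info_hc:
  fixes X :: "'w \<Rightarrow> 'a::countable" and Y :: "'w \<Rightarrow> 'b::countable" and Z :: "'w \<Rightarrow> 'c::countable"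
  assumes fin: "finite (set_pmf P)"
  shows "cond_mutual_info P X Y Z =
    hc (set_pmf P) (pmf P) Y Z - hc (set_pmf P) (pmf P) Y (\<lambda>w. (X w, Z w))"
proof -
  have "ent (set_pmf P) (pmf P) (\<lambda>w. (X w, Y w, Z w)) = ent (set_pmf P) (pmf P) (\<lambda>w. (Y w, X w, Z w))"
    by (rule ent_kernel_cong) auto
  then show ?thesis
    unfolding prob_space.conditional_mutual_information_def[OF prob_space_measure_pmf] count_pair mutual_information_ent[OF fin] hc_def
    by simp
qed

lemma cond_entropy_hc:
  fixes X :: "'w \<Rightarrow> 'a::countable" and Y :: "'w \<Rightarrow> 'b::countable"
  assumes fin: "finite (set_pmf P)"
  shows "cond_entropy P X Y = hc (set_pmf P) (pmf P) X Y"
proof -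
  interpret info: information_space "measure_pmf P" 2 by (rule information_space_pmf)
  let ?XY = "\<lambda>w. (X w, Y w)"
  let ?y = "pmf (map_pmf Y P)" and ?xy = "pmf (map_pmf ?XY P)"
  have "cond_entropy P X Y =
     - (\<integral>(x, y). ?xy (x, y) * log 2 (?xy (x, y) / ?y y) \<partial>(count_space UNIV \<Otimes>\<^sub>M count_space UNIV))"
    by (rule info.conditional_entropy_generic_eq[OF sigma_finite_count sigma_finite_count])
       (auto simp: count_pair intro: distributed_map_pmf)
  also have "\<dots> = - (\<Sum>w\<in>set_pmf P. pmf P w * log 2 (?xy (?XY w) / ?y (Y w)))"
    unfolding count_pair case_prod_unfold using integral_count_map_pmf[OF fin, of ?XY "\<lambda>v. log 2 (?xy v / ?y (snd v))"]
    by simp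
  finally show ?thesis by (subst hc_eq_sum) (simp_all add: fin mass_pmf)
qed

subsection \<open>Reduction of the auxiliary alphabet\<close>

text \<open>Gaussian elimination: an equation with a nonzero coefficient at \<open>b\<close>
  expresses the entry at \<open>b\<close> through the others, which leaves one equation and one
  unknown fewer.\<close>

lemma exists_kernel_vector:
  fixes r :: "'i \<Rightarrow> 'a \<Rightarrow> real"
  assumes "finite I" "finite S" "card I < card S"
  shows "\<exists>d. (\<exists>a\<in>S. d a \<noteq> 0) \<and> (\<forall>i\<in>I. (\<Sum>a\<in>S. d a * r i a) = 0)"
  using assms
proof (induction I arbitrary: S r rule: finite_induct)
  case empty
  then obtain a where "a \<in> S" by fastforce
  then show ?case by (intro exI[of _ "\<lambda>_. 1"]) auto
next
  case (insert i I)
  show ?case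
  proof (cases "\<forall>a\<in>S. r i a = 0")
    case True
    obtain d where "\<exists>a\<in>S. d a \<noteq> 0" "\<forall>i\<in>I. (\<Sum>a\<in>S. d a * r i a) = 0"
      using insert.IH[of S r] insert.prems insert.hyps by auto
    then show ?thesis using True by (intro exI[of _ d]) simp
  next
    case False
    then obtain b where b: "b \<in> S" "r i b \<noteq> 0" by blast
    define S' where "S' = S - {b}"
    have S': "finite S'" "b \<notin> S'" "S = insert b S'" using b insert.prems by (auto simp: S'_def)
    have "card I < card S'" using insert.prems insert.hyps S' by simp
    then obtain d where d: "\<exists>a\<in>S'. d a \<noteq> 0"
        "\<forall>k\<in>I. (\<Sum>a\<in>S'. d a * (r k a - r k b * r i a / r i b)) = 0"
      using insert.IH[of S' "\<lambda>k a. r k a - r k b * r i a / r i b"] S' by auto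
    define e where "e = d(b := - (\<Sum>a\<in>S'. d a * r i a) / r i b)"
    have sum_e: "(\<Sum>a\<in>S. e a * r k a) = (\<Sum>a\<in>S'. d a * r k a) - (\<Sum>a\<in>S'. d a * r i a) / r i b * r k b" for k
    proof -
      have "(\<Sum>a\<in>S'. e a * r k a) = (\<Sum>a\<in>S'. d a * r k a)"
        by (rule sum.cong) (use S' in \<open>auto simp: e_def\<close>)
      then show ?thesis using S' by (simp add: e_def)
    qed
    have "(\<Sum>a\<in>S. e a * r k a) = 0" if "k \<in> insert i I" for k
    proof (cases "k = i")
      case True
      then show ?thesis using sum_e[of k] b by simp
    next
      case False
      then have "(\<Sum>a\<in>S'. d a * (r k a - r k b * r i a / r i b)) = 0" using d that by blast
      moreover have "(\<Sum>a\<in>S'. d a * (r k a - r k b * r i a / r i b))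
          = (\<Sum>a\<in>S'. d a * r k a) - (\<Sum>a\<in>S'. d a * r i a) / r i b * r k b"
        by (simp add: right_diff_distrib sum_subtractf sum_distrib_left sum_divide_distrib
              sum_distrib_right algebra_simps)
      ultimately show ?thesis using sum_e[of k] by simp
    qed
    moreover have "\<exists>a\<in>S. e a \<noteq> 0" using d S' by (auto simp: e_def)
    ultimately show ?thesis by blast
  qed
qed

text \<open>
  Moving along a kernel direction, with the sign chosen so that \<open>f\<close> does not decrease, until a
  weight vanishes.
\<close>

lemma caratheodory_weights:
  fixes r :: "'i \<Rightarrow> 'a \<Rightarrow> real" and f :: "'a \<Rightarrow> real"
  assumes A: "finite A" and I: "finite I" "I0 \<subseteq> I"
    and pos: "\<And>a. a \<in> A \<Longrightarrow> 0 < (\<Sum>i\<in>I0. r i a)"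
  shows "\<exists>c. (\<forall>a. 0 \<le> c a) \<and> card {a\<in>A. c a \<noteq> 0} \<le> card I \<and>
     (\<forall>i\<in>I. (\<Sum>a\<in>A. c a * r i a) = (\<Sum>a\<in>A. r i a)) \<and> (\<Sum>a\<in>A. f a) \<le> (\<Sum>a\<in>A. c a * f a)"
proof -
  define good where "good c \<longleftrightarrow> (\<forall>a. 0 \<le> c a) \<and>
     (\<forall>i\<in>I. (\<Sum>a\<in>A. c a * r i a) = (\<Sum>a\<in>A. r i a)) \<and> (\<Sum>a\<in>A. f a) \<le> (\<Sum>a\<in>A. c a * f a)" for c
  have ex: "\<exists>c. good c" by (intro exI[of _ "\<lambda>_. 1"]) (simp add: good_def)
  then obtain c where c: "good c" and
    min: "\<And>c'. good c' \<Longrightarrow> card {a\<in>A. c a \<noteq> 0} \<le> card {a\<in>A. c' a \<noteq> 0}"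
    using ex_has_least_nat[of good _ "\<lambda>c. card {a\<in>A. c a \<noteq> 0}"] by blast
  have "card {a\<in>A. c a \<noteq> 0} \<le> card I"
  proof (rule ccontr)
    define S where "S = {a\<in>A. c a \<noteq> 0}"
    assume "\<not> card {a\<in>A. c a \<noteq> 0} \<le> card I"
    then have "card I < card S" by (simp add: S_def)
    moreover have S: "finite S" "S \<subseteq> A" using A by (auto simp: S_def)
    ultimately obtain d0 where d0: "\<exists>a\<in>S. d0 a \<noteq> 0" "\<forall>i\<in>I. (\<Sum>a\<in>S. d0 a * r i a) = 0"
      using exists_kernel_vector[OF I(1), of S r] by blast
    define \<sigma> :: real where "\<sigma> = (if (\<Sum>a\<in>S. d0 a * f a) \<ge> 0 then 1 else -1)"
    define d where "d a = (if a \<in> S then \<sigma> * d0 a else 0)" for a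
    have sumd: "(\<Sum>a\<in>A. d a * g a) = \<sigma> * (\<Sum>a\<in>S. d0 a * g a)" for g
    proof -
      have "(\<Sum>a\<in>A. d a * g a) = (\<Sum>a\<in>S. d a * g a)"
        using A S by (intro sum.mono_neutral_right) (auto simp: d_def)
      also have "\<dots> = (\<Sum>a\<in>S. \<sigma> * (d0 a * g a))" by (rule sum.cong) (auto simp: d_def)
      finally show ?thesis by (simp add: sum_distrib_left)
    qed
    have d: "\<exists>a\<in>S. d a \<noteq> 0" "\<forall>i\<in>I. (\<Sum>a\<in>A. d a * r i a) = 0" "(\<Sum>a\<in>A. d a * f a) \<ge> 0"
      using d0 unfolding sumd by (auto simp: d_def \<sigma>_def)
    \<comment> \<open>A nonnegative nonzero direction would give the sum of the rows in
      \<open>I0\<close> a positive value, since that sum is positive on every atom; but all rows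
      vanish on \<open>d\<close>.\<close>
    have "\<exists>a\<in>S. d a < 0"
    proof (rule ccontr)
      assume "\<not> (\<exists>a\<in>S. d a < 0)"
      then have nn: "\<And>a. a \<in> A \<Longrightarrow> 0 \<le> d a" by (auto simp: d_def not_less)
      obtain a0 where a0: "a0 \<in> S" "d a0 \<noteq> 0" using d by blast
      have "0 < d a0" using nn[of a0] a0 S by auto
      note d_a0 = this
      have "0 < (\<Sum>a\<in>A. d a * (\<Sum>i\<in>I0. r i a))"
      proof (rule sum_pos2[OF A])
        show "a0 \<in> A" using a0 S by blast
        then show "0 < d a0 * (\<Sum>i\<in>I0. r i a0)" using d_a0 pos by simp
        show "0 \<le> d a * (\<Sum>i\<in>I0. r i a)" if "a \<in> A" for a
          using nn[OF that] pos[OF that] by (simp add: less_imp_le)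
      qed
      also have "\<dots> = (\<Sum>i\<in>I0. \<Sum>a\<in>A. d a * r i a)"
        by (simp add: sum_distrib_left sum.swap[of _ I0])
      also have "\<dots> = 0" using d(2) I by (intro sum.neutral) auto
      finally show False by simp
    qed
    define N where "N = {a\<in>S. d a < 0}"
    have N: "finite N" "N \<noteq> {}" using S \<open>\<exists>a\<in>S. d a < 0\<close> by (auto simp: N_def)
    \<comment> \<open>The index that limits the step: moving by its ratio keeps all weights
      nonnegative and makes the weight at \<open>b\<close> vanish.\<close>
    define b where "b = arg_min_on (\<lambda>a. c a / - d a) N"
    have b: "b \<in> N" "\<And>a. a \<in> N \<Longrightarrow> c b / - d b \<le> c a / - d a"
      using arg_min_if_finite[OF N, of "\<lambda>a. c a / - d a"] by (auto simp: b_def not_less)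
    define t where "t = c b / - d b"
    have c0: "\<forall>a. 0 \<le> c a" using c by (simp add: good_def)
    have t0: "0 \<le> t" using b(1) c0 unfolding t_def N_def by (simp add: divide_nonneg_neg)
    define c' where "c' a = c a + t * d a" for a
    have c'b: "c' b = 0" using b(1) by (simp add: c'_def t_def N_def)
    have c'0: "0 \<le> c' a" for a
    proof (cases "a \<in> N")
      case True
      then have "t \<le> c a / - d a" "d a < 0" using b(2) by (auto simp: t_def N_def)
      then have "t * (- d a) \<le> c a" using pos_le_divide_eq[of "- d a" t "c a"] by simp
      then show ?thesis by (simp add: c'_def)
    next
      case False
      then have "d a \<ge> 0" by (auto simp: d_def N_def)
      then show ?thesis using t0 c0 by (simp add: c'_def)
    qed
    have sumc: "(\<Sum>a\<in>A. c' a * g a) = (\<Sum>a\<in>A. c a * g a) + t * (\<Sum>a\<in>A. d a * g a)" for g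
      by (simp add: c'_def distrib_right sum.distrib sum_distrib_left mult.assoc)
    have "good c'"
      using c c'0 d(2,3) t0 unfolding good_def sumc by (auto simp: add_increasing2)
    moreover have "{a\<in>A. c' a \<noteq> 0} \<subset> S"
    proof
      show "{a\<in>A. c' a \<noteq> 0} \<subseteq> S" by (auto simp: c'_def S_def d_def)
      show "{a\<in>A. c' a \<noteq> 0} \<noteq> S" using c'b b(1) by (auto simp: N_def)
    qed
    then have "card {a\<in>A. c' a \<noteq> 0} < card {a\<in>A. c a \<noteq> 0}"
      using psubset_card_mono[OF S(1)] by (simp add: S_def)
    ultimately show False using min[of c'] by linarith
  qed
  then show ?thesis using c unfolding good_def by blast
qed

section \<open>Compactness, continuity of entropy, and behaviour under images and disjoint
  unions\<close>

lemma bounded_family_subsequence: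
  fixes f :: "nat \<Rightarrow> 'i \<Rightarrow> real"
  assumes "finite I" "\<And>n i. i \<in> I \<Longrightarrow> f n i \<in> {0..1}"
  shows "\<exists>r g. strict_mono r \<and> (\<forall>i\<in>I. (\<lambda>n. f (r n) i) \<longlonglongrightarrow> g i)"
  using assms
proof (induction I rule: finite_induct)
  case empty
  show ?case by (intro exI[of _ id]) (auto simp: strict_mono_def)
next
  case (insert i I)
  then obtain r g where r: "strict_mono r" "\<forall>i\<in>I. (\<lambda>n. f (r n) i) \<longlonglongrightarrow> g i" by auto
  have "compact {0..1::real}" by simp
  then obtain l s where s: "strict_mono s" "((\<lambda>n. f (r n) i) \<circ> s) \<longlonglongrightarrow> l"
    using insert.prems unfolding compact_def by (metis insertI1)
  have "strict_mono (r \<circ> s)" using r s by (simp add: strict_mono_o)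
  moreover have "\<forall>k\<in>insert i I. (\<lambda>n. f ((r \<circ> s) n) k) \<longlonglongrightarrow> (g(i := l)) k"
    using s r(2) insert.hyps LIMSEQ_subseq_LIMSEQ[OF _ s(1)] by (auto simp: o_def)
  ultimately show ?case by blast
qed

text \<open>Only a limit 0 needs an argument: x log x tends to 0 from the right, which agrees with
  the value \<open>0 * log 2 0 = 0\<close>.\<close>

lemma tendsto_xlog:
  assumes "f \<longlonglongrightarrow> l" "\<And>n. 0 \<le> f n"
  shows "(\<lambda>n. f n * log 2 (f n)) \<longlonglongrightarrow> l * log 2 l"
proof (cases "l = 0")
  case False
  then show ?thesis using assms by (intro tendsto_intros) auto
next
  case True
  have lim: "((\<lambda>x::real. x * log 2 x) \<longlongrightarrow> 0) (at_right 0)" by real_asymp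
  have "((\<lambda>x::real. x * log 2 x) \<longlongrightarrow> 0) (at 0 within {0..})"
  proof -
    have "at 0 within {0..} = at_right (0::real)"
      by (rule at_within_nhd[of _ UNIV]) auto
    then show ?thesis using lim by simp
  qed
  then have "continuous (at 0 within {0..}) (\<lambda>x::real. x * log 2 x)"
    by (simp add: continuous_within)
  then have "((\<lambda>n. f n * log 2 (f n)) \<longlongrightarrow> 0 * log 2 (0::real)) sequentially"
    using continuous_within_tendsto_compose'[of 0 "{0..}" "\<lambda>x::real. x * log 2 x" f sequentially] assms True
    by auto
  then show ?thesis using True by simp
qed

lemma ent_eq_values:
  assumes "finite A"
  shows "ent A \<mu> f = - (\<Sum>v\<in>f ` A. mass A \<mu> f v * log 2 (mass A \<mu> f v))"
  using sum_by_values[OF assms, of \<mu> "\<lambda>v. log 2 (mass A \<mu> f v)" f] unfolding ent_def by simp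

lemma tendsto_hc:
  assumes A: "finite A" and lim: "\<And>w. w \<in> A \<Longrightarrow> (\<lambda>n. \<mu> n w) \<longlonglongrightarrow> \<nu> w"
    and nn: "\<And>n. \<forall>w\<in>A. 0 \<le> \<mu> n w"
  shows "(\<lambda>n. hc A (\<mu> n) X V) \<longlonglongrightarrow> hc A \<nu> X V"
proof -
  have m: "(\<lambda>n. mass A (\<mu> n) f v) \<longlonglongrightarrow> mass A \<nu> f v" for f :: "'a \<Rightarrow> 'd" and v
    unfolding mass_def using lim by (intro tendsto_sum) auto
  have e1: "(\<lambda>n. ent A (\<mu> n) V) \<longlonglongrightarrow> ent A \<nu> V"
    unfolding ent_eq_values[OF A]
    by (intro tendsto_intros tendsto_xlog) (auto simp: mass_def intro!: tendsto_sum lim sum_nonneg bspec[OF nn])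
  have e2: "(\<lambda>n. ent A (\<mu> n) (\<lambda>w. (X w, V w))) \<longlonglongrightarrow> ent A \<nu> (\<lambda>w. (X w, V w))"
    unfolding ent_eq_values[OF A]
    by (intro tendsto_intros tendsto_xlog) (auto simp: mass_def intro!: tendsto_sum lim sum_nonneg bspec[OF nn])
  show ?thesis unfolding hc_def by (intro tendsto_diff e1 e2)
qed

lemma mass_mass:
  assumes "finite A"
  shows "mass (h ` A) (mass A \<mu> h) f v = mass A \<mu> (\<lambda>w. f (h w)) v"
proof -
  have "mass (h ` A) (mass A \<mu> h) f v = (\<Sum>u\<in>{u \<in> h ` A. f u = v}. \<Sum>w\<in>{w\<in>{w\<in>A. f (h w) = v}. h w = u}. \<mu> w)"
    unfolding mass_def by (intro sum.cong) auto
  also have "\<dots> = (\<Sum>w\<in>{w\<in>A. f (h w) = v}. \<mu> w)"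
    using assms by (intro sum.group) auto
  finally show ?thesis unfolding mass_def .
qed

lemma hc_image:
  assumes "finite A"
  shows "hc A \<mu> (\<lambda>w. X (h w)) (\<lambda>w. V (h w)) = hc (h ` A) (mass A \<mu> h) X V"
proof -
  have e: "ent A \<mu> (\<lambda>w. V (h w)) = ent (h ` A) (mass A \<mu> h) V"
    unfolding ent_def mass_mass[OF assms]
    by (subst sum_by_values[OF assms, of \<mu> "\<lambda>u. log 2 (mass A \<mu> (\<lambda>w. V (h w)) (V u))" h]) simp
  have e2: "ent A \<mu> (\<lambda>w. (X (h w), V (h w))) = ent (h ` A) (mass A \<mu> h) (\<lambda>u. (X u, V u))"
    unfolding ent_def mass_mass[OF assms]
    by (subst sum_by_values[OF assms, of \<mu> "\<lambda>u. log 2 (mass A \<mu> (\<lambda>w. (X (h w), V (h w))) (X u, V u))" h]) simp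
  show ?thesis unfolding hc_def e e2 ..
qed

lemma ent_family:
  fixes emb :: "'c \<Rightarrow> 'w \<Rightarrow> 'b"
  assumes A: "finite A" "finite B"
    and inj: "\<And>a a' w w'. emb a w = emb a' w' \<Longrightarrow> a = a' \<and> w = w'"
    and f: "\<And>a a' w w'. f (emb a w) = f (emb a' w') \<Longrightarrow> a = a'"
  shows "ent (case_prod emb ` (A \<times> B)) \<mu> f = (\<Sum>a\<in>A. ent B (\<lambda>w. \<mu> (emb a w)) (\<lambda>w. f (emb a w)))"
proof -
  have i: "inj_on (case_prod emb) (A \<times> B)" by (rule inj_onI) (auto dest: inj)
  have m: "mass (case_prod emb ` (A \<times> B)) \<mu> f (f (emb a w)) = mass B (\<lambda>w. \<mu> (emb a w)) (\<lambda>w. f (emb a w)) (f (emb a w))"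
    if "a \<in> A" for a w
  proof -
    have "{u \<in> case_prod emb ` (A \<times> B). f u = f (emb a w)} = emb a ` {w'\<in>B. f (emb a w') = f (emb a w)}"
      using that by (auto dest: f)
    moreover have "inj_on (emb a) {w'\<in>B. f (emb a w') = f (emb a w)}"
      by (rule inj_onI) (auto dest: inj)
    ultimately show ?thesis unfolding mass_def by (simp add: sum.reindex)
  qed
  have "(\<Sum>u\<in>case_prod emb ` (A \<times> B). \<mu> u * log 2 (mass (case_prod emb ` (A \<times> B)) \<mu> f (f u)))
    = (\<Sum>(a, w)\<in>A \<times> B. \<mu> (emb a w) * log 2 (mass (case_prod emb ` (A \<times> B)) \<mu> f (f (emb a w))))"
    by (subst sum.reindex[OF i]) (simp add: case_prod_unfold)
  also have "\<dots> = (\<Sum>(a, w)\<in>A \<times> B. \<mu> (emb a w) * log 2 (mass B (\<lambda>w. \<mu> (emb a w)) (\<lambda>w. f (emb a w)) (f (emb a w))))"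
    by (rule sum.cong) (auto simp: m)
  also have "\<dots> = (\<Sum>a\<in>A. \<Sum>w\<in>B. \<mu> (emb a w) * log 2 (mass B (\<lambda>w. \<mu> (emb a w)) (\<lambda>w. f (emb a w)) (f (emb a w))))"
    by (simp add: sum.cartesian_product)
  finally show ?thesis unfolding ent_def by (simp add: sum_negf)
qed

text \<open>If the condition reveals the label \<open>a\<close>, no two labels share a class and the
  entropy splits into a sum over labels. This makes every quantity conditioned on U additive over
  the values of U.\<close>

lemma hc_family:
  fixes emb :: "'c \<Rightarrow> 'w \<Rightarrow> 'b"
  assumes A: "finite A" "finite B"
    and inj: "\<And>a a' w w'. emb a w = emb a' w' \<Longrightarrow> a = a' \<and> w = w'"
    and V: "\<And>a a' w w'. V (emb a w) = V (emb a' w') \<Longrightarrow> a = a'"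
  shows "hc (case_prod emb ` (A \<times> B)) \<mu> X V =
     (\<Sum>a\<in>A. hc B (\<lambda>w. \<mu> (emb a w)) (\<lambda>w. X (emb a w)) (\<lambda>w. V (emb a w)))"
proof -
  have "ent (case_prod emb ` (A \<times> B)) \<mu> (\<lambda>u. (X u, V u)) =
     (\<Sum>a\<in>A. ent B (\<lambda>w. \<mu> (emb a w)) (\<lambda>w. (X (emb a w), V (emb a w))))"
    by (rule ent_family[OF A]) (use inj V in blast)+
  moreover have "ent (case_prod emb ` (A \<times> B)) \<mu> V = (\<Sum>a\<in>A. ent B (\<lambda>w. \<mu> (emb a w)) (\<lambda>w. V (emb a w)))"
    by (rule ent_family[OF A]) (use inj V in blast)+
  ultimately show ?thesis unfolding hc_def by (simp add: sum_subtractf)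
qed

text \<open>Evaluates a conditional entropy from a known conditional law without dividing by masses:
  where the mass of \<open>V\<close> vanishes the weight is 0, whatever \<open>k\<close> is
  there.\<close>

lemma hc_of_kernel:
  assumes A: "finite A" and \<mu>: "\<forall>w\<in>A. 0 \<le> \<mu> w"
    and k: "\<And>w. w \<in> A \<Longrightarrow> mass A \<mu> (\<lambda>w. (X w, V w)) (X w, V w) = k w * mass A \<mu> V (V w)"
  shows "hc A \<mu> X V = - (\<Sum>w\<in>A. \<mu> w * log 2 (k w))"
proof -
  have "\<mu> w * log 2 (mass A \<mu> (\<lambda>w. (X w, V w)) (X w, V w) / mass A \<mu> V (V w)) = \<mu> w * log 2 (k w)"
    if w: "w \<in> A" for w
  proof (cases "\<mu> w = 0")
    case False
    then have "0 < \<mu> w" using \<mu> w by force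
    then have "0 < mass A \<mu> V (V w)" using mass_ge[OF A \<mu> w, where f=V] by simp
    then show ?thesis unfolding k[OF w] by simp
  qed simp
  then have "(\<Sum>w\<in>A. \<mu> w * log 2 (mass A \<mu> (\<lambda>w. (X w, V w)) (X w, V w) / mass A \<mu> V (V w)))
      = (\<Sum>w\<in>A. \<mu> w * log 2 (k w))" by (rule sum.cong[OF refl])
  then show ?thesis using hc_eq_sum[OF A \<mu>, where X=X and V=V] by simp
qed

lemma mass_eqI:
  assumes "{w\<in>A. f w = v} = h ` B" "inj_on h B"
  shows "mass A \<mu> f v = (\<Sum>b\<in>B. \<mu> (h b))"
  unfolding mass_def assms(1) by (simp add: sum.reindex[OF assms(2)])

section \<open>Atoms of the joint law and the functionals of the region\<close>

fun tS1 where "tS1 (s1, s2, x1, x2, y) = s1"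
fun tS2 where "tS2 (s1, s2, x1, x2, y) = s2"
fun tX1 where "tX1 (s1, s2, x1, x2, y) = x1"
fun tX2 where "tX2 (s1, s2, x1, x2, y) = x2"
fun tY where "tY (s1, s2, x1, x2, y) = y"

locale mac =
  fixes pS :: "('s1::finite \<times> 's2::finite) pmf"
    and W :: "'x1::finite \<Rightarrow> 'x2::finite \<Rightarrow> 's1 \<Rightarrow> 's2 \<Rightarrow> 'y::finite pmf"
    and z :: "'x1 \<Rightarrow> 's1 \<Rightarrow> 'z::finite"
begin

definition tZ :: "('s1, 's2, 'x1, 'x2, 'y) letter \<Rightarrow> 'z" where
  "tZ w = z (tX1 w) (tS1 w)"

definition chan :: "('s1, 's2, 'x1, 'x2, 'y) letter \<Rightarrow> real" where
  "chan w = pmf (W (tX1 w) (tX2 w) (tS1 w) (tS2 w)) (tY w)"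

definition atom :: "('s1 \<Rightarrow> 'x1 \<Rightarrow> real) \<Rightarrow> ('s2 \<Rightarrow> 'x2 \<Rightarrow> real) \<Rightarrow> ('s1, 's2, 'x1, 'x2, 'y) letter \<Rightarrow> real" where
  "atom q t w = pmf pS (tS1 w, tS2 w) * q (tS1 w) (tX1 w) * t (tS2 w) (tX2 w) * chan w"

text \<open>
  \<open>atom q t\<close> is the part of the joint law on which the auxiliary variable has a fixed value, with
  \<open>q s1 x1\<close> the probability of that value and \<open>x1\<close> given \<open>s1\<close>; a \<open>fam\<close> lists these parts. On a
  family, \<open>kap\<close> adds up to $H(Y|X_1,X_2,S_1,S_2)$, the functionals \<open>i1\<close>, \<open>i2\<close>, \<open>i3\<close>, \<open>i5\<close> to the
  mutual informations of the region (\<open>i5\<close> only on the whole law), and \<open>crib\<close> minus \<open>H0\<close> to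
  $H(Z|S_1,U) - I(U;S_1|S_2)$, since $I(U;S_1|S_2) = H(S_1|S_2) - H(S_1|S_2,U)$.
\<close>

definition kap :: "(('s1, 's2, 'x1, 'x2, 'y) letter \<Rightarrow> real) \<Rightarrow> real" where
  "kap \<mu> = - (\<Sum>w\<in>UNIV. \<mu> w * log 2 (chan w))"

definition i1 where "i1 \<mu> = hc UNIV \<mu> tY (\<lambda>w. (tX2 w, tZ w, tS1 w, tS2 w)) - kap \<mu>"
definition i2 where "i2 \<mu> = hc UNIV \<mu> tY (\<lambda>w. (tX1 w, tS1 w, tS2 w)) - kap \<mu>"
definition i3 where "i3 \<mu> = hc UNIV \<mu> tY (\<lambda>w. (tZ w, tS1 w, tS2 w)) - kap \<mu>"
definition i5 where "i5 \<mu> = hc UNIV \<mu> tY (\<lambda>w. (tS1 w, tS2 w)) - kap \<mu>"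
definition crib where
  "crib (\<mu> :: ('s1, 's2, 'x1, 'x2, 'y) letter \<Rightarrow> real) = hc UNIV \<mu> tZ tS1 + hc UNIV \<mu> tS1 tS2"
definition H0 :: real where "H0 = hc (set_pmf pS) (pmf pS) fst snd"

definition feas :: "'c set \<Rightarrow> ('c \<Rightarrow> ('s1, 's2, 'x1, 'x2, 'y) letter \<Rightarrow> real) \<Rightarrow> real \<Rightarrow> real \<Rightarrow> bool" where
  "feas A \<mu> R1 R2 \<longleftrightarrow>
     R1 \<le> (\<Sum>a\<in>A. i1 (\<mu> a)) + ((\<Sum>a\<in>A. crib (\<mu> a)) - H0) \<and>
     R2 \<le> (\<Sum>a\<in>A. i2 (\<mu> a)) \<and>
     R1 + R2 \<le> (\<Sum>a\<in>A. i3 (\<mu> a)) + ((\<Sum>a\<in>A. crib (\<mu> a)) - H0) \<and>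
     R1 + R2 \<le> i5 (\<lambda>w. \<Sum>a\<in>A. \<mu> a w) \<and>
     0 \<le> (\<Sum>a\<in>A. crib (\<mu> a)) - H0"

definition fam :: "'c set \<Rightarrow> ('c \<Rightarrow> 's1 \<Rightarrow> 'x1 \<Rightarrow> real) \<Rightarrow> ('c \<Rightarrow> 's2 \<Rightarrow> 'x2 \<Rightarrow> real) \<Rightarrow> bool" where
  "fam A q t \<longleftrightarrow> finite A \<and> (\<forall>a\<in>A. \<forall>s x. 0 \<le> q a s x) \<and> (\<forall>a\<in>A. \<forall>s x. 0 \<le> t a s x) \<and>
     (\<forall>a\<in>A. \<forall>s. (\<Sum>x\<in>UNIV. t a s x) = 1) \<and> (\<forall>s. (\<Sum>a\<in>A. \<Sum>x\<in>UNIV. q a s x) = 1)"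

lemma chan_nonneg: "0 \<le> chan w" unfolding chan_def by simp

lemma sum_chan: "(\<Sum>y\<in>UNIV. chan (s1, s2, x1, x2, y)) = 1"
  unfolding chan_def by (simp add: sum_pmf_eq_1)

text \<open>Weights with a factor \<open>chan\<close> have the channel as conditional law of Y.
  Hence H(Y|X1,X2,S1,S2) is linear in such weights, although entropies in general are not.\<close>

lemma hc_channel:
  assumes \<mu>: "\<And>s1 s2 x1 x2 y. \<mu> (s1, s2, x1, x2, y) = g s1 s2 x1 x2 * chan (s1, s2, x1, x2, y)"
    and g: "\<And>s1 s2 x1 x2. 0 \<le> g s1 s2 x1 x2"
  shows "hc UNIV \<mu> tY (\<lambda>w. (tX1 w, tX2 w, tS1 w, tS2 w)) = kap \<mu>"
proof -
  have "hc UNIV \<mu> tY (\<lambda>w. (tX1 w, tX2 w, tS1 w, tS2 w)) = - (\<Sum>w\<in>UNIV. \<mu> w * log 2 (chan w))"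
  proof (rule hc_of_kernel)
    show "\<forall>w\<in>UNIV. 0 \<le> \<mu> w" using \<mu> g chan_nonneg by (auto simp: split_paired_all)
    fix w :: "('s1, 's2, 'x1, 'x2, 'y) letter"
    obtain s1 s2 x1 x2 y where w: "w = (s1, s2, x1, x2, y)" by (cases w) auto
    have "{w'. (tY w', tX1 w', tX2 w', tS1 w', tS2 w') = (tY w, tX1 w, tX2 w, tS1 w, tS2 w)} = {w}"
      unfolding w by auto
    then have 1: "mass UNIV \<mu> (\<lambda>w. (tY w, tX1 w, tX2 w, tS1 w, tS2 w)) (tY w, tX1 w, tX2 w, tS1 w, tS2 w) = \<mu> w"
      unfolding mass_def by simp
    have "mass UNIV \<mu> (\<lambda>w. (tX1 w, tX2 w, tS1 w, tS2 w)) (tX1 w, tX2 w, tS1 w, tS2 w)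
        = (\<Sum>y\<in>UNIV. \<mu> (s1, s2, x1, x2, y))"
      by (rule mass_eqI) (auto simp: w inj_on_def)
    also have "\<dots> = g s1 s2 x1 x2" unfolding \<mu> sum_distrib_left[symmetric] sum_chan by simp
    finally show "mass UNIV \<mu> (\<lambda>w. (tY w, tX1 w, tX2 w, tS1 w, tS2 w)) (tY w, tX1 w, tX2 w, tS1 w, tS2 w)
       = chan w * mass UNIV \<mu> (\<lambda>w. (tX1 w, tX2 w, tS1 w, tS2 w)) (tX1 w, tX2 w, tS1 w, tS2 w)"
      using 1 \<mu> w by simp
  qed simp
  then show ?thesis unfolding kap_def .
qed

lemma atom_tuple: "atom q t (s1, s2, x1, x2, y) = (pmf pS (s1, s2) * q s1 x1 * t s2 x2) * chan (s1, s2, x1, x2, y)"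
  unfolding atom_def by simp

lemma atom_nonneg: "\<lbrakk>\<And>s x. 0 \<le> q s x; \<And>s x. 0 \<le> t s x\<rbrakk> \<Longrightarrow> 0 \<le> atom q t w"
  unfolding atom_def using chan_nonneg by simp

text \<open>At a fixed value of U the input X2 is drawn from \<open>t\<close> at its own state,
  independently of X1 and S1.\<close>

lemma hc_atom_x2:
  assumes q: "\<And>s x. 0 \<le> q s x" and t: "\<And>s x. 0 \<le> t s x" "\<And>s. (\<Sum>x\<in>UNIV. t s x) = 1"
  shows "hc UNIV (atom q t) tX2 (\<lambda>w. (tX1 w, tS1 w, tS2 w)) = - (\<Sum>w\<in>UNIV. atom q t w * log 2 (t (tS2 w) (tX2 w)))"
proof (rule hc_of_kernel)
  show "\<forall>w\<in>UNIV. 0 \<le> atom q t w" using q t by (auto intro!: atom_nonneg)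
  fix w :: "('s1, 's2, 'x1, 'x2, 'y) letter"
  obtain s1 s2 x1 x2 y where w: "w = (s1, s2, x1, x2, y)" by (cases w) auto
  have "mass UNIV (atom q t) (\<lambda>w. (tX2 w, tX1 w, tS1 w, tS2 w)) (tX2 w, tX1 w, tS1 w, tS2 w)
      = (\<Sum>y\<in>UNIV. atom q t (s1, s2, x1, x2, y))"
    by (rule mass_eqI) (auto simp: w inj_on_def)
  also have "\<dots> = pmf pS (s1, s2) * q s1 x1 * t s2 x2"
    by (simp add: atom_tuple sum_distrib_left[symmetric] sum_chan)
  finally have 1: "mass UNIV (atom q t) (\<lambda>w. (tX2 w, tX1 w, tS1 w, tS2 w)) (tX2 w, tX1 w, tS1 w, tS2 w)
      = pmf pS (s1, s2) * q s1 x1 * t s2 x2" .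
  have "mass UNIV (atom q t) (\<lambda>w. (tX1 w, tS1 w, tS2 w)) (tX1 w, tS1 w, tS2 w)
      = (\<Sum>b\<in>UNIV \<times> UNIV. atom q t (s1, s2, x1, fst b, snd b))"
    by (rule mass_eqI) (force simp: w inj_on_def image_iff)+
  also have "\<dots> = (\<Sum>x2\<in>UNIV. \<Sum>y\<in>UNIV. atom q t (s1, s2, x1, x2, y))"
    by (simp add: sum.cartesian_product case_prod_unfold del: UNIV_Times_UNIV)
  also have "\<dots> = pmf pS (s1, s2) * q s1 x1"
    by (simp add: atom_tuple sum_distrib_left[symmetric] sum_chan t)
  finally show "mass UNIV (atom q t) (\<lambda>w. (tX2 w, tX1 w, tS1 w, tS2 w)) (tX2 w, tX1 w, tS1 w, tS2 w)
    = t (tS2 w) (tX2 w) * mass UNIV (atom q t) (\<lambda>w. (tX1 w, tS1 w, tS2 w)) (tX1 w, tS1 w, tS2 w)"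
    using 1 w by simp
qed simp

text \<open>After the chain rule this says I(X2;Y|Z,S1,S2) <= I(X2;Y|X1,S1,S2). Within an atom X2 is
  independent of X1 given the states, so exchanging Z for X1 does not lower H(X2) before Y is seen;
  and X1 with S1 determines Z, so it can only lower the entropy of X2 left after Y.\<close>

lemma i3_le_i1_i2:
  assumes q: "\<And>s x. 0 \<le> q s x" and t: "\<And>s x. 0 \<le> t s x" "\<And>s. (\<Sum>x\<in>UNIV. t s x) = 1"
  shows "i3 (atom q t) \<le> i1 (atom q t) + i2 (atom q t)"
proof -
  let ?\<mu> = "atom q t"
  let ?h = "hc UNIV ?\<mu>"
  have nn: "\<forall>w\<in>UNIV. 0 \<le> ?\<mu> w" using q t by (auto intro!: atom_nonneg)
  have k: "?h tY (\<lambda>w. (tX1 w, tX2 w, tS1 w, tS2 w)) = kap ?\<mu>"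
    by (rule hc_channel[OF atom_tuple]) (use q t in simp)
  have a: "?h tX2 (\<lambda>w. (tZ w, tS1 w, tS2 w)) \<le> - (\<Sum>w\<in>UNIV. ?\<mu> w * log 2 (t (tS2 w) (tX2 w)))"
  proof -
    have "?h tX2 (\<lambda>w. (tZ w, tS1 w, tS2 w)) \<le> - (\<Sum>w\<in>UNIV. ?\<mu> w * log 2 ((\<lambda>x v. t (snd (snd v)) x) (tX2 w) (tZ w, tS1 w, tS2 w)))"
    proof (rule hc_le_cross[OF _ nn])
      fix w assume "0 < ?\<mu> w"
      moreover have "?\<mu> w = 0" if "t (tS2 w) (tX2 w) = 0" using that unfolding atom_def by simp
      ultimately show "0 < t (snd (snd (tZ w, tS1 w, tS2 w))) (tX2 w)"
        using t(1)[of "tS2 w" "tX2 w"] by (cases "t (tS2 w) (tX2 w) = 0") auto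
    next
      fix v :: "'z \<times> 's1 \<times> 's2"
      have "(\<Sum>x\<in>range tX2. t (snd (snd v)) x) \<le> (\<Sum>x\<in>UNIV. t (snd (snd v)) x)"
        using t by (intro sum_mono2) auto
      then show "(\<Sum>x\<in>range (tX2 :: ('s1, 's2, 'x1, 'x2, 'y) letter \<Rightarrow> 'x2). t (snd (snd v)) x) \<le> 1"
        using t(2) by simp
    qed (use t in simp_all)
    then show ?thesis by simp
  qed
  have b: "?h tX2 (\<lambda>w. (tX1 w, tS1 w, tS2 w)) = - (\<Sum>w\<in>UNIV. ?\<mu> w * log 2 (t (tS2 w) (tX2 w)))"
    by (rule hc_atom_x2[OF q t])
  have c: "?h tX2 (\<lambda>w. (tY w, tX1 w, tS1 w, tS2 w)) \<le> ?h tX2 (\<lambda>w. (tY w, tZ w, tS1 w, tS2 w))"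
    by (rule hc_mono[OF _ nn]) (auto simp: tZ_def)
  have sw: "?h (\<lambda>w. (tX2 w, tY w)) V = ?h (\<lambda>w. (tY w, tX2 w)) V" for V :: "('s1, 's2, 'x1, 'x2, 'y) letter \<Rightarrow> 'd"
    by (rule hc_kernel_cong) auto
  have d: "?h tX2 V + ?h tY (\<lambda>w. (tX2 w, V w)) = ?h tY V + ?h tX2 (\<lambda>w. (tY w, V w))" for V :: "('s1, 's2, 'x1, 'x2, 'y) letter \<Rightarrow> 'd"
    using sw[of V] unfolding hc_chain .
  have e: "?h tY (\<lambda>w. (tX2 w, tX1 w, tS1 w, tS2 w)) = ?h tY (\<lambda>w. (tX1 w, tX2 w, tS1 w, tS2 w))"
    by (rule hc_kernel_cong) auto
  show ?thesis
    unfolding i1_def i2_def i3_def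
    using a b c k e d[of "\<lambda>w. (tZ w, tS1 w, tS2 w)"] d[of "\<lambda>w. (tX1 w, tS1 w, tS2 w)"] by linarith
qed

lemma kap_scale: "kap (\<lambda>w. c * \<mu> w) = c * kap \<mu>"
  unfolding kap_def by (simp add: sum_distrib_left mult.assoc)

lemma scale:
  assumes "\<And>w. 0 \<le> \<mu> w" "0 \<le> c"
  shows "i1 (\<lambda>w. c * \<mu> w) = c * i1 \<mu>" "i2 (\<lambda>w. c * \<mu> w) = c * i2 \<mu>" "i3 (\<lambda>w. c * \<mu> w) = c * i3 \<mu>"
    "crib (\<lambda>w. c * \<mu> w) = c * crib \<mu>"
proof -
  have h2: "hc UNIV (\<lambda>w. c * \<mu> w) tZ tS1 = c * hc UNIV \<mu> tZ tS1"
      "hc UNIV (\<lambda>w. c * \<mu> w) tS1 tS2 = c * hc UNIV \<mu> tS1 tS2"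
      "hc UNIV (\<lambda>w. c * \<mu> w) tY (\<lambda>w. (tX2 w, tZ w, tS1 w, tS2 w)) = c * hc UNIV \<mu> tY (\<lambda>w. (tX2 w, tZ w, tS1 w, tS2 w))"
      "hc UNIV (\<lambda>w. c * \<mu> w) tY (\<lambda>w. (tX1 w, tS1 w, tS2 w)) = c * hc UNIV \<mu> tY (\<lambda>w. (tX1 w, tS1 w, tS2 w))"
      "hc UNIV (\<lambda>w. c * \<mu> w) tY (\<lambda>w. (tZ w, tS1 w, tS2 w)) = c * hc UNIV \<mu> tY (\<lambda>w. (tZ w, tS1 w, tS2 w))"
    by (rule hc_scale; use assms in simp)+
  show "i1 (\<lambda>w. c * \<mu> w) = c * i1 \<mu>" "i2 (\<lambda>w. c * \<mu> w) = c * i2 \<mu>" "i3 (\<lambda>w. c * \<mu> w) = c * i3 \<mu>"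
    "crib (\<lambda>w. c * \<mu> w) = c * crib \<mu>"
    unfolding i1_def i2_def i3_def crib_def kap_scale h2 by (simp_all add: algebra_simps)
qed

definition channel_form :: "(('s1, 's2, 'x1, 'x2, 'y) letter \<Rightarrow> real) \<Rightarrow> bool" where
  "channel_form \<mu> \<longleftrightarrow> (\<exists>g. (\<forall>s1 s2 x1 x2. 0 \<le> g s1 s2 x1 x2) \<and>
     (\<forall>s1 s2 x1 x2 y. \<mu> (s1, s2, x1, x2, y) = g s1 s2 x1 x2 * chan (s1, s2, x1, x2, y)))"

lemma zero_measure: "i1 (\<lambda>w. 0) = 0" "i2 (\<lambda>w. 0) = 0" "i3 (\<lambda>w. 0) = 0" "crib (\<lambda>w. 0) = 0"
  using scale[of "\<lambda>_. 0" 0] by simp_all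

text \<open>The rows \<open>\<rho>\<close> have three duties: those in \<open>I0\<close> sum to 1
  and so are positive on each atom of positive mass, as the elimination requires; sums of rows give
  the indicators of state pairs, so that the state marginal survives; and together they determine
  \<open>i5\<close>. The two further constraints, \<open>g1\<close> and \<open>g2\<close>, take care
  of the first three bounds.\<close>

lemma reduce:
  fixes \<rho> :: "'i \<Rightarrow> ('s1, 's2, 'x1, 'x2, 'y) letter \<Rightarrow> real"
  assumes fam: "fam A q t" and feas: "feas A (\<lambda>a. atom (q a) (t a)) R1 R2"
    and I: "finite I" "I0 \<subseteq> I" "\<And>w. (\<Sum>i\<in>I0. \<rho> i w) = 1"
    and states: "\<And>s1 s2. \<exists>J\<subseteq>I. \<forall>w. (\<Sum>i\<in>J. \<rho> i w) = (if tS1 w = s1 \<and> tS2 w = s2 then 1 else 0)"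
    and i5: "\<And>\<mu> \<nu>. channel_form \<mu> \<Longrightarrow> channel_form \<nu> \<Longrightarrow>
         (\<And>i. i \<in> I \<Longrightarrow> (\<Sum>w\<in>UNIV. \<mu> w * \<rho> i w) = (\<Sum>w\<in>UNIV. \<nu> w * \<rho> i w)) \<Longrightarrow> i5 \<mu> = i5 \<nu>"
  shows "\<exists>c. (\<forall>a. 0 \<le> c a) \<and> card {a\<in>A. c a \<noteq> 0} \<le> card I + 2 \<and>
     (\<forall>s1 s2. 0 < pmf pS (s1, s2) \<longrightarrow> (\<Sum>a\<in>A. \<Sum>x\<in>UNIV. c a * q a s1 x) = 1) \<and>
     feas A (\<lambda>a w. c a * atom (q a) (t a) w) R1 R2"
proof -
  define \<mu> where "\<mu> a = atom (q a) (t a)" for a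
  have A: "finite A" and q: "\<And>a s x. a \<in> A \<Longrightarrow> 0 \<le> q a s x" and t: "\<And>a s x. a \<in> A \<Longrightarrow> 0 \<le> t a s x"
    and t1: "\<And>a s. a \<in> A \<Longrightarrow> (\<Sum>x\<in>UNIV. t a s x) = 1"
    and q1: "\<And>s. (\<Sum>a\<in>A. \<Sum>x\<in>UNIV. q a s x) = 1"
    using fam unfolding fam_def by auto
  have \<mu>0: "0 \<le> \<mu> a w" if "a \<in> A" for a w unfolding \<mu>_def using q t that by (intro atom_nonneg) auto
  \<comment> \<open>Atoms without mass violate the positivity needed for the elimination; since all
    functionals vanish on them they are dropped.\<close>
  define A0 where "A0 = {a\<in>A. 0 < (\<Sum>w\<in>UNIV. \<mu> a w)}"
  have A0: "finite A0" "A0 \<subseteq> A" using A by (auto simp: A0_def)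
  have null: "\<mu> a = (\<lambda>w. 0)" if "a \<in> A - A0" for a
  proof -
    have "(\<Sum>w\<in>UNIV. \<mu> a w) = 0"
      using that \<mu>0 sum_nonneg[of UNIV "\<mu> a"] by (force simp: A0_def)
    then show ?thesis using \<mu>0 that by (auto simp: sum_nonneg_eq_0_iff)
  qed
  have sumA0: "(\<Sum>a\<in>A0. \<phi> a) = (\<Sum>a\<in>A. \<phi> a)" if "\<And>a. \<mu> a = (\<lambda>w. 0) \<Longrightarrow> \<phi> a = 0" for \<phi> :: "'a \<Rightarrow> real"
    using A A0 null that by (intro sum.mono_neutral_left) auto
  define h where "h a = i1 (\<mu> a) + i2 (\<mu> a) - i3 (\<mu> a)" for a
  have h0: "0 \<le> h a" if "a \<in> A" for a
    using i3_le_i1_i2[of "q a" "t a"] q t t1 that unfolding h_def \<mu>_def by auto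
  define F1 F2 F3 F4 where "F1 = (\<Sum>a\<in>A. i1 (\<mu> a))" "F2 = (\<Sum>a\<in>A. i2 (\<mu> a))" "F3 = (\<Sum>a\<in>A. i3 (\<mu> a))"
    "F4 = (\<Sum>a\<in>A. crib (\<mu> a))"
  note F = this
  have fe: "R1 \<le> F1 + (F4 - H0)" "R2 \<le> F2" "R1 + R2 \<le> F3 + (F4 - H0)" "R1 + R2 \<le> i5 (\<lambda>w. \<Sum>a\<in>A. \<mu> a w)"
      "0 \<le> F4 - H0"
    using feas unfolding feas_def F \<mu>_def by auto
  have hs: "(\<Sum>a\<in>A. h a) = F1 + F2 - F3" unfolding h_def F by (simp add: sum.distrib sum_subtractf)
  have hs0: "0 \<le> (\<Sum>a\<in>A. h a)" using h0 by (rule sum_nonneg)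
  \<comment> \<open>By the sum bound, the slacks \<open>F1 + (F4 - H0) - R1\<close> and
    \<open>F2 - R2\<close> add up to at least the sum of \<open>h\<close>. So that sum can be
    divided between them in proportion \<open>l\<close> to \<open>1 - l\<close>.\<close>
  obtain l :: real where l: "0 \<le> l" "l \<le> 1" "l * (\<Sum>a\<in>A. h a) \<le> F1 + (F4 - H0) - R1"
      "(1 - l) * (\<Sum>a\<in>A. h a) \<le> F2 - R2"
  proof (cases "(\<Sum>a\<in>A. h a) \<le> F1 + (F4 - H0) - R1")
    case True
    then show ?thesis using fe by (intro that[of 1]) auto
  next
    case False
    let ?l = "(F1 + (F4 - H0) - R1) / (\<Sum>a\<in>A. h a)"
    have pos: "0 < (\<Sum>a\<in>A. h a)" using False fe by linarith
    have e: "?l * (\<Sum>a\<in>A. h a) = F1 + (F4 - H0) - R1" using pos by simp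
    show ?thesis
    proof (rule that[of ?l])
      show "0 \<le> ?l" "?l \<le> 1" using pos False fe by (auto simp: divide_le_eq)
      show "?l * (\<Sum>a\<in>A. h a) \<le> F1 + (F4 - H0) - R1" using e by simp
      show "(1 - ?l) * (\<Sum>a\<in>A. h a) \<le> F2 - R2"
        unfolding left_diff_distrib e using hs fe by simp
    qed
  qed
  \<comment> \<open>\<open>g1 + g2\<close> equals \<open>i3 + crib\<close>, while \<open>g1\<close>
    is at most \<open>i1 + crib\<close> and \<open>g2\<close> at most \<open>i2\<close>, because
    \<open>h\<close> is nonnegative on atoms. Fixing the two sums therefore preserves three
    bounds.\<close>
  define g1 where "g1 a = i1 (\<mu> a) + crib (\<mu> a) - l * h a" for a
  define g2 where "g2 a = i2 (\<mu> a) - (1 - l) * h a" for a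
  define r where "r k a = (case k of Inl i \<Rightarrow> (\<Sum>w\<in>UNIV. \<mu> a w * \<rho> i w) | Inr b \<Rightarrow> (if b then g1 a else g2 a))" for k a
  let ?I = "Inl ` I \<union> range Inr :: ('i + bool) set"
  have cardI: "card ?I = card I + 2"
    using I(1) by (subst card_Un_disjoint) (auto simp: card_image inj_on_def card_UNIV_bool)
  have "\<exists>c. (\<forall>a. 0 \<le> c a) \<and> card {a\<in>A0. c a \<noteq> 0} \<le> card ?I \<and>
     (\<forall>i\<in>?I. (\<Sum>a\<in>A0. c a * r i a) = (\<Sum>a\<in>A0. r i a)) \<and> (\<Sum>a\<in>A0. crib (\<mu> a)) \<le> (\<Sum>a\<in>A0. c a * crib (\<mu> a))"
  proof (rule caratheodory_weights[OF A0(1), of ?I "Inl ` I0"])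
    fix a assume a: "a \<in> A0"
    have "(\<Sum>i\<in>Inl ` I0. r i a) = (\<Sum>i\<in>I0. \<Sum>w\<in>UNIV. \<mu> a w * \<rho> i w)"
      by (simp add: sum.reindex inj_on_def r_def)
    also have "\<dots> = (\<Sum>w\<in>UNIV. \<mu> a w * (\<Sum>i\<in>I0. \<rho> i w))"
      by (subst sum.swap) (simp add: sum_distrib_left)
    finally show "0 < (\<Sum>i\<in>Inl ` I0. r i a)" using a I(3) by (simp add: A0_def)
  qed (use I in auto)
  then obtain c0 where c0: "\<And>a. 0 \<le> c0 a" "card {a\<in>A0. c0 a \<noteq> 0} \<le> card I + 2"
     "\<And>i. i \<in> ?I \<Longrightarrow> (\<Sum>a\<in>A0. c0 a * r i a) = (\<Sum>a\<in>A0. r i a)"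
     "(\<Sum>a\<in>A0. crib (\<mu> a)) \<le> (\<Sum>a\<in>A0. c0 a * crib (\<mu> a))"
    unfolding cardI by blast
  define c where "c a = (if a \<in> A0 then c0 a else 0)" for a
  have c: "0 \<le> c a" for a using c0(1) by (simp add: c_def)
  have csum: "(\<Sum>a\<in>A0. c0 a * \<phi> a) = (\<Sum>a\<in>A. c a * \<phi> a)" for \<phi> :: "'a \<Rightarrow> real"
    using A A0 by (intro sum.mono_neutral_cong_left) (auto simp: c_def)
  have rows: "(\<Sum>a\<in>A. c a * (\<Sum>w\<in>UNIV. \<mu> a w * \<rho> i w)) = (\<Sum>a\<in>A. \<Sum>w\<in>UNIV. \<mu> a w * \<rho> i w)" if "i \<in> I" for i
    using c0(3)[of "Inl i"] that sumA0[of "r (Inl i)"] unfolding csum by (simp add: r_def)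
  have G1: "(\<Sum>a\<in>A. c a * g1 a) = (\<Sum>a\<in>A. g1 a)"
    using c0(3)[OF UnI2[OF rangeI[of Inr True]]] sumA0[of g1] unfolding csum by (simp add: r_def g1_def h_def zero_measure)
  have G2: "(\<Sum>a\<in>A. c a * g2 a) = (\<Sum>a\<in>A. g2 a)"
    using c0(3)[OF UnI2[OF rangeI[of Inr False]]] sumA0[of g2] unfolding csum by (simp add: r_def g2_def h_def zero_measure)
  have C: "F4 \<le> (\<Sum>a\<in>A. c a * crib (\<mu> a))"
    using c0(4) sumA0[of "\<lambda>a. crib (\<mu> a)"] unfolding csum F by (simp add: zero_measure)
  have sc: "(\<Sum>a\<in>A. i1 (\<lambda>w. c a * \<mu> a w)) = (\<Sum>a\<in>A. c a * i1 (\<mu> a))"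
    "(\<Sum>a\<in>A. i2 (\<lambda>w. c a * \<mu> a w)) = (\<Sum>a\<in>A. c a * i2 (\<mu> a))"
    "(\<Sum>a\<in>A. i3 (\<lambda>w. c a * \<mu> a w)) = (\<Sum>a\<in>A. c a * i3 (\<mu> a))"
    "(\<Sum>a\<in>A. crib (\<lambda>w. c a * \<mu> a w)) = (\<Sum>a\<in>A. c a * crib (\<mu> a))"
    using scale[OF \<mu>0 c] by (auto intro!: sum.cong)
  have hc0: "0 \<le> (\<Sum>a\<in>A. c a * h a)" using c h0 by (intro sum_nonneg mult_nonneg_nonneg) auto
  have g1s: "(\<Sum>a\<in>A. g1 a) = F1 + F4 - l * (\<Sum>a\<in>A. h a)"
    unfolding g1_def F by (simp add: sum.distrib sum_subtractf sum_distrib_left)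
  have g2s: "(\<Sum>a\<in>A. g2 a) = F2 - (1 - l) * (\<Sum>a\<in>A. h a)"
    unfolding g2_def F by (simp add: sum_subtractf sum_distrib_left)
  have cg1: "(\<Sum>a\<in>A. c a * g1 a) = (\<Sum>a\<in>A. c a * i1 (\<mu> a)) + (\<Sum>a\<in>A. c a * crib (\<mu> a)) - l * (\<Sum>a\<in>A. c a * h a)"
    unfolding g1_def by (simp add: sum.distrib sum_subtractf sum_distrib_left algebra_simps)
  have cg2: "(\<Sum>a\<in>A. c a * g2 a) = (\<Sum>a\<in>A. c a * i2 (\<mu> a)) - (1 - l) * (\<Sum>a\<in>A. c a * h a)"
  proof -
    have "(\<Sum>a\<in>A. c a * g2 a) = (\<Sum>a\<in>A. c a * i2 (\<mu> a) - (1 - l) * (c a * h a))"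
      unfolding g2_def by (intro sum.cong) (auto simp: algebra_simps)
    then show ?thesis by (simp add: sum_subtractf sum_distrib_left)
  qed
  have ch: "(\<Sum>a\<in>A. c a * h a) = (\<Sum>a\<in>A. c a * i1 (\<mu> a)) + (\<Sum>a\<in>A. c a * i2 (\<mu> a)) - (\<Sum>a\<in>A. c a * i3 (\<mu> a))"
    unfolding h_def by (simp add: sum.distrib sum_subtractf algebra_simps)
  have lh: "0 \<le> l * (\<Sum>a\<in>A. c a * h a)" "0 \<le> (1 - l) * (\<Sum>a\<in>A. c a * h a)" using l hc0 by auto
  have form: "channel_form (\<lambda>w. \<Sum>a\<in>A. \<mu> a w)" "channel_form (\<lambda>w. \<Sum>a\<in>A. c a * \<mu> a w)"
    unfolding channel_form_def
    by (rule exI[of _ "\<lambda>s1 s2 x1 x2. \<Sum>a\<in>A. pmf pS (s1, s2) * q a s1 x1 * t a s2 x2"],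
        auto simp: \<mu>_def atom_tuple sum_distrib_right intro!: sum_nonneg mult_nonneg_nonneg q t)
       (rule exI[of _ "\<lambda>s1 s2 x1 x2. \<Sum>a\<in>A. c a * (pmf pS (s1, s2) * q a s1 x1 * t a s2 x2)"],
        auto simp: \<mu>_def atom_tuple sum_distrib_right mult.assoc intro!: sum_nonneg mult_nonneg_nonneg q t c)
  have rows': "(\<Sum>w\<in>UNIV. (\<Sum>a\<in>A. c a * \<mu> a w) * \<rho> i w) = (\<Sum>w\<in>UNIV. (\<Sum>a\<in>A. \<mu> a w) * \<rho> i w)" if "i \<in> I" for i
  proof -
    have "(\<Sum>w\<in>UNIV. (\<Sum>a\<in>A. c a * \<mu> a w) * \<rho> i w) = (\<Sum>a\<in>A. c a * (\<Sum>w\<in>UNIV. \<mu> a w * \<rho> i w))"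
      by (simp add: sum_distrib_right sum_distrib_left mult.assoc sum.swap[of _ A UNIV])
    also have "\<dots> = (\<Sum>w\<in>UNIV. (\<Sum>a\<in>A. \<mu> a w) * \<rho> i w)"
      unfolding rows[OF that] by (simp add: sum_distrib_right sum.swap[of _ A UNIV])
    finally show ?thesis .
  qed
  have "i5 (\<lambda>w. \<Sum>a\<in>A. c a * \<mu> a w) = i5 (\<lambda>w. \<Sum>a\<in>A. \<mu> a w)"
    using form rows' by (intro i5) auto
  moreover have "(1 - l) * (\<Sum>a\<in>A. c a * h a) = (\<Sum>a\<in>A. c a * h a) - l * (\<Sum>a\<in>A. c a * h a)"
    "(1 - l) * (\<Sum>a\<in>A. h a) = (\<Sum>a\<in>A. h a) - l * (\<Sum>a\<in>A. h a)"
    by (simp_all add: left_diff_distrib)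
  ultimately have feas': "feas A (\<lambda>a w. c a * \<mu> a w) R1 R2"
    unfolding feas_def sc using l(3,4) g1s g2s cg1 cg2 ch G1 G2 C lh fe by (intro conjI) linarith+
  \<comment> \<open>The rows see \<open>q\<close> only weighted with \<open>pS\<close>, so the
    normalisation can be recovered exactly at states of positive probability.\<close>
  have norm: "(\<Sum>a\<in>A. \<Sum>x\<in>UNIV. c a * q a s1 x) = 1" if p: "0 < pmf pS (s1, s2)" for s1 s2
  proof -
    obtain J where J: "J \<subseteq> I" "\<And>w. (\<Sum>i\<in>J. \<rho> i w) = (if tS1 w = s1 \<and> tS2 w = s2 then 1 else 0)"
      using states[of s1 s2] by blast
    have ms: "(\<Sum>w\<in>UNIV. \<mu> a w * (\<Sum>i\<in>J. \<rho> i w)) = pmf pS (s1, s2) * (\<Sum>x\<in>UNIV. q a s1 x)" if a: "a \<in> A" for a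
    proof -
      have "(\<Sum>w\<in>UNIV. \<mu> a w * (\<Sum>i\<in>J. \<rho> i w)) = mass UNIV (\<mu> a) (\<lambda>w. (tS1 w, tS2 w)) (s1, s2)"
        unfolding J mass_def by (simp add: sum.If_cases if_distrib cong: if_cong)
      also have "\<dots> = (\<Sum>b\<in>UNIV \<times> UNIV \<times> UNIV. \<mu> a (s1, s2, fst b, fst (snd b), snd (snd b)))"
        by (rule mass_eqI) (force simp: inj_on_def image_iff)+
      also have "\<dots> = (\<Sum>x1\<in>UNIV. \<Sum>x2\<in>UNIV. \<Sum>y\<in>UNIV. \<mu> a (s1, s2, x1, x2, y))"
        by (simp add: sum.cartesian_product case_prod_unfold del: UNIV_Times_UNIV)
      also have "\<dots> = pmf pS (s1, s2) * (\<Sum>x\<in>UNIV. q a s1 x)"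
        unfolding \<mu>_def by (simp add: atom_tuple sum_distrib_left[symmetric] sum_chan t1[OF a])
      finally show ?thesis .
    qed
    have "(\<Sum>a\<in>A. c a * (\<Sum>w\<in>UNIV. \<mu> a w * (\<Sum>i\<in>J. \<rho> i w))) = (\<Sum>i\<in>J. \<Sum>a\<in>A. c a * (\<Sum>w\<in>UNIV. \<mu> a w * \<rho> i w))"
      by (simp add: sum_distrib_left sum.swap[of _ J])
    also have "\<dots> = (\<Sum>i\<in>J. \<Sum>a\<in>A. (\<Sum>w\<in>UNIV. \<mu> a w * \<rho> i w))"
      by (rule sum.cong[OF refl], rule rows) (use J(1) in blast)
    also have "\<dots> = (\<Sum>a\<in>A. (\<Sum>w\<in>UNIV. \<mu> a w * (\<Sum>i\<in>J. \<rho> i w)))"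
      by (simp add: sum_distrib_left sum.swap[of _ J])
    finally have "(\<Sum>a\<in>A. c a * (pmf pS (s1, s2) * (\<Sum>x\<in>UNIV. q a s1 x))) = (\<Sum>a\<in>A. pmf pS (s1, s2) * (\<Sum>x\<in>UNIV. q a s1 x))"
      using ms by simp
    then have "pmf pS (s1, s2) * (\<Sum>a\<in>A. c a * (\<Sum>x\<in>UNIV. q a s1 x)) = pmf pS (s1, s2)"
      unfolding sum_distrib_left[symmetric] q1 by (simp add: sum_distrib_left mult.left_commute)
    then have "(\<Sum>a\<in>A. c a * (\<Sum>x\<in>UNIV. q a s1 x)) = 1" using p by simp
    then show ?thesis by (simp only: sum_distrib_left)
  qed
  have "{a\<in>A. c a \<noteq> 0} = {a\<in>A0. c0 a \<noteq> 0}" using A0 by (auto simp: c_def)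
  then have "card {a\<in>A. c a \<noteq> 0} \<le> card I + 2" using c0(2) by simp
  then show ?thesis using c norm feas' unfolding \<mu>_def by blast
qed

lemma feas_reindex:
  assumes A: "finite A" "A' \<subseteq> A" and B: "finite B" "h ` A' \<subseteq> B" and inj: "inj_on h A'"
    and \<nu>: "\<And>a. a \<in> A' \<Longrightarrow> \<nu> (h a) = \<mu> a" "\<And>b. b \<in> B - h ` A' \<Longrightarrow> \<nu> b = (\<lambda>w. 0)"
    and \<mu>: "\<And>a. a \<in> A - A' \<Longrightarrow> \<mu> a = (\<lambda>w. 0)"
    and feas: "feas A \<mu> R1 R2"
  shows "feas B \<nu> R1 R2"
proof -
  have sums: "(\<Sum>b\<in>B. \<phi> (\<nu> b)) = (\<Sum>a\<in>A. \<phi> (\<mu> a))" if "\<phi> (\<lambda>w. 0) = 0" for \<phi> :: "_ \<Rightarrow> real"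
  proof -
    have "(\<Sum>b\<in>B. \<phi> (\<nu> b)) = (\<Sum>b\<in>h ` A'. \<phi> (\<nu> b))"
      using B \<nu>(2) that by (intro sum.mono_neutral_right) auto
    also have "\<dots> = (\<Sum>a\<in>A'. \<phi> (\<mu> a))" by (simp add: sum.reindex[OF inj] \<nu>(1))
    also have "\<dots> = (\<Sum>a\<in>A. \<phi> (\<mu> a))"
      using A \<mu> that by (intro sum.mono_neutral_left) auto
    finally show ?thesis .
  qed
  have "(\<Sum>b\<in>B. \<nu> b w) = (\<Sum>a\<in>A. \<mu> a w)" for w using sums[of "\<lambda>m. m w"] by simp
  then show ?thesis using feas unfolding feas_def by (simp add: sums zero_measure)
qed

lemma reduce_to:
  fixes \<rho> :: "'i \<Rightarrow> ('s1, 's2, 'x1, 'x2, 'y) letter \<Rightarrow> real"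
  assumes fam: "fam A q t" and feas: "feas A (\<lambda>a. atom (q a) (t a)) R1 R2"
    and I: "finite I" "I0 \<subseteq> I" "\<And>w. (\<Sum>i\<in>I0. \<rho> i w) = 1"
    and states: "\<And>s1 s2. \<exists>J\<subseteq>I. \<forall>w. (\<Sum>i\<in>J. \<rho> i w) = (if tS1 w = s1 \<and> tS2 w = s2 then 1 else 0)"
    and i5: "\<And>\<mu> \<nu>. channel_form \<mu> \<Longrightarrow> channel_form \<nu> \<Longrightarrow>
         (\<And>i. i \<in> I \<Longrightarrow> (\<Sum>w\<in>UNIV. \<mu> w * \<rho> i w) = (\<Sum>w\<in>UNIV. \<nu> w * \<rho> i w)) \<Longrightarrow> i5 \<mu> = i5 \<nu>"
    and k: "card I + 2 \<le> k"
  shows "\<exists>q' t'. fam {..<k::nat} q' t' \<and> feas {..<k} (\<lambda>a. atom (q' a) (t' a)) R1 R2"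
proof -
  obtain c where c: "\<And>a. 0 \<le> c a" "card {a\<in>A. c a \<noteq> 0} \<le> card I + 2"
     "\<And>s1 s2. 0 < pmf pS (s1, s2) \<Longrightarrow> (\<Sum>a\<in>A. \<Sum>x\<in>UNIV. c a * q a s1 x) = 1"
     "feas A (\<lambda>a w. c a * atom (q a) (t a) w) R1 R2"
  proof -
    have "\<exists>c. (\<forall>a. 0 \<le> c a) \<and> card {a\<in>A. c a \<noteq> 0} \<le> card I + 2 \<and>
      (\<forall>s1 s2. 0 < pmf pS (s1, s2) \<longrightarrow> (\<Sum>a\<in>A. \<Sum>x\<in>UNIV. c a * q a s1 x) = 1) \<and>
      feas A (\<lambda>a w. c a * atom (q a) (t a) w) R1 R2"
      by (rule reduce[OF fam feas I states]) (rule i5)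
    then show thesis using that by blast
  qed
  have A: "finite A" and q: "\<And>a s x. a \<in> A \<Longrightarrow> 0 \<le> q a s x" and t: "\<And>a s x. a \<in> A \<Longrightarrow> 0 \<le> t a s x"
    and t1: "\<And>a s. a \<in> A \<Longrightarrow> (\<Sum>x\<in>UNIV. t a s x) = 1"
    using fam unfolding fam_def by auto
  define A' where "A' = {a\<in>A. c a \<noteq> 0}"
  have A': "finite A'" "A' \<subseteq> A" using A by (auto simp: A'_def)
  have "card A' \<le> card {..<k}" using c(2) k by (simp add: A'_def)
  then obtain h where h: "h ` A' \<subseteq> {..<k}" "inj_on h A'"
    using card_le_inj[OF A'(1), of "{..<k}"] by auto
  define g where "g = inv_into A' h"
  have gh: "g (h a) = a" if "a \<in> A'" for a using h(2) that by (simp add: g_def)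
  define pos where "pos s \<longleftrightarrow> (\<exists>s2. 0 < pmf pS (s, s2))" for s
  \<comment> \<open>At states of probability 0 the reweighted \<open>q\<close> need not be
    normalised; a point mass is put there instead, which no atom sees. New labels outside the image
    of \<open>h\<close> get a vanishing \<open>q'\<close> and an arbitrary law
    \<open>t'\<close>.\<close>
  define q' where "q' b s x = (if pos s then (if b \<in> h ` A' then c (g b) * q (g b) s x else 0)
       else if b = 0 \<and> x = undefined then 1 else 0)" for b s x
  define t' where "t' b s x = (if b \<in> h ` A' then t (g b) s x else if x = undefined then 1 else 0)" for b s x
  have npos: "pmf pS (s, s2) = 0" if "\<not> pos s" for s s2
    using that pmf_nonneg[of pS "(s, s2)"] unfolding pos_def by (metis order_le_less)
  have gA: "g b \<in> A" if "b \<in> h ` A'" for b using that gh A' by auto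
  have "fam {..<k} q' t'"
    unfolding fam_def
  proof (intro conjI ballI allI)
    fix s
    show "(\<Sum>b\<in>{..<k}. \<Sum>x\<in>UNIV. q' b s x) = 1"
    proof (cases "pos s")
      case True
      have "(\<Sum>b\<in>{..<k}. \<Sum>x\<in>UNIV. q' b s x) = (\<Sum>b\<in>h ` A'. \<Sum>x\<in>UNIV. q' b s x)"
        using h True by (intro sum.mono_neutral_right) (auto simp: q'_def)
      also have "\<dots> = (\<Sum>a\<in>A'. \<Sum>x\<in>UNIV. c a * q a s x)"
        using True gh by (simp add: sum.reindex[OF h(2)] q'_def)
      also have "\<dots> = (\<Sum>a\<in>A. \<Sum>x\<in>UNIV. c a * q a s x)"
        using A by (intro sum.mono_neutral_left) (auto simp: A'_def)
      finally show ?thesis using True c(3) by (auto simp: pos_def)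
    next
      case False
      have "(\<Sum>b\<in>{..<k}. \<Sum>x\<in>UNIV. q' b s x) = (\<Sum>b\<in>{..<k}. if b = 0 then 1 else 0)"
        using False by (intro sum.cong) (auto simp: q'_def)
      then show ?thesis using k by simp
    qed
  next
    fix b s assume "b \<in> {..<k}"
    show "(\<Sum>x\<in>UNIV. t' b s x) = 1" using gA t1 by (cases "b \<in> h ` A'") (auto simp: t'_def)
  qed (use c(1) gA q t in \<open>auto simp: q'_def t'_def\<close>)
  moreover have "feas {..<k} (\<lambda>b. atom (q' b) (t' b)) R1 R2"
  proof (rule feas_reindex[OF A A'(2) _ h(1) h(2) _ _ _ c(4)])
    fix a assume a: "a \<in> A'"
    show "atom (q' (h a)) (t' (h a)) = (\<lambda>w. c a * atom (q a) (t a) w)"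
      using a gh npos unfolding atom_def q'_def t'_def by (auto simp: fun_eq_iff)
  next
    fix b assume "b \<in> {..<k} - h ` A'"
    then show "atom (q' b) (t' b) = (\<lambda>w. 0)"
      using npos unfolding atom_def q'_def by (auto simp: fun_eq_iff)
  qed (auto simp: A'_def)
  ultimately show ?thesis by blast
qed

text \<open>The rows are the indicators of (s1, s2, x1, x2). Together with the channel they
  determine the whole law and hence \<open>i5\<close>; two more constraints come from
  \<open>reduce\<close>.\<close>

lemma cardinality_x:
  assumes fam: "fam A q t" and feas: "feas A (\<lambda>a. atom (q a) (t a)) R1 R2"
    and k: "CARD('s2) * CARD('s1) * CARD('x1) * CARD('x2) + 2 \<le> k"
  shows "\<exists>q' t'. fam {..<k::nat} q' t' \<and> feas {..<k} (\<lambda>a. atom (q' a) (t' a)) R1 R2"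
proof (rule reduce_to[OF fam feas, of UNIV UNIV "\<lambda>v w. of_bool ((tS1 w, tS2 w, tX1 w, tX2 w) = v)"])
  show "card (UNIV :: ('s1 \<times> 's2 \<times> 'x1 \<times> 'x2) set) + 2 \<le> k" using k by (simp add: mult_ac)
next
  fix w :: "('s1, 's2, 'x1, 'x2, 'y) letter"
  show "(\<Sum>v\<in>UNIV. of_bool ((tS1 w, tS2 w, tX1 w, tX2 w) = v)) = (1::real)"
    by (simp add: of_bool_def)
next
  fix s1 :: 's1 and s2 :: 's2
  have "(\<Sum>v\<in>{v. fst v = s1 \<and> fst (snd v) = s2}. of_bool ((tS1 w, tS2 w, tX1 w, tX2 w) = v))
     = (if tS1 w = s1 \<and> tS2 w = s2 then 1 else 0 :: real)" for w :: "('s1, 's2, 'x1, 'x2, 'y) letter"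
    by (simp add: of_bool_def)
  then show "\<exists>J\<subseteq>UNIV. \<forall>w::('s1, 's2, 'x1, 'x2, 'y) letter. (\<Sum>v\<in>J. of_bool ((tS1 w, tS2 w, tX1 w, tX2 w) = v)) =
     (if tS1 w = s1 \<and> tS2 w = s2 then 1 else 0 :: real)" by blast
next
  fix \<mu> \<nu> :: "('s1, 's2, 'x1, 'x2, 'y) letter \<Rightarrow> real"
  assume f: "channel_form \<mu>" "channel_form \<nu>"
    and eq: "\<And>v. v \<in> UNIV \<Longrightarrow> (\<Sum>w\<in>UNIV. \<mu> w * of_bool ((tS1 w, tS2 w, tX1 w, tX2 w) = v))
        = (\<Sum>w\<in>UNIV. \<nu> w * of_bool ((tS1 w, tS2 w, tX1 w, tX2 w) = v))"
  obtain g where g: "\<And>s1 s2 x1 x2 y. \<mu> (s1, s2, x1, x2, y) = g s1 s2 x1 x2 * chan (s1, s2, x1, x2, y)"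
    using f unfolding channel_form_def by blast
  obtain g' where g': "\<And>s1 s2 x1 x2 y. \<nu> (s1, s2, x1, x2, y) = g' s1 s2 x1 x2 * chan (s1, s2, x1, x2, y)"
    using f unfolding channel_form_def by blast
  have marg: "(\<Sum>w\<in>UNIV. m w * of_bool ((tS1 w, tS2 w, tX1 w, tX2 w) = (s1, s2, x1, x2))) = (\<Sum>y\<in>UNIV. m (s1, s2, x1, x2, y))"
    for m :: "('s1, 's2, 'x1, 'x2, 'y) letter \<Rightarrow> real" and s1 s2 x1 x2
  proof -
    have "(\<Sum>w\<in>UNIV. m w * of_bool ((tS1 w, tS2 w, tX1 w, tX2 w) = (s1, s2, x1, x2)))
      = mass UNIV m (\<lambda>w. (tS1 w, tS2 w, tX1 w, tX2 w)) (s1, s2, x1, x2)"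
      unfolding mass_def of_bool_def by (simp add: sum.If_cases if_distrib cong: if_cong)
    also have "\<dots> = (\<Sum>y\<in>UNIV. m (s1, s2, x1, x2, y))"
      by (rule mass_eqI) (force simp: inj_on_def image_iff)+
    finally show ?thesis .
  qed
  have "g s1 s2 x1 x2 = g' s1 s2 x1 x2" for s1 s2 x1 x2
    using eq[of "(s1, s2, x1, x2)"] unfolding marg g g' sum_distrib_left[symmetric] sum_chan by simp
  then have "\<mu> = \<nu>" using g g' by (auto simp: fun_eq_iff)
  then show "i5 \<mu> = i5 \<nu>" by simp
qed auto

text \<open>To determine \<open>i5\<close> it suffices to fix the law of (S1, S2, Y) and the linear
  functional \<open>kap\<close>. The row \<open>None\<close> stands for \<open>kap\<close>; with the
  two constraints of \<open>reduce\<close> this explains the summand 3.\<close>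

lemma cardinality_y:
  assumes fam: "fam A q t" and feas: "feas A (\<lambda>a. atom (q a) (t a)) R1 R2"
    and k: "CARD('s1) * CARD('s2) * CARD('y) + 3 \<le> k"
  shows "\<exists>q' t'. fam {..<k::nat} q' t' \<and> feas {..<k} (\<lambda>a. atom (q' a) (t' a)) R1 R2"
proof -
  let ?g = "\<lambda>w :: ('s1, 's2, 'x1, 'x2, 'y) letter. (tS1 w, tS2 w, tY w)"
  define \<rho> :: "('s1 \<times> 's2 \<times> 'y) option \<Rightarrow> ('s1, 's2, 'x1, 'x2, 'y) letter \<Rightarrow> real" where
    "\<rho> v w = (case v of None \<Rightarrow> log 2 (chan w) | Some u \<Rightarrow> of_bool (?g w = u))" for v w
  have some: "(\<Sum>v\<in>Some ` J. \<rho> v w) = (\<Sum>u\<in>J. of_bool (?g w = u))" for J w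
    by (simp add: sum.reindex \<rho>_def)
  show ?thesis
  proof (rule reduce_to[OF fam feas, of UNIV "range Some" \<rho>])
    show "card (UNIV :: ('s1 \<times> 's2 \<times> 'y) option set) + 2 \<le> k" using k by (simp add: mult_ac card_UNIV_option)
  next
    fix w :: "('s1, 's2, 'x1, 'x2, 'y) letter"
    show "(\<Sum>v\<in>range Some. \<rho> v w) = 1" unfolding some by (simp add: of_bool_def)
  next
    fix s1 :: 's1 and s2 :: 's2
    have "(\<Sum>v\<in>Some ` {v. fst v = s1 \<and> fst (snd v) = s2}. \<rho> v w) = (if tS1 w = s1 \<and> tS2 w = s2 then 1 else 0)" for w
      unfolding some by (simp add: of_bool_def)
    then show "\<exists>J\<subseteq>UNIV. \<forall>w. (\<Sum>v\<in>J. \<rho> v w) = (if tS1 w = s1 \<and> tS2 w = s2 then 1 else 0)" by blast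
  next
    fix \<mu> \<nu> :: "('s1, 's2, 'x1, 'x2, 'y) letter \<Rightarrow> real"
    assume eq: "\<And>v. v \<in> UNIV \<Longrightarrow> (\<Sum>w\<in>UNIV. \<mu> w * \<rho> v w) = (\<Sum>w\<in>UNIV. \<nu> w * \<rho> v w)"
    have "kap \<mu> = kap \<nu>" using eq[of None] unfolding kap_def \<rho>_def by simp
    moreover have "mass UNIV \<mu> ?g v = mass UNIV \<nu> ?g v" for v
      using eq[of "Some v"] unfolding \<rho>_def mass_def of_bool_def
      by (simp add: sum.If_cases if_distrib cong: if_cong)
    then have "hc (range ?g) (mass UNIV \<mu> ?g) (\<lambda>v. snd (snd v)) (\<lambda>v. (fst v, fst (snd v)))
      = hc (range ?g) (mass UNIV \<nu> ?g) (\<lambda>v. snd (snd v)) (\<lambda>v. (fst v, fst (snd v)))"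
      by (intro hc_cong_measure) simp
    then have "hc UNIV \<mu> tY (\<lambda>w. (tS1 w, tS2 w)) = hc UNIV \<nu> tY (\<lambda>w. (tS1 w, tS2 w))"
      using hc_image[of UNIV \<mu> "\<lambda>v. snd (snd v)" ?g "\<lambda>v. (fst v, fst (snd v))"]
        hc_image[of UNIV \<nu> "\<lambda>v. snd (snd v)" ?g "\<lambda>v. (fst v, fst (snd v))"] by simp
    ultimately show "i5 \<mu> = i5 \<nu>" unfolding i5_def by simp
  qed auto
qed

end

subsection \<open>Closedness, and the region in terms of atoms\<close>

text \<open>The outcome \<open>i\<close> reveals the intermediate value, so only one path leads to
  it.\<close>

lemma pmf_bind_single:
  assumes "\<And>x. x \<noteq> a \<Longrightarrow> i \<notin> set_pmf (f x)"
  shows "pmf (bind_pmf p f) i = pmf p a * pmf (f a) i"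
proof -
  have "pmf (bind_pmf p f) i = measure_pmf.expectation p (\<lambda>x. pmf (f x) i)" by (rule pmf_bind)
  also have "\<dots> = measure_pmf.expectation p (\<lambda>x. indicator {a} x * pmf (f a) i)"
    by (rule Bochner_Integration.integral_cong) (use assms in \<open>auto simp: indicator_def set_pmf_iff\<close>)
  also have "\<dots> = pmf p a * pmf (f a) i" by (simp add: pmf.rep_eq)
  finally show ?thesis .
qed

lemma hc_map_pmf:
  assumes "finite (set_pmf P)"
  shows "hc (set_pmf (map_pmf h P)) (pmf (map_pmf h P)) X V = hc (set_pmf P) (pmf P) (\<lambda>w. X (h w)) (\<lambda>w. V (h w))"
proof -
  have "mass (set_pmf P) (pmf P) h = pmf (map_pmf h P)" by (rule ext) (rule mass_pmf[OF assms])
  then show ?thesis using hc_image[OF assms, of "pmf P" X h V] by simp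
qed

lemma exists_pmf:
  fixes f :: "'a \<Rightarrow> real"
  assumes "finite A" "\<And>x. x \<in> A \<Longrightarrow> 0 \<le> f x" "(\<Sum>x\<in>A. f x) = 1"
  shows "\<exists>p. (\<forall>x\<in>A. pmf p x = f x) \<and> set_pmf p \<subseteq> A"
proof -
  define g where "g x = (if x \<in> A then f x else 0)" for x
  have g0: "0 \<le> g x" for x using assms by (simp add: g_def)
  have "(\<integral>\<^sup>+x. ennreal (g x) \<partial>count_space UNIV) = (\<Sum>x\<in>A. ennreal (g x))"
    by (rule nn_integral_count_space'[OF assms(1)]) (auto simp: g_def)
  also have "\<dots> = ennreal (\<Sum>x\<in>A. g x)" using g0 by (simp add: sum_ennreal)
  also have "(\<Sum>x\<in>A. g x) = 1" using assms(3) by (simp add: g_def)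
  finally have e: "pmf (embed_pmf g) x = g x" for x using g0 by (intro pmf_embed_pmf) auto
  have "set_pmf (embed_pmf g) \<subseteq> A" by (auto simp: set_pmf_eq e g_def)
  then show ?thesis using e by (intro exI[of _ "embed_pmf g"]) (auto simp: g_def)
qed

context mac
begin

lemma tendsto_functionals:
  assumes lim: "\<And>w. (\<lambda>n. \<mu> n w) \<longlonglongrightarrow> \<nu> w" and nn: "\<And>n w. 0 \<le> \<mu> n w"
  shows "(\<lambda>n. i1 (\<mu> n)) \<longlonglongrightarrow> i1 \<nu>" "(\<lambda>n. i2 (\<mu> n)) \<longlonglongrightarrow> i2 \<nu>" "(\<lambda>n. i3 (\<mu> n)) \<longlonglongrightarrow> i3 \<nu>"
    "(\<lambda>n. i5 (\<mu> n)) \<longlonglongrightarrow> i5 \<nu>" "(\<lambda>n. crib (\<mu> n)) \<longlonglongrightarrow> crib \<nu>"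
proof -
  have k: "(\<lambda>n. kap (\<mu> n)) \<longlonglongrightarrow> kap \<nu>" unfolding kap_def by (intro tendsto_intros lim)
  have h: "(\<lambda>n. hc UNIV (\<mu> n) tY (\<lambda>w. (tX2 w, tZ w, tS1 w, tS2 w))) \<longlonglongrightarrow> hc UNIV \<nu> tY (\<lambda>w. (tX2 w, tZ w, tS1 w, tS2 w))"
    "(\<lambda>n. hc UNIV (\<mu> n) tY (\<lambda>w. (tX1 w, tS1 w, tS2 w))) \<longlonglongrightarrow> hc UNIV \<nu> tY (\<lambda>w. (tX1 w, tS1 w, tS2 w))"
    "(\<lambda>n. hc UNIV (\<mu> n) tY (\<lambda>w. (tZ w, tS1 w, tS2 w))) \<longlonglongrightarrow> hc UNIV \<nu> tY (\<lambda>w. (tZ w, tS1 w, tS2 w))"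
    "(\<lambda>n. hc UNIV (\<mu> n) tY (\<lambda>w. (tS1 w, tS2 w))) \<longlonglongrightarrow> hc UNIV \<nu> tY (\<lambda>w. (tS1 w, tS2 w))"
    "(\<lambda>n. hc UNIV (\<mu> n) tZ tS1) \<longlonglongrightarrow> hc UNIV \<nu> tZ tS1"
    "(\<lambda>n. hc UNIV (\<mu> n) tS1 tS2) \<longlonglongrightarrow> hc UNIV \<nu> tS1 tS2"
    by (rule tendsto_hc; use lim nn in simp)+
  show "(\<lambda>n. i1 (\<mu> n)) \<longlonglongrightarrow> i1 \<nu>" unfolding i1_def by (rule tendsto_diff[OF h(1) k])
  show "(\<lambda>n. i2 (\<mu> n)) \<longlonglongrightarrow> i2 \<nu>" unfolding i2_def by (rule tendsto_diff[OF h(2) k])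
  show "(\<lambda>n. i3 (\<mu> n)) \<longlonglongrightarrow> i3 \<nu>" unfolding i3_def by (rule tendsto_diff[OF h(3) k])
  show "(\<lambda>n. i5 (\<mu> n)) \<longlonglongrightarrow> i5 \<nu>" unfolding i5_def by (rule tendsto_diff[OF h(4) k])
  show "(\<lambda>n. crib (\<mu> n)) \<longlonglongrightarrow> crib \<nu>" unfolding crib_def by (rule tendsto_add[OF h(5) h(6)])
qed

lemma feasible_limit:
  assumes "\<And>\<eta>. 0 < \<eta> \<Longrightarrow> \<exists>q t. fam {..<k} q t \<and> feas {..<k} (\<lambda>a::nat. atom (q a) (t a)) (R1 - \<eta>) (R2 - \<eta>)"
  shows "\<exists>q t. fam {..<k} q t \<and> feas {..<k} (\<lambda>a::nat. atom (q a) (t a)) R1 R2"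
proof -
  define \<eta> where "\<eta> n = 1 / real (Suc n)" for n
  have "\<forall>n. \<exists>q t. fam {..<k} q t \<and> feas {..<k} (\<lambda>a. atom (q a) (t a)) (R1 - \<eta> n) (R2 - \<eta> n)"
    using assms by (simp add: \<eta>_def)
  then obtain q t where qt: "\<And>n. fam {..<k} (q n) (t n)"
      "\<And>n. feas {..<k} (\<lambda>a. atom (q n a) (t n a)) (R1 - \<eta> n) (R2 - \<eta> n)"
    unfolding choice_iff by blast
  have q0: "0 \<le> q n a s x" and t1: "(\<Sum>x\<in>UNIV. t n a s' x) = 1" if "a < k" for n a s s' x
    using qt(1)[of n] that by (auto simp: fam_def)
  have t0': "0 \<le> t n a s x" if "a < k" for n a s x using qt(1)[of n] that by (auto simp: fam_def)
  have q1: "(\<Sum>a<k. \<Sum>x\<in>UNIV. q n a s x) = 1" for n s using qt(1)[of n] by (auto simp: fam_def)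
  have q_le: "q n a s x \<le> 1" if "a < k" for n a s x
  proof -
    have "q n a s x \<le> (\<Sum>x\<in>UNIV. q n a s x)" using q0[OF that] by (intro member_le_sum) auto
    also have "\<dots> \<le> (\<Sum>a<k. \<Sum>x\<in>UNIV. q n a s x)"
      using q0 that by (intro member_le_sum) (auto intro!: sum_nonneg)
    finally show ?thesis using q1 by simp
  qed
  have t_le: "t n a s x \<le> 1" if "a < k" for n a s x
    using member_le_sum[of x UNIV "t n a s"] t0'[OF that] t1[OF that, of n] by simp
  define F where "F n i = (case i of Inl (a, s, x) \<Rightarrow> q n a s x | Inr (a, s, x) \<Rightarrow> t n a s x)" for n i
  define I where "I = Inl ` ({..<k} \<times> (UNIV :: ('s1 \<times> 'x1) set)) \<union> Inr ` ({..<k} \<times> (UNIV :: ('s2 \<times> 'x2) set))"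
  have "finite I" unfolding I_def by simp
  moreover have "F n i \<in> {0..1}" if "i \<in> I" for n i
    using that q0 q_le t0' t_le unfolding F_def I_def by auto
  ultimately obtain r G where r: "strict_mono r" and G: "\<And>i. i \<in> I \<Longrightarrow> (\<lambda>n. F (r n) i) \<longlonglongrightarrow> G i"
    using bounded_family_subsequence[of I F] by blast
  define q' where "q' a s x = G (Inl (a, s, x))" for a s x
  define t' where "t' a s x = G (Inr (a, s, x))" for a s x
  have qlim: "(\<lambda>n. q (r n) a s x) \<longlonglongrightarrow> q' a s x" if "a < k" for a s x
    using G[of "Inl (a, s, x)"] that by (auto simp: I_def F_def q'_def)
  have tlim: "(\<lambda>n. t (r n) a s x) \<longlonglongrightarrow> t' a s x" if "a < k" for a s x
    using G[of "Inr (a, s, x)"] that by (auto simp: I_def F_def t'_def)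
  have fam: "fam {..<k} q' t'"
    unfolding fam_def
  proof (intro conjI ballI allI)
    fix a s x assume "a \<in> {..<k}"
    then show "0 \<le> q' a s x" using qlim[of a s x] q0 by (intro LIMSEQ_le_const) auto
  next
    fix a s x assume "a \<in> {..<k}"
    then show "0 \<le> t' a s x" using tlim[of a s x] t0' by (intro LIMSEQ_le_const) auto
  next
    fix a s assume a: "a \<in> {..<k}"
    have "(\<lambda>n. \<Sum>x\<in>UNIV. t (r n) a s x) \<longlonglongrightarrow> (\<Sum>x\<in>UNIV. t' a s x)"
      using a by (intro tendsto_sum tlim) auto
    moreover have "(\<lambda>n. \<Sum>x\<in>UNIV. t (r n) a s x) = (\<lambda>n. 1)" using a t1 by auto
    ultimately show "(\<Sum>x\<in>UNIV. t' a s x) = 1" using LIMSEQ_unique[OF _ tendsto_const] by metis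
  next
    fix s
    have "(\<lambda>n. \<Sum>a<k. \<Sum>x\<in>UNIV. q (r n) a s x) \<longlonglongrightarrow> (\<Sum>a<k. \<Sum>x\<in>UNIV. q' a s x)"
      by (intro tendsto_sum qlim) auto
    then show "(\<Sum>a<k. \<Sum>x\<in>UNIV. q' a s x) = 1" unfolding q1 using LIMSEQ_unique[OF _ tendsto_const] by metis
  qed simp
  define \<mu> where "\<mu> n a = atom (q (r n) a) (t (r n) a)" for n a
  have ml: "(\<lambda>n. \<mu> n a w) \<longlonglongrightarrow> atom (q' a) (t' a) w" if "a < k" for a w
    unfolding \<mu>_def atom_def by (intro tendsto_intros qlim tlim that)
  have m0: "0 \<le> \<mu> n a w" if "a < k" for n a w
    unfolding \<mu>_def by (intro atom_nonneg q0 t0' that)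
  have S: "(\<lambda>n. \<Sum>a<k. i1 (\<mu> n a)) \<longlonglongrightarrow> (\<Sum>a<k. i1 (atom (q' a) (t' a)))"
    "(\<lambda>n. \<Sum>a<k. i2 (\<mu> n a)) \<longlonglongrightarrow> (\<Sum>a<k. i2 (atom (q' a) (t' a)))"
    "(\<lambda>n. \<Sum>a<k. i3 (\<mu> n a)) \<longlonglongrightarrow> (\<Sum>a<k. i3 (atom (q' a) (t' a)))"
    "(\<lambda>n. \<Sum>a<k. crib (\<mu> n a)) \<longlonglongrightarrow> (\<Sum>a<k. crib (atom (q' a) (t' a)))"
    by (intro tendsto_sum tendsto_functionals ml m0; simp)+
  have S5: "(\<lambda>n. i5 (\<lambda>w. \<Sum>a<k. \<mu> n a w)) \<longlonglongrightarrow> i5 (\<lambda>w. \<Sum>a<k. atom (q' a) (t' a) w)"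
    by (intro tendsto_functionals tendsto_sum ml sum_nonneg m0; simp)
  have "\<eta> \<longlonglongrightarrow> 0" unfolding \<eta>_def by (rule LIMSEQ_Suc[OF lim_1_over_n])
  then have e: "(\<lambda>n. \<eta> (r n)) \<longlonglongrightarrow> 0" using LIMSEQ_subseq_LIMSEQ[OF _ r] by (auto simp: o_def)
  have R: "(\<lambda>n. R1 - \<eta> (r n)) \<longlonglongrightarrow> R1" "(\<lambda>n. R2 - \<eta> (r n)) \<longlonglongrightarrow> R2"
    using tendsto_diff[OF tendsto_const e] by auto
  have R12: "(\<lambda>n. (R1 - \<eta> (r n)) + (R2 - \<eta> (r n))) \<longlonglongrightarrow> R1 + R2" by (intro tendsto_add R)
  have fe: "feas {..<k} (\<mu> n) (R1 - \<eta> (r n)) (R2 - \<eta> (r n))" for n unfolding \<mu>_def by (rule qt(2))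
  have "feas {..<k} (\<lambda>a. atom (q' a) (t' a)) R1 R2"
    unfolding feas_def
  proof (intro conjI)
    show "R1 \<le> (\<Sum>a<k. i1 (atom (q' a) (t' a))) + ((\<Sum>a<k. crib (atom (q' a) (t' a))) - H0)"
      by (rule LIMSEQ_le[OF R(1) tendsto_add[OF S(1) tendsto_diff[OF S(4) tendsto_const]]])
         (use fe in \<open>auto simp: feas_def\<close>)
    show "R2 \<le> (\<Sum>a<k. i2 (atom (q' a) (t' a)))"
      by (rule LIMSEQ_le[OF R(2) S(2)]) (use fe in \<open>auto simp: feas_def\<close>)
    show "R1 + R2 \<le> (\<Sum>a<k. i3 (atom (q' a) (t' a))) + ((\<Sum>a<k. crib (atom (q' a) (t' a))) - H0)"
      by (rule LIMSEQ_le[OF R12 tendsto_add[OF S(3) tendsto_diff[OF S(4) tendsto_const]]])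
         (use fe in \<open>auto simp: feas_def\<close>)
    show "R1 + R2 \<le> i5 (\<lambda>w. \<Sum>a<k. atom (q' a) (t' a) w)"
      by (rule LIMSEQ_le[OF R12 S5]) (use fe in \<open>auto simp: feas_def\<close>)
    show "0 \<le> (\<Sum>a<k. crib (atom (q' a) (t' a))) - H0"
      by (rule LIMSEQ_le[OF tendsto_const tendsto_diff[OF S(4) tendsto_const]])
         (use fe in \<open>auto simp: feas_def\<close>)
  qed
  then show ?thesis using fam by blast
qed

section \<open>The joint law as a family of atoms\<close>

definition emb :: "nat \<Rightarrow> ('s1, 's2, 'x1, 'x2, 'y) letter \<Rightarrow> 's1 \<times> 's2 \<times> nat \<times> 'x1 \<times> 'x2 \<times> 'y" where
  "emb a w = (tS1 w, tS2 w, a, tX1 w, tX2 w, tY w)"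

abbreviation qof where "qof Q a s x \<equiv> pmf (Q s) (x, a)"
abbreviation tof where "tof T a s x \<equiv> pmf (T a s) x"

lemma emb_inj: "emb a w = emb a' w' \<Longrightarrow> a = a' \<and> w = w'"
  unfolding emb_def by (cases w; cases w') auto

lemma pmf_joint: "pmf (joint_pmf pS Q T W) (emb a w) = atom (qof Q a) (tof T a) w"
proof -
  have "pmf (joint_pmf pS Q T W) (emb a w) = pmf pS (tS1 w, tS2 w) * (pmf (Q (tS1 w)) (tX1 w, a) *
      (pmf (T a (tS2 w)) (tX2 w) * (chan w * 1)))"
    unfolding joint_pmf_def chan_def emb_def
    apply (subst pmf_bind_single[of "(tS1 w, tS2 w)"], force)
    apply (rule arg_cong2[where f=times, OF refl], simp only: prod.case)
    apply (subst pmf_bind_single[of "(tX1 w, a)"], force)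
    apply (rule arg_cong2[where f=times, OF refl], simp only: prod.case)
    apply (subst pmf_bind_single[of "tX2 w"], force)
    apply (rule arg_cong2[where f=times, OF refl])
    apply (subst pmf_bind_single[of "tY w"], force)
    apply simp
    done
  then show ?thesis unfolding atom_def by (simp add: mult_ac)
qed

context
  fixes Q :: "'s1 \<Rightarrow> ('x1 \<times> nat) pmf" and T :: "nat \<Rightarrow> 's2 \<Rightarrow> 'x2 pmf" and k :: nat
  assumes supp: "\<And>s1. snd ` set_pmf (Q s1) \<subseteq> {..<k}"
begin

lemma joint_support: "set_pmf (joint_pmf pS Q T W) \<subseteq> case_prod emb ` ({..<k} \<times> UNIV)"
proof
  fix u assume "u \<in> set_pmf (joint_pmf pS Q T W)"
  then obtain s1 s2 x1 a x2 y where u: "u = (s1, s2, a, x1, x2, y)" "(x1, a) \<in> set_pmf (Q s1)"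
    unfolding joint_pmf_def by auto
  then have "u = emb a (s1, s2, x1, x2, y)" "a < k" using supp[of s1] by (auto simp: emb_def)
  then show "u \<in> case_prod emb ` ({..<k} \<times> UNIV)" by auto
qed

lemma joint_finite: "finite (set_pmf (joint_pmf pS Q T W))"
  by (rule finite_subset[OF joint_support]) auto

lemma fam_joint: "fam {..<k} (qof Q) (tof T)"
proof -
  have "(\<Sum>a<k. \<Sum>x\<in>UNIV. pmf (Q s) (x, a)) = 1" for s
  proof -
    have "(\<Sum>a<k. \<Sum>x\<in>UNIV. pmf (Q s) (x, a)) = (\<Sum>x\<in>UNIV. \<Sum>a<k. pmf (Q s) (x, a))" by (rule sum.swap)
    also have "\<dots> = (\<Sum>v\<in>UNIV \<times> {..<k}. pmf (Q s) v)" by (simp add: sum.cartesian_product)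
    also have "\<dots> = 1" using supp[of s] by (intro sum_pmf_eq_1) (auto intro!: finite_SigmaI)
    finally show ?thesis .
  qed
  then show ?thesis unfolding fam_def by (auto simp: sum_pmf_eq_1)
qed

lemma hc_joint:
  fixes X :: "_ \<Rightarrow> 'a" and V :: "_ \<Rightarrow> 'b"
  assumes "\<And>a a' w w'. V (emb a w) = V (emb a' w') \<Longrightarrow> a = a'"
  shows "hc (set_pmf (joint_pmf pS Q T W)) (pmf (joint_pmf pS Q T W)) X V =
     (\<Sum>a<k. hc UNIV (atom (qof Q a) (tof T a)) (\<lambda>w. X (emb a w)) (\<lambda>w. V (emb a w)))"
proof -
  have "hc (set_pmf (joint_pmf pS Q T W)) (pmf (joint_pmf pS Q T W)) X V =
    hc (case_prod emb ` ({..<k} \<times> UNIV)) (pmf (joint_pmf pS Q T W)) X V"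
    by (rule hc_superset[OF _ joint_support, symmetric]) (auto simp: set_pmf_iff)
  also have "\<dots> = (\<Sum>a<k. hc UNIV (\<lambda>w. pmf (joint_pmf pS Q T W) (emb a w)) (\<lambda>w. X (emb a w)) (\<lambda>w. V (emb a w)))"
    by (rule hc_family) (use emb_inj assms in auto)
  finally show ?thesis unfolding pmf_joint .
qed

lemma hc_joint':
  fixes X :: "_ \<Rightarrow> 'a" and V :: "_ \<Rightarrow> 'b" and X' :: "_ \<Rightarrow> 'a" and V' :: "_ \<Rightarrow> 'b2"
  assumes "\<And>a a' w w'. V (emb a w) = V (emb a' w') \<longleftrightarrow> a = a' \<and> V' w = V' w'"
    and "\<And>a w. X (emb a w) = X' w"
  shows "hc (set_pmf (joint_pmf pS Q T W)) (pmf (joint_pmf pS Q T W)) X V =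
     (\<Sum>a<k. hc UNIV (atom (qof Q a) (tof T a)) X' V')"
proof -
  have "hc (set_pmf (joint_pmf pS Q T W)) (pmf (joint_pmf pS Q T W)) X V =
     (\<Sum>a<k. hc UNIV (atom (qof Q a) (tof T a)) (\<lambda>w. X (emb a w)) (\<lambda>w. V (emb a w)))"
    by (rule hc_joint) (use assms(1) in blast)
  also have "\<dots> = (\<Sum>a<k. hc UNIV (atom (qof Q a) (tof T a)) X' V')"
    by (rule sum.cong[OF refl], rule hc_kernel_cong) (simp_all add: assms)
  finally show ?thesis .
qed

lemma map_joint_states: "map_pmf (\<lambda>(s1, s2, u, x1, x2, y). (s1, s2)) (joint_pmf pS Q T W) = pS"
  unfolding joint_pmf_def by (simp add: map_bind_pmf case_prod_unfold bind_return_pmf')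

text \<open>A quantity that does not mention U sees only the image under \<open>h\<close>, which
  forgets the label; the weights there are the sums of the atoms.\<close>

lemma hc_joint_marginal:
  assumes "\<And>a w. V (emb a w) = V' w" "\<And>a w. X (emb a w) = X' w"
  shows "hc (set_pmf (joint_pmf pS Q T W)) (pmf (joint_pmf pS Q T W)) X V =
     hc UNIV (\<lambda>w. \<Sum>a<k. atom (qof Q a) (tof T a) w) X' V'"
proof -
  let ?P = "joint_pmf pS Q T W" and ?\<Omega> = "case_prod emb ` ({..<k} \<times> UNIV)"
  define h where "h u = (case u of (s1, s2, a :: nat, x1, x2, y) \<Rightarrow> (s1, s2, x1, x2, y))"
    for u :: "'s1 \<times> 's2 \<times> nat \<times> 'x1 \<times> 'x2 \<times> 'y"
  have he: "h (emb a w) = w" for a w unfolding h_def emb_def by (cases w) auto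
  have eh: "\<exists>a. u = emb a (h u)" for u unfolding h_def emb_def by (cases u) auto
  have X: "X u = X' (h u)" "V u = V' (h u)" for u using eh[of u] he assms by metis+
  have "hc (set_pmf ?P) (pmf ?P) X V = hc ?\<Omega> (pmf ?P) X V"
    by (rule hc_superset[OF _ joint_support, symmetric]) (auto simp: set_pmf_iff)
  also have "\<dots> = hc ?\<Omega> (pmf ?P) (\<lambda>u. X' (h u)) (\<lambda>u. V' (h u))" unfolding X ..
  also have "\<dots> = hc (h ` ?\<Omega>) (mass ?\<Omega> (pmf ?P) h) X' V'" by (rule hc_image) simp
  also have "\<dots> = hc UNIV (mass ?\<Omega> (pmf ?P) h) X' V'"
  proof (rule hc_superset[symmetric])
    show "\<forall>w\<in>UNIV - h ` ?\<Omega>. mass ?\<Omega> (pmf ?P) h w = 0"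
    proof
      fix w assume "w \<in> UNIV - h ` ?\<Omega>"
      then have "{u \<in> ?\<Omega>. h u = w} = {}" by blast
      then show "mass ?\<Omega> (pmf ?P) h w = 0" unfolding mass_def by (simp only: sum.empty)
    qed
  qed simp_all
  also have "mass ?\<Omega> (pmf ?P) h = (\<lambda>w. \<Sum>a<k. atom (qof Q a) (tof T a) w)"
  proof
    fix w
    have "mass ?\<Omega> (pmf ?P) h w = (\<Sum>a<k. pmf ?P (emb a w))"
    proof (rule mass_eqI)
      show "{u \<in> ?\<Omega>. h u = w} = (\<lambda>a. emb a w) ` {..<k}"
      proof (intro set_eqI iffI)
        fix u assume "u \<in> (\<lambda>a. emb a w) ` {..<k}"
        then obtain a where "a < k" "u = case_prod emb (a, w)" by auto
        then have "u \<in> ?\<Omega>" by (intro image_eqI[of _ _ "(a, w)"]) simp_all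
        moreover have "h u = w" using \<open>u = case_prod emb (a, w)\<close> he[of a w] by simp
        ultimately show "u \<in> {u \<in> ?\<Omega>. h u = w}" by simp
      qed (auto simp: he)
    qed (auto simp: inj_on_def dest: emb_inj)
    then show "mass ?\<Omega> (pmf ?P) h w = (\<Sum>a<k. atom (qof Q a) (tof T a) w)" unfolding pmf_joint .
  qed
  finally show ?thesis .
qed

lemma kap_joint:
  fixes V :: "_ \<Rightarrow> 'b"
  assumes "\<And>a a' w w'. V (emb a w) = V (emb a' w') \<longleftrightarrow> a = a' \<and> tX1 w = tX1 w' \<and> tX2 w = tX2 w' \<and> tS1 w = tS1 w' \<and> tS2 w = tS2 w'"
  shows "hc (set_pmf (joint_pmf pS Q T W)) (pmf (joint_pmf pS Q T W)) (\<lambda>(s1, s2, u, x1, x2, y). y) V =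
     (\<Sum>a<k. kap (atom (qof Q a) (tof T a)))"
proof -
  have "hc (set_pmf (joint_pmf pS Q T W)) (pmf (joint_pmf pS Q T W)) (\<lambda>(s1, s2, u, x1, x2, y). y) V =
     (\<Sum>a<k. hc UNIV (atom (qof Q a) (tof T a)) tY (\<lambda>w. (tX1 w, tX2 w, tS1 w, tS2 w)))"
    by (rule hc_joint') (simp_all add: assms, simp add: emb_def)
  also have "\<dots> = (\<Sum>a<k. kap (atom (qof Q a) (tof T a)))"
    by (intro sum.cong[OF refl] hc_channel[OF atom_tuple]) simp
  finally show ?thesis .
qed

text \<open>Conditions containing U become sums over atoms by \<open>hc_joint'\<close>; the last
  bound has no U in its condition and becomes \<open>i5\<close> of the total. In I(U;S1|S2) the term
  H(S1|S2) is the constant \<open>H0\<close>, because the state law is given.\<close>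

lemma region_iff_feas:
  "(let P = joint_pmf pS Q T W;
        S1 = (\<lambda>(s1, s2, u, x1, x2, y). s1);
        S2 = (\<lambda>(s1, s2, u, x1, x2, y). s2);
        U = (\<lambda>(s1, s2, u, x1, x2, y). u);
        X1 = (\<lambda>(s1, s2, u, x1, x2, y). x1);
        X2 = (\<lambda>(s1, s2, u, x1, x2, y). x2);
        Y = (\<lambda>(s1, s2, u, x1, x2, y). y);
        Z = (\<lambda>\<omega>. z (X1 \<omega>) (S1 \<omega>));
        I_U = cond_mutual_info P U S1 S2;
        H_Z = cond_entropy P Z (\<lambda>\<omega>. (S1 \<omega>, U \<omega>))
    in R1 \<le> cond_mutual_info P X1 Y (\<lambda>\<omega>. (X2 \<omega>, Z \<omega>, S1 \<omega>, S2 \<omega>, U \<omega>)) + H_Z - I_U \<and>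
       R2 \<le> cond_mutual_info P X2 Y (\<lambda>\<omega>. (X1 \<omega>, S1 \<omega>, S2 \<omega>, U \<omega>)) \<and>
       R1 + R2 \<le> cond_mutual_info P (\<lambda>\<omega>. (X1 \<omega>, X2 \<omega>)) Y (\<lambda>\<omega>. (Z \<omega>, S1 \<omega>, S2 \<omega>, U \<omega>))
                   + H_Z - I_U \<and>
       R1 + R2 \<le> cond_mutual_info P (\<lambda>\<omega>. (X1 \<omega>, X2 \<omega>)) Y (\<lambda>\<omega>. (S1 \<omega>, S2 \<omega>)) \<and>
       I_U \<le> H_Z) \<longleftrightarrow> feas {..<k} (\<lambda>a. atom (qof Q a) (tof T a)) R1 R2"
proof -
  define P where "P = joint_pmf pS Q T W"
  define S1 where "S1 = (\<lambda>(s1 :: 's1, s2 :: 's2, u :: nat, x1 :: 'x1, x2 :: 'x2, y :: 'y). s1)"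
  define S2 where "S2 = (\<lambda>(s1 :: 's1, s2 :: 's2, u :: nat, x1 :: 'x1, x2 :: 'x2, y :: 'y). s2)"
  define U where "U = (\<lambda>(s1 :: 's1, s2 :: 's2, u :: nat, x1 :: 'x1, x2 :: 'x2, y :: 'y). u)"
  define X1 where "X1 = (\<lambda>(s1 :: 's1, s2 :: 's2, u :: nat, x1 :: 'x1, x2 :: 'x2, y :: 'y). x1)"
  define X2 where "X2 = (\<lambda>(s1 :: 's1, s2 :: 's2, u :: nat, x1 :: 'x1, x2 :: 'x2, y :: 'y). x2)"
  define Y where "Y = (\<lambda>(s1 :: 's1, s2 :: 's2, u :: nat, x1 :: 'x1, x2 :: 'x2, y :: 'y). y)"
  define Z where "Z = (\<lambda>\<omega>. z (X1 \<omega>) (S1 \<omega>))"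
  note defs = S1_def S2_def U_def X1_def X2_def Y_def Z_def
  have e: "S1 (emb a w) = tS1 w" "S2 (emb a w) = tS2 w" "U (emb a w) = a" "X1 (emb a w) = tX1 w"
    "X2 (emb a w) = tX2 w" "Y (emb a w) = tY w" "Z (emb a w) = tZ w" for a w
    by (simp_all add: defs emb_def tZ_def)
  let ?\<mu> = "\<lambda>a. atom (qof Q a) (tof T a)"
  let ?h = "hc (set_pmf P) (pmf P)"
  note cmi = cond_mutual_info_hc[OF joint_finite, folded P_def]
  have kY: "hc (set_pmf P) (pmf P) Y V = (\<Sum>a<k. kap (?\<mu> a))"
    if "\<And>a a' w w'. V (emb a w) = V (emb a' w') \<longleftrightarrow> a = a' \<and> tX1 w = tX1 w' \<and> tX2 w = tX2 w' \<and> tS1 w = tS1 w' \<and> tS2 w = tS2 w'"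
    for V :: "_ \<Rightarrow> 'b" using kap_joint[of V] that unfolding P_def Y_def by blast
  have 1: "cond_mutual_info P U S1 S2 = H0 - (\<Sum>a<k. hc UNIV (?\<mu> a) tS1 tS2)"
  proof -
    have "?h S1 S2 = H0"
    proof -
      have "H0 = hc (set_pmf (map_pmf (\<lambda>\<omega>. (S1 \<omega>, S2 \<omega>)) P)) (pmf (map_pmf (\<lambda>\<omega>. (S1 \<omega>, S2 \<omega>)) P)) fst snd"
        using map_joint_states unfolding H0_def P_def S1_def S2_def case_prod_unfold by simp
      then show ?thesis unfolding P_def hc_map_pmf[OF joint_finite] by simp
    qed
    moreover have "?h S1 (\<lambda>\<omega>. (U \<omega>, S2 \<omega>)) = (\<Sum>a<k. hc UNIV (?\<mu> a) tS1 tS2)"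
      unfolding P_def by (rule hc_joint') (auto simp: e)
    ultimately show ?thesis unfolding cmi by simp
  qed
  have 2: "cond_entropy P Z (\<lambda>\<omega>. (S1 \<omega>, U \<omega>)) = (\<Sum>a<k. hc UNIV (?\<mu> a) tZ tS1)"
    unfolding P_def cond_entropy_hc[OF joint_finite] by (rule hc_joint') (auto simp: e)
  have 3: "cond_mutual_info P X1 Y (\<lambda>\<omega>. (X2 \<omega>, Z \<omega>, S1 \<omega>, S2 \<omega>, U \<omega>)) = (\<Sum>a<k. i1 (?\<mu> a))"
  proof -
    have "?h Y (\<lambda>\<omega>. (X2 \<omega>, Z \<omega>, S1 \<omega>, S2 \<omega>, U \<omega>)) = (\<Sum>a<k. hc UNIV (?\<mu> a) tY (\<lambda>w. (tX2 w, tZ w, tS1 w, tS2 w)))"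
      unfolding P_def by (rule hc_joint') (auto simp: e)
    moreover have "?h Y (\<lambda>\<omega>. (X1 \<omega>, X2 \<omega>, Z \<omega>, S1 \<omega>, S2 \<omega>, U \<omega>)) = (\<Sum>a<k. kap (?\<mu> a))"
      by (rule kY) (auto simp: e tZ_def)
    ultimately show ?thesis unfolding cmi i1_def by (simp add: sum_subtractf)
  qed
  have 4: "cond_mutual_info P X2 Y (\<lambda>\<omega>. (X1 \<omega>, S1 \<omega>, S2 \<omega>, U \<omega>)) = (\<Sum>a<k. i2 (?\<mu> a))"
  proof -
    have "?h Y (\<lambda>\<omega>. (X1 \<omega>, S1 \<omega>, S2 \<omega>, U \<omega>)) = (\<Sum>a<k. hc UNIV (?\<mu> a) tY (\<lambda>w. (tX1 w, tS1 w, tS2 w)))"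
      unfolding P_def by (rule hc_joint') (auto simp: e)
    moreover have "?h Y (\<lambda>\<omega>. (X2 \<omega>, X1 \<omega>, S1 \<omega>, S2 \<omega>, U \<omega>)) = (\<Sum>a<k. kap (?\<mu> a))"
      by (rule kY) (auto simp: e)
    ultimately show ?thesis unfolding cmi i2_def by (simp add: sum_subtractf)
  qed
  have 5: "cond_mutual_info P (\<lambda>\<omega>. (X1 \<omega>, X2 \<omega>)) Y (\<lambda>\<omega>. (Z \<omega>, S1 \<omega>, S2 \<omega>, U \<omega>)) = (\<Sum>a<k. i3 (?\<mu> a))"
  proof -
    have "?h Y (\<lambda>\<omega>. (Z \<omega>, S1 \<omega>, S2 \<omega>, U \<omega>)) = (\<Sum>a<k. hc UNIV (?\<mu> a) tY (\<lambda>w. (tZ w, tS1 w, tS2 w)))"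
      unfolding P_def by (rule hc_joint') (auto simp: e)
    moreover have "?h Y (\<lambda>\<omega>. ((X1 \<omega>, X2 \<omega>), Z \<omega>, S1 \<omega>, S2 \<omega>, U \<omega>)) = (\<Sum>a<k. kap (?\<mu> a))"
      by (rule kY) (auto simp: e tZ_def)
    ultimately show ?thesis unfolding cmi i3_def by (simp add: sum_subtractf)
  qed
  have 6: "cond_mutual_info P (\<lambda>\<omega>. (X1 \<omega>, X2 \<omega>)) Y (\<lambda>\<omega>. (S1 \<omega>, S2 \<omega>)) = i5 (\<lambda>w. \<Sum>a<k. ?\<mu> a w)"
  proof -
    have "?h Y (\<lambda>\<omega>. (S1 \<omega>, S2 \<omega>)) = hc UNIV (\<lambda>w. \<Sum>a<k. ?\<mu> a w) tY (\<lambda>w. (tS1 w, tS2 w))"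
      unfolding P_def by (rule hc_joint_marginal) (auto simp: e)
    moreover have "?h Y (\<lambda>\<omega>. ((X1 \<omega>, X2 \<omega>), S1 \<omega>, S2 \<omega>)) = hc UNIV (\<lambda>w. \<Sum>a<k. ?\<mu> a w) tY (\<lambda>w. ((tX1 w, tX2 w), tS1 w, tS2 w))"
      unfolding P_def by (rule hc_joint_marginal) (auto simp: e)
    moreover have "hc UNIV (\<lambda>w. \<Sum>a<k. ?\<mu> a w) tY (\<lambda>w. ((tX1 w, tX2 w), tS1 w, tS2 w)) =
       hc UNIV (\<lambda>w. \<Sum>a<k. ?\<mu> a w) tY (\<lambda>w. (tX1 w, tX2 w, tS1 w, tS2 w))"
      by (rule hc_kernel_cong) auto
    moreover have "hc UNIV (\<lambda>w. \<Sum>a<k. ?\<mu> a w) tY (\<lambda>w. (tX1 w, tX2 w, tS1 w, tS2 w)) = kap (\<lambda>w. \<Sum>a<k. ?\<mu> a w)"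
      by (rule hc_channel[of _ "\<lambda>s1 s2 x1 x2. \<Sum>a<k. pmf pS (s1, s2) * qof Q a s1 x1 * tof T a s2 x2"])
         (auto simp: atom_tuple sum_distrib_right intro!: sum_nonneg)
    ultimately show ?thesis unfolding cmi i5_def by simp
  qed
  show ?thesis
    unfolding Let_def P_def[symmetric] S1_def[symmetric] S2_def[symmetric] U_def[symmetric] X1_def[symmetric]
      X2_def[symmetric] Y_def[symmetric] 1 2[unfolded Z_def] 3[unfolded Z_def] 4 5[unfolded Z_def] 6 feas_def crib_def
    by (simp add: sum.distrib algebra_simps)
qed

end

text \<open>Converse of \<open>fam_joint\<close>. From label \<open>k\<close> on the kernel
  \<open>T\<close> is arbitrary, since \<open>Q\<close> never produces such labels.\<close>

lemma fam_to_pmfs: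
  assumes fam: "fam {..<k::nat} q t"
  shows "\<exists>Q T. (\<forall>s1. snd ` set_pmf (Q s1) \<subseteq> {..<k}) \<and>
     (\<forall>a<k. atom (qof Q a) (tof T a) = atom (q a) (t a))"
proof -
  have "\<forall>s. \<exists>p. (\<forall>v\<in>UNIV \<times> {..<k}. pmf p v = q (snd v) s (fst v)) \<and> set_pmf p \<subseteq> UNIV \<times> {..<k}"
  proof (rule allI, rule exists_pmf)
    fix s show "(\<Sum>v\<in>UNIV \<times> {..<k}. q (snd v) s (fst v)) = 1"
    proof -
      have "(\<Sum>v\<in>UNIV \<times> {..<k}. q (snd v) s (fst v)) = (\<Sum>x\<in>UNIV. \<Sum>a<k. q a s x)"
        by (simp add: sum.cartesian_product case_prod_unfold)
      also have "\<dots> = (\<Sum>a<k. \<Sum>x\<in>UNIV. q a s x)" by (rule sum.swap)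
      finally show ?thesis using fam by (simp add: fam_def)
    qed
  qed (use fam in \<open>auto simp: fam_def\<close>)
  then obtain Q where Q: "\<And>s v. v \<in> UNIV \<times> {..<k} \<Longrightarrow> pmf (Q s) v = q (snd v) s (fst v)" "\<And>s. set_pmf (Q s) \<subseteq> UNIV \<times> {..<k}"
    unfolding choice_iff by blast
  have "\<forall>a s. \<exists>p. a < k \<longrightarrow> (\<forall>x. pmf p x = t a s x)"
  proof (intro allI)
    fix a s show "\<exists>p. a < k \<longrightarrow> (\<forall>x. pmf p x = t a s x)"
      using exists_pmf[of UNIV "t a s"] fam by (cases "a < k") (auto simp: fam_def)
  qed
  then obtain T where T: "\<And>a s x. a < k \<Longrightarrow> pmf (T a s) x = t a s x"
    unfolding choice_iff by blast
  have "snd ` set_pmf (Q s1) \<subseteq> {..<k}" for s1 using Q(2)[of s1] by auto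
  moreover have "atom (qof Q a) (tof T a) = atom (q a) (t a)" if "a < k" for a
    using that by (simp add: Q(1) T)
  ultimately show ?thesis by blast
qed

end

subsection \<open>Converse\<close>

text \<open>Both sides are I(M;T|V).\<close>

lemma hc_swap:
  "hc A \<mu> M V - hc A \<mu> M (\<lambda>w. (T w, V w)) = hc A \<mu> T V - hc A \<mu> T (\<lambda>w. (M w, V w))"
proof -
  have "hc A \<mu> (\<lambda>w. (M w, T w)) V = hc A \<mu> (\<lambda>w. (T w, M w)) V" by (rule hc_kernel_cong) auto
  then show ?thesis unfolding hc_chain by simp
qed

text \<open>The chain rule, followed by coarsening each condition. \<open>F i\<close> is any
  encoding of the values of \<open>X\<close> before time \<open>i\<close>; \<open>G i\<close> may be
  any function of this past and of \<open>V\<close>.\<close>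

lemma hc_le_sum:
  assumes A: "finite A" and \<mu>: "\<forall>w\<in>A. 0 \<le> \<mu> w"
    and F0: "\<And>w w'. w \<in> A \<Longrightarrow> w' \<in> A \<Longrightarrow> F 1 w = F 1 w'"
    and F: "\<And>i w w'. i \<in> {1..n} \<Longrightarrow> w \<in> A \<Longrightarrow> w' \<in> A \<Longrightarrow> F (Suc i) w = F (Suc i) w' \<longleftrightarrow> F i w = F i w' \<and> X i w = X i w'"
    and G: "\<And>i w w'. i \<in> {1..n} \<Longrightarrow> w \<in> A \<Longrightarrow> w' \<in> A \<Longrightarrow> F i w = F i w' \<Longrightarrow> V w = V w' \<Longrightarrow> G i w = G i w'"
  shows "hc A \<mu> (F (Suc n)) V \<le> (\<Sum>i\<in>{1..n}. hc A \<mu> (X i) (G i))"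
proof -
  have "hc A \<mu> (F (Suc m)) V \<le> (\<Sum>i\<in>{1..m}. hc A \<mu> (X i) (G i))" if "m \<le> n" for m
    using that
  proof (induction m)
    case 0
    have "hc A \<mu> (F 1) V = 0" by (rule hc_determined) (rule F0)
    then show ?case by simp
  next
    case (Suc m)
    have i: "Suc m \<in> {1..n}" using Suc.prems by simp
    have "hc A \<mu> (F (Suc (Suc m))) V = hc A \<mu> (\<lambda>w. (F (Suc m) w, X (Suc m) w)) V"
      by (rule hc_kernel_cong) (use F[OF i] in auto)
    also have "\<dots> = hc A \<mu> (F (Suc m)) V + hc A \<mu> (X (Suc m)) (\<lambda>w. (F (Suc m) w, V w))" by (rule hc_chain)
    also have "\<dots> \<le> (\<Sum>i\<in>{1..m}. hc A \<mu> (X i) (G i)) + hc A \<mu> (X (Suc m)) (G (Suc m))"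
    proof (rule add_mono)
      show "hc A \<mu> (X (Suc m)) (\<lambda>w. (F (Suc m) w, V w)) \<le> hc A \<mu> (X (Suc m)) (G (Suc m))"
      proof (rule hc_mono[OF A \<mu>])
        fix w w' assume "w \<in> A" "w' \<in> A" "(F (Suc m) w, V w) = (F (Suc m) w', V w')"
        then show "G (Suc m) w = G (Suc m) w'" using G[OF i, of w w'] by blast
      qed
    qed (use Suc in simp)
    finally show ?case by simp
  qed
  then show ?thesis by simp
qed

lemma hc_sum_ge:
  assumes A: "finite A" and I: "finite I" and \<mu>: "\<And>i. i \<in> I \<Longrightarrow> \<forall>w\<in>A. 0 \<le> \<mu> i w"
  shows "(\<Sum>i\<in>I. hc A (\<mu> i) X V) \<le> hc A (\<lambda>w. \<Sum>i\<in>I. \<mu> i w) X V"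
  using I \<mu>
proof (induction I rule: finite_induct)
  case empty
  show ?case by (simp add: hc_def ent_def)
next
  case (insert i I)
  have "(\<Sum>j\<in>I. hc A (\<mu> j) X V) \<le> hc A (\<lambda>w. \<Sum>j\<in>I. \<mu> j w) X V"
    by (rule insert.IH) (rule insert.prems, simp)
  then have "(\<Sum>j\<in>insert i I. hc A (\<mu> j) X V) \<le> hc A (\<mu> i) X V + hc A (\<lambda>w. \<Sum>j\<in>I. \<mu> j w) X V"
    using insert.hyps by simp
  also have "\<dots> \<le> hc A (\<lambda>w. \<mu> i w + (\<Sum>j\<in>I. \<mu> j w)) X V"
  proof (rule hc_add_ge[OF A])
    show "\<forall>w\<in>A. 0 \<le> \<mu> i w" by (rule insert.prems) simp
    show "\<forall>w\<in>A. 0 \<le> (\<Sum>j\<in>I. \<mu> j w)" using insert.prems by (intro ballI sum_nonneg) blast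
  qed
  finally show ?case using insert.hyps by simp
qed

lemma hc_independent_uniform:
  assumes fin: "finite (set_pmf P)" and S: "finite S" "S \<noteq> {}"
    and P: "map_pmf (\<lambda>w. (M w, V w)) P = pair_pmf (pmf_of_set S) (map_pmf V P)"
  shows "hc (set_pmf P) (pmf P) M V = log 2 (card S)"
proof -
  have "hc (set_pmf P) (pmf P) M V = - (\<Sum>w\<in>set_pmf P. pmf P w * log 2 (1 / card S))"
  proof (rule hc_of_kernel[OF fin])
    fix w assume w: "w \<in> set_pmf P"
    have "(M w, V w) \<in> set_pmf (pair_pmf (pmf_of_set S) (map_pmf V P))"
      unfolding P[symmetric] using w by simp
    then have "M w \<in> S" using S by simp
    then show "mass (set_pmf P) (pmf P) (\<lambda>w. (M w, V w)) (M w, V w) = 1 / card S * mass (set_pmf P) (pmf P) V (V w)"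
      unfolding mass_pmf[OF fin] P using S by (simp add: pmf_pair)
  qed simp
  also have "\<dots> = - ((\<Sum>w\<in>set_pmf P. pmf P w) * log 2 (1 / card S))" by (simp add: sum_distrib_right)
  also have "(\<Sum>w\<in>set_pmf P. pmf P w) = 1" using fin by (rule sum_pmf_eq_1) simp
  also have "- (1 * log 2 (1 / card S)) = log 2 (card S)"
    using S by (simp add: log_divide card_gt_0_iff)
  finally show ?thesis .
qed

text \<open>
  Fano's inequality without the binary entropy term: compare with the conditional law that puts
  half of its mass on the decision and spreads the other half uniformly.
\<close>

lemma fano:
  assumes fin: "finite (set_pmf P)" and S: "finite S" "S \<noteq> {}" "M ` set_pmf P \<subseteq> S"
    and err: "measure_pmf.prob P {w. dec (V w) \<noteq> M w} \<le> \<epsilon>"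
  shows "hc (set_pmf P) (pmf P) M V \<le> 1 + \<epsilon> * log 2 (card S)"
proof -
  define q where "q x v = (if x = dec v then 1/2 else 1 / (2 * real (card S)))" for x v
  have cS: "1 \<le> card S" using S by (simp add: Suc_leI card_gt_0_iff)
  have "hc (set_pmf P) (pmf P) M V \<le> - (\<Sum>w\<in>set_pmf P. pmf P w * log 2 (q (M w) (V w)))"
  proof (rule hc_le_cross[OF fin])
    fix v
    have "(\<Sum>x\<in>M ` set_pmf P. q x v) \<le> (\<Sum>x\<in>S. q x v)"
      using S by (intro sum_mono2) (auto simp: q_def)
    also have "\<dots> \<le> (\<Sum>x\<in>S. (if x = dec v then 1/2 else 0) + 1 / (2 * real (card S)))"
      by (intro sum_mono) (auto simp: q_def)
    also have "\<dots> = (\<Sum>x\<in>S. if x = dec v then 1/2 else 0) + 1/2"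
      using cS by (simp add: sum.distrib)
    also have "\<dots> \<le> 1" using S(1) by (simp add: sum.delta)
    finally show "(\<Sum>x\<in>M ` set_pmf P. q x v) \<le> 1" .
  qed (use cS in \<open>auto simp: q_def\<close>)
  also have "\<dots> = (\<Sum>w\<in>set_pmf P. pmf P w * (1 + (if dec (V w) \<noteq> M w then log 2 (card S) else 0)))"
    unfolding sum_negf[symmetric]
  proof (rule sum.cong[OF refl])
    fix w
    have "log 2 (q (M w) (V w)) = - (1 + (if dec (V w) \<noteq> M w then log 2 (card S) else 0))"
      using cS unfolding q_def by (auto simp: log_divide log_mult)
    then show "- (pmf P w * log 2 (q (M w) (V w))) = pmf P w * (1 + (if dec (V w) \<noteq> M w then log 2 (card S) else 0))"
      by (simp only: mult_minus_right minus_minus)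
  qed
  also have "\<dots> = (\<Sum>w\<in>set_pmf P. pmf P w) + log 2 (card S) * (\<Sum>w\<in>set_pmf P. if dec (V w) \<noteq> M w then pmf P w else 0)"
    unfolding sum_distrib_left sum.distrib[symmetric] by (rule sum.cong) (auto simp: algebra_simps)
  also have "(\<Sum>w\<in>set_pmf P. pmf P w) = 1" using fin by (rule sum_pmf_eq_1) simp
  also have "(\<Sum>w\<in>set_pmf P. if dec (V w) \<noteq> M w then pmf P w else 0) = measure_pmf.prob P {w. dec (V w) \<noteq> M w}"
  proof -
    have "measure_pmf.prob P {w. dec (V w) \<noteq> M w} = measure_pmf.prob P ({w. dec (V w) \<noteq> M w} \<inter> set_pmf P)"
      by (simp add: measure_Int_set_pmf)
    also have "\<dots> = sum (pmf P) ({w. dec (V w) \<noteq> M w} \<inter> set_pmf P)"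
      using fin by (intro measure_measure_pmf_finite) auto
    also have "\<dots> = (\<Sum>w\<in>set_pmf P. if dec (V w) \<noteq> M w then pmf P w else 0)"
      using fin by (simp add: sum.If_cases Int_commute)
    finally show ?thesis by simp
  qed
  also have "1 + log 2 (card S) * measure_pmf.prob P {w. dec (V w) \<noteq> M w} \<le> 1 + log 2 (card S) * \<epsilon>"
    using err cS by (intro add_left_mono mult_left_mono) auto
  finally show ?thesis by (simp add: mult.commute)
qed

lemma sum_expectation_map:
  fixes f :: "'b \<Rightarrow> real"
  assumes "finite (set_pmf P)" "finite B" "h ` set_pmf P \<subseteq> B"
  shows "(\<Sum>v\<in>B. pmf (map_pmf h P) v * f v) = (\<Sum>w\<in>set_pmf P. pmf P w * f (h w))"
proof -
  have "(\<Sum>v\<in>B. pmf (map_pmf h P) v * f v) = (\<Sum>v\<in>set_pmf (map_pmf h P). pmf (map_pmf h P) v * f v)"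
    using assms by (intro sum.mono_neutral_right) (auto simp: pmf_eq_0_set_pmf)
  also have "\<dots> = (\<Sum>w\<in>set_pmf P. pmf P w * f (h w))"
    using expectation_finite_support[OF assms(1), of "\<lambda>w. f (h w)"]
      expectation_finite_support[of "map_pmf h P" f] assms(1) by simp
  finally show ?thesis .
qed

text \<open>Single-letter form of an entropy of the whole experiment: the first component of
  \<open>L\<close> plays the part of U, the second is the letter at one time.\<close>

lemma hc_labelled:
  fixes L :: "'w \<Rightarrow> 'v \<times> 'u::finite"
  assumes fin: "finite (set_pmf P)" and B: "finite B" "\<And>w. w \<in> set_pmf P \<Longrightarrow> fst (L w) \<in> B"
    and X: "\<And>w. X (snd (L w)) = X' w"
    and V: "\<And>w w'. w \<in> set_pmf P \<Longrightarrow> w' \<in> set_pmf P \<Longrightarrow> V' w = V' w' \<longleftrightarrow> fst (L w) = fst (L w') \<and> V (snd (L w)) = V (snd (L w'))"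
  shows "hc (set_pmf P) (pmf P) X' V' = (\<Sum>v\<in>B. hc UNIV (\<lambda>u. pmf (map_pmf L P) (v, u)) X V)"
proof -
  have "hc (set_pmf P) (pmf P) X' V' = hc (set_pmf P) (pmf P) (\<lambda>w. X (snd (L w))) (\<lambda>w. (fst (L w), V (snd (L w))))"
  proof (rule hc_kernel_cong)
    fix w w' assume "w \<in> set_pmf P" "w' \<in> set_pmf P"
    then show "V' w = V' w' \<longleftrightarrow> (fst (L w), V (snd (L w))) = (fst (L w'), V (snd (L w')))" using V[of w w'] by blast
  qed (simp add: X)
  also have "\<dots> = hc (set_pmf (map_pmf L P)) (pmf (map_pmf L P)) (\<lambda>u. X (snd u)) (\<lambda>u. (fst u, V (snd u)))"
    by (rule hc_map_pmf[OF fin, symmetric])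
  also have "\<dots> = hc (case_prod Pair ` (B \<times> UNIV)) (pmf (map_pmf L P)) (\<lambda>u. X (snd u)) (\<lambda>u. (fst u, V (snd u)))"
  proof (rule hc_superset[symmetric])
    show "set_pmf (map_pmf L P) \<subseteq> case_prod Pair ` (B \<times> UNIV)"
    proof
      fix u assume "u \<in> set_pmf (map_pmf L P)"
      then have "fst u \<in> B" using B(2) by auto
      then show "u \<in> case_prod Pair ` (B \<times> UNIV)" by (cases u) auto
    qed
    show "\<forall>u\<in>case_prod Pair ` (B \<times> UNIV) - set_pmf (map_pmf L P). pmf (map_pmf L P) u = 0"
      unfolding pmf_eq_0_set_pmf by blast
  qed (use B in simp)
  also have "\<dots> = (\<Sum>v\<in>B. hc UNIV (\<lambda>u. pmf (map_pmf L P) (v, u)) (\<lambda>u. X (snd (v, u))) (\<lambda>u. (fst (v, u), V (snd (v, u)))))"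
    by (rule hc_family) (use B in auto)
  also have "\<dots> = (\<Sum>v\<in>B. hc UNIV (\<lambda>u. pmf (map_pmf L P) (v, u)) X V)"
    by (rule sum.cong[OF refl], rule hc_kernel_cong) auto
  finally show ?thesis .
qed

lemma messages_finite: "finite (messages n R)" unfolding messages_def by simp

lemma card_messages: "card (messages n R) = nat \<lfloor>2 powr (real n * R)\<rfloor>"
  unfolding messages_def by simp

lemma messages_nonempty: "0 \<le> R \<Longrightarrow> messages n R \<noteq> {}"
  unfolding messages_def by (simp add: le_nat_iff le_floor_iff ge_one_powr_ge_zero)

text \<open>Rounding down a number that is at least 1 loses at most half of it, which is one
  bit.\<close>

lemma log_card_messages:
  assumes "0 \<le> R"
  shows "real n * R - 1 \<le> log 2 (card (messages n R))"
proof -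
  define x where "x = 2 powr (real n * R)"
  have x: "1 \<le> x" unfolding x_def using assms by (intro ge_one_powr_ge_zero) auto
  have "real (nat \<lfloor>x\<rfloor>) = of_int \<lfloor>x\<rfloor>" using x by simp
  moreover have "1 \<le> \<lfloor>x\<rfloor>" using x by simp
  ultimately have "x / 2 \<le> real (nat \<lfloor>x\<rfloor>)" by linarith
  then have "log 2 (x / 2) \<le> log 2 (real (nat \<lfloor>x\<rfloor>))" using x by (intro log_mono) auto
  moreover have "log 2 (x / 2) = real n * R - 1" using x by (simp add: log_divide x_def)
  ultimately show ?thesis unfolding card_messages x_def by simp
qed

lemma finite_Pi_support: "finite A \<Longrightarrow> (\<And>x. x \<in> A \<Longrightarrow> finite (set_pmf (p x))) \<Longrightarrow> finite (set_pmf (Pi_pmf A d p))"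
  by (subst set_Pi_pmf) (auto intro!: finite_PiE_dflt)

lemma iid_hc:
  fixes p :: "('a \<times> 'b) pmf"
  assumes A: "finite A" and p: "finite (set_pmf p)"
  defines "P \<equiv> Pi_pmf A undefined (\<lambda>_. p)"
  shows "hc (set_pmf P) (pmf P) (\<lambda>s. fst \<circ> s) (\<lambda>s. snd \<circ> s) = card A * hc (set_pmf p) (pmf p) fst snd"
proof -
  define r where "r v = pmf p v / pmf (map_pmf snd p) (snd v)" for v
  have fin: "finite (set_pmf P)" unfolding P_def using A p by (rule finite_Pi_support)
  have out: "s i = undefined" if "s \<in> set_pmf P" "i \<notin> A" for s i
    using set_mp[OF set_Pi_pmf_subset[OF A] that(1)[unfolded P_def]] that(2) by auto
  have inA: "s i \<in> set_pmf p" if "s \<in> set_pmf P" "i \<in> A" for s i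
    using that A unfolding P_def by (auto simp: set_Pi_pmf PiE_dflt_def)
  have rpos: "0 < r v" if "v \<in> set_pmf p" for v
    using that unfolding r_def by (intro divide_pos_pos pmf_positive) auto
  have 1: "hc (set_pmf P) (pmf P) (\<lambda>s. fst \<circ> s) (\<lambda>s. snd \<circ> s) = - (\<Sum>s\<in>set_pmf P. pmf P s * log 2 (\<Prod>i\<in>A. r (s i)))"
  proof (rule hc_of_kernel[OF fin])
    fix s assume s: "s \<in> set_pmf P"
    have "mass (set_pmf P) (pmf P) (\<lambda>s. (fst \<circ> s, snd \<circ> s)) (fst \<circ> s, snd \<circ> s) = (\<Sum>s\<in>{s}. pmf P s)"
      unfolding mass_def using s by (intro sum.cong) (auto simp: fun_eq_iff prod_eq_iff)
    also have "\<dots> = (\<Prod>i\<in>A. pmf p (s i))"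
      unfolding P_def using out[OF s] A by (simp add: pmf_Pi')
    finally have a: "mass (set_pmf P) (pmf P) (\<lambda>s. (fst \<circ> s, snd \<circ> s)) (fst \<circ> s, snd \<circ> s) = (\<Prod>i\<in>A. pmf p (s i))" .
    \<comment> \<open>Taking second components turns the default value \<open>undefined\<close> into
      \<open>snd undefined\<close>, which is also the value of \<open>snd \<circ> s\<close> outside
      \<open>A\<close>.\<close>
    have "map_pmf (\<lambda>s. snd \<circ> s) P = Pi_pmf A (snd (undefined :: 'a \<times> 'b)) (\<lambda>_. map_pmf snd p)"
      unfolding P_def by (rule Pi_pmf_map[OF A, symmetric]) simp
    then have b: "mass (set_pmf P) (pmf P) (\<lambda>s. snd \<circ> s) (snd \<circ> s) = (\<Prod>i\<in>A. pmf (map_pmf snd p) (snd (s i)))"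
      unfolding mass_pmf[OF fin] using out[OF s] A by (simp add: pmf_Pi')
    have "pmf (map_pmf snd p) (snd (s i)) \<noteq> 0" if "i \<in> A" for i
      using inA[OF s that] by (auto simp: pmf_eq_0_set_pmf)
    then show "mass (set_pmf P) (pmf P) (\<lambda>s. (fst \<circ> s, snd \<circ> s)) (fst \<circ> s, snd \<circ> s) =
       (\<Prod>i\<in>A. r (s i)) * mass (set_pmf P) (pmf P) (\<lambda>s. snd \<circ> s) (snd \<circ> s)"
      unfolding a b prod.distrib[symmetric] by (intro prod.cong) (auto simp: r_def)
  qed simp
  have 2: "hc (set_pmf p) (pmf p) fst snd = - (\<Sum>v\<in>set_pmf p. pmf p v * log 2 (r v))"
  proof (rule hc_of_kernel[OF p])
    fix v assume "v \<in> set_pmf p"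
    then have "pmf (map_pmf snd p) (snd v) \<noteq> 0" by (auto simp: pmf_eq_0_set_pmf)
    moreover have "mass (set_pmf p) (pmf p) (\<lambda>v. (fst v, snd v)) (fst v, snd v) = pmf p v"
      unfolding mass_pmf[OF p] by (simp add: map_pmf_ident)
    ultimately show "mass (set_pmf p) (pmf p) (\<lambda>v. (fst v, snd v)) (fst v, snd v) = r v * mass (set_pmf p) (pmf p) snd (snd v)"
      unfolding mass_pmf[OF p] r_def by simp
  qed simp
  have "(\<Sum>s\<in>set_pmf P. pmf P s * log 2 (\<Prod>i\<in>A. r (s i))) = (\<Sum>s\<in>set_pmf P. \<Sum>i\<in>A. pmf P s * log 2 (r (s i)))"
  proof (rule sum.cong[OF refl])
    fix s assume s: "s \<in> set_pmf P"
    have "r (s i) \<noteq> 0" if "i \<in> A" for i using rpos[OF inA[OF s that]] by simp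
    then have "log 2 (\<Prod>i\<in>A. r (s i)) = (\<Sum>i\<in>A. log 2 (r (s i)))"
      unfolding log_def using A by (subst ln_prod) (auto simp: sum_divide_distrib)
    then show "pmf P s * log 2 (\<Prod>i\<in>A. r (s i)) = (\<Sum>i\<in>A. pmf P s * log 2 (r (s i)))" by (simp add: sum_distrib_left)
  qed
  also have "\<dots> = (\<Sum>i\<in>A. \<Sum>s\<in>set_pmf P. pmf P s * log 2 (r (s i)))" by (rule sum.swap)
  also have "\<dots> = (\<Sum>i\<in>A. \<Sum>v\<in>set_pmf p. pmf p v * log 2 (r v))"
  proof (rule sum.cong[OF refl])
    fix i assume i: "i \<in> A"
    have "map_pmf (\<lambda>s. s i) P = p" unfolding P_def using A i by (simp add: Pi_pmf_component)
    then show "(\<Sum>s\<in>set_pmf P. pmf P s * log 2 (r (s i))) = (\<Sum>v\<in>set_pmf p. pmf p v * log 2 (r v))"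
      using sum_expectation_map[OF fin p, of "\<lambda>s. s i" "\<lambda>v. log 2 (r v)"] inA[OF _ i] by auto
  qed
  finally show ?thesis unfolding 1 2 by simp
qed

lemma bind_reorder:
  "bind_pmf A (\<lambda>a. bind_pmf B (\<lambda>b. bind_pmf C (\<lambda>c. bind_pmf D (\<lambda>d. K a b c d)))) =
   bind_pmf C (\<lambda>c. bind_pmf A (\<lambda>a. bind_pmf D (\<lambda>d. bind_pmf B (\<lambda>b. K a b c d))))"
proof -
  have "bind_pmf A (\<lambda>a. bind_pmf B (\<lambda>b. bind_pmf C (\<lambda>c. bind_pmf D (\<lambda>d. K a b c d)))) =
    bind_pmf A (\<lambda>a. bind_pmf C (\<lambda>c. bind_pmf B (\<lambda>b. bind_pmf D (\<lambda>d. K a b c d))))"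
    by (subst bind_commute_pmf) (rule refl)
  also have "\<dots> = bind_pmf C (\<lambda>c. bind_pmf A (\<lambda>a. bind_pmf B (\<lambda>b. bind_pmf D (\<lambda>d. K a b c d))))"
    by (rule bind_commute_pmf)
  also have "\<dots> = bind_pmf C (\<lambda>c. bind_pmf A (\<lambda>a. bind_pmf D (\<lambda>d. bind_pmf B (\<lambda>b. K a b c d))))"
    by (subst bind_commute_pmf[of B]) (rule refl)
  finally show ?thesis .
qed

section \<open>The transcript of a given code\<close>

context mac
begin

context
  fixes n :: nat and R1 R2 :: real
    and enc1 :: "nat \<Rightarrow> (nat \<Rightarrow> 's1) \<Rightarrow> nat \<Rightarrow> 'x1"
    and enc2 :: "nat \<Rightarrow> nat \<Rightarrow> (nat \<Rightarrow> 's2) \<Rightarrow> (nat \<Rightarrow> 'z) \<Rightarrow> 'x2"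
  assumes R: "0 \<le> R1" "0 \<le> R2"
begin

abbreviation "Ms1 \<equiv> messages n R1"
abbreviation "Ms2 \<equiv> messages n R2"
abbreviation "TR \<equiv> transmission pS W z R1 R2 n enc1 enc2"

definition rM1 :: "('s1, 's2, 'y) transcript \<Rightarrow> nat" where "rM1 = fst"
definition rM2 :: "('s1, 's2, 'y) transcript \<Rightarrow> nat" where "rM2 w = fst (snd w)"
definition rS1 :: "('s1, 's2, 'y) transcript \<Rightarrow> nat \<Rightarrow> 's1" where "rS1 w = fst (snd (snd w))"
definition rS2 :: "('s1, 's2, 'y) transcript \<Rightarrow> nat \<Rightarrow> 's2" where "rS2 w = fst (snd (snd (snd w)))"
definition rY :: "('s1, 's2, 'y) transcript \<Rightarrow> nat \<Rightarrow> 'y" where "rY w = snd (snd (snd (snd w)))"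
definition rX1 where "rX1 i w = enc1 (rM1 w) (rS1 w) i"
definition rZ where "rZ i w = z (rX1 i w) (rS1 w i)"
definition rZp where "rZp i w = restrict (\<lambda>j. rZ j w) {1..<i}"
definition rX2 where "rX2 i w = enc2 i (rM2 w) (rS2 w) (rZp i w)"
text \<open>The auxiliary variable. Overwriting time \<open>i\<close> removes the second state at
  time \<open>i\<close>, and restoring this state gives back the whole of \<open>rS2 w\<close>; the
  crib has the form in which encoder 2 receives it.\<close>

definition rV where "rV i w = (rZp i w, (rS2 w)(i := undefined))"
definition rL where "rL i w = (rV i w, (rS1 w i, rS2 w i, rX1 i w, rX2 i w, rY w i))"

lemma input2_eq: "input2 z enc1 enc2 (rM1 w) (rM2 w) (rS1 w) (rS2 w) i = rX2 i w"
  unfolding input2_def rX2_def rZp_def rZ_def rX1_def ..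

text \<open>Sequences are functions on all naturals. On the support their values outside
  \<open>{1..n}\<close> are fixed, so the restrictions to \<open>{1..n}\<close> determine
  them.\<close>

lemma TR_support:
  assumes "w \<in> set_pmf TR"
  shows "rM1 w \<in> Ms1" "rM2 w \<in> Ms2" "i \<notin> {1..n} \<Longrightarrow> rY w i = undefined"
    "i \<notin> {1..n} \<Longrightarrow> rS1 w i = fst (undefined :: 's1 \<times> 's2)" "i \<notin> {1..n} \<Longrightarrow> rS2 w i = snd (undefined :: 's1 \<times> 's2)"
proof -
  obtain m1 m2 s y where w: "w = (m1, m2, fst \<circ> s, snd \<circ> s, y)" "m1 \<in> Ms1" "m2 \<in> Ms2"
    "s \<in> set_pmf (seq_pmf n (\<lambda>_. pS))"
    "y \<in> set_pmf (seq_pmf n (\<lambda>i. W (enc1 m1 (fst \<circ> s) i)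
        (input2 z enc1 enc2 m1 m2 (fst \<circ> s) (snd \<circ> s) i) ((fst \<circ> s) i) ((snd \<circ> s) i)))"
    using assms unfolding transmission_def Let_def
    by (auto simp: set_pmf_of_set[OF messages_nonempty[OF R(1)] messages_finite] set_pmf_of_set[OF messages_nonempty[OF R(2)] messages_finite])
  have "s i = undefined" "y i = undefined" if "i \<notin> {1..n}" for i
    using set_mp[OF set_Pi_pmf_subset w(4)] set_mp[OF set_Pi_pmf_subset w(5)] that by auto
  then show "rM1 w \<in> Ms1" "rM2 w \<in> Ms2" "i \<notin> {1..n} \<Longrightarrow> rY w i = undefined"
    "i \<notin> {1..n} \<Longrightarrow> rS1 w i = fst (undefined :: 's1 \<times> 's2)" "i \<notin> {1..n} \<Longrightarrow> rS2 w i = snd (undefined :: 's1 \<times> 's2)"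
    using w by (auto simp: rM1_def rM2_def rY_def rS1_def rS2_def)
qed

lemma TR_finite: "finite (set_pmf TR)"
  unfolding transmission_def Let_def
  by (auto intro!: finite_UN_I finite_Pi_support simp: messages_finite
      set_pmf_of_set[OF messages_nonempty[OF R(1)] messages_finite] set_pmf_of_set[OF messages_nonempty[OF R(2)] messages_finite])

lemma TR_nonneg: "\<forall>w\<in>set_pmf TR. 0 \<le> pmf TR w" by simp

abbreviation hT :: "(_ \<Rightarrow> 'a) \<Rightarrow> (_ \<Rightarrow> 'b) \<Rightarrow> real" where "hT \<equiv> hc (set_pmf TR) (pmf TR)"
abbreviation "hY1 i \<equiv> hT (\<lambda>w. rY w i) (\<lambda>w. (rV i w, rX2 i w, rZ i w, rS1 w i, rS2 w i))"
abbreviation "hY2 i \<equiv> hT (\<lambda>w. rY w i) (\<lambda>w. (rV i w, rX1 i w, rS1 w i, rS2 w i))"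
abbreviation "hY3 i \<equiv> hT (\<lambda>w. rY w i) (\<lambda>w. (rV i w, rZ i w, rS1 w i, rS2 w i))"
abbreviation "hY5 i \<equiv> hT (\<lambda>w. rY w i) (\<lambda>w. (rS1 w i, rS2 w i))"
abbreviation "hC i \<equiv> hT (rZ i) (\<lambda>w. (rV i w, rS1 w i)) + hT (\<lambda>w. rS1 w i) (\<lambda>w. (rV i w, rS2 w i))"

lemma map_TR: "map_pmf f TR = do {
   m1 \<leftarrow> pmf_of_set Ms1; m2 \<leftarrow> pmf_of_set Ms2; s \<leftarrow> seq_pmf n (\<lambda>_. pS);
   y \<leftarrow> seq_pmf n (\<lambda>i. W (enc1 m1 (fst \<circ> s) i) (input2 z enc1 enc2 m1 m2 (fst \<circ> s) (snd \<circ> s) i) (fst (s i)) (snd (s i)));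
   return_pmf (f (m1, m2, fst \<circ> s, snd \<circ> s, y)) }"
  unfolding transmission_def Let_def by (simp add: map_bind_pmf)

lemma uniform1: "hT rM1 (\<lambda>w. (rM2 w, rS1 w, rS2 w)) = log 2 (card Ms1)"
  by (rule hc_independent_uniform[OF TR_finite messages_finite messages_nonempty[OF R(1)]])
     (simp add: map_TR pair_pmf_def bind_assoc_pmf bind_return_pmf rM1_def rM2_def rS1_def rS2_def)

lemma uniform2: "hT rM2 (\<lambda>w. (rM1 w, rS1 w, rS2 w)) = log 2 (card Ms2)"
proof (rule hc_independent_uniform[OF TR_finite messages_finite messages_nonempty[OF R(2)]])
  show "map_pmf (\<lambda>w. (rM2 w, rM1 w, rS1 w, rS2 w)) TR = pair_pmf (pmf_of_set Ms2) (map_pmf (\<lambda>w. (rM1 w, rS1 w, rS2 w)) TR)"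
    by (simp add: map_TR pair_pmf_def bind_assoc_pmf bind_return_pmf rM1_def rM2_def rS1_def rS2_def)
       (subst bind_commute_pmf, rule refl)
qed

lemma uniform12: "hT (\<lambda>w. (rM1 w, rM2 w)) (\<lambda>w. (rS1 w, rS2 w)) = log 2 (card Ms1) + log 2 (card Ms2)"
proof -
  have "hT (\<lambda>w. (rM1 w, rM2 w)) (\<lambda>w. (rS1 w, rS2 w)) = hT rM1 (\<lambda>w. (rS1 w, rS2 w)) + hT rM2 (\<lambda>w. (rM1 w, rS1 w, rS2 w))"
    by (rule hc_chain)
  moreover have "hT rM1 (\<lambda>w. (rS1 w, rS2 w)) = log 2 (card Ms1)"
    by (rule hc_independent_uniform[OF TR_finite messages_finite messages_nonempty[OF R(1)]])
       (simp add: map_TR pair_pmf_def bind_assoc_pmf bind_return_pmf rM1_def rM2_def rS1_def rS2_def)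
  ultimately show ?thesis using uniform2 by simp
qed

definition kapT :: "nat \<Rightarrow> real" where
  "kapT i = - (\<Sum>w\<in>set_pmf TR. pmf TR w * log 2 (chan (snd (rL i w))))"

lemma pmf_TR:
  assumes "w \<in> set_pmf TR"
  shows "pmf TR w = pmf (map_pmf (\<lambda>w. (rM1 w, rM2 w, rS1 w, rS2 w)) TR) (rM1 w, rM2 w, rS1 w, rS2 w) *
     (\<Prod>i\<in>{1..n}. chan (snd (rL i w)))"
proof -
  let ?K = "\<lambda>(m1, m2, s1, s2). map_pmf (\<lambda>y. (m1, m2, s1, s2, y)) (seq_pmf n
      (\<lambda>i. W (enc1 m1 s1 i) (input2 z enc1 enc2 m1 m2 s1 s2 i) (s1 i) (s2 i)))"
  have "TR = bind_pmf (map_pmf (\<lambda>w. (rM1 w, rM2 w, rS1 w, rS2 w)) TR) ?K"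
    unfolding map_TR by (simp add: rM1_def rM2_def rS1_def rS2_def bind_assoc_pmf bind_return_pmf)
      (simp add: transmission_def Let_def map_pmf_def)
  then have "pmf TR w = pmf (bind_pmf (map_pmf (\<lambda>w. (rM1 w, rM2 w, rS1 w, rS2 w)) TR) ?K) w" by simp
  also have "\<dots> = pmf (map_pmf (\<lambda>w. (rM1 w, rM2 w, rS1 w, rS2 w)) TR) (rM1 w, rM2 w, rS1 w, rS2 w) *
      pmf (?K (rM1 w, rM2 w, rS1 w, rS2 w)) w"
    by (rule pmf_bind_single) (auto simp: rM1_def rM2_def rS1_def rS2_def)
  also have "pmf (?K (rM1 w, rM2 w, rS1 w, rS2 w)) w = (\<Prod>i\<in>{1..n}. chan (snd (rL i w)))"
  proof -
    have w: "w = (\<lambda>y. (rM1 w, rM2 w, rS1 w, rS2 w, y)) (rY w)"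
      by (simp add: rM1_def rM2_def rS1_def rS2_def rY_def)
    have "pmf (?K (rM1 w, rM2 w, rS1 w, rS2 w)) w = pmf (seq_pmf n
      (\<lambda>i. W (enc1 (rM1 w) (rS1 w) i) (input2 z enc1 enc2 (rM1 w) (rM2 w) (rS1 w) (rS2 w) i) (rS1 w i) (rS2 w i))) (rY w)"
      by (simp, subst w, subst pmf_map_inj') (auto simp: inj_on_def)
    also have "\<dots> = (\<Prod>i\<in>{1..n}. pmf (W (enc1 (rM1 w) (rS1 w) i) (input2 z enc1 enc2 (rM1 w) (rM2 w) (rS1 w) (rS2 w) i) (rS1 w i) (rS2 w i)) (rY w i))"
      by (rule pmf_Pi') (use TR_support(3)[OF assms] in auto)
    finally show ?thesis by (simp add: chan_def rL_def input2_eq rX1_def)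
  qed
  finally show ?thesis .
qed

text \<open>Given messages and states both input sequences are determined, so the outputs are
  independent and the logarithm of their probability splits over time. The factors are nonzero on
  the support.\<close>

lemma hT_channel: "hT rY (\<lambda>w. (rM1 w, rM2 w, rS1 w, rS2 w)) = (\<Sum>i\<in>{1..n}. kapT i)"
proof -
  have "hT rY (\<lambda>w. (rM1 w, rM2 w, rS1 w, rS2 w)) = - (\<Sum>w\<in>set_pmf TR. pmf TR w * log 2 (\<Prod>i\<in>{1..n}. chan (snd (rL i w))))"
  proof (rule hc_of_kernel[OF TR_finite TR_nonneg])
    fix w assume w: "w \<in> set_pmf TR"
    have "mass (set_pmf TR) (pmf TR) (\<lambda>w. (rY w, rM1 w, rM2 w, rS1 w, rS2 w)) (rY w, rM1 w, rM2 w, rS1 w, rS2 w) = (\<Sum>w\<in>{w}. pmf TR w)"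
      unfolding mass_def using w by (intro sum.cong) (auto simp: rM1_def rM2_def rS1_def rS2_def rY_def prod_eq_iff)
    then show "mass (set_pmf TR) (pmf TR) (\<lambda>w. (rY w, rM1 w, rM2 w, rS1 w, rS2 w)) (rY w, rM1 w, rM2 w, rS1 w, rS2 w) =
        (\<Prod>i\<in>{1..n}. chan (snd (rL i w))) * mass (set_pmf TR) (pmf TR) (\<lambda>w. (rM1 w, rM2 w, rS1 w, rS2 w)) (rM1 w, rM2 w, rS1 w, rS2 w)"
      using pmf_TR[OF w] unfolding mass_pmf[OF TR_finite] by (simp add: mult.commute)
  qed
  also have "\<dots> = - (\<Sum>w\<in>set_pmf TR. \<Sum>i\<in>{1..n}. pmf TR w * log 2 (chan (snd (rL i w))))"
  proof (intro arg_cong[where f=uminus] sum.cong refl)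
    fix w assume w: "w \<in> set_pmf TR"
    then have "pmf TR w \<noteq> 0" by (simp add: set_pmf_iff)
    then have "(\<Prod>i\<in>{1..n}. chan (snd (rL i w))) \<noteq> 0" using pmf_TR[OF w] by auto
    then have "chan (snd (rL i w)) \<noteq> 0" if "i \<in> {1..n}" for i using that by auto
    then have "log 2 (\<Prod>i\<in>{1..n}. chan (snd (rL i w))) = (\<Sum>i\<in>{1..n}. log 2 (chan (snd (rL i w))))"
      unfolding log_def by (subst ln_prod) (auto simp: sum_divide_distrib)
    then show "pmf TR w * log 2 (\<Prod>i\<in>{1..n}. chan (snd (rL i w))) = (\<Sum>i\<in>{1..n}. pmf TR w * log 2 (chan (snd (rL i w))))"
      by (simp add: sum_distrib_left)
  qed
  also have "\<dots> = (\<Sum>i\<in>{1..n}. kapT i)"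
    unfolding kapT_def sum_negf by (subst sum.swap) (rule refl)
  finally show ?thesis .
qed

lemma hT_output:
  fixes V :: "_ \<Rightarrow> 'v" and G :: "nat \<Rightarrow> _ \<Rightarrow> 'g"
  assumes "\<And>i w w'. i \<in> {1..n} \<Longrightarrow> V w = V w' \<Longrightarrow> G i w = G i w'"
  shows "hT rY V \<le> (\<Sum>i\<in>{1..n}. hT (\<lambda>w. rY w i) (G i))"
proof -
  have "hT rY V = hT (\<lambda>w. restrict (rY w) {1..<Suc n}) V"
  proof (rule hc_kernel_cong)
    fix w w' assume w: "w \<in> set_pmf TR" "w' \<in> set_pmf TR"
    show "rY w = rY w' \<longleftrightarrow> restrict (rY w) {1..<Suc n} = restrict (rY w') {1..<Suc n}"
    proof
      assume e: "restrict (rY w) {1..<Suc n} = restrict (rY w') {1..<Suc n}"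
      show "rY w = rY w'"
      proof
        fix i show "rY w i = rY w' i"
          using TR_support(3)[OF w(1), of i] TR_support(3)[OF w(2), of i] fun_cong[OF e, of i]
          by (cases "i \<in> {1..n}") (auto simp: restrict_def)
      qed
    qed simp
  qed simp
  also have "\<dots> \<le> (\<Sum>i\<in>{1..n}. hT (\<lambda>w. rY w i) (G i))"
  proof (rule hc_le_sum[OF TR_finite TR_nonneg, where F="\<lambda>i w. restrict (rY w) {1..<i}"])
    fix i w w' assume "i \<in> {1..n}"
    then have "{1..<Suc i} = insert i {1..<i}" by auto
    then show "(restrict (rY w) {1..<Suc i} = restrict (rY w') {1..<Suc i}) \<longleftrightarrow>
       restrict (rY w) {1..<i} = restrict (rY w') {1..<i} \<and> rY w i = rY w' i"
      by (auto simp: restrict_def fun_eq_iff split: if_splits)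
  next
    fix i w w' assume "i \<in> {1..n}" "V w = V w'"
    then show "G i w = G i w'" by (rule assms)
  qed auto
  finally show ?thesis .
qed

lemma hT_states: "hT rS1 rS2 = real n * H0"
proof -
  let ?Pn = "seq_pmf n (\<lambda>_. pS)"
  have e: "map_pmf (\<lambda>w. (rS1 w, rS2 w)) TR = map_pmf (\<lambda>s. (fst \<circ> s, snd \<circ> s)) ?Pn"
    by (simp add: map_TR rS1_def rS2_def) (simp add: map_pmf_def)
  have fin: "finite (set_pmf ?Pn)" by (intro finite_Pi_support) auto
  have "hT rS1 rS2 = hc (set_pmf (map_pmf (\<lambda>w. (rS1 w, rS2 w)) TR)) (pmf (map_pmf (\<lambda>w. (rS1 w, rS2 w)) TR)) fst snd"
    unfolding hc_map_pmf[OF TR_finite] by simp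
  also have "\<dots> = hc (set_pmf ?Pn) (pmf ?Pn) (\<lambda>s. fst \<circ> s) (\<lambda>s. snd \<circ> s)"
    unfolding e hc_map_pmf[OF fin] by simp
  also have "\<dots> = real n * H0"
    unfolding H0_def by (subst iid_hc) auto
  finally show ?thesis .
qed

text \<open>The pair of \<open>S1^n\<close> and \<open>Z^n\<close> given \<open>S2^n\<close> is
  expanded in two ways. Sequence by sequence it gives \<open>n * H0\<close> plus the left-hand side;
  letter by letter every condition is coarsened to \<open>rV\<close> with one state, which gives
  \<open>hC\<close>.\<close>

lemma hT_crib:
  "hT (rZp (Suc n)) (\<lambda>w. (rS1 w, rS2 w)) \<le>
   (\<Sum>i\<in>{1..n}. hC i) - real n * H0"
proof -
  have "hT (\<lambda>w. (rS1 w, rZp (Suc n) w)) rS2 = hT (\<lambda>w. (restrict (rS1 w) {1..<Suc n}, rZp (Suc n) w)) rS2"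
  proof (rule hc_kernel_cong)
    fix w w' assume w: "w \<in> set_pmf TR" "w' \<in> set_pmf TR"
    have "rS1 w = rS1 w' \<longleftrightarrow> restrict (rS1 w) {1..<Suc n} = restrict (rS1 w') {1..<Suc n}"
    proof
      assume e: "restrict (rS1 w) {1..<Suc n} = restrict (rS1 w') {1..<Suc n}"
      show "rS1 w = rS1 w'"
      proof
        fix i show "rS1 w i = rS1 w' i"
          using TR_support(4)[OF w(1), of i] TR_support(4)[OF w(2), of i] fun_cong[OF e, of i]
          by (cases "i \<in> {1..n}") (auto simp: restrict_def)
      qed
    qed simp
    then show "((rS1 w, rZp (Suc n) w) = (rS1 w', rZp (Suc n) w')) =
       ((restrict (rS1 w) {1..<Suc n}, rZp (Suc n) w) = (restrict (rS1 w') {1..<Suc n}, rZp (Suc n) w'))" by blast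
  qed simp
  also have "\<dots> \<le> (\<Sum>i\<in>{1..n}. hT (\<lambda>w. (rS1 w i, rZ i w)) (\<lambda>w. (rV i w, rS2 w i)))"
  proof (rule hc_le_sum[OF TR_finite TR_nonneg, where F="\<lambda>i w. (restrict (rS1 w) {1..<i}, rZp i w)"])
    fix i w w' assume "i \<in> {1..n}"
    then have "{1..<Suc i} = insert i {1..<i}" by auto
    then show "((restrict (rS1 w) {1..<Suc i}, rZp (Suc i) w) = (restrict (rS1 w') {1..<Suc i}, rZp (Suc i) w')) \<longleftrightarrow>
       (restrict (rS1 w) {1..<i}, rZp i w) = (restrict (rS1 w') {1..<i}, rZp i w') \<and> (rS1 w i, rZ i w) = (rS1 w' i, rZ i w')"
      unfolding rZp_def by (auto simp: restrict_def fun_eq_iff split: if_splits)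
  next
    fix i w w' assume "(restrict (rS1 w) {1..<i}, rZp i w) = (restrict (rS1 w') {1..<i}, rZp i w')" "rS2 w = rS2 w'"
    then show "(rV i w, rS2 w i) = (rV i w', rS2 w' i)" unfolding rV_def by simp
  qed (auto simp: rZp_def restrict_def)
  also have "\<dots> \<le> (\<Sum>i\<in>{1..n}. hC i)"
  proof (rule sum_mono)
    fix i
    have "hT (rZ i) (\<lambda>w. (rS1 w i, rV i w, rS2 w i)) \<le> hT (rZ i) (\<lambda>w. (rV i w, rS1 w i))"
      by (rule hc_mono[OF TR_finite TR_nonneg]) auto
    then show "hT (\<lambda>w. (rS1 w i, rZ i w)) (\<lambda>w. (rV i w, rS2 w i)) \<le>
      hC i"
      unfolding hc_chain by linarith
  qed
  finally show ?thesis using hT_states hc_chain[of "set_pmf TR" "pmf TR" rS1 "rZp (Suc n)" rS2] by linarith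
qed

text \<open>Law of (X1, U) at time \<open>i\<close> given S1 there. The states at other times are
  independent of time \<open>i\<close>, and U contains S2 only at those times, so the second state
  at time \<open>i\<close> does not enter.\<close>

definition QT :: "nat \<Rightarrow> 's1 \<Rightarrow> ('x1 \<times> (nat \<Rightarrow> 'z) \<times> (nat \<Rightarrow> 's2)) pmf" where
  "QT i s = do { m1 \<leftarrow> pmf_of_set Ms1; f \<leftarrow> Pi_pmf ({1..n} - {i}) undefined (\<lambda>_. pS);
     let s1 = (fst \<circ> f)(i := s);
     return_pmf (enc1 m1 s1 i, restrict (\<lambda>j. z (enc1 m1 s1 j) (s1 j)) {1..<i}, (snd \<circ> f)(i := undefined)) }"

definition TT :: "nat \<Rightarrow> (nat \<Rightarrow> 'z) \<times> (nat \<Rightarrow> 's2) \<Rightarrow> 's2 \<Rightarrow> 'x2 pmf" where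
  "TT i v s = map_pmf (\<lambda>m2. enc2 i m2 ((snd v)(i := s)) (fst v)) (pmf_of_set Ms2)"

text \<open>The Markov structure required of the joint law: splitting off the state pair at time
  \<open>i\<close> exhibits (X1, U) as drawn given S1, and X2 as drawn from U, S2 and message
  2.\<close>

lemma map_rL:
  assumes i: "i \<in> {1..n}"
  shows "map_pmf (rL i) TR = do { s \<leftarrow> pS; xv \<leftarrow> QT i (fst s); x2 \<leftarrow> TT i (snd xv) (snd s);
     y \<leftarrow> W (fst xv) x2 (fst s) (snd s); return_pmf (snd xv, fst s, snd s, fst xv, x2, y) }"
proof -
  have ins: "{1..n} = insert i ({1..n} - {i})" using i by auto
  have Pi: "seq_pmf n (\<lambda>_. pS) = do { a \<leftarrow> pS; f \<leftarrow> Pi_pmf ({1..n} - {i}) undefined (\<lambda>_. pS); return_pmf (f(i := a)) }"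
    by (subst ins, subst Pi_pmf_insert') auto
  define v where "v m1 s = (restrict (\<lambda>j. z (enc1 m1 (fst \<circ> s) j) (fst (s j))) {1..<i}, (snd \<circ> s)(i := undefined))" for m1 and s :: "nat \<Rightarrow> 's1 \<times> 's2"
  define x2 where "x2 m1 m2 s = enc2 i m2 (snd \<circ> s) (fst (v m1 s))" for m1 m2 s
  have "map_pmf (rL i) TR = do { m1 \<leftarrow> pmf_of_set Ms1; m2 \<leftarrow> pmf_of_set Ms2; s \<leftarrow> seq_pmf n (\<lambda>_. pS);
     y \<leftarrow> W (enc1 m1 (fst \<circ> s) i) (x2 m1 m2 s) (fst (s i)) (snd (s i));
     return_pmf (v m1 s, fst (s i), snd (s i), enc1 m1 (fst \<circ> s) i, x2 m1 m2 s, y) }"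
    unfolding map_TR
  proof (intro bind_pmf_cong[OF refl])
    fix m1 m2 s
    have r: "rL i (m1, m2, fst \<circ> s, snd \<circ> s, y) = (v m1 s, fst (s i), snd (s i), enc1 m1 (fst \<circ> s) i, x2 m1 m2 s, y i)" for y
      by (simp add: rL_def rV_def rX1_def rX2_def rZp_def rZ_def rM1_def rM2_def rS1_def rS2_def rY_def v_def x2_def)
    have x: "input2 z enc1 enc2 m1 m2 (fst \<circ> s) (snd \<circ> s) i = x2 m1 m2 s" by (simp add: input2_def x2_def v_def)
    have "seq_pmf n (\<lambda>i. W (enc1 m1 (fst \<circ> s) i) (input2 z enc1 enc2 m1 m2 (fst \<circ> s) (snd \<circ> s) i) (fst (s i)) (snd (s i)))
        \<bind> (\<lambda>y. return_pmf (rL i (m1, m2, fst \<circ> s, snd \<circ> s, y))) =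
      map_pmf (\<lambda>y. (v m1 s, fst (s i), snd (s i), enc1 m1 (fst \<circ> s) i, x2 m1 m2 s, y)) (map_pmf (\<lambda>y. y i) (seq_pmf n
        (\<lambda>i. W (enc1 m1 (fst \<circ> s) i) (input2 z enc1 enc2 m1 m2 (fst \<circ> s) (snd \<circ> s) i) (fst (s i)) (snd (s i)))))"
      unfolding r map_pmf_comp by (simp add: map_pmf_def)
    also have "\<dots> = W (enc1 m1 (fst \<circ> s) i) (x2 m1 m2 s) (fst (s i)) (snd (s i)) \<bind>
        (\<lambda>y. return_pmf (v m1 s, fst (s i), snd (s i), enc1 m1 (fst \<circ> s) i, x2 m1 m2 s, y))"
      using i by (subst Pi_pmf_component) (simp_all add: x map_pmf_def)
    finally show "seq_pmf n (\<lambda>i. W (enc1 m1 (fst \<circ> s) i) (input2 z enc1 enc2 m1 m2 (fst \<circ> s) (snd \<circ> s) i) (fst (s i)) (snd (s i)))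
        \<bind> (\<lambda>y. return_pmf (rL i (m1, m2, fst \<circ> s, snd \<circ> s, y))) = \<dots>" .
  qed
  also have "\<dots> = do { m1 \<leftarrow> pmf_of_set Ms1; m2 \<leftarrow> pmf_of_set Ms2; a \<leftarrow> pS; f \<leftarrow> Pi_pmf ({1..n} - {i}) undefined (\<lambda>_. pS);
     y \<leftarrow> W (enc1 m1 (fst \<circ> f(i := a)) i) (x2 m1 m2 (f(i := a))) (fst a) (snd a);
     return_pmf (v m1 (f(i := a)), fst a, snd a, enc1 m1 (fst \<circ> f(i := a)) i, x2 m1 m2 (f(i := a)), y) }"
    unfolding Pi by (simp add: bind_assoc_pmf bind_return_pmf)
  \<comment> \<open>Message 2 is drawn last: neither X1 nor the auxiliary variable depends on
    it.\<close>
  also have "\<dots> = do { a \<leftarrow> pS; m1 \<leftarrow> pmf_of_set Ms1; f \<leftarrow> Pi_pmf ({1..n} - {i}) undefined (\<lambda>_. pS); m2 \<leftarrow> pmf_of_set Ms2;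
     y \<leftarrow> W (enc1 m1 (fst \<circ> f(i := a)) i) (x2 m1 m2 (f(i := a))) (fst a) (snd a);
     return_pmf (v m1 (f(i := a)), fst a, snd a, enc1 m1 (fst \<circ> f(i := a)) i, x2 m1 m2 (f(i := a)), y) }"
    by (rule bind_reorder)
  also have "\<dots> = do { s \<leftarrow> pS; xv \<leftarrow> QT i (fst s); x2 \<leftarrow> TT i (snd xv) (snd s);
     y \<leftarrow> W (fst xv) x2 (fst s) (snd s); return_pmf (snd xv, fst s, snd s, fst xv, x2, y) }"
  proof -
    have f: "fst \<circ> f(i := a) = (fst \<circ> f)(i := fst a)" "snd \<circ> f(i := a) = (snd \<circ> f)(i := snd a)" for f :: "nat \<Rightarrow> 's1 \<times> 's2" and a
      by (auto simp: fun_eq_iff)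
    have g: "restrict (\<lambda>j. z (enc1 m1 s j) (fst ((f(i := a)) j))) {1..<i} = restrict (\<lambda>j. z (enc1 m1 s j) (((fst \<circ> f)(i := fst a)) j)) {1..<i}"
      for m1 s and f :: "nat \<Rightarrow> 's1 \<times> 's2" and a by (auto simp: restrict_def fun_eq_iff)
    show ?thesis unfolding QT_def TT_def v_def x2_def f g
      by (simp add: bind_assoc_pmf bind_return_pmf map_pmf_def Let_def)
  qed
  finally show ?thesis .
qed

lemma pmf_rL:
  assumes i: "i \<in> {1..n}"
  shows "pmf (map_pmf (rL i) TR) (v, w) = atom (\<lambda>s x. pmf (QT i s) (x, v)) (\<lambda>s x. pmf (TT i v s) x) w"
proof -
  obtain s1 s2 x1 x2 y where w: "w = (s1, s2, x1, x2, y)" by (cases w) auto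
  have "pmf (map_pmf (rL i) TR) (v, w) = pmf pS (s1, s2) * (pmf (QT i s1) (x1, v) *
      (pmf (TT i v s2) x2 * (pmf (W x1 x2 s1 s2) y * 1)))"
    unfolding map_rL[OF i] w
    apply (subst pmf_bind_single[of "(s1, s2)"], force)
    apply (rule arg_cong2[where f=times, OF refl], simp only: fst_conv snd_conv)
    apply (subst pmf_bind_single[of "(x1, v)"], force)
    apply (rule arg_cong2[where f=times, OF refl], simp only: fst_conv snd_conv)
    apply (subst pmf_bind_single[of "x2"], force)
    apply (rule arg_cong2[where f=times, OF refl])
    apply (subst pmf_bind_single[of "y"], force)
    apply simp
    done
  then show ?thesis unfolding atom_def chan_def w by (simp add: mult_ac)
qed

text \<open>Message 1 is measured through the pair of crib and outputs, given message 2 and the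
  states. The crib contributes at most its entropy given the states, the outputs an information with
  the crib in the condition.\<close>

lemma message1_bound:
  assumes err: "measure_pmf.prob TR {w. dec1 (rY w) (rS1 w) (rS2 w) \<noteq> rM1 w} \<le> \<epsilon>"
  shows "(1 - \<epsilon>) * log 2 (card Ms1) - 1 \<le> hT (rZp (Suc n)) (\<lambda>w. (rS1 w, rS2 w))
      + hT rY (\<lambda>w. (rZp (Suc n) w, rM2 w, rS1 w, rS2 w)) - (\<Sum>i\<in>{1..n}. kapT i)"
proof -
  let ?V = "\<lambda>w. (rM2 w, rS1 w, rS2 w)" and ?Zn = "rZp (Suc n)"
  let ?T = "\<lambda>w. (?Zn w, rY w)"
  have "hT rM1 (\<lambda>w. (?T w, ?V w)) \<le> hT rM1 (\<lambda>w. (rY w, rS1 w, rS2 w))"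
    by (rule hc_mono[OF TR_finite TR_nonneg]) auto
  also have "\<dots> \<le> 1 + \<epsilon> * log 2 (card Ms1)"
    by (rule fano[OF TR_finite messages_finite messages_nonempty[OF R(1)], where dec="\<lambda>(y, s1, s2). dec1 y s1 s2"])
       (use TR_support(1) err in auto)
  finally have f: "hT rM1 (\<lambda>w. (?T w, ?V w)) \<le> 1 + \<epsilon> * log 2 (card Ms1)" .
  have z: "hT ?Zn ?V \<le> hT ?Zn (\<lambda>w. (rS1 w, rS2 w))" by (rule hc_mono[OF TR_finite TR_nonneg]) auto
  have k: "hT rY (\<lambda>w. (?Zn w, rM1 w, ?V w)) = (\<Sum>i\<in>{1..n}. kapT i)"
    unfolding hT_channel[symmetric]
    by (rule hc_kernel_cong) (auto simp: rZp_def rZ_def rX1_def)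
  have z0: "0 \<le> hT ?Zn (\<lambda>w. (rM1 w, ?V w))" by (rule hc_nonneg[OF TR_finite TR_nonneg])
  show ?thesis
    using hc_swap[of "set_pmf TR" "pmf TR" rM1 ?V ?T] f z k z0 uniform1
    unfolding hc_chain[of "set_pmf TR" "pmf TR" ?Zn rY] by (simp add: algebra_simps)
qed

text \<open>No cribbing term arises here: message 1 and S1 stand in the condition and determine the
  crib.\<close>

lemma message2_bound:
  assumes err: "measure_pmf.prob TR {w. dec2 (rY w) (rS1 w) (rS2 w) \<noteq> rM2 w} \<le> \<epsilon>"
  shows "(1 - \<epsilon>) * log 2 (card Ms2) - 1 \<le> hT rY (\<lambda>w. (rM1 w, rS1 w, rS2 w)) - (\<Sum>i\<in>{1..n}. kapT i)"
proof -
  let ?V = "\<lambda>w. (rM1 w, rS1 w, rS2 w)"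
  have "hT rM2 (\<lambda>w. (rY w, ?V w)) \<le> hT rM2 (\<lambda>w. (rY w, rS1 w, rS2 w))"
    by (rule hc_mono[OF TR_finite TR_nonneg]) auto
  also have "\<dots> \<le> 1 + \<epsilon> * log 2 (card Ms2)"
    by (rule fano[OF TR_finite messages_finite messages_nonempty[OF R(2)], where dec="\<lambda>(y, s1, s2). dec2 y s1 s2"])
       (use TR_support(2) err in auto)
  finally have f: "hT rM2 (\<lambda>w. (rY w, ?V w)) \<le> 1 + \<epsilon> * log 2 (card Ms2)" .
  have k: "hT rY (\<lambda>w. (rM2 w, ?V w)) = (\<Sum>i\<in>{1..n}. kapT i)"
    unfolding hT_channel[symmetric] by (rule hc_kernel_cong) auto
  show ?thesis
    using hc_swap[of "set_pmf TR" "pmf TR" rM2 ?V rY] f k uniform2 by (simp add: algebra_simps)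
qed

text \<open>The same Fano estimate used twice, with the crib added to the observation and without
  it.\<close>

lemma messages12_bound:
  assumes err: "measure_pmf.prob TR {w. (dec1 (rY w) (rS1 w) (rS2 w), dec2 (rY w) (rS1 w) (rS2 w)) \<noteq> (rM1 w, rM2 w)} \<le> \<epsilon>"
  defines "L \<equiv> log 2 (card Ms1) + log 2 (card Ms2)"
  shows "(1 - \<epsilon>) * L - 1 \<le> hT (rZp (Suc n)) (\<lambda>w. (rS1 w, rS2 w))
      + hT rY (\<lambda>w. (rZp (Suc n) w, rS1 w, rS2 w)) - (\<Sum>i\<in>{1..n}. kapT i)"
    "(1 - \<epsilon>) * L - 1 \<le> hT rY (\<lambda>w. (rS1 w, rS2 w)) - (\<Sum>i\<in>{1..n}. kapT i)"
proof -
  let ?V = "\<lambda>w. (rS1 w, rS2 w)" and ?Zn = "rZp (Suc n)" and ?M = "\<lambda>w. (rM1 w, rM2 w)"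
  let ?T = "\<lambda>w. (?Zn w, rY w)"
  have L: "L = log 2 (card (Ms1 \<times> Ms2))"
    unfolding L_def card_cartesian_product using messages_nonempty[OF R(1)] messages_nonempty[OF R(2)] messages_finite
    by (simp add: log_mult card_gt_0_iff)
  have f: "hT ?M (\<lambda>w. (rY w, ?V w)) \<le> 1 + \<epsilon> * L"
    unfolding L
    by (rule fano[OF TR_finite, where dec="\<lambda>(y, s1, s2). (dec1 y s1 s2, dec2 y s1 s2)"])
       (use TR_support(1,2) err messages_nonempty[OF R(1)] messages_nonempty[OF R(2)] messages_finite in auto)
  have f': "hT ?M (\<lambda>w. (?T w, ?V w)) \<le> hT ?M (\<lambda>w. (rY w, ?V w))"
    by (rule hc_mono[OF TR_finite TR_nonneg]) auto
  have k: "hT rY (\<lambda>w. (?Zn w, ?M w, ?V w)) = (\<Sum>i\<in>{1..n}. kapT i)"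
    "hT rY (\<lambda>w. (?M w, ?V w)) = (\<Sum>i\<in>{1..n}. kapT i)"
    unfolding hT_channel[symmetric]
    by (rule hc_kernel_cong; auto simp: rZp_def rZ_def rX1_def)+
  have z0: "0 \<le> hT ?Zn (\<lambda>w. (?M w, ?V w))" by (rule hc_nonneg[OF TR_finite TR_nonneg])
  show "(1 - \<epsilon>) * L - 1 \<le> hT (rZp (Suc n)) (\<lambda>w. (rS1 w, rS2 w))
      + hT rY (\<lambda>w. (rZp (Suc n) w, rS1 w, rS2 w)) - (\<Sum>i\<in>{1..n}. kapT i)"
    using hc_swap[of "set_pmf TR" "pmf TR" ?M ?V ?T] f f' k(1) z0 uniform12
    unfolding hc_chain[of "set_pmf TR" "pmf TR" ?Zn rY] L_def by (simp add: algebra_simps)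
  show "(1 - \<epsilon>) * L - 1 \<le> hT rY (\<lambda>w. (rS1 w, rS2 w)) - (\<Sum>i\<in>{1..n}. kapT i)"
    using hc_swap[of "set_pmf TR" "pmf TR" ?M ?V rY] f k(2) uniform12 unfolding L_def by (simp add: algebra_simps)
qed

definition VT :: "nat \<Rightarrow> ((nat \<Rightarrow> 'z) \<times> (nat \<Rightarrow> 's2)) set" where
  "VT i = snd ` (\<Union>s. set_pmf (QT i s))"

lemma VT_finite: "finite (VT i)"
  unfolding VT_def QT_def Let_def
  by (auto intro!: finite_imageI finite_UN_I finite_Pi_support simp: set_pmf_of_set[OF messages_nonempty[OF R(1)] messages_finite] messages_finite)

lemma rV_in_VT:
  assumes "i \<in> {1..n}" "w \<in> set_pmf TR"
  shows "fst (rL i w) \<in> VT i"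
proof -
  have "rL i w \<in> set_pmf (map_pmf (rL i) TR)" using assms by simp
  then show ?thesis unfolding map_rL[OF assms(1)] VT_def by force
qed

definition \<mu>T :: "nat \<times> (nat \<Rightarrow> 'z) \<times> (nat \<Rightarrow> 's2) \<Rightarrow> ('s1, 's2, 'x1, 'x2, 'y) letter \<Rightarrow> real" where
  "\<mu>T a w = pmf (map_pmf (rL (fst a)) TR) (snd a, w)"

lemma hT_single:
  fixes V :: "_ \<Rightarrow> 'v" and X :: "_ \<Rightarrow> 'b"
  assumes "i \<in> {1..n}" "\<And>w. X (snd (rL i w)) = X' w" "\<And>w. V' w = (rV i w, V (snd (rL i w)))"
  shows "(\<Sum>v\<in>VT i. hc UNIV (\<mu>T (i, v)) X V) = hT X' V'"
  unfolding \<mu>T_def fst_conv snd_conv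
  by (rule hc_labelled[OF TR_finite VT_finite, symmetric])
     (use assms rV_in_VT in \<open>auto simp: rL_def\<close>)

lemma kapT_single:
  assumes i: "i \<in> {1..n}"
  shows "(\<Sum>v\<in>VT i. kap (\<mu>T (i, v))) = kapT i"
proof -
  have "(\<Sum>v\<in>VT i. kap (\<mu>T (i, v))) = - (\<Sum>u\<in>VT i \<times> UNIV. pmf (map_pmf (rL i) TR) u * log 2 (chan (snd u)))"
    unfolding kap_def \<mu>T_def by (simp add: sum_negf sum.cartesian_product case_prod_unfold)
  also have "(\<Sum>u\<in>VT i \<times> UNIV. pmf (map_pmf (rL i) TR) u * log 2 (chan (snd u))) = (\<Sum>w\<in>set_pmf TR. pmf TR w * log 2 (chan (snd (rL i w))))"
  proof (rule sum_expectation_map[OF TR_finite])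
    show "rL i ` set_pmf TR \<subseteq> VT i \<times> UNIV"
    proof
      fix u assume "u \<in> rL i ` set_pmf TR"
      then have "fst u \<in> VT i" using rV_in_VT[OF i] by auto
      then show "u \<in> VT i \<times> UNIV" by (cases u) auto
    qed
  qed (simp add: VT_finite)
  finally show ?thesis unfolding kapT_def .
qed

text \<open>The time becomes a part of U: labels are pairs of a time and a value, and the factor
  \<open>1 / real n\<close> in \<open>qT\<close> makes the time uniform.\<close>

definition AT where "AT = Sigma {1..n} VT"
definition qT where "qT a s x = 1 / real n * pmf (QT (fst a) s) (x, snd a)" for a s x
definition tT where "tT a s x = pmf (TT (fst a) (snd a) s) x" for a s x

lemma fam_T:
  assumes n: "0 < n"
  shows "fam AT qT tT"
proof -
  have "(\<Sum>a\<in>AT. \<Sum>x\<in>UNIV. qT a s x) = 1" for s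
  proof -
    have "(\<Sum>v\<in>VT i. \<Sum>x\<in>UNIV. pmf (QT i s) (x, v)) = 1" for i
    proof -
      have "(\<Sum>v\<in>VT i. \<Sum>x\<in>UNIV. pmf (QT i s) (x, v)) = (\<Sum>x\<in>UNIV. \<Sum>v\<in>VT i. pmf (QT i s) (x, v))" by (rule sum.swap)
      also have "\<dots> = (\<Sum>u\<in>UNIV \<times> VT i. pmf (QT i s) u)" by (simp add: sum.cartesian_product)
      also have "\<dots> = 1"
      proof (rule sum_pmf_eq_1)
        show "set_pmf (QT i s) \<subseteq> UNIV \<times> VT i"
        proof
          fix u assume "u \<in> set_pmf (QT i s)"
          then have "snd u \<in> VT i" unfolding VT_def by blast
          then show "u \<in> UNIV \<times> VT i" by (cases u) auto
        qed
      qed (simp add: VT_finite)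
      finally show ?thesis .
    qed
    then have "(\<Sum>i\<in>{1..n}. \<Sum>v\<in>VT i. \<Sum>x\<in>UNIV. 1 / real n * pmf (QT i s) (x, v)) = 1"
      unfolding sum_distrib_left[symmetric] using n by simp
    moreover have "(\<Sum>a\<in>AT. \<Sum>x\<in>UNIV. qT a s x) = (\<Sum>i\<in>{1..n}. \<Sum>v\<in>VT i. \<Sum>x\<in>UNIV. 1 / real n * pmf (QT i s) (x, v))"
      unfolding AT_def qT_def by (subst sum.Sigma) (auto simp: VT_finite case_prod_unfold)
    ultimately show ?thesis by simp
  qed
  moreover have "(\<Sum>x\<in>UNIV. tT a s x) = 1" for a s unfolding tT_def by (simp add: sum_pmf_eq_1)
  moreover have "finite AT" unfolding AT_def by (auto simp: VT_finite)
  ultimately show ?thesis unfolding fam_def by (auto simp: qT_def tT_def)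
qed

lemma atom_T:
  assumes "a \<in> AT"
  shows "atom (qT a) (tT a) = (\<lambda>w. 1 / real n * \<mu>T a w)"
proof
  fix w
  have "fst a \<in> {1..n}" using assms by (auto simp: AT_def)
  then show "atom (qT a) (tT a) w = 1 / real n * \<mu>T a w"
    unfolding \<mu>T_def by (subst pmf_rL) (simp_all add: atom_def qT_def tT_def)
qed

lemma sum_AT:
  assumes "\<And>i. i \<in> {1..n} \<Longrightarrow> (\<Sum>v\<in>VT i. \<phi> (\<mu>T (i, v))) = \<psi> i"
    and "\<And>a. \<phi> (\<lambda>w. 1 / real n * \<mu>T a w) = 1 / real n * \<phi> (\<mu>T a)"
  shows "(\<Sum>a\<in>AT. \<phi> (atom (qT a) (tT a))) = (\<Sum>i\<in>{1..n}. \<psi> i) / real n"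
proof -
  have "(\<Sum>a\<in>AT. \<phi> (atom (qT a) (tT a))) = (\<Sum>a\<in>AT. 1 / real n * \<phi> (\<mu>T a))"
    by (rule sum.cong[OF refl]) (simp only: atom_T assms(2))
  also have "\<dots> = 1 / real n * (\<Sum>i\<in>{1..n}. \<Sum>v\<in>VT i. \<phi> (\<mu>T (i, v)))"
    unfolding AT_def sum_distrib_left[symmetric] by (subst sum.Sigma) (auto simp: VT_finite case_prod_unfold)
  also have "(\<Sum>i\<in>{1..n}. \<Sum>v\<in>VT i. \<phi> (\<mu>T (i, v))) = (\<Sum>i\<in>{1..n}. \<psi> i)"
    by (rule sum.cong[OF refl]) (rule assms(1))
  finally show ?thesis by simp
qed

text \<open>Where U is in the condition, so is the time, and averages over time are exact. The last
  quantity conditions on the states only; averaging over time then raises the output entropy, by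
  concavity, while \<open>kap\<close> is linear.\<close>

lemma single_letter:
  "(\<Sum>a\<in>AT. i1 (atom (qT a) (tT a))) = (\<Sum>i\<in>{1..n}. hY1 i - kapT i) / n"
  "(\<Sum>a\<in>AT. i2 (atom (qT a) (tT a))) = (\<Sum>i\<in>{1..n}. hY2 i - kapT i) / n"
  "(\<Sum>a\<in>AT. i3 (atom (qT a) (tT a))) = (\<Sum>i\<in>{1..n}. hY3 i - kapT i) / n"
  "(\<Sum>a\<in>AT. crib (atom (qT a) (tT a))) = (\<Sum>i\<in>{1..n}. hC i) / n"
  "(\<Sum>i\<in>{1..n}. hY5 i - kapT i) / n \<le> i5 (\<lambda>w. \<Sum>a\<in>AT. atom (qT a) (tT a) w)"
proof -
  have s: "\<phi> (\<lambda>w. 1 / real n * \<mu>T a w) = 1 / real n * \<phi> (\<mu>T a)" if "\<phi> \<in> {i1, i2, i3, crib}" for \<phi> a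
    using that scale[of "\<mu>T a" "1 / real n"] by (auto simp: \<mu>T_def)
  show "(\<Sum>a\<in>AT. i1 (atom (qT a) (tT a))) = (\<Sum>i\<in>{1..n}. hY1 i - kapT i) / n"
  proof (rule sum_AT)
    fix i assume i: "i \<in> {1..n}"
    show "(\<Sum>v\<in>VT i. i1 (\<mu>T (i, v))) = hY1 i - kapT i"
      unfolding i1_def sum_subtractf kapT_single[OF i]
      by (subst hT_single[OF i]) (auto simp: rL_def tZ_def rZ_def)
  qed (rule s, simp)
  show "(\<Sum>a\<in>AT. i2 (atom (qT a) (tT a))) = (\<Sum>i\<in>{1..n}. hY2 i - kapT i) / n"
  proof (rule sum_AT)
    fix i assume i: "i \<in> {1..n}"
    show "(\<Sum>v\<in>VT i. i2 (\<mu>T (i, v))) = hY2 i - kapT i"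
      unfolding i2_def sum_subtractf kapT_single[OF i]
      by (subst hT_single[OF i]) (auto simp: rL_def)
  qed (rule s, simp)
  show "(\<Sum>a\<in>AT. i3 (atom (qT a) (tT a))) = (\<Sum>i\<in>{1..n}. hY3 i - kapT i) / n"
  proof (rule sum_AT)
    fix i assume i: "i \<in> {1..n}"
    show "(\<Sum>v\<in>VT i. i3 (\<mu>T (i, v))) = hY3 i - kapT i"
      unfolding i3_def sum_subtractf kapT_single[OF i]
      by (subst hT_single[OF i]) (auto simp: rL_def tZ_def rZ_def)
  qed (rule s, simp)
  show "(\<Sum>a\<in>AT. crib (atom (qT a) (tT a))) = (\<Sum>i\<in>{1..n}. hC i) / n"
  proof (rule sum_AT)
    fix i assume i: "i \<in> {1..n}"
    have "(\<Sum>v\<in>VT i. hc UNIV (\<mu>T (i, v)) tZ tS1) = hT (rZ i) (\<lambda>w. (rV i w, rS1 w i))"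
      by (rule hT_single[OF i]) (auto simp: rL_def tZ_def rZ_def)
    moreover have "(\<Sum>v\<in>VT i. hc UNIV (\<mu>T (i, v)) tS1 tS2) = hT (\<lambda>w. rS1 w i) (\<lambda>w. (rV i w, rS2 w i))"
      by (rule hT_single[OF i]) (auto simp: rL_def)
    ultimately show "(\<Sum>v\<in>VT i. crib (\<mu>T (i, v))) = hC i"
      unfolding crib_def sum.distrib by simp
  qed (rule s, simp)
  define \<nu> where "\<nu> i w = pmf (map_pmf (\<lambda>w. snd (rL i w)) TR) w" for i w
  have tot: "(\<Sum>a\<in>AT. atom (qT a) (tT a) w) = (\<Sum>i\<in>{1..n}. 1 / n * \<nu> i w)" for w
  proof -
    have "(\<Sum>v\<in>VT i. \<mu>T (i, v) w) = \<nu> i w" if i: "i \<in> {1..n}" for i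
    proof -
      have "(\<Sum>v\<in>VT i. \<mu>T (i, v) w) = (\<Sum>u\<in>VT i \<times> UNIV. pmf (map_pmf (rL i) TR) u * (if snd u = w then 1 else 0))"
      proof -
        have "(\<Sum>v\<in>VT i. \<mu>T (i, v) w) = (\<Sum>v\<in>VT i. \<Sum>w'\<in>UNIV. pmf (map_pmf (rL i) TR) (v, w') * (if w' = w then 1 else 0))"
          unfolding \<mu>T_def by (simp add: if_distrib cong: if_cong)
        then show ?thesis by (simp only: sum.cartesian_product case_prod_unfold prod.collapse)
      qed
      also have "\<dots> = (\<Sum>w'\<in>set_pmf TR. pmf TR w' * (if snd (rL i w') = w then 1 else 0))"
      proof (rule sum_expectation_map[OF TR_finite])
        show "rL i ` set_pmf TR \<subseteq> VT i \<times> UNIV"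
        proof
          fix u assume "u \<in> rL i ` set_pmf TR"
          then have "fst u \<in> VT i" using rV_in_VT[OF i] by auto
          then show "u \<in> VT i \<times> UNIV" by (cases u) auto
        qed
      qed (simp add: VT_finite)
      also have "\<dots> = mass (set_pmf TR) (pmf TR) (\<lambda>w. snd (rL i w)) w"
        unfolding mass_def using TR_finite by (simp add: sum.inter_filter if_distrib cong: if_cong)
      finally show ?thesis unfolding \<nu>_def mass_pmf[OF TR_finite] .
    qed
    then show ?thesis by (rule sum_AT[of "\<lambda>m. m w", THEN trans]) (simp_all add: sum_divide_distrib)
  qed
  have k: "kap (\<lambda>w. \<Sum>a\<in>AT. atom (qT a) (tT a) w) = (\<Sum>i\<in>{1..n}. kapT i) / n"
  proof -
    have "kap (\<lambda>w. \<Sum>a\<in>AT. atom (qT a) (tT a) w) = (\<Sum>a\<in>AT. kap (atom (qT a) (tT a)))"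
      unfolding kap_def sum_distrib_right sum_negf by (subst sum.swap) simp
    also have "\<dots> = (\<Sum>i\<in>{1..n}. kapT i) / n" by (rule sum_AT) (simp_all only: kapT_single kap_scale)
    finally show ?thesis .
  qed
  have "(\<Sum>i\<in>{1..n}. hY5 i) / n = (\<Sum>i\<in>{1..n}. hc UNIV (\<lambda>w. 1 / n * \<nu> i w) tY (\<lambda>w. (tS1 w, tS2 w)))"
    unfolding sum_divide_distrib
  proof (rule sum.cong[OF refl])
    fix i
    have "hY5 i = hT (\<lambda>w. tY (snd (rL i w))) (\<lambda>w. (tS1 (snd (rL i w)), tS2 (snd (rL i w))))"
      by (simp add: rL_def)
    also have "\<dots> = hc (set_pmf (map_pmf (\<lambda>w. snd (rL i w)) TR)) (\<nu> i) tY (\<lambda>w. (tS1 w, tS2 w))"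
      unfolding \<nu>_def by (rule hc_map_pmf[OF TR_finite, symmetric])
    also have "\<dots> = hc UNIV (\<nu> i) tY (\<lambda>w. (tS1 w, tS2 w))"
      by (rule hc_superset[symmetric]) (auto simp: \<nu>_def pmf_eq_0_set_pmf)
    finally show "hY5 i / n = hc UNIV (\<lambda>w. 1 / n * \<nu> i w) tY (\<lambda>w. (tS1 w, tS2 w))"
      by (subst hc_scale) (simp_all add: \<nu>_def)
  qed
  also have "\<dots> \<le> hc UNIV (\<lambda>w. \<Sum>i\<in>{1..n}. 1 / n * \<nu> i w) tY (\<lambda>w. (tS1 w, tS2 w))"
    by (rule hc_sum_ge) (simp_all add: \<nu>_def)
  finally show "(\<Sum>i\<in>{1..n}. hY5 i - kapT i) / n \<le> i5 (\<lambda>w. \<Sum>a\<in>AT. atom (qT a) (tT a) w)"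
    unfolding i5_def k unfolding tot by (simp add: sum_subtractf diff_divide_distrib)
qed

lemma converse_bounds:
  fixes r1 r2 :: real
  assumes n: "0 < n" and err: "measure_pmf.prob TR (wrong dec1 dec2) \<le> \<epsilon>"
    and r1: "n * r1 \<le> (1 - \<epsilon>) * log 2 (card Ms1) - 1" and r2: "n * r2 \<le> (1 - \<epsilon>) * log 2 (card Ms2) - 1"
    and r12: "n * (r1 + r2) \<le> (1 - \<epsilon>) * (log 2 (card Ms1) + log 2 (card Ms2)) - 1"
  shows "feas AT (\<lambda>a. atom (qT a) (tT a)) r1 r2"
proof -
  have e12: "measure_pmf.prob TR {w. (dec1 (rY w) (rS1 w) (rS2 w), dec2 (rY w) (rS1 w) (rS2 w)) \<noteq> (rM1 w, rM2 w)} \<le> \<epsilon>"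
    using err by (simp add: rY_def rS1_def rS2_def rM1_def rM2_def case_prod_unfold)
  have e1: "measure_pmf.prob TR {w. dec1 (rY w) (rS1 w) (rS2 w) \<noteq> rM1 w} \<le> \<epsilon>"
    by (rule order_trans[OF measure_pmf.finite_measure_mono e12]) auto
  have e2: "measure_pmf.prob TR {w. dec2 (rY w) (rS1 w) (rS2 w) \<noteq> rM2 w} \<le> \<epsilon>"
    by (rule order_trans[OF measure_pmf.finite_measure_mono e12]) auto
  let ?Zn = "rZp (Suc n)"
  have zp: "rZp i w = rZp i w'" "rZ i w = rZ i w'" if "i \<in> {1..n}" "?Zn w = ?Zn w'" for i w w'
  proof -
    have "rZ j w = rZ j w'" if "j \<in> {1..n}" for j
      using fun_cong[OF \<open>?Zn w = ?Zn w'\<close>, of j] that unfolding rZp_def by (auto simp: restrict_def)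
    then show "rZp i w = rZp i w'" "rZ i w = rZ i w'"
      using that(1) unfolding rZp_def by (auto simp: restrict_def fun_eq_iff)
  qed
  have b1: "hT rY (\<lambda>w. (?Zn w, rM2 w, rS1 w, rS2 w)) \<le> (\<Sum>i\<in>{1..n}. hY1 i)"
  proof (rule hT_output)
    fix i w w' assume i: "i \<in> {1..n}" and "(?Zn w, rM2 w, rS1 w, rS2 w) = (?Zn w', rM2 w', rS1 w', rS2 w')"
    then have e: "?Zn w = ?Zn w'" "rM2 w = rM2 w'" "rS1 w = rS1 w'" "rS2 w = rS2 w'" by auto
    show "(rV i w, rX2 i w, rZ i w, rS1 w i, rS2 w i) = (rV i w', rX2 i w', rZ i w', rS1 w' i, rS2 w' i)"
      using zp[OF i e(1)] e(2-4) unfolding rV_def rX2_def by simp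
  qed
  have b2: "hT rY (\<lambda>w. (rM1 w, rS1 w, rS2 w)) \<le> (\<Sum>i\<in>{1..n}. hY2 i)"
    by (rule hT_output) (auto simp: rV_def rX1_def rZp_def rZ_def)
  have b3: "hT rY (\<lambda>w. (?Zn w, rS1 w, rS2 w)) \<le> (\<Sum>i\<in>{1..n}. hY3 i)"
  proof (rule hT_output)
    fix i w w' assume i: "i \<in> {1..n}" and "(?Zn w, rS1 w, rS2 w) = (?Zn w', rS1 w', rS2 w')"
    then have e: "?Zn w = ?Zn w'" "rS1 w = rS1 w'" "rS2 w = rS2 w'" by auto
    show "(rV i w, rZ i w, rS1 w i, rS2 w i) = (rV i w', rZ i w', rS1 w' i, rS2 w' i)"
      using zp[OF i e(1)] e(2-3) unfolding rV_def by simp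
  qed
  have b5: "hT rY (\<lambda>w. (rS1 w, rS2 w)) \<le> (\<Sum>i\<in>{1..n}. hY5 i)"
    by (rule hT_output) auto
  have z0: "0 \<le> hT ?Zn (\<lambda>w. (rS1 w, rS2 w))" by (rule hc_nonneg[OF TR_finite TR_nonneg])
  define C where "C = (\<Sum>i\<in>{1..n}. hC i)"
  have c: "hT ?Zn (\<lambda>w. (rS1 w, rS2 w)) \<le> C - n * H0" using hT_crib unfolding C_def .
  define K where "K = (\<Sum>i\<in>{1..n}. kapT i)"
  have conv: "x \<le> a / n + (C / n - H0)" if "n * x \<le> a + (C - n * H0)" for a x :: real
    using that n by (simp add: field_simps)
  have conv2: "x \<le> a / n" if "n * x \<le> a" for a x :: real
    using that n by (simp add: field_simps)
  note m1 = message1_bound[OF e1] note m2 = message2_bound[OF e2] note m12 = messages12_bound[OF e12]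
  have "r1 \<le> (\<Sum>i\<in>{1..n}. hY1 i - kapT i) / n + (C / n - H0)"
    using m1 b1 c r1 by (intro conv) (simp add: sum_subtractf)
  moreover have "r2 \<le> (\<Sum>i\<in>{1..n}. hY2 i - kapT i) / n"
    using m2 b2 r2 by (intro conv2) (simp add: sum_subtractf)
  moreover have "r1 + r2 \<le> (\<Sum>i\<in>{1..n}. hY3 i - kapT i) / n + (C / n - H0)"
    using m12(1) b3 c r12 by (intro conv) (simp add: sum_subtractf)
  moreover have "r1 + r2 \<le> i5 (\<lambda>w. \<Sum>a\<in>AT. atom (qT a) (tT a) w)"
  proof -
    have "r1 + r2 \<le> (\<Sum>i\<in>{1..n}. hY5 i - kapT i) / n"
      using m12(2) b5 r12 by (intro conv2) (simp add: sum_subtractf)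
    then show ?thesis using single_letter(5) by linarith
  qed
  \<comment> \<open>The constraint I(U;S1|S2) <= H(Z|S1,U) is the nonnegativity of the entropy of
    the crib given both state sequences.\<close>
  moreover have "0 \<le> C / n - H0" using c z0 n by (simp add: field_simps)
  ultimately show ?thesis unfolding feas_def single_letter(1-4) C_def by blast
qed

end

lemma converse:
  assumes ach: "achievable pS W z R1 R2" and \<eta>: "0 < \<eta>"
  shows "\<exists>(A :: (nat \<times> (nat \<Rightarrow> 'z) \<times> (nat \<Rightarrow> 's2)) set) q t. fam A q t \<and> feas A (\<lambda>a. atom (q a) (t a)) (R1 - \<eta>) (R2 - \<eta>)"
proof -
  have R: "0 \<le> R1" "0 \<le> R2" using ach by (auto simp: achievable_def)
  \<comment> \<open>Fano's error term \<open>\<epsilon> * n * r\<close> then costs at most half of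
    \<open>n * \<eta>\<close> for every rate \<open>r\<close> up to \<open>R1 + R2\<close>.\<close>
  define \<epsilon> where "\<epsilon> = min 1 (\<eta> / (2 * (R1 + R2 + 1)))"
  have \<epsilon>: "0 < \<epsilon>" "\<epsilon> \<le> 1" using \<eta> R by (auto simp: \<epsilon>_def)
  have half: "\<eta> / (2 * D) * D = \<eta> / 2" if "0 < D" for D :: real using that by (simp add: field_simps)
  have "\<epsilon> * (R1 + R2 + 1) \<le> \<eta> / (2 * (R1 + R2 + 1)) * (R1 + R2 + 1)"
    using R by (intro mult_right_mono) (auto simp: \<epsilon>_def)
  also have "\<dots> = \<eta> / 2" by (rule half) (use R in simp)
  finally have \<epsilon>R: "\<epsilon> * (R1 + R2 + 1) \<le> \<eta> / 2" .
  \<comment> \<open>The other half of \<open>n * \<eta>\<close> must exceed 3 bits: one from Fano's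
    inequality and up to two from rounding two message sets.\<close>
  obtain N :: nat where N: "6 / \<eta> < N" using reals_Archimedean2 by blast
  obtain n enc1 enc2 dec1 dec2 where n: "n \<ge> Suc N" and
    err: "measure_pmf.prob (transmission pS W z R1 R2 n enc1 enc2) (wrong dec1 dec2) \<le> \<epsilon>"
    using ach \<epsilon>(1) unfolding achievable_def by blast
  have n0: "0 < n" using n by simp
  have "6 / \<eta> < n" using N n by linarith
  then have n6: "6 < n * \<eta>" using \<eta> by (simp add: field_simps)
  have key: "n * (r - \<eta>) \<le> (1 - \<epsilon>) * L - 1" if r: "0 \<le> r" "r \<le> R1 + R2" and L: "n * r - 2 \<le> L" for r L :: real
  proof -
    have "\<epsilon> * r \<le> \<epsilon> * (R1 + R2 + 1)" using r \<epsilon> by (intro mult_left_mono) auto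
    then have "n * (\<epsilon> * r) \<le> n * (\<eta> / 2)" using \<epsilon>R by (intro mult_left_mono) auto
    moreover have "(1 - \<epsilon>) * (n * r - 2) \<le> (1 - \<epsilon>) * L" using L \<epsilon> by (intro mult_left_mono) auto
    moreover have "(1 - \<epsilon>) * (n * r - 2) = n * r - 2 - n * (\<epsilon> * r) + 2 * \<epsilon>" by (simp add: algebra_simps)
    ultimately show ?thesis using n6 \<epsilon>(1) by (simp add: algebra_simps)
  qed
  have "feas (AT n R1 enc1) (\<lambda>a. atom (qT n R1 enc1 a) (tT n R2 enc2 a)) (R1 - \<eta>) (R2 - \<eta>)"
  proof (rule converse_bounds[OF R n0 err])
    show "n * (R1 - \<eta>) \<le> (1 - \<epsilon>) * log 2 (card (messages n R1)) - 1"
      using R log_card_messages[OF R(1), of n] by (intro key) auto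
    show "n * (R2 - \<eta>) \<le> (1 - \<epsilon>) * log 2 (card (messages n R2)) - 1"
      using R log_card_messages[OF R(2), of n] by (intro key) auto
    have "n * (R1 + R2 - \<eta>) \<le> (1 - \<epsilon>) * (log 2 (card (messages n R1)) + log 2 (card (messages n R2))) - 1"
      using R log_card_messages[OF R(1), of n] log_card_messages[OF R(2), of n] by (intro key) (auto simp: algebra_simps)
    moreover have "n * (R1 - \<eta> + (R2 - \<eta>)) \<le> n * (R1 + R2 - \<eta>)" using \<eta> by (intro mult_left_mono) auto
    ultimately show "n * (R1 - \<eta> + (R2 - \<eta>)) \<le> (1 - \<epsilon>) * (log 2 (card (messages n R1)) + log 2 (card (messages n R2))) - 1"
      by linarith
  qed
  then show ?thesis using fam_T[OF R n0] by blast
qed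

end

subsection \<open>Block Markov coding\<close>

lemma nn_integral_pmf_swap:
  fixes f :: "'a \<Rightarrow> 'b \<Rightarrow> ennreal"
  shows "mean p (\<lambda>x. mean q (\<lambda>y. f x y)) = mean q (\<lambda>y. mean p (\<lambda>x. f x y))"
proof -
  have "mean p (\<lambda>x. mean q (\<lambda>y. f x y)) = mean (pair_pmf p q) (\<lambda>u. f (fst u) (snd u))"
    by (simp add: nn_integral_pair_pmf')
  also have "\<dots> = mean (pair_pmf q p) (\<lambda>u. f (snd u) (fst u))"
    by (subst pair_commute_pmf) (simp add: case_prod_unfold)
  finally show ?thesis by (simp add: nn_integral_pair_pmf')
qed

lemma nn_integral_pmf_mono:
  assumes "\<And>x. x \<in> set_pmf p \<Longrightarrow> f x \<le> g x"
  shows "mean p (\<lambda>x. f x) \<le> mean p (\<lambda>x. g x)"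
  by (rule nn_integral_mono_AE) (simp add: AE_measure_pmf_iff assms)

lemma exists_le_nn_integral_pmf:
  fixes f :: "'a \<Rightarrow> ennreal"
  assumes "mean p (\<lambda>x. f x) \<le> c" "c < \<top>"
  shows "\<exists>x\<in>set_pmf p. f x \<le> c"
proof (rule ccontr)
  assume "\<not> (\<exists>x\<in>set_pmf p. f x \<le> c)"
  then have lt: "\<And>x. x \<in> set_pmf p \<Longrightarrow> c < f x" by (auto simp: not_le)
  have c: "mean p (\<lambda>x. c) = c" by simp
  have "mean p (\<lambda>x. c) < (mean p (\<lambda>x. f x))"
  proof (rule nn_integral_less)
    show "\<not> (AE x in measure_pmf p. f x \<le> c)"
      using lt set_pmf_not_empty[of p] by (auto simp: AE_measure_pmf_iff not_le)
    show "AE x in measure_pmf p. c \<le> f x" using lt by (auto simp: AE_measure_pmf_iff less_imp_le)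
    show "mean p (\<lambda>x. c) \<noteq> \<infinity>" using assms(2) by (simp add: c)
  qed auto
  then show False using assms(1) c by simp
qed

lemma Pi_pmf_reindex:
  assumes "finite A" "finite B" "inj_on h A" "h ` A \<subseteq> B"
  shows "map_pmf (\<lambda>f i. if i \<in> A then f (h i) else d) (Pi_pmf B d' p) = Pi_pmf A d (\<lambda>i. p (h i))"
  using assms
proof (induction A arbitrary: B rule: finite_induct)
  case empty
  show ?case by (simp add: map_pmf_const)
next
  case (insert x A)
  define B' where "B' = B - {h x}"
  have B: "B = insert (h x) B'" "h x \<notin> B'" "finite B'" using insert.prems by (auto simp: B'_def)
  have hA: "h ` A \<subseteq> B'" "inj_on h A" using insert.prems insert.hyps by (auto simp: B'_def inj_on_def)
  have e: "(\<lambda>i. if i \<in> insert x A then (g(h x := y)) (h i) else d) = (\<lambda>i. if i \<in> A then g (h i) else d)(x := y)" for g y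
    using insert.prems(2) insert.hyps(2) by (auto simp: fun_eq_iff inj_on_def)
  have "map_pmf (\<lambda>f i. if i \<in> insert x A then f (h i) else d) (Pi_pmf B d' p) =
     do { y \<leftarrow> p (h x); g \<leftarrow> Pi_pmf B' d' p; return_pmf ((\<lambda>i. if i \<in> A then g (h i) else d)(x := y)) }"
    unfolding B(1) by (subst Pi_pmf_insert'[OF B(3,2)]) (simp only: map_bind_pmf map_return_pmf e)
  also have "\<dots> = do { y \<leftarrow> p (h x); g \<leftarrow> map_pmf (\<lambda>f i. if i \<in> A then f (h i) else d) (Pi_pmf B' d' p); return_pmf (g(x := y)) }"
    by (simp add: bind_map_pmf)
  also have "\<dots> = Pi_pmf (insert x A) d (\<lambda>i. p (h i))"
    unfolding insert.IH[OF B(3) hA(2,1)] by (rule Pi_pmf_insert'[OF insert.hyps, symmetric])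
  finally show ?case .
qed

text \<open>Block \<open>b\<close>, counted from 0, occupies the times \<open>b * N + 1\<close> to
  \<open>b * N + N\<close> and is moved back to \<open>{1..N}\<close>.\<close>

definition blk :: "'a \<Rightarrow> nat \<Rightarrow> nat \<Rightarrow> (nat \<Rightarrow> 'a) \<Rightarrow> nat \<Rightarrow> 'a" where
  "blk d N b f = (\<lambda>i. if i \<in> {1..N} then f (b * N + i) else d)"

lemma blk_index: "b < B \<Longrightarrow> i \<in> {1..N} \<Longrightarrow> b * N + i \<in> {1..N * B}" for b N i B :: nat
proof -
  assume "b < B" and i: "i \<in> {1..N}"
  then have "(b + 1) * N \<le> B * N" by (intro mult_right_mono) auto
  then show "b * N + i \<in> {1..N * B}" using i by (simp add: algebra_simps)
qed

lemma map_blk: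
  assumes "b < B"
  shows "map_pmf (blk d N b) (Pi_pmf {1..N * B} d' p) = Pi_pmf {1..N} d (\<lambda>i. p (b * N + i))"
  unfolding blk_def by (intro Pi_pmf_reindex image_subsetI blk_index[OF assms]) (auto simp: inj_on_def)

definition tb :: "nat \<Rightarrow> nat \<Rightarrow> nat" where "tb N t = (t - 1) div N"
definition ti :: "nat \<Rightarrow> nat \<Rightarrow> nat" where "ti N t = (t - 1) mod N + 1"

lemma tb_ti: "i \<in> {1..N} \<Longrightarrow> tb N (b * N + i) = b \<and> ti N (b * N + i) = i"
proof -
  assume i: "i \<in> {1..N}"
  then have "b * N + i - 1 = (i - 1) + b * N" "i - 1 < N" "i - 1 + 1 = i" by auto
  then show ?thesis unfolding tb_def ti_def by (simp only: div_mult_self1 mod_mult_self1 div_less mod_less) simp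
qed

lemma unshift:
  fixes d r q :: nat
  assumes "d < q" "r \<le> q"
  shows "((d + r) mod q + (q - r)) mod q = d"
proof -
  have "((d + r) mod q + (q - r)) mod q = (d + r + (q - r)) mod q" by (rule mod_add_left_eq)
  also have "\<dots> = d" using assms by simp
  finally show ?thesis .
qed

text \<open>A cyclic shift permutes each factor, so a uniform dither stays uniform whatever is added
  to it.\<close>

lemma map_shift_uniform:
  fixes a k b c :: nat
  assumes "0 < J" "0 < K" "0 < A" "0 < C"
  shows "map_pmf (\<lambda>r. ((a + fst r) mod J, (k + fst (snd r)) mod K, (b + fst (snd (snd r))) mod A, (c + snd (snd (snd r))) mod C))
     (pmf_of_set ({..<J} \<times> {..<K} \<times> {..<A} \<times> {..<C})) = pmf_of_set ({..<J} \<times> {..<K} \<times> {..<A} \<times> {..<C})"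
proof (rule map_pmf_of_set_bij_betw)
  let ?S = "{..<J} \<times> {..<K} \<times> {..<A} \<times> {..<C}"
  let ?f = "\<lambda>r. ((a + fst r) mod J, (k + fst (snd r)) mod K, (b + fst (snd (snd r))) mod A, (c + snd (snd (snd r))) mod C)"
  have cancel: "x = y" if "(a + x) mod q = (a + y) mod q" "x < q" "y < q" for a x y q :: nat
  proof -
    have "x = ((x + a mod q) mod q + (q - a mod q)) mod q" by (rule unshift[symmetric]) (use that in auto)
    also have "(x + a mod q) mod q = (y + a mod q) mod q" using that(1) by (simp add: mod_add_right_eq add.commute)
    also have "((y + a mod q) mod q + (q - a mod q)) mod q = y" by (rule unshift) (use that in auto)
    finally show ?thesis .
  qed
  have inj: "inj_on ?f ?S" by (rule inj_onI) (auto dest: cancel)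
  have "?f ` ?S \<subseteq> ?S" using assms by auto
  then have "?f ` ?S = ?S" using inj by (intro endo_inj_surj) auto
  then show "bij_betw ?f ?S ?S" using inj by (simp add: bij_betw_def)
qed (use assms in auto)

context mac
begin

text \<open>Misreading the crib counts as certain error, since encoder 2 would start the next block
  with wrong indices. The decoder is handed \<open>k\<close>: in backward decoding this index
  follows from the block decoded before.\<close>

definition block_error ::
  "nat \<Rightarrow> (nat \<Rightarrow> (nat \<Rightarrow> 's1) \<Rightarrow> nat \<Rightarrow> nat \<Rightarrow> nat \<Rightarrow> 'x1) \<Rightarrow> (nat \<Rightarrow> (nat \<Rightarrow> 's1) \<Rightarrow> nat)
    \<Rightarrow> (nat \<Rightarrow> nat \<Rightarrow> (nat \<Rightarrow> 's2) \<Rightarrow> nat \<Rightarrow> nat \<Rightarrow> 'x2) \<Rightarrow> (nat \<Rightarrow> (nat \<Rightarrow> 'z) \<Rightarrow> nat)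
    \<Rightarrow> ((nat \<Rightarrow> 'y) \<Rightarrow> (nat \<Rightarrow> 's1) \<Rightarrow> (nat \<Rightarrow> 's2) \<Rightarrow> nat \<Rightarrow> nat \<times> nat \<times> nat \<times> nat)
    \<Rightarrow> nat \<times> nat \<times> nat \<times> nat \<Rightarrow> (nat \<Rightarrow> 's1 \<times> 's2) \<Rightarrow> ennreal" where
  "block_error N e1 bt e2 h dec r s = (case r of (j, k, a, c) \<Rightarrow>
     let s1 = fst \<circ> s; s2 = snd \<circ> s in
     if h j (restrict (\<lambda>i. z (e1 j s1 k a i) (s1 i)) {1..N}) \<noteq> k then 1
     else emeasure (seq_pmf N (\<lambda>i. W (e1 j s1 k a i) (e2 j (bt j s1) s2 c i) (s1 i) (s2 i)))
       {y. dec y s1 s2 k \<noteq> (j, bt j s1, a, c)})"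

text \<open>
  A block code: \<open>j\<close> is the part of message 1 that encoder 2 knows already, \<open>k\<close> the index to be
  read off the cribbing signal, \<open>bt j s1\<close> the bin index that encoder 2 needs before the block.
\<close>

definition block_code where
  "block_code N J L A C \<delta> \<longleftrightarrow> 0 < J \<and> 0 < L \<and> 0 < A \<and> 0 < C \<and> (\<exists>e1 bt e2 h dec. (\<forall>j s1. bt j s1 < L) \<and>
     (mean (pmf_of_set (indices J L A C)) (\<lambda>r. mean (seq_pmf N (\<lambda>_. pS)) (\<lambda>s. block_error N e1 bt e2 h dec r s))) \<le> \<delta>)"

context
  fixes N J L A C B :: nat and e1 bt e2 h dec and \<delta> :: ennreal
    and \<phi>1 :: "nat \<Rightarrow> nat \<Rightarrow> nat \<times> nat" and \<phi>2 :: "nat \<Rightarrow> nat \<Rightarrow> nat"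
    and d1 :: 's1 and d2 :: 's2
  assumes d12: "(d1, d2) = undefined" and pos: "0 < J" "0 < L" "0 < A" "0 < C" and bt: "\<And>j s1. bt j s1 < L"
    and \<delta>: "mean (pmf_of_set (indices J L A C)) (\<lambda>r. mean (seq_pmf N (\<lambda>_. pS)) (\<lambda>s. block_error N e1 bt e2 h dec r s)) \<le> \<delta>"
    and B: "0 < B"
    and \<phi>1: "\<And>m b. fst (\<phi>1 m b) < J \<and> snd (\<phi>1 m b) < A" "\<And>m. fst (\<phi>1 m 0) = 0" and \<phi>2: "\<And>m b. \<phi>2 m b < C"
begin

abbreviation "U4 \<equiv> pmf_of_set (indices J L A C)"
abbreviation "b1 b \<equiv> blk d1 N b"
abbreviation "b2 b \<equiv> blk d2 N b"

text \<open>\<open>\<rho> b\<close> is the dither of block \<open>b\<close>; the message digits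
  \<open>\<phi>1\<close>, \<open>\<phi>2\<close> and the code are shifted by it.
  \<open>bcode\<close> packs the first index and the bin index of the next block into one number
  below \<open>J * L\<close>; the last block has no successor and sends 0.\<close>

definition "bJ \<rho> m b = (fst (\<phi>1 m b) + fst (\<rho> b)) mod J"
definition "bA \<rho> m b = (snd (\<phi>1 m b) + fst (snd (snd (\<rho> b)))) mod A"
definition "bC \<rho> m b = (\<phi>2 m b + snd (snd (snd (\<rho> b)))) mod C"
definition "bcode \<rho> m s1 b = (if Suc b < B then bJ \<rho> m (Suc b) * L + bt (bJ \<rho> m (Suc b)) (b1 (Suc b) s1) else 0)"
definition "bK \<rho> m s1 b = (bcode \<rho> m s1 b + fst (snd (\<rho> b))) mod (J * L)"

definition enc1 where
  "enc1 \<rho> m s1 t = (let b = tb N t in e1 (bJ \<rho> m b) (b1 b s1) (bK \<rho> m s1 b) (bA \<rho> m b) (ti N t))"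

text \<open>What encoder 2 learns from the crib, going forwards. Its start for block 0 is right in
  the first component because the digit there is 0 by assumption. The bin index of block 0 is
  unknown to encoder 2 and set to 0, which is why no digits are decoded from that block.\<close>

primrec jl :: "(nat \<Rightarrow> nat \<times> nat \<times> nat \<times> nat) \<Rightarrow> (nat \<Rightarrow> 'z) \<Rightarrow> nat \<Rightarrow> nat \<times> nat" where
  "jl \<rho> zc 0 = (fst (\<rho> 0) mod J, 0)"
| "jl \<rho> zc (Suc b) = (let c = (h (fst (jl \<rho> zc b)) (restrict (\<lambda>i. zc (b * N + i)) {1..N})
        + (J * L - fst (snd (\<rho> b)))) mod (J * L) in (c div L, c mod L))"

definition enc2 where
  "enc2 \<rho> t m s2 zc = (let b = tb N t; v = jl \<rho> zc b in e2 (fst v) (snd v) (b2 b s2) (bC \<rho> m b) (ti N t))"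

text \<open>The decoder goes backwards: \<open>rd\<close> at \<open>d\<close> estimates the code
  sent in block \<open>B - Suc d\<close>. It starts from the 0 of the last block, and the pair
  decoded in a block is the code of its predecessor.\<close>

primrec rd :: "(nat \<Rightarrow> nat \<times> nat \<times> nat \<times> nat) \<Rightarrow> (nat \<Rightarrow> 'y) \<Rightarrow> (nat \<Rightarrow> 's1) \<Rightarrow> (nat \<Rightarrow> 's2) \<Rightarrow> nat \<Rightarrow> nat" where
  "rd \<rho> y s1 s2 0 = 0"
| "rd \<rho> y s1 s2 (Suc d) = (let b = B - Suc d;
       v = dec (blk undefined N b y) (b1 b s1) (b2 b s2) ((rd \<rho> y s1 s2 d + fst (snd (\<rho> b))) mod (J * L))
     in fst v * L + fst (snd v))"

definition bdec where
  "bdec \<rho> y s1 s2 b = dec (blk undefined N b y) (b1 b s1) (b2 b s2)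
     ((rd \<rho> y s1 s2 (B - Suc b) + fst (snd (\<rho> b))) mod (J * L))"

definition good_crib where
  "good_crib \<rho> m s1 \<longleftrightarrow> (\<forall>b<B. h (bJ \<rho> m b) (restrict (\<lambda>i. z (e1 (bJ \<rho> m b) (b1 b s1) (bK \<rho> m s1 b) (bA \<rho> m b) i) (b1 b s1 i)) {1..N}) = bK \<rho> m s1 b)"

lemma enc1_block:
  assumes "i \<in> {1..N}"
  shows "enc1 \<rho> m s1 (b * N + i) = e1 (bJ \<rho> m b) (b1 b s1) (bK \<rho> m s1 b) (bA \<rho> m b) i"
proof -
  have "tb N (b * N + i) = b" "ti N (b * N + i) = i" using tb_ti[OF assms, of b] by auto
  then show ?thesis unfolding enc1_def Let_def by (simp only:)
qed

text \<open>Strict causality is enough: a block before \<open>b'\<close> ends before the first time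
  of \<open>b'\<close>.\<close>

lemma crib_block:
  assumes "b < b'" and i': "1 \<le> i'"
  shows "restrict (\<lambda>i. restrict (\<lambda>j. z (enc1 \<rho> m s1 j) (s1 j)) {1..<b' * N + i'} (b * N + i)) {1..N} =
    restrict (\<lambda>i. z (e1 (bJ \<rho> m b) (b1 b s1) (bK \<rho> m s1 b) (bA \<rho> m b) i) (b1 b s1 i)) {1..N}"
proof
  fix i
  show "restrict (\<lambda>i. restrict (\<lambda>j. z (enc1 \<rho> m s1 j) (s1 j)) {1..<b' * N + i'} (b * N + i)) {1..N} i =
    restrict (\<lambda>i. z (e1 (bJ \<rho> m b) (b1 b s1) (bK \<rho> m s1 b) (bA \<rho> m b) i) (b1 b s1 i)) {1..N} i"
  proof (cases "i \<in> {1..N}")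
    case True
    have "(b + 1) * N \<le> b' * N" using assms by (intro mult_right_mono) auto
    then have "b * N + i \<in> {1..<b' * N + i'}" using True i' by (simp add: algebra_simps)
    then show ?thesis using True by (simp only: restrict_apply if_True enc1_block) (simp add: blk_def)
  qed (simp only: restrict_apply if_False)
qed

lemma jl_correct:
  assumes good: "good_crib \<rho> m s1" and \<rho>: "\<And>b. b < B \<Longrightarrow> fst (snd (\<rho> b)) \<le> J * L" and i': "1 \<le> i'"
    and zc: "zc = restrict (\<lambda>j. z (enc1 \<rho> m s1 j) (s1 j)) {1..<b' * N + i'}"
  shows "b < B \<Longrightarrow> b \<le> b' \<Longrightarrow> jl \<rho> zc b = (bJ \<rho> m b, if b = 0 then 0 else bt (bJ \<rho> m b) (b1 b s1))"
proof (induction b)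
  case 0
  show ?case using \<phi>1(2) by (simp add: bJ_def)
next
  case (Suc b)
  have IH: "fst (jl \<rho> zc b) = bJ \<rho> m b" using Suc by simp
  have "h (bJ \<rho> m b) (restrict (\<lambda>i. zc (b * N + i)) {1..N}) = bK \<rho> m s1 b"
    using good Suc.prems crib_block[of b b' i' \<rho> m s1, OF _ i'] unfolding good_crib_def zc by simp
  moreover have "(bK \<rho> m s1 b + (J * L - fst (snd (\<rho> b)))) mod (J * L) = bcode \<rho> m s1 b"
    unfolding bK_def
  proof (rule unshift)
    have "bJ \<rho> m (Suc b) < J" using pos by (simp add: bJ_def)
    then have "(bJ \<rho> m (Suc b) + 1) * L \<le> J * L" by (intro mult_right_mono) auto
    then show "bcode \<rho> m s1 b < J * L"
      using bt[of "bJ \<rho> m (Suc b)" "b1 (Suc b) s1"] pos unfolding bcode_def by (auto simp: algebra_simps)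
  qed (use \<rho> Suc.prems in simp)
  moreover have "bcode \<rho> m s1 b = bJ \<rho> m (Suc b) * L + bt (bJ \<rho> m (Suc b)) (b1 (Suc b) s1)"
    using Suc.prems by (simp add: bcode_def)
  ultimately have "(h (fst (jl \<rho> zc b)) (restrict (\<lambda>i. zc (b * N + i)) {1..N}) + (J * L - fst (snd (\<rho> b)))) mod (J * L)
      = bJ \<rho> m (Suc b) * L + bt (bJ \<rho> m (Suc b)) (b1 (Suc b) s1)"
    unfolding IH by (simp only:)
  then have "jl \<rho> zc (Suc b) = ((bJ \<rho> m (Suc b) * L + bt (bJ \<rho> m (Suc b)) (b1 (Suc b) s1)) div L,
     (bJ \<rho> m (Suc b) * L + bt (bJ \<rho> m (Suc b)) (b1 (Suc b) s1)) mod L)"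
    by (simp only: jl.simps Let_def)
  then show ?case using bt[of "bJ \<rho> m (Suc b)" "b1 (Suc b) s1"] by simp
qed

lemma input2_correct:
  assumes good: "good_crib \<rho> m s1" and \<rho>: "\<And>b. b < B \<Longrightarrow> fst (snd (\<rho> b)) \<le> J * L" and b: "0 < b" "b < B" and i: "i \<in> {1..N}"
  shows "input2 z (enc1 \<rho>) (enc2 \<rho>) m m2 s1 s2 (b * N + i) =
     e2 (bJ \<rho> m b) (bt (bJ \<rho> m b) (b1 b s1)) (b2 b s2) (bC \<rho> m2 b) i"
proof -
  have t: "tb N (b * N + i) = b" "ti N (b * N + i) = i" using tb_ti[OF i, of b] by auto
  have "jl \<rho> (restrict (\<lambda>j. z (enc1 \<rho> m s1 j) (s1 j)) {1..<b * N + i}) b = (bJ \<rho> m b, if b = 0 then 0 else bt (bJ \<rho> m b) (b1 b s1))"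
    by (rule jl_correct[OF good \<rho> _ refl]) (use b i in auto)
  then show ?thesis unfolding input2_def enc2_def Let_def t using b by (simp only: fst_conv snd_conv) simp
qed

lemma rd_correct:
  assumes d: "\<And>b. 0 < b \<Longrightarrow> b < B \<Longrightarrow> dec (blk undefined N b y) (b1 b s1) (b2 b s2) (bK \<rho> m s1 b)
      = (bJ \<rho> m b, bt (bJ \<rho> m b) (b1 b s1), bA \<rho> m b, bC \<rho> m2 b)"
  shows "b < B \<Longrightarrow> rd \<rho> y s1 s2 (B - Suc b) = bcode \<rho> m s1 b"
proof (induction "B - Suc b" arbitrary: b)
  case 0
  then show ?case unfolding bcode_def by simp
next
  case (Suc d)
  then have b: "Suc b < B" "d = B - Suc (Suc b)" "B - Suc d = Suc b" by auto
  have "rd \<rho> y s1 s2 d = bcode \<rho> m s1 (Suc b)" using Suc.hyps(1)[OF b(2)] b by simp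
  then show ?case
    unfolding Suc.hyps(2)[symmetric] using d[of "Suc b"] b by (simp add: Let_def bcode_def bK_def)
qed

definition digits1 where
  "digits1 \<rho> y s1 s2 b = ((fst (bdec \<rho> y s1 s2 b) + (J - fst (\<rho> b))) mod J,
     (fst (snd (snd (bdec \<rho> y s1 s2 b))) + (A - fst (snd (snd (\<rho> b))))) mod A)"
definition digits2 where
  "digits2 \<rho> y s1 s2 b = (snd (snd (snd (bdec \<rho> y s1 s2 b))) + (C - snd (snd (snd (\<rho> b))))) mod C"

lemma digits_correct:
  assumes \<rho>: "\<And>b. b < B \<Longrightarrow> \<rho> b \<in> indices J L A C"
    and d: "\<And>b. 0 < b \<Longrightarrow> b < B \<Longrightarrow> dec (blk undefined N b y) (b1 b s1) (b2 b s2) (bK \<rho> m s1 b)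
      = (bJ \<rho> m b, bt (bJ \<rho> m b) (b1 b s1), bA \<rho> m b, bC \<rho> m2 b)"
    and b: "0 < b" "b < B"
  shows "digits1 \<rho> y s1 s2 b = \<phi>1 m b" "digits2 \<rho> y s1 s2 b = \<phi>2 m2 b"
proof -
  have "bdec \<rho> y s1 s2 b = (bJ \<rho> m b, bt (bJ \<rho> m b) (b1 b s1), bA \<rho> m b, bC \<rho> m2 b)"
  proof -
    have r: "rd \<rho> y s1 s2 (B - Suc b) = bcode \<rho> m s1 b" by (rule rd_correct[OF d b(2)])
    show ?thesis unfolding bdec_def r using d[OF b] by (simp add: bK_def)
  qed
  note e = this
  have u: "((fst (\<phi>1 m b) + fst (\<rho> b)) mod J + (J - fst (\<rho> b))) mod J = fst (\<phi>1 m b)"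
    "((snd (\<phi>1 m b) + fst (snd (snd (\<rho> b)))) mod A + (A - fst (snd (snd (\<rho> b))))) mod A = snd (\<phi>1 m b)"
    "((\<phi>2 m2 b + snd (snd (snd (\<rho> b)))) mod C + (C - snd (snd (snd (\<rho> b))))) mod C = \<phi>2 m2 b"
    by (rule unshift; use \<rho>[OF b(2)] \<phi>1(1)[of m b] \<phi>2[of m2 b] in auto)+
  show "digits1 \<rho> y s1 s2 b = \<phi>1 m b" "digits2 \<rho> y s1 s2 b = \<phi>2 m2 b"
    unfolding digits1_def digits2_def e bJ_def bA_def bC_def fst_conv snd_conv u by simp_all
qed

definition block_input where
  "block_input \<rho> m m2 s1 b = (bJ \<rho> m b, bK \<rho> m s1 b, bA \<rho> m b, bC \<rho> m2 b)"

text \<open>If a crib is misread, one summand is already 1. Otherwise encoder 2 has the right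
  indices in all blocks after block 0, each of them behaves like the block code, and a wrong digit
  requires a decoding failure in one of them.\<close>

lemma error_given_states:
  assumes \<rho>: "\<And>b. b < B \<Longrightarrow> \<rho> b \<in> indices J L A C"
  defines "s1 s \<equiv> fst \<circ> s" and "s2 s \<equiv> snd \<circ> s"
  shows "emeasure (Pi_pmf {1..N * B} undefined (\<lambda>i. W (enc1 \<rho> m (s1 s) i) (input2 z (enc1 \<rho>) (enc2 \<rho>) m m2 (s1 s) (s2 s) i) (s1 s i) (s2 s i)))
     {y. \<not> (\<forall>b\<in>{1..<B}. digits1 \<rho> y (s1 s) (s2 s) b = \<phi>1 m b \<and> digits2 \<rho> y (s1 s) (s2 s) b = \<phi>2 m2 b)}
    \<le> (\<Sum>b<B. block_error N e1 bt e2 h dec (block_input \<rho> m m2 (s1 s) b) (blk undefined N b s))"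
proof -
  let ?Y = "Pi_pmf {1..N * B} undefined (\<lambda>i. W (enc1 \<rho> m (s1 s) i) (input2 z (enc1 \<rho>) (enc2 \<rho>) m m2 (s1 s) (s2 s) i) (s1 s i) (s2 s i))"
  let ?E = "{y. \<not> (\<forall>b\<in>{1..<B}. digits1 \<rho> y (s1 s) (s2 s) b = \<phi>1 m b \<and> digits2 \<rho> y (s1 s) (s2 s) b = \<phi>2 m2 b)}"
  have bs: "fst \<circ> blk undefined N b s = b1 b (s1 s)" "snd \<circ> blk undefined N b s = b2 b (s2 s)" for b
    by (auto simp: blk_def s1_def s2_def fun_eq_iff d12[symmetric])
  have be: "block_error N e1 bt e2 h dec (block_input \<rho> m m2 (s1 s) b) (blk undefined N b s) =
    (if h (bJ \<rho> m b) (restrict (\<lambda>i. z (e1 (bJ \<rho> m b) (b1 b (s1 s)) (bK \<rho> m (s1 s) b) (bA \<rho> m b) i) (b1 b (s1 s) i)) {1..N}) \<noteq> bK \<rho> m (s1 s) b then 1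
     else emeasure (seq_pmf N (\<lambda>i. W (e1 (bJ \<rho> m b) (b1 b (s1 s)) (bK \<rho> m (s1 s) b) (bA \<rho> m b) i)
         (e2 (bJ \<rho> m b) (bt (bJ \<rho> m b) (b1 b (s1 s))) (b2 b (s2 s)) (bC \<rho> m2 b) i) (b1 b (s1 s) i) (b2 b (s2 s) i)))
       {y. dec y (b1 b (s1 s)) (b2 b (s2 s)) (bK \<rho> m (s1 s) b) \<noteq> (bJ \<rho> m b, bt (bJ \<rho> m b) (b1 b (s1 s)), bA \<rho> m b, bC \<rho> m2 b)})" for b
    unfolding block_error_def block_input_def Let_def prod.case bs ..
  show ?thesis
  proof (cases "good_crib \<rho> m (s1 s)")
    case False
    then obtain b where b: "b < B" "block_error N e1 bt e2 h dec (block_input \<rho> m m2 (s1 s) b) (blk undefined N b s) = 1"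
      unfolding be good_crib_def by auto
    have "emeasure ?Y ?E \<le> 1" by (rule measure_pmf.emeasure_le_1)
    also have "\<dots> = block_error N e1 bt e2 h dec (block_input \<rho> m m2 (s1 s) b) (blk undefined N b s)" using b by simp
    also have "\<dots> \<le> (\<Sum>b<B. block_error N e1 bt e2 h dec (block_input \<rho> m m2 (s1 s) b) (blk undefined N b s))"
      using b by (intro member_le_sum) auto
    finally show ?thesis .
  next
    case True
    define F where "F b = {y. dec y (b1 b (s1 s)) (b2 b (s2 s)) (bK \<rho> m (s1 s) b) \<noteq> (bJ \<rho> m b, bt (bJ \<rho> m b) (b1 b (s1 s)), bA \<rho> m b, bC \<rho> m2 b)}" for b
    have "?E \<subseteq> (\<Union>b\<in>{1..<B}. blk undefined N b -` F b)"
    proof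
      fix y assume y: "y \<in> ?E"
      show "y \<in> (\<Union>b\<in>{1..<B}. blk undefined N b -` F b)"
      proof (rule ccontr)
        assume "y \<notin> (\<Union>b\<in>{1..<B}. blk undefined N b -` F b)"
        then have "\<And>b. 0 < b \<Longrightarrow> b < B \<Longrightarrow> dec (blk undefined N b y) (b1 b (s1 s)) (b2 b (s2 s)) (bK \<rho> m (s1 s) b)
          = (bJ \<rho> m b, bt (bJ \<rho> m b) (b1 b (s1 s)), bA \<rho> m b, bC \<rho> m2 b)" by (auto simp: F_def)
        from digits_correct[OF \<rho> this] y show False by auto
      qed
    qed
    then have "emeasure ?Y ?E \<le> emeasure ?Y (\<Union>b\<in>{1..<B}. blk undefined N b -` F b)" by (intro emeasure_mono) auto
    also have "\<dots> \<le> (\<Sum>b\<in>{1..<B}. emeasure ?Y (blk undefined N b -` F b))"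
      by (rule emeasure_subadditive_finite) auto
    also have "\<dots> = (\<Sum>b\<in>{1..<B}. block_error N e1 bt e2 h dec (block_input \<rho> m m2 (s1 s) b) (blk undefined N b s))"
    proof (rule sum.cong[OF refl])
      fix b assume "b \<in> {1..<B}"
      then have b: "0 < b" "b < B" by auto
      have "emeasure ?Y (blk undefined N b -` F b) = emeasure (map_pmf (blk undefined N b) ?Y) (F b)" by simp
      also have "map_pmf (blk undefined N b) ?Y = seq_pmf N (\<lambda>i. W (enc1 \<rho> m (s1 s) (b * N + i))
          (input2 z (enc1 \<rho>) (enc2 \<rho>) m m2 (s1 s) (s2 s) (b * N + i)) (s1 s (b * N + i)) (s2 s (b * N + i)))"
        by (rule map_blk[OF b(2)])
      also have "\<dots> = seq_pmf N (\<lambda>i. W (e1 (bJ \<rho> m b) (b1 b (s1 s)) (bK \<rho> m (s1 s) b) (bA \<rho> m b) i)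
         (e2 (bJ \<rho> m b) (bt (bJ \<rho> m b) (b1 b (s1 s))) (b2 b (s2 s)) (bC \<rho> m2 b) i) (b1 b (s1 s) i) (b2 b (s2 s) i))"
      proof (rule Pi_pmf_cong[OF refl refl])
        fix i assume i: "i \<in> {1..N}"
        have \<rho>': "fst (snd (\<rho> b)) \<le> J * L" if "b < B" for b using \<rho>[OF that] by auto
        show "W (enc1 \<rho> m (s1 s) (b * N + i)) (input2 z (enc1 \<rho>) (enc2 \<rho>) m m2 (s1 s) (s2 s) (b * N + i)) (s1 s (b * N + i)) (s2 s (b * N + i)) =
          W (e1 (bJ \<rho> m b) (b1 b (s1 s)) (bK \<rho> m (s1 s) b) (bA \<rho> m b) i)
         (e2 (bJ \<rho> m b) (bt (bJ \<rho> m b) (b1 b (s1 s))) (b2 b (s2 s)) (bC \<rho> m2 b) i) (b1 b (s1 s) i) (b2 b (s2 s) i)"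
        proof -
          have "b1 b (s1 s) i = s1 s (b * N + i)" "b2 b (s2 s) i = s2 s (b * N + i)" using i by (simp_all add: blk_def)
          moreover have "input2 z (enc1 \<rho>) (enc2 \<rho>) m m2 (s1 s) (s2 s) (b * N + i) =
             e2 (bJ \<rho> m b) (bt (bJ \<rho> m b) (b1 b (s1 s))) (b2 b (s2 s)) (bC \<rho> m2 b) i"
            by (rule input2_correct[OF True \<rho>' b i])
          ultimately show ?thesis by (simp only: enc1_block[OF i])
        qed
      qed
      also have "emeasure (seq_pmf N (\<lambda>i. W (e1 (bJ \<rho> m b) (b1 b (s1 s)) (bK \<rho> m (s1 s) b) (bA \<rho> m b) i)
         (e2 (bJ \<rho> m b) (bt (bJ \<rho> m b) (b1 b (s1 s))) (b2 b (s2 s)) (bC \<rho> m2 b) i) (b1 b (s1 s) i) (b2 b (s2 s) i))) (F b) =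
         block_error N e1 bt e2 h dec (block_input \<rho> m m2 (s1 s) b) (blk undefined N b s)"
        unfolding be F_def using True b by (simp add: good_crib_def)
      finally show "emeasure ?Y (blk undefined N b -` F b) = block_error N e1 bt e2 h dec (block_input \<rho> m m2 (s1 s) b) (blk undefined N b s)" .
    qed
    also have "\<dots> \<le> (\<Sum>b<B. block_error N e1 bt e2 h dec (block_input \<rho> m m2 (s1 s) b) (blk undefined N b s))"
      by (rule sum_mono2) auto
    finally show ?thesis .
  qed
qed

text \<open>\<open>\<rho> b\<close> enters the indices of block \<open>b\<close> only as a shift;
  the code sent there involves the dither of the next block. Averaging over \<open>\<rho> b\<close>
  first gives uniform indices for every value of the states and of the other dithers.\<close>

lemma dither:
  assumes b: "b < B"
  shows "mean (Pi_pmf {..<B} undefined (\<lambda>_. U4)) (\<lambda>\<rho>. f (block_input \<rho> m m2 s1 b)) = mean U4 (\<lambda>r. f r)"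
proof -
  define S where "S = {..<B} - {b}"
  have S: "{..<B} = insert b S" "b \<notin> S" "finite S" using b by (auto simp: S_def)
  have e: "block_input (\<rho>(b := r)) m m2 s1 b = ((fst (\<phi>1 m b) + fst r) mod J, (bcode \<rho> m s1 b + fst (snd r)) mod (J * L),
      (snd (\<phi>1 m b) + fst (snd (snd r))) mod A, (\<phi>2 m2 b + snd (snd (snd r))) mod C)" for \<rho> r
    unfolding block_input_def bK_def bcode_def bA_def bC_def bJ_def by simp
  have "mean (Pi_pmf {..<B} undefined (\<lambda>_. U4)) (\<lambda>\<rho>. f (block_input \<rho> m m2 s1 b)) =
     mean U4 (\<lambda>r. mean (Pi_pmf S undefined (\<lambda>_. U4)) (\<lambda>\<rho>. f (block_input (\<rho>(b := r)) m m2 s1 b)))"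
    unfolding S(1) Pi_pmf_insert'[OF S(3,2)] by simp
  also have "\<dots> = mean (Pi_pmf S undefined (\<lambda>_. U4)) (\<lambda>\<rho>. mean U4 (\<lambda>r. f (block_input (\<rho>(b := r)) m m2 s1 b)))"
    by (rule nn_integral_pmf_swap)
  also have "\<dots> = mean (Pi_pmf S undefined (\<lambda>_. U4)) (\<lambda>\<rho>. mean U4 (\<lambda>r. f r))"
  proof (rule nn_integral_cong)
    fix \<rho>
    have "mean U4 (\<lambda>r. f (block_input (\<rho>(b := r)) m m2 s1 b)) = mean (map_pmf (\<lambda>r. ((fst (\<phi>1 m b) + fst r) mod J, (bcode \<rho> m s1 b + fst (snd r)) mod (J * L),
      (snd (\<phi>1 m b) + fst (snd (snd r))) mod A, (\<phi>2 m2 b + snd (snd (snd r))) mod C)) U4) (\<lambda>r. f r)"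
      unfolding e by simp
    then show "mean U4 (\<lambda>r. f (block_input (\<rho>(b := r)) m m2 s1 b)) = mean U4 (\<lambda>r. f r)"
      using pos by (subst (asm) map_shift_uniform) auto
  qed
  also have "\<dots> = mean U4 (\<lambda>r. f r)" by simp
  finally show ?thesis .
qed

lemma expected_error:
  "mean (Pi_pmf {..<B} undefined (\<lambda>_. U4)) (\<lambda>\<rho>. mean (Pi_pmf {1..N * B} undefined (\<lambda>_. pS)) (\<lambda>s. (\<Sum>b<B. block_error N e1 bt e2 h dec (block_input \<rho> m m2 (fst \<circ> s) b) (blk undefined N b s)))) \<le> of_nat B * \<delta>"
proof -
  let ?S = "Pi_pmf {1..N * B} undefined (\<lambda>_. pS)"
  have "mean (Pi_pmf {..<B} undefined (\<lambda>_. U4)) (\<lambda>\<rho>. mean ?S (\<lambda>s. (\<Sum>b<B. block_error N e1 bt e2 h dec (block_input \<rho> m m2 (fst \<circ> s) b) (blk undefined N b s))))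
    = mean ?S (\<lambda>s. mean (Pi_pmf {..<B} undefined (\<lambda>_. U4)) (\<lambda>\<rho>. (\<Sum>b<B. block_error N e1 bt e2 h dec (block_input \<rho> m m2 (fst \<circ> s) b) (blk undefined N b s))))"
    by (rule nn_integral_pmf_swap)
  also have "\<dots> = mean ?S (\<lambda>s. (\<Sum>b<B. mean U4 (\<lambda>r. block_error N e1 bt e2 h dec r (blk undefined N b s))))"
    by (rule nn_integral_cong, subst nn_integral_sum) (auto intro!: sum.cong dither)
  also have "\<dots> = (\<Sum>b<B. mean ?S (\<lambda>s. mean U4 (\<lambda>r. block_error N e1 bt e2 h dec r (blk undefined N b s))))"
    by (subst nn_integral_sum) auto
  also have "\<dots> \<le> (\<Sum>b<B. \<delta>)"
  proof (rule sum_mono)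
    fix b assume b: "b \<in> {..<B}"
    have "mean ?S (\<lambda>s. mean U4 (\<lambda>r. block_error N e1 bt e2 h dec r (blk undefined N b s))) =
      mean (map_pmf (blk undefined N b) ?S) (\<lambda>s. mean U4 (\<lambda>r. block_error N e1 bt e2 h dec r s))" by simp
    also have "map_pmf (blk undefined N b) ?S = seq_pmf N (\<lambda>_. pS)" by (rule map_blk) (use b in simp)
    also have "mean (seq_pmf N (\<lambda>_. pS)) (\<lambda>s. mean U4 (\<lambda>r. block_error N e1 bt e2 h dec r s)) \<le> \<delta>"
      by (subst nn_integral_pmf_swap) (rule \<delta>)
    finally show "mean ?S (\<lambda>s. mean U4 (\<lambda>r. block_error N e1 bt e2 h dec r (blk undefined N b s))) \<le> \<delta>" .
  qed
  also have "\<dots> = of_nat B * \<delta>" by simp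
  finally show ?thesis .
qed

text \<open>The error averaged over the dither is at most \<open>B\<close> times that of one block,
  for any pair of messages, so some fixed dither does as well and becomes a part of the
  code.\<close>

lemma exists_code:
  assumes R: "0 \<le> R1" "0 \<le> R2" and \<delta>_fin: "\<delta> < \<top>"
    and inj1: "\<And>m m'. m \<in> messages (N * B) R1 \<Longrightarrow> m' \<in> messages (N * B) R1 \<Longrightarrow> \<forall>b\<in>{1..<B}. \<phi>1 m b = \<phi>1 m' b \<Longrightarrow> m = m'"
    and inj2: "\<And>m m'. m \<in> messages (N * B) R2 \<Longrightarrow> m' \<in> messages (N * B) R2 \<Longrightarrow> \<forall>b\<in>{1..<B}. \<phi>2 m b = \<phi>2 m' b \<Longrightarrow> m = m'"
  shows "\<exists>enc1 enc2 dec1 dec2.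
        (\<forall>y s1 s2. dec1 y s1 s2 \<in> messages (N * B) R1 \<and> dec2 y s1 s2 \<in> messages (N * B) R2) \<and>
        emeasure (transmission pS W z R1 R2 (N * B) enc1 enc2) (wrong dec1 dec2) \<le> of_nat B * \<delta>"
proof -
  let ?M1 = "messages (N * B) R1" and ?M2 = "messages (N * B) R2"
  let ?p1 = "pmf_of_set ?M1" and ?p2 = "pmf_of_set ?M2"
  have sM: "set_pmf ?p1 = ?M1" "set_pmf ?p2 = ?M2"
    using R by (auto simp: set_pmf_of_set messages_nonempty messages_finite)
  define dec1 where "dec1 \<rho> y s1 s2 = (if \<exists>m\<in>?M1. \<forall>b\<in>{1..<B}. \<phi>1 m b = digits1 \<rho> y s1 s2 b
      then SOME m. m \<in> ?M1 \<and> (\<forall>b\<in>{1..<B}. \<phi>1 m b = digits1 \<rho> y s1 s2 b) else SOME m. m \<in> ?M1)" for \<rho> y s1 s2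
  define dec2 where "dec2 \<rho> y s1 s2 = (if \<exists>m\<in>?M2. \<forall>b\<in>{1..<B}. \<phi>2 m b = digits2 \<rho> y s1 s2 b
      then SOME m. m \<in> ?M2 \<and> (\<forall>b\<in>{1..<B}. \<phi>2 m b = digits2 \<rho> y s1 s2 b) else SOME m. m \<in> ?M2)" for \<rho> y s1 s2
  have in1: "dec1 \<rho> y s1 s2 \<in> ?M1" for \<rho> y s1 s2
  proof (cases "\<exists>m\<in>?M1. \<forall>b\<in>{1..<B}. \<phi>1 m b = digits1 \<rho> y s1 s2 b")
    case True
    then have "\<exists>m. m \<in> ?M1 \<and> (\<forall>b\<in>{1..<B}. \<phi>1 m b = digits1 \<rho> y s1 s2 b)" by blast
    from someI_ex[OF this] show ?thesis unfolding dec1_def using True by simp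
  next
    case False
    then show ?thesis unfolding dec1_def if_not_P[OF False] using messages_nonempty[OF R(1)] some_in_eq by blast
  qed
  have in2: "dec2 \<rho> y s1 s2 \<in> ?M2" for \<rho> y s1 s2
  proof (cases "\<exists>m\<in>?M2. \<forall>b\<in>{1..<B}. \<phi>2 m b = digits2 \<rho> y s1 s2 b")
    case True
    then have "\<exists>m. m \<in> ?M2 \<and> (\<forall>b\<in>{1..<B}. \<phi>2 m b = digits2 \<rho> y s1 s2 b)" by blast
    from someI_ex[OF this] show ?thesis unfolding dec2_def using True by simp
  next
    case False
    then show ?thesis unfolding dec2_def if_not_P[OF False] using messages_nonempty[OF R(2)] some_in_eq by blast
  qed
  have ok1: "dec1 \<rho> y s1 s2 = m" if "m \<in> ?M1" "\<forall>b\<in>{1..<B}. digits1 \<rho> y s1 s2 b = \<phi>1 m b" for \<rho> y s1 s2 m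
  proof -
    have ex: "\<exists>m\<in>?M1. \<forall>b\<in>{1..<B}. \<phi>1 m b = digits1 \<rho> y s1 s2 b" using that by (intro bexI[of _ m]) auto
    then have "\<exists>m. m \<in> ?M1 \<and> (\<forall>b\<in>{1..<B}. \<phi>1 m b = digits1 \<rho> y s1 s2 b)" by blast
    from someI_ex[OF this] have "dec1 \<rho> y s1 s2 \<in> ?M1" "\<forall>b\<in>{1..<B}. \<phi>1 (dec1 \<rho> y s1 s2) b = digits1 \<rho> y s1 s2 b"
      unfolding dec1_def if_P[OF ex] by auto
    then show ?thesis using that by (intro inj1) auto
  qed
  have ok2: "dec2 \<rho> y s1 s2 = m" if "m \<in> ?M2" "\<forall>b\<in>{1..<B}. digits2 \<rho> y s1 s2 b = \<phi>2 m b" for \<rho> y s1 s2 m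
  proof -
    have ex: "\<exists>m\<in>?M2. \<forall>b\<in>{1..<B}. \<phi>2 m b = digits2 \<rho> y s1 s2 b" using that by (intro bexI[of _ m]) auto
    then have "\<exists>m. m \<in> ?M2 \<and> (\<forall>b\<in>{1..<B}. \<phi>2 m b = digits2 \<rho> y s1 s2 b)" by blast
    from someI_ex[OF this] have "dec2 \<rho> y s1 s2 \<in> ?M2" "\<forall>b\<in>{1..<B}. \<phi>2 (dec2 \<rho> y s1 s2) b = digits2 \<rho> y s1 s2 b"
      unfolding dec2_def if_P[OF ex] by auto
    then show ?thesis using that by (intro inj2) auto
  qed
  let ?R = "Pi_pmf {..<B} undefined (\<lambda>_. U4)"
  let ?S = "Pi_pmf {1..N * B} undefined (\<lambda>_. pS)"
  define G where "G \<rho> m m2 = mean ?S (\<lambda>s. (\<Sum>b<B. block_error N e1 bt e2 h dec (block_input \<rho> m m2 (fst \<circ> s) b) (blk undefined N b s)))" for \<rho> m m2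
  define Err where "Err \<rho> = emeasure (transmission pS W z R1 R2 (N * B) (enc1 \<rho>) (enc2 \<rho>))
          {(m1, m2, s1, s2, y). (dec1 \<rho> y s1 s2, dec2 \<rho> y s1 s2) \<noteq> (m1, m2)}" for \<rho>
  have Err: "Err \<rho> \<le> mean ?p1 (\<lambda>m. mean ?p2 (\<lambda>m2. G \<rho> m m2))" if \<rho>: "\<rho> \<in> set_pmf ?R" for \<rho>
  proof -
    have \<rho>b: "\<rho> b \<in> indices J L A C" if "b < B" for b
    proof -
      have "\<rho> b \<in> set_pmf U4" using \<rho> that by (auto simp: set_Pi_pmf PiE_dflt_def)
      moreover have "(0, 0, 0, 0) \<in> indices J L A C" using pos by simp
      then have "indices J L A C \<noteq> {}" by blast
      ultimately show ?thesis by (subst (asm) set_pmf_of_set) auto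
    qed
    show ?thesis
      unfolding Err_def transmission_def Let_def G_def
      apply (simp only: emeasure_bind_pmf)
      apply (rule nn_integral_pmf_mono, rule nn_integral_pmf_mono, rule nn_integral_pmf_mono)
      subgoal premises p for m m2 s
      proof -
        have m: "m \<in> ?M1" "m2 \<in> ?M2" using p sM by auto
        let ?Y = "Pi_pmf {1..N * B} undefined (\<lambda>i. W (enc1 \<rho> m (fst \<circ> s) i) (input2 z (enc1 \<rho>) (enc2 \<rho>) m m2 (fst \<circ> s) (snd \<circ> s) i) ((fst \<circ> s) i) ((snd \<circ> s) i))"
        have "mean ?Y (\<lambda>y. emeasure (return_pmf (m, m2, fst \<circ> s, snd \<circ> s, y)) {(m1, m2, s1, s2, y). (dec1 \<rho> y s1 s2, dec2 \<rho> y s1 s2) \<noteq> (m1, m2)})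
          = emeasure (map_pmf (\<lambda>y. (m, m2, fst \<circ> s, snd \<circ> s, y)) ?Y) {(m1, m2, s1, s2, y). (dec1 \<rho> y s1 s2, dec2 \<rho> y s1 s2) \<noteq> (m1, m2)}"
          unfolding map_pmf_def by (simp only: emeasure_bind_pmf)
        also have "\<dots> = emeasure ?Y {y. (dec1 \<rho> y (fst \<circ> s) (snd \<circ> s), dec2 \<rho> y (fst \<circ> s) (snd \<circ> s)) \<noteq> (m, m2)}"
          unfolding emeasure_map_pmf by (rule arg_cong[where f="emeasure ?Y"]) auto
        also have "\<dots> \<le> emeasure ?Y {y. \<not> (\<forall>b\<in>{1..<B}. digits1 \<rho> y (fst \<circ> s) (snd \<circ> s) b = \<phi>1 m b \<and> digits2 \<rho> y (fst \<circ> s) (snd \<circ> s) b = \<phi>2 m2 b)}"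
        proof (rule emeasure_mono, rule subsetI)
          fix y assume "y \<in> {y. (dec1 \<rho> y (fst \<circ> s) (snd \<circ> s), dec2 \<rho> y (fst \<circ> s) (snd \<circ> s)) \<noteq> (m, m2)}"
          then show "y \<in> {y. \<not> (\<forall>b\<in>{1..<B}. digits1 \<rho> y (fst \<circ> s) (snd \<circ> s) b = \<phi>1 m b \<and> digits2 \<rho> y (fst \<circ> s) (snd \<circ> s) b = \<phi>2 m2 b)}"
            using ok1[OF m(1), of \<rho> y "fst \<circ> s" "snd \<circ> s"] ok2[OF m(2), of \<rho> y "fst \<circ> s" "snd \<circ> s"] by blast
        qed simp
        also have "\<dots> \<le> (\<Sum>b<B. block_error N e1 bt e2 h dec (block_input \<rho> m m2 (fst \<circ> s) b) (blk undefined N b s))"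
          by (rule error_given_states[OF \<rho>b])
        finally show ?thesis .
      qed
      done
  qed
  have "mean ?R (\<lambda>\<rho>. Err \<rho>) \<le> mean ?R (\<lambda>\<rho>. mean ?p1 (\<lambda>m. mean ?p2 (\<lambda>m2. G \<rho> m m2)))"
    by (rule nn_integral_pmf_mono) (rule Err)
  also have "\<dots> = mean ?p1 (\<lambda>m. mean ?R (\<lambda>\<rho>. mean ?p2 (\<lambda>m2. G \<rho> m m2)))" by (rule nn_integral_pmf_swap)
  also have "\<dots> = mean ?p1 (\<lambda>m. mean ?p2 (\<lambda>m2. mean ?R (\<lambda>\<rho>. G \<rho> m m2)))"
    by (rule nn_integral_cong) (rule nn_integral_pmf_swap)
  also have "\<dots> \<le> mean ?p1 (\<lambda>m. mean ?p2 (\<lambda>m2. of_nat B * \<delta>))"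
    unfolding G_def by (intro nn_integral_pmf_mono expected_error)
  also have "\<dots> = of_nat B * \<delta>" by simp
  finally have "\<exists>\<rho>\<in>set_pmf ?R. Err \<rho> \<le> of_nat B * \<delta>"
    by (rule exists_le_nn_integral_pmf) (use \<delta>_fin in \<open>simp add: ennreal_mult_less_top of_nat_less_top\<close>)
  then obtain \<rho> where "Err \<rho> \<le> of_nat B * \<delta>" by blast
  then show ?thesis unfolding Err_def using in1 in2 by blast
qed

end

text \<open>A message is written as a word of \<open>B - 1\<close> digits, one for each block after
  block 0; the cardinality assumptions say that there are enough words.\<close>

lemma multiblock:
  assumes bc: "block_code N J L A C \<delta>" and \<delta>: "\<delta> < \<top>" and B: "0 < B" and R: "0 \<le> R1" "0 \<le> R2"
    and c1: "card (messages (N * B) R1) \<le> (J * A) ^ (B - 1)" and c2: "card (messages (N * B) R2) \<le> C ^ (B - 1)"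
  shows "\<exists>enc1 enc2 dec1 dec2.
        (\<forall>y s1 s2. dec1 y s1 s2 \<in> messages (N * B) R1 \<and> dec2 y s1 s2 \<in> messages (N * B) R2) \<and>
        emeasure (transmission pS W z R1 R2 (N * B) enc1 enc2) (wrong dec1 dec2) \<le> of_nat B * \<delta>"
proof -
  obtain e1 bt e2 h dec where pos: "0 < J" "0 < L" "0 < A" "0 < C" and bt: "\<And>j s1. bt j s1 < L" and
     \<delta>': "mean (pmf_of_set (indices J L A C)) (\<lambda>r. mean (seq_pmf N (\<lambda>_. pS)) (\<lambda>s. block_error N e1 bt e2 h dec r s)) \<le> \<delta>"
    using bc unfolding block_code_def by blast
  let ?Ms1 = "messages (N * B) R1" and ?Ms2 = "messages (N * B) R2"
  have "card ?Ms1 \<le> card (PiE {1..<B} (\<lambda>_. {..<J} \<times> {..<A}))" using c1 by (simp add: card_PiE)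
  then obtain f1 where f1: "f1 ` ?Ms1 \<subseteq> PiE {1..<B} (\<lambda>_. {..<J} \<times> {..<A})" "inj_on f1 ?Ms1"
    using card_le_inj[OF messages_finite finite_PiE[OF finite_atLeastLessThan]] by (metis finite_cartesian_product finite_lessThan)
  have "card ?Ms2 \<le> card (PiE {1..<B} (\<lambda>_. {..<C}))" using c2 by (simp add: card_PiE)
  then obtain f2 where f2: "f2 ` ?Ms2 \<subseteq> PiE {1..<B} (\<lambda>_. {..<C})" "inj_on f2 ?Ms2"
    using card_le_inj[OF messages_finite finite_PiE[OF finite_atLeastLessThan]] by (metis finite_lessThan)
  define \<phi>1 where "\<phi>1 m b = (if b \<in> {1..<B} \<and> m \<in> ?Ms1 then f1 m b else (0, 0))" for m b
  define \<phi>2 where "\<phi>2 m b = (if b \<in> {1..<B} \<and> m \<in> ?Ms2 then f2 m b else 0)" for m b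
  have \<phi>1: "fst (\<phi>1 m b) < J \<and> snd (\<phi>1 m b) < A" "fst (\<phi>1 m 0) = 0" for m b
    using f1(1) pos unfolding \<phi>1_def by (auto simp: PiE_iff mem_Times_iff image_subset_iff)
  have \<phi>2: "\<phi>2 m b < C" for m b
    using f2(1) pos unfolding \<phi>2_def by (auto simp: PiE_iff image_subset_iff)
  have inj1: "m = m'" if "m \<in> ?Ms1" "m' \<in> ?Ms1" "\<forall>b\<in>{1..<B}. \<phi>1 m b = \<phi>1 m' b" for m m'
  proof -
    have "f1 m = f1 m'"
      using that f1(1) by (intro PiE_ext[of _ "{1..<B}" "\<lambda>_. {..<J} \<times> {..<A}"]) (auto simp: \<phi>1_def)
    then show ?thesis using f1(2) that by (auto simp: inj_on_def)
  qed
  have inj2: "m = m'" if "m \<in> ?Ms2" "m' \<in> ?Ms2" "\<forall>b\<in>{1..<B}. \<phi>2 m b = \<phi>2 m' b" for m m'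
  proof -
    have "f2 m = f2 m'"
      using that f2(1) by (intro PiE_ext[of _ "{1..<B}" "\<lambda>_. {..<C}"]) (auto simp: \<phi>2_def)
    then show ?thesis using f2(2) that by (auto simp: inj_on_def)
  qed
  have d12: "(fst (undefined :: 's1 \<times> 's2), snd (undefined :: 's1 \<times> 's2)) = undefined" by simp
  show ?thesis
    by (rule exists_code[where bt=bt and ?\<phi>1.0=\<phi>1 and ?\<phi>2.0=\<phi>2 and J=J and L=L and A=A and C=C and N=N and B=B and \<delta>=\<delta>, OF d12 pos bt \<delta>' B \<phi>1 \<phi>2 R \<delta> inj1 inj2])
qed

end

subsection \<open>Random codes for one block\<close>

lemma nn_integral_Pi_component:
  assumes "finite I" "i \<in> I"
  shows "mean (Pi_pmf I d p) (\<lambda>c. f (c i)) = mean (p i) (\<lambda>x. f x)"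
proof -
  have "mean (Pi_pmf I d p) (\<lambda>c. f (c i)) = mean (map_pmf (\<lambda>c. c i) (Pi_pmf I d p)) (\<lambda>x. f x)"
    by simp
  then show ?thesis using assms by (simp add: Pi_pmf_component)
qed

lemma nn_integral_Pi_two:
  assumes I: "finite I" "i \<in> I" "i' \<in> I" "i \<noteq> i'"
  shows "mean (Pi_pmf I d p) (\<lambda>c. f (c i) (c i')) = mean (p i) (\<lambda>x. mean (p i') (\<lambda>x'. f x x'))"
proof -
  define I' where "I' = I - {i}"
  have I': "I = insert i I'" "i \<notin> I'" "finite I'" "i' \<in> I'" using I by (auto simp: I'_def)
  have "mean (Pi_pmf I d p) (\<lambda>c. f (c i) (c i')) = mean (p i) (\<lambda>x. mean (Pi_pmf I' d p) (\<lambda>c. f x (c i')))"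
    unfolding I'(1) Pi_pmf_insert'[OF I'(3,2)] using I(4) by simp
  also have "\<dots> = mean (p i) (\<lambda>x. mean (p i') (\<lambda>x'. f x x'))"
    by (intro nn_integral_cong nn_integral_Pi_component I')
  finally show ?thesis .
qed

lemma nn_integral_Pi_all:
  assumes I: "finite I" "I' \<subseteq> I"
  shows "mean (Pi_pmf I d p) (\<lambda>c. of_bool (\<forall>i\<in>I'. P (c i))) = (\<Prod>i\<in>I'. mean (p i) (\<lambda>x. of_bool (P x)))"
proof -
  have "(of_bool (\<forall>i\<in>I'. P (c i)) :: ennreal) = (\<Prod>i\<in>I. if i \<in> I' then of_bool (P (c i)) else 1)" for c
  proof -
    have "(\<Prod>i\<in>I. if i \<in> I' then of_bool (P (c i)) else 1) = (\<Prod>i\<in>I'. of_bool (P (c i)) :: ennreal)"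
      using I by (intro prod.mono_neutral_cong_right) auto
    also have "\<dots> = of_bool (\<forall>i\<in>I'. P (c i))"
      using finite_subset[OF I(2,1)] by (induction I' rule: finite_induct) auto
    finally show ?thesis by simp
  qed
  then have "mean (Pi_pmf I d p) (\<lambda>c. of_bool (\<forall>i\<in>I'. P (c i))) = mean (Pi_pmf I d p) (\<lambda>c. (\<Prod>i\<in>I. if i \<in> I' then of_bool (P (c i)) else 1))"
    by simp
  also have "\<dots> = (\<Prod>i\<in>I. mean (p i) (\<lambda>x. (if i \<in> I' then of_bool (P x) else 1)))"
    by (rule nn_integral_prod_Pi_pmf[OF I(1)])
  also have "\<dots> = (\<Prod>i\<in>I'. mean (p i) (\<lambda>x. of_bool (P x)))"
    using I by (intro prod.mono_neutral_cong_right) auto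
  finally show ?thesis .
qed

text \<open>Change of measure: on the accepted set a draw from the codebook law may be treated as a
  draw from the ideal law, at the price of the factor \<open>c\<close>.\<close>

lemma nn_integral_dominate:
  fixes f :: "'a \<Rightarrow> ennreal"
  assumes "\<And>x. P x \<Longrightarrow> ennreal (pmf p x) \<le> c * ennreal (pmf q x)"
  shows "mean p (\<lambda>x. of_bool (P x) * f x) \<le> c * mean q (\<lambda>x. f x)"
proof -
  have "mean p (\<lambda>x. of_bool (P x) * f x) = (\<integral>\<^sup>+x. ennreal (pmf p x) * (of_bool (P x) * f x) \<partial>count_space UNIV)"
    by (rule nn_integral_measure_pmf)
  also have "\<dots> \<le> (\<integral>\<^sup>+x. c * (ennreal (pmf q x) * f x) \<partial>count_space UNIV)"
  proof (rule nn_integral_mono)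
    fix x show "ennreal (pmf p x) * (of_bool (P x) * f x) \<le> c * (ennreal (pmf q x) * f x)"
      using assms[of x] by (cases "P x") (auto simp: mult.assoc[symmetric] intro!: mult_right_mono)
  qed
  also have "\<dots> = c * (\<integral>\<^sup>+x. ennreal (pmf q x) * f x \<partial>count_space UNIV)" by (rule nn_integral_cmult) simp
  also have "\<dots> = c * mean q (\<lambda>x. f x)" by (simp add: nn_integral_measure_pmf)
  finally show ?thesis .
qed

lemma nn_sum: "mean P (\<lambda>x. (\<Sum>i\<in>I. f i x)) = (\<Sum>i\<in>I. mean P (\<lambda>x. f i x))"
  by (rule nn_integral_sum) simp
lemma nn_add: "mean P (\<lambda>x. f x + g x) = mean P (\<lambda>x. f x) + mean P (\<lambda>x. g x)"
  by (rule nn_integral_add) simp_all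
lemma nn_cmult: "mean P (\<lambda>x. b * f x) = b * mean P (\<lambda>x. f x)"
  by (rule nn_integral_cmult) simp
lemma nn_const: "mean P (\<lambda>x. b) = b" by simp
lemma mean_swap: "mean p (\<lambda>a. mean (q a) (\<lambda>b. mean r (\<lambda>c. f a b c))) = mean r (\<lambda>c. mean p (\<lambda>a. mean (q a) (\<lambda>b. f a b c)))"
  by (rule trans[OF nn_integral_cong nn_integral_pmf_swap]) (rule nn_integral_pmf_swap)
lemma nn_le_const: "(\<And>x. x \<in> set_pmf P \<Longrightarrow> f x \<le> b) \<Longrightarrow> (mean P (\<lambda>x. f x)) \<le> b"
  using nn_integral_pmf_mono[of P f "\<lambda>_. b"] by simp

text \<open>A one-shot code; its symbols will be whole sequences of one block. \<open>p\<close>,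
  \<open>q\<close> are the states, and \<open>com1\<close>, \<open>com2\<close> compute from them a
  label, known to both encoders, that selects the law of the codewords for U. There are
  \<open>L\<close> bins of \<open>M\<close> words \<open>u\<close>, \<open>T\<close> candidates
  \<open>v\<close> for each index \<open>k\<close>, and \<open>A\<close> and \<open>C\<close>
  satellite words. The tests enter only through bounds: \<open>AU\<close> and \<open>AZ\<close> for
  the change of measure, \<open>B2\<close> for a false \<open>u\<close>, \<open>BZ\<close> for the
  probability of one \<open>v\<close>, and \<open>D1\<close> to \<open>D4\<close> for the decoder
  with a fresh \<open>x1\<close>, a fresh \<open>x2\<close>, both fresh, or everything
  fresh.\<close>

locale random_code =
  fixes PS :: "('p \<times> 'q) pmf" and com1 :: "'p \<Rightarrow> 'l" and com2 :: "'q \<Rightarrow> 'l"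
    and PU :: "'l \<Rightarrow> 'u pmf" and PZ :: "'v pmf" and QU :: "'p \<Rightarrow> 'u pmf" and QZ :: "'u \<Rightarrow> 'p \<Rightarrow> 'v pmf"
    and QX1 :: "'u \<Rightarrow> 'p \<Rightarrow> 'v \<Rightarrow> 'x1 pmf" and QX2 :: "'u \<Rightarrow> 'q \<Rightarrow> 'x2 pmf"
    and Wn :: "'x1 \<Rightarrow> 'x2 \<Rightarrow> 'p \<Rightarrow> 'q \<Rightarrow> 'y pmf" and zf :: "'x1 \<Rightarrow> 'p \<Rightarrow> 'v"
    and accU :: "'u \<Rightarrow> 'p \<Rightarrow> bool" and accZ :: "'u \<Rightarrow> 'p \<Rightarrow> 'v \<Rightarrow> bool"
    and T2 :: "'u \<Rightarrow> 'q \<Rightarrow> bool" and TZ :: "'v \<Rightarrow> bool"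
    and D :: "'p \<Rightarrow> 'q \<Rightarrow> 'u \<Rightarrow> 'v \<Rightarrow> 'x1 \<Rightarrow> 'x2 \<Rightarrow> 'y \<Rightarrow> bool"
    and J L M T A C :: nat and AU AZ B2 BZ D1 D2 D3 D4 :: ennreal
  assumes finite_support: "finite (set_pmf PS)" "\<And>p. finite (set_pmf (PU (com1 p)))" "finite (set_pmf PZ)"
    and pos: "0 < J" "0 < L" "0 < M" "0 < T" "0 < A" "0 < C"
    and common: "\<And>p q. (p, q) \<in> set_pmf PS \<Longrightarrow> com1 p = com2 q"
    and zf: "\<And>u p v x1. u \<in> set_pmf (QU p) \<Longrightarrow> v \<in> set_pmf (QZ u p) \<Longrightarrow> x1 \<in> set_pmf (QX1 u p v) \<Longrightarrow> zf x1 p = v"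
    and accU: "\<And>u p. accU u p \<Longrightarrow> ennreal (pmf (PU (com1 p)) u) \<le> AU * ennreal (pmf (QU p) u)"
    and accZ: "\<And>u p v. accZ u p v \<Longrightarrow> ennreal (pmf PZ v) \<le> AZ * ennreal (pmf (QZ u p) v)"
    and T2: "\<And>q. (mean (PU (com2 q)) (\<lambda>u. of_bool (T2 u q))) \<le> B2"
    and TZ: "\<And>v. TZ v \<Longrightarrow> ennreal (pmf PZ v) \<le> BZ"
    and D1: "\<And>p q u v x2 y. (mean (QX1 u p v) (\<lambda>x1. of_bool (D p q u v x1 x2 y))) \<le> D1"
    and D2: "\<And>p q u v x1 y. (mean (QX2 u q) (\<lambda>x2. of_bool (D p q u v x1 x2 y))) \<le> D2"
    and D3: "\<And>p q u v y. (mean (QX1 u p v) (\<lambda>x1. mean (QX2 u q) (\<lambda>x2. of_bool (D p q u v x1 x2 y)))) \<le> D3"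
    and D4: "\<And>p q y. (mean (QU p) (\<lambda>u. mean (QZ u p) (\<lambda>v. mean (QX1 u p v) (\<lambda>x1. mean (QX2 u q) (\<lambda>x2. of_bool (D p q u v x1 x2 y)))))) \<le> D4"
begin

definition "K = J * L"
definition "SP = fst ` set_pmf PS"
definition "SQ = snd ` set_pmf PS"
definition "LAB = com1 ` SP"
definition "SU = (\<Union>l\<in>LAB. set_pmf (PU l))"
definition "SV = set_pmf PZ"
definition "LM = {..<L} \<times> {..<M}"

text \<open>Satellite words are drawn in advance for all values of \<open>u\<close>,
  \<open>v\<close> and the states. This keeps all entries of the codebooks independent, although the
  words used are selected by tests.\<close>

definition "IU = {..<J} \<times> LM \<times> LAB"
definition "IZ = {..<J} \<times> {..<K} \<times> {..<T}"
definition "I1 = {..<J} \<times> {..<A} \<times> SU \<times> SP \<times> SV"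
definition "I2 = {..<J} \<times> {..<C} \<times> SU \<times> SQ"

definition "CU = Pi_pmf IU undefined (\<lambda>(j, l, b). PU b)"
definition "CZ = Pi_pmf IZ undefined (\<lambda>_. PZ)"
definition "C1 = Pi_pmf I1 undefined (\<lambda>(j, a, u, p, v). QX1 u p v)"
definition "C2 = Pi_pmf I2 undefined (\<lambda>(j, c, u, q). QX2 u q)"

lemma finite_sets: "finite SP" "finite SQ" "finite LAB" "finite SU" "finite SV" "finite LM" "finite IU" "finite IZ" "finite I1" "finite I2"
proof -
  show a: "finite SP" "finite SQ" "finite SV" "finite LM" unfolding SP_def SQ_def SV_def LM_def using finite_support by auto
  then show b: "finite LAB" unfolding LAB_def by auto
  have "SU = (\<Union>p\<in>SP. set_pmf (PU (com1 p)))" unfolding SU_def LAB_def by auto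
  then show c: "finite SU" using a finite_support by simp
  show "finite IU" "finite IZ" "finite I1" "finite I2" unfolding IU_def IZ_def I1_def I2_def using a b c by auto
qed

definition "good p q u v x1 x2 y \<longleftrightarrow> T2 u q \<and> TZ v \<and> D p q u v x1 x2 y"
definition "naU p = mean (PU (com1 p)) (\<lambda>u. of_bool (\<not> accU u p))"
definition "naZ u p = mean PZ (\<lambda>v. of_bool (\<not> accZ u p v))"
definition "cU = of_nat (L * M) * AU"
definition "cZ = of_nat T * AZ"
definition "bad p q = mean (QU p) (\<lambda>u. mean (QZ u p) (\<lambda>v. mean (QX1 u p v) (\<lambda>x1. mean (QX2 u q) (\<lambda>x2. mean (Wn x1 x2 p q) (\<lambda>y. of_bool (\<not> good p q u v x1 x2 y))))))"

text \<open>In order: no \<open>u\<close> is accepted; the accepted \<open>u\<close> has no accepted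
  \<open>v\<close>; another \<open>u\<close> of the bin passes \<open>T2\<close>; and then, after
  the change of measure, the same \<open>v\<close> is listed under another index, the tests fail for
  the true words, a wrong \<open>a\<close>, a wrong \<open>c\<close>, both wrong, and a wrong
  \<open>j\<close>. In the last case the competing pair was selected by acceptance as well, whence
  the second \<open>cU * cZ\<close>.\<close>

definition "err_bound p q = naU p ^ (L * M) + cU * mean (QU p) (\<lambda>u. naZ u p ^ T) + cU * of_nat (M - 1) * B2
   + cU * cZ * (of_nat ((K - 1) * T) * BZ + bad p q + of_nat (A - 1) * D1 + of_nat (C - 1) * D2 + of_nat ((A - 1) * (C - 1)) * D3
      + of_nat ((J - 1) * A * C) * (cU * cZ * D4))"

context
  fixes j k a c :: nat and p :: 'p and q :: 'q
begin

definition "uu cu l = cu (j, l, com1 p)"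
definition "vv cz t = cz (j, k, t)"

definition "comp1 c1 c2 u v x1 x2 y =
    (\<Sum>a'\<in>{..<A} - {a}. of_bool (D p q u v (c1 (j, a', u, p, v)) x2 y))
  + (\<Sum>c'\<in>{..<C} - {c}. of_bool (D p q u v x1 (c2 (j, c', u, q)) y))
  + (\<Sum>a'\<in>{..<A} - {a}. \<Sum>c'\<in>{..<C} - {c}. of_bool (D p q u v (c1 (j, a', u, p, v)) (c2 (j, c', u, q)) y) :: ennreal)"
definition "comp2 cu cz c1 c2 y =
    (\<Sum>j'\<in>{..<J} - {j}. \<Sum>a'\<in>{..<A}. \<Sum>c'\<in>{..<C}. \<Sum>l'\<in>LM. \<Sum>t'\<in>{..<T}.
       of_bool (accU (cu (j', l', com1 p)) p) * (of_bool (accZ (cu (j', l', com1 p)) p (cz (j', k, t'))) *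
       of_bool (D p q (cu (j', l', com1 p)) (cz (j', k, t')) (c1 (j', a', cu (j', l', com1 p), p, cz (j', k, t')))
          (c2 (j', c', cu (j', l', com1 p), q)) y)) :: ennreal)"

text \<open>Union bound in which the selected candidates are replaced by a sum over all accepted
  ones. After that no term refers to a selection, and averages factor by independence.\<close>

definition "Phi cu cz c1 c2 =
   of_bool (\<forall>l\<in>LM. \<not> accU (uu cu l) p)
 + (\<Sum>l\<in>LM. of_bool (accU (uu cu l) p) *
     (of_bool (\<forall>t\<in>{..<T}. \<not> accZ (uu cu l) p (vv cz t))
    + (\<Sum>m'\<in>{..<M} - {snd l}. of_bool (T2 (uu cu (fst l, m')) q))
    + (\<Sum>t\<in>{..<T}. of_bool (accZ (uu cu l) p (vv cz t)) *
        ((\<Sum>k'\<in>{..<K} - {k}. \<Sum>t'\<in>{..<T}. of_bool (TZ (vv cz t) \<and> cz (j, k', t') = vv cz t))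
       + mean (Wn (c1 (j, a, uu cu l, p, vv cz t)) (c2 (j, c, uu cu l, q)) p q) (\<lambda>y. of_bool (\<not> good p q (uu cu l) (vv cz t) (c1 (j, a, uu cu l, p, vv cz t)) (c2 (j, c, uu cu l, q)) y)
            + comp1 c1 c2 (uu cu l) (vv cz t) (c1 (j, a, uu cu l, p, vv cz t)) (c2 (j, c, uu cu l, q)) y
            + comp2 cu cz c1 c2 y)))))"

definition "gbad u v = mean (QX1 u p v) (\<lambda>x1. mean (QX2 u q) (\<lambda>x2. mean (Wn x1 x2 p q) (\<lambda>y. of_bool (\<not> good p q u v x1 x2 y))))"
definition "d4 u' v' y = mean (QX1 u' p v') (\<lambda>x1. mean (QX2 u' q) (\<lambda>x2. of_bool (D p q u' v' x1 x2 y)))"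
definition "s7 cu cz u v = (\<Sum>j'\<in>{..<J} - {j}. \<Sum>a'\<in>{..<A}. \<Sum>c'\<in>{..<C}. \<Sum>l'\<in>LM. \<Sum>t'\<in>{..<T}.
       of_bool (accU (cu (j', l', com1 p)) p) * (of_bool (accZ (cu (j', l', com1 p)) p (cz (j', k, t'))) *
       mean (QX1 u p v) (\<lambda>x1. mean (QX2 u q) (\<lambda>x2. mean (Wn x1 x2 p q) (\<lambda>y. d4 (cu (j', l', com1 p)) (cz (j', k, t')) y)))))"

definition "E1 = of_nat (A - 1) * D1 + of_nat (C - 1) * D2 + of_nat ((A - 1) * (C - 1)) * D3"

context
  assumes idx: "j < J" "k < K" "a < A" "c < C" and pq: "(p, q) \<in> set_pmf PS"
begin

lemma mem: "p \<in> SP" "q \<in> SQ" "com1 p \<in> LAB" "com2 q = com1 p"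
  using pq common[OF pq] unfolding SP_def SQ_def LAB_def by force+

lemma CU_mem: "cu \<in> set_pmf CU \<Longrightarrow> j' < J \<Longrightarrow> l \<in> LM \<Longrightarrow> cu (j', l, com1 p) \<in> SU"
  unfolding CU_def SU_def using finite_sets mem by (cases l) (auto simp: set_Pi_pmf PiE_dflt_def IU_def intro!: bexI[OF _ mem(3)])

lemma CZ_mem: "cz \<in> set_pmf CZ \<Longrightarrow> j' < J \<Longrightarrow> k' < K \<Longrightarrow> t < T \<Longrightarrow> cz (j', k', t) \<in> SV"
  unfolding CZ_def using finite_sets mem by (auto simp: set_Pi_pmf PiE_dflt_def IZ_def SV_def)

lemma inner_good:
  assumes u: "u \<in> SU" and v: "v \<in> SV"
  shows "mean C1 (\<lambda>c1. mean C2 (\<lambda>c2. mean (Wn (c1 (j, a, u, p, v)) (c2 (j, c, u, q)) p q) (\<lambda>y. of_bool (\<not> good p q u v (c1 (j, a, u, p, v)) (c2 (j, c, u, q)) y)))) = gbad u v"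
proof -
  have i: "(j, a, u, p, v) \<in> I1" "(j, c, u, q) \<in> I2" using idx mem u v by (auto simp: I1_def I2_def)
  have "mean C2 (\<lambda>c2. mean (Wn x1 (c2 (j, c, u, q)) p q) (\<lambda>y. of_bool (\<not> good p q u v x1 (c2 (j, c, u, q)) y))) = mean (QX2 u q) (\<lambda>x2. mean (Wn x1 x2 p q) (\<lambda>y. of_bool (\<not> good p q u v x1 x2 y)))" for x1
    unfolding C2_def by (subst nn_integral_Pi_component[OF finite_sets(10) i(2)]) simp
  then show ?thesis unfolding gbad_def C1_def
    by (simp only:) (subst nn_integral_Pi_component[OF finite_sets(9) i(1)], simp)
qed

lemma inner_comp1:
  assumes u: "u \<in> SU" and v: "v \<in> SV"
  shows "mean C1 (\<lambda>c1. mean C2 (\<lambda>c2. mean (Wn (c1 (j, a, u, p, v)) (c2 (j, c, u, q)) p q) (\<lambda>y. comp1 c1 c2 u v (c1 (j, a, u, p, v)) (c2 (j, c, u, q)) y)))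
     \<le> of_nat (A - 1) * D1 + of_nat (C - 1) * D2 + of_nat ((A - 1) * (C - 1)) * D3"
proof -
  let ?i = "(j, a, u, p, v)" and ?k = "(j, c, u, q)"
  have i: "(j, a', u, p, v) \<in> I1" "(j, c', u, q) \<in> I2" if "a' < A" "c' < C" for a' c' using that idx mem u v by (auto simp: I1_def I2_def)
  have two1: "mean C1 (\<lambda>c1. f (c1 ?i) (c1 (j, a', u, p, v))) = mean (QX1 u p v) (\<lambda>x. mean (QX1 u p v) (\<lambda>x'. f x x'))"
    if "a' \<in> {..<A} - {a}" for a' f
    unfolding C1_def using that i[of a c] i[of a' c] idx
    by (subst nn_integral_Pi_two[OF finite_sets(9), of ?i "(j, a', u, p, v)"]) auto
  have two2: "mean C2 (\<lambda>c2. f (c2 ?k) (c2 (j, c', u, q))) = mean (QX2 u q) (\<lambda>x. mean (QX2 u q) (\<lambda>x'. f x x'))"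
    if "c' \<in> {..<C} - {c}" for c' f
    unfolding C2_def using that i[of a c] i[of a c'] idx
    by (subst nn_integral_Pi_two[OF finite_sets(10), of ?k "(j, c', u, q)"]) auto
  have 1: "mean C1 (\<lambda>c1. mean C2 (\<lambda>c2. mean (Wn (c1 ?i) (c2 ?k) p q) (\<lambda>y. of_bool (D p q u v (c1 (j, a', u, p, v)) (c2 ?k) y)))) \<le> D1"
    if a': "a' \<in> {..<A} - {a}" for a'
  proof (subst nn_integral_pmf_swap, rule nn_le_const)
    fix c2
    show "mean C1 (\<lambda>c1. mean (Wn (c1 ?i) (c2 ?k) p q) (\<lambda>y. of_bool (D p q u v (c1 (j, a', u, p, v)) (c2 ?k) y))) \<le> D1"
      unfolding two1[OF a', of "\<lambda>x x'. mean (Wn x (c2 ?k) p q) (\<lambda>y. of_bool (D p q u v x' (c2 ?k) y))"]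
      by (rule nn_le_const, subst nn_integral_pmf_swap, intro nn_le_const D1)
  qed
  have 2: "mean C1 (\<lambda>c1. mean C2 (\<lambda>c2. mean (Wn (c1 ?i) (c2 ?k) p q) (\<lambda>y. of_bool (D p q u v (c1 ?i) (c2 (j, c', u, q)) y)))) \<le> D2"
    if c': "c' \<in> {..<C} - {c}" for c'
  proof (rule nn_le_const)
    fix c1
    show "mean C2 (\<lambda>c2. mean (Wn (c1 ?i) (c2 ?k) p q) (\<lambda>y. of_bool (D p q u v (c1 ?i) (c2 (j, c', u, q)) y))) \<le> D2"
      unfolding two2[OF c', of "\<lambda>x x'. mean (Wn (c1 ?i) x p q) (\<lambda>y. of_bool (D p q u v (c1 ?i) x' y))"]
      by (rule nn_le_const, subst nn_integral_pmf_swap, intro nn_le_const D2)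
  qed
  have 3: "mean C1 (\<lambda>c1. mean C2 (\<lambda>c2. mean (Wn (c1 ?i) (c2 ?k) p q) (\<lambda>y. of_bool (D p q u v (c1 (j, a', u, p, v)) (c2 (j, c', u, q)) y)))) \<le> D3"
    if a': "a' \<in> {..<A} - {a}" and c': "c' \<in> {..<C} - {c}" for a' c'
    unfolding two2[OF c', of "\<lambda>x x'. mean (Wn _ x p q) (\<lambda>y. of_bool (D p q u v _ x' y))"]
      two1[OF a', of "\<lambda>w w'. mean (QX2 u q) (\<lambda>x. mean (QX2 u q) (\<lambda>x'. mean (Wn w x p q) (\<lambda>y. of_bool (D p q u v w' x' y))))"]
    by (rule nn_le_const, subst nn_integral_pmf_swap, rule nn_le_const, subst mean_swap, intro nn_le_const D3)
  have "mean C1 (\<lambda>c1. mean C2 (\<lambda>c2. mean (Wn (c1 (j, a, u, p, v)) (c2 (j, c, u, q)) p q) (\<lambda>y. comp1 c1 c2 u v (c1 (j, a, u, p, v)) (c2 (j, c, u, q)) y)))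
    \<le> (\<Sum>a'\<in>{..<A} - {a}. D1) + (\<Sum>c'\<in>{..<C} - {c}. D2) + (\<Sum>a'\<in>{..<A} - {a}. \<Sum>c'\<in>{..<C} - {c}. D3)"
    unfolding comp1_def nn_add nn_sum by (intro add_mono sum_mono 1 2 3)
  also have "\<dots> = of_nat (A - 1) * D1 + of_nat (C - 1) * D2 + of_nat ((A - 1) * (C - 1)) * D3"
    using idx by (simp add: card_Diff_singleton mult.assoc)
  finally show ?thesis .
qed

text \<open>With \<open>j'\<close> different from \<open>j\<close> the competing satellites sit at
  other positions of the codebooks, so they are independent of the transmitted ones even if the
  values of \<open>u\<close> and \<open>v\<close> coincide.\<close>

lemma inner_comp2:
  assumes u: "u \<in> SU" and v: "v \<in> SV" and cu: "cu \<in> set_pmf CU" and cz: "cz \<in> set_pmf CZ"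
  shows "mean C1 (\<lambda>c1. mean C2 (\<lambda>c2. mean (Wn (c1 (j, a, u, p, v)) (c2 (j, c, u, q)) p q) (\<lambda>y. comp2 cu cz c1 c2 y))) = s7 cu cz u v"
proof -
  let ?i = "(j, a, u, p, v)" and ?k = "(j, c, u, q)"
  have i: "?i \<in> I1" "?k \<in> I2" using idx mem u v by (auto simp: I1_def I2_def)
  have 1: "mean C1 (\<lambda>c1. mean C2 (\<lambda>c2. mean (Wn (c1 ?i) (c2 ?k) p q) (\<lambda>y. of_bool (D p q u' v' (c1 (j', a', u', p, v')) (c2 (j', c', u', q)) y)))) = mean (QX1 u p v) (\<lambda>x1. mean (QX2 u q) (\<lambda>x2. mean (Wn x1 x2 p q) (\<lambda>y. d4 u' v' y)))"
    if j': "j' \<in> {..<J} - {j}" "a' < A" "c' < C" and u': "u' \<in> SU" and v': "v' \<in> SV" for j' a' c' u' v'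
  proof -
    let ?i' = "(j', a', u', p, v')" and ?k' = "(j', c', u', q)"
    have i': "?i' \<in> I1" "?k' \<in> I2" "?i \<noteq> ?i'" "?k \<noteq> ?k'" using j' mem u' v' by (auto simp: I1_def I2_def)
    have "mean C1 (\<lambda>c1. mean C2 (\<lambda>c2. mean (Wn (c1 ?i) (c2 ?k) p q) (\<lambda>y. of_bool (D p q u' v' (c1 ?i') (c2 ?k') y)))) =
     mean C1 (\<lambda>c1. mean (QX2 u q) (\<lambda>x. mean (QX2 u' q) (\<lambda>x'. mean (Wn (c1 ?i) x p q) (\<lambda>y. of_bool (D p q u' v' (c1 ?i') x' y)))))"
      unfolding C2_def by (rule nn_integral_cong, subst nn_integral_Pi_two[OF finite_sets(10) i(2) i'(2) i'(4)]) simp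
    also have "\<dots> = mean (QX1 u p v) (\<lambda>w. mean (QX1 u' p v') (\<lambda>w'. mean (QX2 u q) (\<lambda>x. mean (QX2 u' q) (\<lambda>x'. mean (Wn w x p q) (\<lambda>y. of_bool (D p q u' v' w' x' y))))))"
      unfolding C1_def by (subst nn_integral_Pi_two[OF finite_sets(9) i(1) i'(1) i'(3)]) simp
    also have "\<dots> = mean (QX1 u p v) (\<lambda>w. mean (QX2 u q) (\<lambda>x. mean (Wn w x p q) (\<lambda>y. d4 u' v' y)))"
      unfolding d4_def by (rule nn_integral_cong, rule trans[OF nn_integral_pmf_swap], rule nn_integral_cong, rule mean_swap)
    finally show ?thesis .
  qed
  show ?thesis
    unfolding comp2_def s7_def nn_sum nn_cmult
    by (intro sum.cong refl arg_cong2[where f=times] 1) (use CU_mem[OF cu] CZ_mem[OF cz] idx in auto)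
qed

text \<open>Two changes of measure, for \<open>v\<close> at given \<open>u\<close> and then for
  \<open>u\<close>.\<close>

lemma dominate_uv:
  "mean (PU (com1 p)) (\<lambda>u. mean PZ (\<lambda>v. of_bool (accU u p) * (of_bool (accZ u p v) * f u v)))
   \<le> AU * (AZ * mean (QU p) (\<lambda>u. mean (QZ u p) (\<lambda>v. f u v)))"
proof -
  have "mean (PU (com1 p)) (\<lambda>u. mean PZ (\<lambda>v. of_bool (accU u p) * (of_bool (accZ u p v) * f u v)))
    \<le> mean (PU (com1 p)) (\<lambda>u. of_bool (accU u p) * (AZ * mean (QZ u p) (\<lambda>v. f u v)))"
    unfolding nn_cmult by (intro nn_integral_mono mult_left_mono nn_integral_dominate accZ) auto
  also have "\<dots> \<le> AU * mean (QU p) (\<lambda>u. AZ * mean (QZ u p) (\<lambda>v. f u v))"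
    by (intro nn_integral_dominate accU)
  finally show ?thesis unfolding nn_cmult .
qed

lemma CU_one: "l \<in> LM \<Longrightarrow> (mean CU (\<lambda>cu. f (cu (j, l, com1 p)))) = mean (PU (com1 p)) (\<lambda>u. f u)"
  unfolding CU_def using idx mem by (subst nn_integral_Pi_component[OF finite_sets(7)]) (auto simp: IU_def)

lemma CU_two: "l \<in> LM \<Longrightarrow> l' \<in> LM \<Longrightarrow> j' < J \<Longrightarrow> (j, l) \<noteq> (j', l') \<Longrightarrow>
  (mean CU (\<lambda>cu. f (cu (j, l, com1 p)) (cu (j', l', com1 p))))
  = mean (PU (com1 p)) (\<lambda>u. mean (PU (com1 p)) (\<lambda>u'. f u u'))"
  unfolding CU_def using idx mem by (subst nn_integral_Pi_two[OF finite_sets(7)]) (auto simp: IU_def)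

lemma CZ_one: "t < T \<Longrightarrow> (mean CZ (\<lambda>cz. f (cz (j, k, t)))) = mean PZ (\<lambda>v. f v)"
  unfolding CZ_def using idx by (subst nn_integral_Pi_component[OF finite_sets(8)]) (auto simp: IZ_def)

lemma CZ_two: "t < T \<Longrightarrow> t' < T \<Longrightarrow> j' < J \<Longrightarrow> k' < K \<Longrightarrow> (j, k, t) \<noteq> (j', k', t') \<Longrightarrow>
  (mean CZ (\<lambda>cz. f (cz (j, k, t)) (cz (j', k', t')))) = mean PZ (\<lambda>v. mean PZ (\<lambda>v'. f v v'))"
  unfolding CZ_def using idx by (subst nn_integral_Pi_two[OF finite_sets(8)]) (auto simp: IZ_def)

lemma CU_none: "mean CU (\<lambda>cu. of_bool (\<forall>l\<in>LM. \<not> accU (uu cu l) p)) = naU p ^ (L * M)"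
proof -
  let ?I = "(\<lambda>l. (j, l, com1 p)) ` LM"
  have "?I \<subseteq> IU" using idx mem by (auto simp: IU_def)
  have "mean CU (\<lambda>cu. of_bool (\<forall>l\<in>LM. \<not> accU (uu cu l) p)) = mean CU (\<lambda>cu. of_bool (\<forall>i\<in>?I. \<not> accU (cu i) p))"
    by (simp add: uu_def)
  also have "\<dots> = (\<Prod>i\<in>?I. mean (case i of (j, l, b) \<Rightarrow> PU b) (\<lambda>x. of_bool (\<not> accU x p)))"
    unfolding CU_def by (rule nn_integral_Pi_all[OF finite_sets(7) \<open>?I \<subseteq> IU\<close>])
  also have "\<dots> = (\<Prod>l\<in>LM. naU p)" by (subst prod.reindex) (auto simp: inj_on_def naU_def)
  finally show ?thesis by (simp add: LM_def)
qed

lemma CZ_none: "mean CZ (\<lambda>cz. of_bool (\<forall>t\<in>{..<T}. \<not> accZ u p (vv cz t))) = naZ u p ^ T"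
proof -
  let ?I = "(\<lambda>t. (j, k, t)) ` {..<T}"
  have "?I \<subseteq> IZ" using idx by (auto simp: IZ_def)
  have "mean CZ (\<lambda>cz. of_bool (\<forall>t\<in>{..<T}. \<not> accZ u p (vv cz t))) = mean CZ (\<lambda>cz. of_bool (\<forall>i\<in>?I. \<not> accZ u p (cz i)))"
    by (simp add: vv_def)
  also have "\<dots> = (\<Prod>i\<in>?I. mean PZ (\<lambda>x. of_bool (\<not> accZ u p x)))"
    unfolding CZ_def by (rule nn_integral_Pi_all[OF finite_sets(8) \<open>?I \<subseteq> IZ\<close>])
  also have "\<dots> = (\<Prod>l\<in>{..<T}. naZ u p)" by (subst prod.reindex) (auto simp: inj_on_def naZ_def)
  finally show ?thesis by simp
qed

lemma inner_Phi:
  assumes cu: "cu \<in> set_pmf CU" and cz: "cz \<in> set_pmf CZ"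
  shows "mean C1 (\<lambda>c1. mean C2 (\<lambda>c2. Phi cu cz c1 c2)) \<le>
     of_bool (\<forall>l\<in>LM. \<not> accU (uu cu l) p)
   + (\<Sum>l\<in>LM. of_bool (accU (uu cu l) p) *
     (of_bool (\<forall>t\<in>{..<T}. \<not> accZ (uu cu l) p (vv cz t))
    + (\<Sum>m'\<in>{..<M} - {snd l}. of_bool (T2 (uu cu (fst l, m')) q))
    + (\<Sum>t\<in>{..<T}. of_bool (accZ (uu cu l) p (vv cz t)) *
        ((\<Sum>k'\<in>{..<K} - {k}. \<Sum>t'\<in>{..<T}. of_bool (TZ (vv cz t) \<and> cz (j, k', t') = vv cz t))
       + (gbad (uu cu l) (vv cz t) + E1 + s7 cu cz (uu cu l) (vv cz t))))))"
proof -
  have u: "uu cu l \<in> SU" if "l \<in> LM" for l unfolding uu_def using CU_mem[OF cu idx(1) that] .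
  have v: "vv cz t \<in> SV" if "t \<in> {..<T}" for t unfolding vv_def using CZ_mem[OF cz idx(1,2)] that by simp
  show ?thesis
    unfolding Phi_def nn_add nn_sum nn_cmult nn_const
    by (intro add_mono sum_mono mult_left_mono order_refl zero_le, simp_all only: inner_good u v)
      (unfold E1_def, simp_all only: inner_comp1 inner_comp2 u v cu cz order_refl)
qed

text \<open>An independent word hits the value \<open>v\<close> with probability
  \<open>pmf PZ v\<close>, which the test \<open>TZ\<close> keeps below \<open>BZ\<close>.\<close>

lemma accept_kterm:
  assumes l: "l \<in> LM" and t: "t < T" "t' < T" and k': "k' \<in> {..<K} - {k}"
  shows "mean CU (\<lambda>cu. mean CZ (\<lambda>cz. of_bool (accU (uu cu l) p) * (of_bool (accZ (uu cu l) p (vv cz t)) * of_bool (TZ (vv cz t) \<and> cz (j, k', t') = vv cz t)))) \<le> AU * (AZ * BZ)"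
proof -
  have b: "mean PZ (\<lambda>v'. of_bool (TZ v \<and> v' = v)) \<le> BZ" for v
  proof (cases "TZ v")
    case True
    have "mean PZ (\<lambda>v'. of_bool (TZ v \<and> v' = v)) = mean PZ (\<lambda>v'. indicator {v} v')"
      using True by (intro nn_integral_cong) (simp add: indicator_def)
    also have "\<dots> = ennreal (pmf PZ v)" by (simp add: emeasure_pmf_single)
    finally show ?thesis using TZ[OF True] by simp
  qed simp
  have "mean CU (\<lambda>cu. mean CZ (\<lambda>cz. of_bool (accU (uu cu l) p) * (of_bool (accZ (uu cu l) p (vv cz t)) * of_bool (TZ (vv cz t) \<and> cz (j, k', t') = vv cz t))))
   = mean (PU (com1 p)) (\<lambda>u. mean PZ (\<lambda>v. mean PZ (\<lambda>v'. of_bool (accU u p) * (of_bool (accZ u p v) * of_bool (TZ v \<and> v' = v)))))"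
    unfolding uu_def vv_def using k' t idx by (subst CZ_two) (auto simp: CU_one[OF l, where f="\<lambda>u. mean PZ (\<lambda>v. mean PZ (\<lambda>v'. of_bool (accU u p) * (of_bool (accZ u p v) * of_bool (TZ v \<and> v' = v))))"])
  also have "\<dots> \<le> AU * (AZ * mean (QU p) (\<lambda>u. mean (QZ u p) (\<lambda>v. mean PZ (\<lambda>v'. of_bool (TZ v \<and> v' = v)))))"
    using dominate_uv[where f="\<lambda>u v. mean PZ (\<lambda>v'. of_bool (TZ v \<and> v' = v))"] by (simp only: nn_cmult)
  also have "\<dots> \<le> AU * (AZ * BZ)" by (intro mult_left_mono nn_le_const b) auto
  finally show ?thesis .
qed

lemma accept_gbad:
  assumes l: "l \<in> LM" and t: "t < T"
  shows "mean CU (\<lambda>cu. mean CZ (\<lambda>cz. of_bool (accU (uu cu l) p) * (of_bool (accZ (uu cu l) p (vv cz t)) * f (uu cu l) (vv cz t)))) \<le> AU * (AZ * mean (QU p) (\<lambda>u. mean (QZ u p) (\<lambda>v. f u v)))"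
proof -
  have "mean CU (\<lambda>cu. mean CZ (\<lambda>cz. of_bool (accU (uu cu l) p) * (of_bool (accZ (uu cu l) p (vv cz t)) * f (uu cu l) (vv cz t))))
   = mean (PU (com1 p)) (\<lambda>u. mean PZ (\<lambda>v. of_bool (accU u p) * (of_bool (accZ u p v) * f u v)))"
    unfolding uu_def vv_def using t by (subst CZ_one) (auto simp: CU_one[OF l, where f="\<lambda>u. mean PZ (\<lambda>v. of_bool (accU u p) * (of_bool (accZ u p v) * f u v))"])
  then show ?thesis using dominate_uv by simp
qed

text \<open>Both the transmitted and the competing pair are accepted candidates. The measure is
  changed for each of them, and the sum over the competing candidates turns its factors into
  \<open>cU * cZ\<close>.\<close>

lemma accept_s7:
  assumes l: "l \<in> LM" and t: "t < T"
  shows "mean CU (\<lambda>cu. mean CZ (\<lambda>cz. of_bool (accU (uu cu l) p) * (of_bool (accZ (uu cu l) p (vv cz t)) * s7 cu cz (uu cu l) (vv cz t)))) \<le> of_nat ((J - 1) * A * C) * (AU * (AZ * (cU * cZ * D4)))"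
proof -
  define g where "g u v u' v' = mean (QX1 u p v) (\<lambda>x1. mean (QX2 u q) (\<lambda>x2. mean (Wn x1 x2 p q) (\<lambda>y. d4 u' v' y)))" for u v u' v'
  have g: "mean (QU p) (\<lambda>u'. mean (QZ u' p) (\<lambda>v'. g u v u' v')) \<le> D4" for u v
    unfolding g_def by (subst mean_swap, rule nn_le_const)+ (unfold d4_def, rule D4)
  define F where "F u v u' v' = of_bool (accU u p) * (of_bool (accZ u p v) * (of_bool (accU u' p) * (of_bool (accZ u' p v') * g u v u' v')))" for u v u' v'
  have 1: "mean CU (\<lambda>cu. mean CZ (\<lambda>cz. F (uu cu l) (vv cz t) (cu (j', l', com1 p)) (cz (j', k, t')))) \<le> AU * (AZ * (AU * (AZ * D4)))"
    if j': "j' \<in> {..<J} - {j}" and l': "l' \<in> LM" and t': "t' \<in> {..<T}" for j' l' t'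
  proof -
    have "mean CU (\<lambda>cu. mean CZ (\<lambda>cz. F (uu cu l) (vv cz t) (cu (j', l', com1 p)) (cz (j', k, t'))))
      = mean CU (\<lambda>cu. mean PZ (\<lambda>v. mean PZ (\<lambda>v'. F (uu cu l) v (cu (j', l', com1 p)) v')))"
      unfolding vv_def using j' t t' idx by (intro nn_integral_cong CZ_two) auto
    also have "\<dots> = mean (PU (com1 p)) (\<lambda>u. mean (PU (com1 p)) (\<lambda>u'. mean PZ (\<lambda>v. mean PZ (\<lambda>v'. F u v u' v'))))"
      unfolding uu_def using j' l l' by (intro CU_two[where f="\<lambda>u u'. mean PZ (\<lambda>v. mean PZ (\<lambda>v'. F u v u' v'))"]) auto
    also have "\<dots> = mean (PU (com1 p)) (\<lambda>u. mean PZ (\<lambda>v. mean (PU (com1 p)) (\<lambda>u'. mean PZ (\<lambda>v'. F u v u' v'))))"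
      by (intro nn_integral_cong nn_integral_pmf_swap)
    also have "\<dots> \<le> mean (PU (com1 p)) (\<lambda>u. mean PZ (\<lambda>v. of_bool (accU u p) * (of_bool (accZ u p v) * (AU * (AZ * D4)))))"
    proof (intro nn_integral_mono)
      fix u v
      have "mean (PU (com1 p)) (\<lambda>u'. mean PZ (\<lambda>v'. F u v u' v'))
         = of_bool (accU u p) * (of_bool (accZ u p v) * mean (PU (com1 p)) (\<lambda>u'. mean PZ (\<lambda>v'. of_bool (accU u' p) * (of_bool (accZ u' p v') * g u v u' v'))))" unfolding F_def nn_cmult ..
      also have "\<dots> \<le> of_bool (accU u p) * (of_bool (accZ u p v) * (AU * (AZ * D4)))"
        by (intro mult_left_mono order_trans[OF dominate_uv] g) auto
      finally show "mean (PU (com1 p)) (\<lambda>u'. mean PZ (\<lambda>v'. F u v u' v')) \<le> of_bool (accU u p) * (of_bool (accZ u p v) * (AU * (AZ * D4)))" .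
    qed
    also have "\<dots> \<le> AU * (AZ * (AU * (AZ * D4)))" by (rule order_trans[OF dominate_uv]) simp
    finally show ?thesis .
  qed
  have e: "of_bool (accU (uu cu l) p) * (of_bool (accZ (uu cu l) p (vv cz t)) * s7 cu cz (uu cu l) (vv cz t))
    = (\<Sum>j'\<in>{..<J} - {j}. \<Sum>a'\<in>{..<A}. \<Sum>c'\<in>{..<C}. \<Sum>l'\<in>LM. \<Sum>t'\<in>{..<T}. F (uu cu l) (vv cz t) (cu (j', l', com1 p)) (cz (j', k, t')))" for cu cz
    unfolding s7_def F_def g_def by (simp only: sum_distrib_left)
  have "mean CU (\<lambda>cu. mean CZ (\<lambda>cz. of_bool (accU (uu cu l) p) * (of_bool (accZ (uu cu l) p (vv cz t)) * s7 cu cz (uu cu l) (vv cz t)))) \<le> (\<Sum>j'\<in>{..<J} - {j}. \<Sum>a'\<in>{..<A}. \<Sum>c'\<in>{..<C}. \<Sum>l'\<in>LM. \<Sum>t'\<in>{..<T}. AU * (AZ * (AU * (AZ * D4))))"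
    unfolding e nn_sum by (intro sum_mono 1)
  also have "\<dots> = of_nat ((J - 1) * A * C) * (AU * (AZ * (cU * cZ * D4)))"
    using idx by (simp add: card_Diff_singleton LM_def cU_def cZ_def mult_ac)
  finally show ?thesis .
qed

lemma integral_Phi: "mean CU (\<lambda>cu. mean CZ (\<lambda>cz. mean C1 (\<lambda>c1. mean C2 (\<lambda>c2. Phi cu cz c1 c2)))) \<le> err_bound p q"
proof -
  let ?u = "\<lambda>cu l. of_bool (accU (uu cu l) p) :: ennreal" and ?v = "\<lambda>cu cz l t. of_bool (accZ (uu cu l) p (vv cz t)) :: ennreal"
  have A: "mean CU (\<lambda>cu. mean CZ (\<lambda>cz. ?u cu l * of_bool (\<forall>t\<in>{..<T}. \<not> accZ (uu cu l) p (vv cz t))))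
    \<le> AU * mean (QU p) (\<lambda>u. naZ u p ^ T)" if l: "l \<in> LM" for l
  proof -
    have "mean CU (\<lambda>cu. mean CZ (\<lambda>cz. ?u cu l * of_bool (\<forall>t\<in>{..<T}. \<not> accZ (uu cu l) p (vv cz t))))
       = mean (PU (com1 p)) (\<lambda>u. of_bool (accU u p) * naZ u p ^ T)"
      unfolding nn_cmult CZ_none unfolding uu_def by (rule CU_one[OF l, where f="\<lambda>u. of_bool (accU u p) * naZ u p ^ T"])
    also have "\<dots> \<le> AU * mean (QU p) (\<lambda>u. naZ u p ^ T)" by (intro nn_integral_dominate accU)
    finally show ?thesis .
  qed
  have B: "mean CU (\<lambda>cu. mean CZ (\<lambda>cz. ?u cu l * of_bool (T2 (uu cu (fst l, m')) q))) \<le> AU * B2"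
    if l: "l \<in> LM" and m': "m' \<in> {..<M} - {snd l}" for l m'
  proof -
    have "mean CU (\<lambda>cu. mean CZ (\<lambda>cz. ?u cu l * of_bool (T2 (uu cu (fst l, m')) q)))
       = mean (PU (com1 p)) (\<lambda>u. mean (PU (com1 p)) (\<lambda>u'. of_bool (accU u p) * of_bool (T2 u' q)))"
      unfolding nn_const uu_def using l m' idx
      by (intro CU_two[where f="\<lambda>u u'. of_bool (accU u p) * of_bool (T2 u' q)"]) (auto simp: LM_def)
    also have "\<dots> \<le> mean (PU (com1 p)) (\<lambda>u. of_bool (accU u p) * B2)"
      unfolding nn_cmult mem(4)[symmetric] by (intro nn_integral_mono mult_left_mono T2) simp
    also have "\<dots> \<le> AU * B2" by (rule order_trans[OF nn_integral_dominate[OF accU]]) (simp_all only: nn_const order_refl)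
    finally show ?thesis .
  qed
  have C: "mean CU (\<lambda>cu. mean CZ (\<lambda>cz. ?u cu l * (?v cu cz l t * (gbad (uu cu l) (vv cz t) + E1))))
     \<le> AU * (AZ * (bad p q + E1))" if l: "l \<in> LM" and t: "t \<in> {..<T}" for l t
    using accept_gbad[OF l, of t "\<lambda>u v. gbad u v + E1"] t unfolding nn_add nn_const bad_def gbad_def by simp
  have "mean CU (\<lambda>cu. mean CZ (\<lambda>cz. mean C1 (\<lambda>c1. mean C2 (\<lambda>c2. Phi cu cz c1 c2))))
    \<le> mean CU (\<lambda>cu. mean CZ (\<lambda>cz. (of_bool (\<forall>l\<in>LM. \<not> accU (uu cu l) p)
   + (\<Sum>l\<in>LM. of_bool (accU (uu cu l) p) *
     (of_bool (\<forall>t\<in>{..<T}. \<not> accZ (uu cu l) p (vv cz t))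
    + (\<Sum>m'\<in>{..<M} - {snd l}. of_bool (T2 (uu cu (fst l, m')) q))
    + (\<Sum>t\<in>{..<T}. of_bool (accZ (uu cu l) p (vv cz t)) *
        ((\<Sum>k'\<in>{..<K} - {k}. \<Sum>t'\<in>{..<T}. of_bool (TZ (vv cz t) \<and> cz (j, k', t') = vv cz t))
       + (gbad (uu cu l) (vv cz t) + E1 + s7 cu cz (uu cu l) (vv cz t)))))))))"
    by (intro nn_integral_pmf_mono inner_Phi)
  also have "\<dots> = mean CU (\<lambda>cu. mean CZ (\<lambda>cz. (of_bool (\<forall>l\<in>LM. \<not> accU (uu cu l) p)
   + (\<Sum>l\<in>LM. ?u cu l * of_bool (\<forall>t\<in>{..<T}. \<not> accZ (uu cu l) p (vv cz t))
    + (\<Sum>m'\<in>{..<M} - {snd l}. ?u cu l * of_bool (T2 (uu cu (fst l, m')) q))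
    + (\<Sum>t\<in>{..<T}.
        (\<Sum>k'\<in>{..<K} - {k}. \<Sum>t'\<in>{..<T}. ?u cu l * (?v cu cz l t * of_bool (TZ (vv cz t) \<and> cz (j, k', t') = vv cz t)))
       + (?u cu l * (?v cu cz l t * (gbad (uu cu l) (vv cz t) + E1)) + ?u cu l * (?v cu cz l t * s7 cu cz (uu cu l) (vv cz t))))))))"
    by (simp only: sum_distrib_left distrib_left)
  also have "\<dots> \<le> naU p ^ (L * M) + (\<Sum>l\<in>LM. AU * mean (QU p) (\<lambda>u. naZ u p ^ T)
     + (\<Sum>m'\<in>{..<M} - {snd l}. AU * B2)
     + (\<Sum>t\<in>{..<T}. (\<Sum>k'\<in>{..<K} - {k}. \<Sum>t'\<in>{..<T}. AU * (AZ * BZ)) + (AU * (AZ * (bad p q + E1)) + of_nat ((J - 1) * A * C) * (AU * (AZ * (cU * cZ * D4))))))"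
    unfolding nn_add nn_sum nn_const[where P=CZ] CU_none
    by (intro add_mono sum_mono order_refl A B[unfolded nn_const] C accept_kterm accept_s7) auto
  also have "\<dots> = (naU p ^ (L * M) + (\<Sum>l\<in>LM. AU * mean (QU p) (\<lambda>u. naZ u p ^ T)
     + of_nat (M - 1) * (AU * B2)
     + of_nat T * (of_nat ((K - 1) * T) * (AU * (AZ * BZ)) + (AU * (AZ * (bad p q + E1)) + of_nat ((J - 1) * A * C) * (AU * (AZ * (cU * cZ * D4)))))))"
    using idx by (intro arg_cong2[where f="(+)"] sum.cong refl) (auto simp: card_Diff_singleton LM_def mult.assoc)
  also have "\<dots> = err_bound p q"
    unfolding err_bound_def E1_def LM_def cU_def cZ_def
    by (simp only: sum_constant card_cartesian_product card_lessThan distrib_left mult_ac add_ac)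
  finally show ?thesis .
qed

end

end

section \<open>The code read off a codebook, and its error\<close>

definition "lsel cu j p = (if \<exists>l\<in>LM. accU (cu (j, l, com1 p)) p then SOME l. l \<in> LM \<and> accU (cu (j, l, com1 p)) p else (0, 0))"
definition "us cu j p = cu (j, lsel cu j p, com1 p)"
definition "tsel cu cz j p k = (SOME t. t < T \<and> accZ (us cu j p) p (cz (j, k, t)))"
definition "vs cu cz j p k = cz (j, k, tsel cu cz j p k)"
definition "enc1 cu cz c1 j p k a = c1 (j, a, us cu j p, p, vs cu cz j p k)"
definition "uhat cu j b q = cu (j, (b, SOME m. m < M \<and> T2 (cu (j, (b, m), com2 q)) q), com2 q)"
definition "enc2 cu c2 j b q c = c2 (j, c, uhat cu j b q, q)"
definition "read_crib cz j v = (SOME k. k < K \<and> (\<exists>t<T. cz (j, k, t) = v))"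
text \<open>Knowing the states and \<open>k\<close>, the decoder can repeat the selections of
  encoder 1 for every \<open>j\<close>. So it searches only over \<open>j\<close>, \<open>a\<close>
  and \<open>c\<close>.\<close>

definition "valid cu cz c1 c2 p q k y = (\<lambda>(j, a, c). j < J \<and> a < A \<and> c < C \<and> lsel cu j p \<in> LM \<and> tsel cu cz j p k < T \<and>
   accU (us cu j p) p \<and> accZ (us cu j p) p (vs cu cz j p k) \<and>
   D p q (us cu j p) (vs cu cz j p k) (c1 (j, a, us cu j p, p, vs cu cz j p k)) (c2 (j, c, us cu j p, q)) y)"
definition "decode cu cz c1 c2 y p q k = (case (SOME w. valid cu cz c1 c2 p q k y w) of (j, a, c) \<Rightarrow> (j, fst (lsel cu j p), a, c))"

lemma lsel_less: "fst (lsel cu j p) < L"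
proof (cases "\<exists>l\<in>LM. accU (cu (j, l, com1 p)) p")
  case True
  then have "lsel cu j p \<in> LM" unfolding lsel_def using someI_ex[of "\<lambda>l. l \<in> LM \<and> accU (cu (j, l, com1 p)) p"] by auto
  then show ?thesis by (auto simp: LM_def)
next
  case False
  then show ?thesis using pos by (simp add: lsel_def)
qed

lemma one_le_sum:
  fixes f :: "'b \<Rightarrow> ennreal"
  assumes "finite S" "i \<in> S" "1 \<le> f i"
  shows "1 \<le> sum f S"
  using assms(3) member_le_sum[OF assms(2) _ assms(1), of f] by (auto intro: order_trans)

text \<open>The triple picked by the decoder is valid and differs from the true one. With the same
  \<open>j\<close> it shares \<open>u\<close> and \<open>v\<close> and is counted in
  \<open>comp1\<close>; with another \<open>j\<close> it is counted in \<open>comp2\<close>.\<close>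

lemma decode_wrong:
  assumes l: "l = lsel cu j p" "l \<in> LM" and t: "t = tsel cu cz j p k" "t < T"
    and u: "u = us cu j p" and v: "v = vs cu cz j p k"
    and acc: "accU u p" "accZ u p v" and idx: "j < J" "k < K" "a < A" "c < C"
    and D: "D p q u v (c1 (j, a, u, p, v)) (c2 (j, c, u, q)) y"
    and wrong: "decode cu cz c1 c2 y p q k \<noteq> (j, fst l, a, c)"
  shows "1 \<le> comp1 j a c p q c1 c2 u v (c1 (j, a, u, p, v)) (c2 (j, c, u, q)) y + comp2 j k p q cu cz c1 c2 y"
proof -
  have val: "valid cu cz c1 c2 p q k y (j, a, c)"
    using l t acc idx D by (simp add: valid_def u v)
  define w where "w = (SOME w. valid cu cz c1 c2 p q k y w)"
  have w: "valid cu cz c1 c2 p q k y w" unfolding w_def by (rule someI[of "valid cu cz c1 c2 p q k y", OF val])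
  obtain j' a' c' where w': "w = (j', a', c')" by (cases w) auto
  have ne: "(j', a', c') \<noteq> (j, a, c)"
    using wrong l unfolding decode_def w_def[symmetric] w' by auto
  have V: "j' < J" "a' < A" "c' < C" "lsel cu j' p \<in> LM" "tsel cu cz j' p k < T" "accU (us cu j' p) p"
    "accZ (us cu j' p) p (vs cu cz j' p k)"
    "D p q (us cu j' p) (vs cu cz j' p k) (c1 (j', a', us cu j' p, p, vs cu cz j' p k)) (c2 (j', c', us cu j' p, q)) y"
    using w unfolding w' valid_def by auto
  show ?thesis
  proof (cases "j' = j")
    case True
    have D': "D p q u v (c1 (j, a', u, p, v)) (c2 (j, c', u, q)) y" using V(8) by (simp add: True u v)
    have "1 \<le> comp1 j a c p q c1 c2 u v (c1 (j, a, u, p, v)) (c2 (j, c, u, q)) y"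
    proof (cases "c' = c")
      case c: True
      then have "1 \<le> (\<Sum>a'\<in>{..<A} - {a}. of_bool (D p q u v (c1 (j, a', u, p, v)) (c2 (j, c, u, q)) y) :: ennreal)"
        using ne True V D' by (intro one_le_sum[of _ a']) auto
      then show ?thesis unfolding comp1_def by (simp add: add.assoc add_increasing2)
    next
      case c: False
      show ?thesis
      proof (cases "a' = a")
        case a: True
        then have "1 \<le> (\<Sum>c'\<in>{..<C} - {c}. of_bool (D p q u v (c1 (j, a, u, p, v)) (c2 (j, c', u, q)) y) :: ennreal)"
          using c V D' by (intro one_le_sum[of _ c']) auto
        then show ?thesis unfolding comp1_def by (simp add: add_increasing add_increasing2)
      next
        case a: False
        then have "1 \<le> (\<Sum>a'\<in>{..<A} - {a}. \<Sum>c'\<in>{..<C} - {c}. of_bool (D p q u v (c1 (j, a', u, p, v)) (c2 (j, c', u, q)) y) :: ennreal)"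
          using c V D' by (intro one_le_sum[of _ a'] one_le_sum[of _ c']) auto
        then show ?thesis unfolding comp1_def by (simp add: add_increasing)
      qed
    qed
    then show ?thesis by (rule order_trans) simp
  next
    case False
    have "1 \<le> comp2 j k p q cu cz c1 c2 y" unfolding comp2_def
      using V False finite_sets
      by (intro one_le_sum[of _ j'] one_le_sum[of _ a'] one_le_sum[of _ c'] one_le_sum[of _ "lsel cu j' p"] one_le_sum[of _ "tsel cu cz j' p k"])
        (auto simp: us_def vs_def)
    then show ?thesis by (rule order_trans) simp
  qed
qed

definition "code_error cu cz c1 c2 j k a c p q =
  (if read_crib cz j (zf (enc1 cu cz c1 j p k a) p) \<noteq> k then 1
   else emeasure (Wn (enc1 cu cz c1 j p k a) (enc2 cu c2 j (fst (lsel cu j p)) q c) p q)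
     {y. decode cu cz c1 c2 y p q k \<noteq> (j, fst (lsel cu j p), a, c)})"

lemma code_error_le_1: "code_error cu cz c1 c2 j k a c p q \<le> 1"
  unfolding code_error_def by (simp add: measure_pmf.emeasure_le_1)

text \<open>Each early failure makes a summand of \<open>Phi\<close> at least 1, and an error never
  exceeds 1. If none occurs, encoder 2 finds the right \<open>u\<close> in the bin, the crib gives
  the right \<open>k\<close>, and only decoding errors remain.\<close>

lemma code_error_le:
  assumes idx: "j < J" "k < K" "a < A" "c < C" and pq: "(p, q) \<in> set_pmf PS"
    and cu: "cu \<in> set_pmf CU" and cz: "cz \<in> set_pmf CZ" and c1: "c1 \<in> set_pmf C1"
  shows "code_error cu cz c1 c2 j k a c p q \<le> Phi j k a c p q cu cz c1 c2"
proof (cases "\<exists>l\<in>LM. accU (cu (j, l, com1 p)) p")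
  case False
  then have "1 \<le> Phi j k a c p q cu cz c1 c2" unfolding Phi_def uu_def by simp
  then show ?thesis using code_error_le_1 by (rule order_trans[rotated])
next
  case True
  define l where "l = lsel cu j p"
  define u where "u = us cu j p"
  have l: "l \<in> LM" and accu: "accU u p"
    using True someI_ex[of "\<lambda>l. l \<in> LM \<and> accU (cu (j, l, com1 p)) p"] unfolding l_def u_def us_def lsel_def by auto
  have ul: "uu j p cu l = u" by (simp add: uu_def l_def u_def us_def)
  define t where "t = tsel cu cz j p k"
  define v where "v = vs cu cz j p k"
  have vt: "vv j k cz t = v" by (simp add: vv_def v_def vs_def t_def)
  define x1 where "x1 = c1 (j, a, u, p, v)"
  define x2 where "x2 = c2 (j, c, u, q)"
  define R where "R = mean (Wn x1 x2 p q) (\<lambda>y. of_bool (\<not> good p q u v x1 x2 y) + comp1 j a c p q c1 c2 u v x1 x2 y + comp2 j k p q cu cz c1 c2 y)"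
  define b1 b2 b3 where "b1 = (of_bool (\<forall>t\<in>{..<T}. \<not> accZ u p (vv j k cz t)) :: ennreal)"
    and "b2 = (\<Sum>m'\<in>{..<M} - {snd l}. of_bool (T2 (uu j p cu (fst l, m')) q) :: ennreal)"
    and "b3 = (\<Sum>k'\<in>{..<K} - {k}. \<Sum>t'\<in>{..<T}. of_bool (TZ v \<and> cz (j, k', t') = v) :: ennreal)"
  let ?G = "\<lambda>l t. of_bool (accZ (uu j p cu l) p (vv j k cz t)) *
        ((\<Sum>k'\<in>{..<K} - {k}. \<Sum>t'\<in>{..<T}. of_bool (TZ (vv j k cz t) \<and> cz (j, k', t') = vv j k cz t))
       + mean (Wn (c1 (j, a, uu j p cu l, p, vv j k cz t)) (c2 (j, c, uu j p cu l, q)) p q) (\<lambda>y. of_bool (\<not> good p q (uu j p cu l) (vv j k cz t) (c1 (j, a, uu j p cu l, p, vv j k cz t)) (c2 (j, c, uu j p cu l, q)) y)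
            + comp1 j a c p q c1 c2 (uu j p cu l) (vv j k cz t) (c1 (j, a, uu j p cu l, p, vv j k cz t)) (c2 (j, c, uu j p cu l, q)) y
            + comp2 j k p q cu cz c1 c2 y))"
  let ?F = "\<lambda>l. of_bool (accU (uu j p cu l) p) *
     (of_bool (\<forall>t\<in>{..<T}. \<not> accZ (uu j p cu l) p (vv j k cz t))
    + (\<Sum>m'\<in>{..<M} - {snd l}. of_bool (T2 (uu j p cu (fst l, m')) q))
    + (\<Sum>t\<in>{..<T}. ?G l t))"
  have "?F l \<le> (\<Sum>l\<in>LM. ?F l)" using finite_sets(6) by (intro member_le_sum l) auto
  then have le0: "?F l \<le> Phi j k a c p q cu cz c1 c2" unfolding Phi_def by (rule order_trans) simp
  have Fl: "?F l = b1 + b2 + (\<Sum>t\<in>{..<T}. ?G l t)" by (simp only: ul accu b1_def b2_def of_bool_eq mult_1_left simp_thms)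
  show ?thesis
  proof (cases "(\<forall>t\<in>{..<T}. \<not> accZ u p (vv j k cz t)) \<or> (\<exists>m'\<in>{..<M} - {snd l}. T2 (uu j p cu (fst l, m')) q)")
    case True
    then have "1 \<le> b1 + b2"
    proof
      assume "\<forall>t\<in>{..<T}. \<not> accZ u p (vv j k cz t)" then show ?thesis by (simp add: b1_def)
    next
      assume "\<exists>m'\<in>{..<M} - {snd l}. T2 (uu j p cu (fst l, m')) q"
      then obtain m' where "m' \<in> {..<M} - {snd l}" "T2 (uu j p cu (fst l, m')) q" by blast
      then have "1 \<le> b2" unfolding b2_def by (intro one_le_sum[of _ m']) auto
      then show ?thesis by (rule order_trans) simp
    qed
    then have "1 \<le> ?F l" unfolding Fl by (rule order_trans) simp
    then show ?thesis using le0 code_error_le_1[of cu cz c1 c2 j k a c p q] by (meson order_trans)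
  next
    case False
    then obtain t0 where "t0 < T" "accZ u p (vv j k cz t0)" by auto
    then have t: "t < T" and accz: "accZ u p v"
      using someI[of "\<lambda>t. t < T \<and> accZ (us cu j p) p (cz (j, k, t))" t0]
      unfolding t_def v_def vs_def u_def tsel_def vv_def by auto
    have "?G l t \<le> (\<Sum>t\<in>{..<T}. ?G l t)" using t by (intro member_le_sum) auto
    then have "?G l t \<le> ?F l" unfolding Fl by (rule add_increasing[OF zero_le])
    moreover have Glt: "?G l t = b3 + R" by (simp only: ul vt accz b3_def R_def x1_def x2_def of_bool_eq mult_1_left)
    ultimately have "b3 + R \<le> ?F l" by (simp only: Glt)
    then have le1: "b3 + R \<le> Phi j k a c p q cu cz c1 c2" using le0 by (rule order_trans)
    show ?thesis
    proof (cases "T2 u q \<and> TZ v")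
      case False
      have "mean (Wn x1 x2 p q) (\<lambda>y. 1) \<le> R" unfolding R_def
        by (intro nn_integral_mono) (use False in \<open>auto simp: good_def add.assoc\<close>)
      then have "1 \<le> R" by simp
      then have "1 \<le> b3 + R" by (rule order_trans) simp
      then show ?thesis using le1 code_error_le_1[of cu cz c1 c2 j k a c p q] by (meson order_trans)
    next
      case T: True
      show ?thesis
      proof (cases "\<exists>k'\<in>{..<K} - {k}. \<exists>t'\<in>{..<T}. cz (j, k', t') = v")
        case True
        then obtain k' t' where k': "k' \<in> {..<K} - {k}" "t' \<in> {..<T}" "cz (j, k', t') = v" by blast
        then have "1 \<le> b3" unfolding b3_def using T by (intro one_le_sum[of _ k'] one_le_sum[of _ t']) auto
        then have "1 \<le> b3 + R" by (rule order_trans) simp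
        then show ?thesis using le1 code_error_le_1[of cu cz c1 c2 j k a c p q] by (meson order_trans)
      next
        case uniq: False
        have com: "com2 q = com1 p" using common[OF pq] by simp
        have "(SOME m. m < M \<and> T2 (cu (j, (fst l, m), com2 q)) q) = snd l"
        proof (rule some_equality)
          show "snd l < M \<and> T2 (cu (j, (fst l, snd l), com2 q)) q"
            using l T by (auto simp: LM_def com u_def us_def l_def)
          show "m = snd l" if "m < M \<and> T2 (cu (j, (fst l, m), com2 q)) q" for m
            using that False by (auto simp: uu_def com)
        qed
        then have uh: "uhat cu j (fst l) q = u" by (simp add: uhat_def com u_def us_def l_def)
        have uS: "u \<in> SU" using CU_mem[OF idx pq cu idx(1) l] unfolding u_def us_def l_def .
        have vS: "v \<in> SV" using CZ_mem[OF idx pq cz idx(1,2) t] unfolding v_def vs_def t_def .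
        have u_pu: "u \<in> set_pmf (PU (com1 p))"
          using cu l idx mem(3)[OF idx pq] unfolding CU_def u_def us_def l_def[symmetric]
          using finite_sets(7) by (cases l) (auto simp: set_Pi_pmf PiE_dflt_def IU_def)
        \<comment> \<open>By acceptance, a word of positive probability under the codebook law also
          has positive probability under the ideal law. The same holds for \<open>v\<close>, so
          \<open>zf\<close> applies.\<close>
        have uq: "u \<in> set_pmf (QU p)"
        proof (rule ccontr)
          assume "u \<notin> set_pmf (QU p)"
          then show False using accU[OF accu] u_pu by (simp add: set_pmf_iff)
        qed
        have vq: "v \<in> set_pmf (QZ u p)"
        proof (rule ccontr)
          assume "v \<notin> set_pmf (QZ u p)"
          then show False using accZ[OF accz] vS by (simp add: set_pmf_iff SV_def)
        qed
        have i1: "(j, a, u, p, v) \<in> I1" using idx uS vS mem(1)[OF idx pq] by (auto simp: I1_def)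
        have "x1 \<in> set_pmf (QX1 u p v)"
          using c1 i1 finite_sets(9) unfolding x1_def C1_def by (force simp: set_Pi_pmf PiE_dflt_def)
        then have zf': "zf x1 p = v" using zf uq vq by blast
        have e1: "enc1 cu cz c1 j p k a = x1" by (simp add: enc1_def x1_def u_def v_def)
        have e2: "enc2 cu c2 j (fst (lsel cu j p)) q c = x2" using uh by (simp add: enc2_def x2_def l_def)
        have rc: "read_crib cz j v = k" unfolding read_crib_def
        proof (rule some_equality)
          show "k < K \<and> (\<exists>t<T. cz (j, k, t) = v)" using idx t by (auto simp: v_def vs_def t_def)
          show "k' = k" if "k' < K \<and> (\<exists>t<T. cz (j, k', t) = v)" for k' using that uniq by auto
        qed
        have "code_error cu cz c1 c2 j k a c p q = mean (Wn x1 x2 p q) (\<lambda>y. indicator {y. decode cu cz c1 c2 y p q k \<noteq> (j, fst l, a, c)} y)"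
          unfolding code_error_def e1 e2 zf' rc by (simp add: l_def)
        also have "\<dots> \<le> R" unfolding R_def
        proof (rule nn_integral_mono)
          fix y
          show "indicator {y. decode cu cz c1 c2 y p q k \<noteq> (j, fst l, a, c)} y
             \<le> of_bool (\<not> good p q u v x1 x2 y) + comp1 j a c p q c1 c2 u v x1 x2 y + comp2 j k p q cu cz c1 c2 y"
          proof (cases "D p q u v x1 x2 y \<and> decode cu cz c1 c2 y p q k \<noteq> (j, fst l, a, c)")
            case True
            have "1 \<le> comp1 j a c p q c1 c2 u v x1 x2 y + comp2 j k p q cu cz c1 c2 y"
              unfolding x1_def x2_def
              by (rule decode_wrong[OF l_def l t_def t u_def v_def accu accz idx]) (use True in \<open>auto simp: x1_def x2_def\<close>)
            then show ?thesis by (auto simp: indicator_def add.assoc intro: add_increasing)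
          next
            case False
            then show ?thesis by (auto simp: good_def indicator_def add.assoc)
          qed
        qed
        also have "R \<le> b3 + R" by simp
        also note le1
        finally show ?thesis .
      qed
    qed
  qed
qed

theorem exists_code:
  assumes \<delta>: "mean PS (\<lambda>s. err_bound (fst s) (snd s)) \<le> \<delta>" "\<delta> < \<top>"
  shows "\<exists>e1 bt e2 h dec. (\<forall>j p. bt j p < L) \<and>
    (mean (pmf_of_set (indices J L A C)) (\<lambda>r. mean PS (\<lambda>s. (case r of (j, k, a, c) \<Rightarrow> case s of (p, q) \<Rightarrow>
        if h j (zf (e1 j p k a) p) \<noteq> k then 1
        else emeasure (Wn (e1 j p k a) (e2 j (bt j p) q c) p q) {y. dec y p q k \<noteq> (j, bt j p, a, c)})))) \<le> \<delta>"
proof -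
  define RR where "RR = pmf_of_set (indices J L A C)"
  define G where "G = pair_pmf CU (pair_pmf CZ (pair_pmf C1 C2))"
  define f where "f g r s = (case g of (cu, cz, c1, c2) \<Rightarrow> case r of (j, k, a, c) \<Rightarrow> case s of (p, q) \<Rightarrow> code_error cu cz c1 c2 j k a c p q)"
    for g :: "_ \<times> _ \<times> _ \<times> _" and r :: "nat \<times> nat \<times> nat \<times> nat" and s
  have setR: "set_pmf RR = indices J L A C"
    unfolding RR_def by (rule set_pmf_of_set) (use pos in \<open>auto simp: lessThan_empty_iff\<close>)
  have 1: "mean G (\<lambda>g. f g r s) \<le> err_bound (fst s) (snd s)" if r: "r \<in> set_pmf RR" and s: "s \<in> set_pmf PS" for r s
  proof -
    obtain j k a c where r': "r = (j, k, a, c)" by (cases r) auto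
    obtain p q where s': "s = (p, q)" by (cases s) auto
    have idx: "j < J" "k < K" "a < A" "c < C" using r unfolding setR r' by (auto simp: K_def)
    have pq: "(p, q) \<in> set_pmf PS" using s by (simp add: s')
    have "mean G (\<lambda>g. f g r s) = mean CU (\<lambda>cu. mean CZ (\<lambda>cz. mean C1 (\<lambda>c1. mean C2 (\<lambda>c2. code_error cu cz c1 c2 j k a c p q))))"
      unfolding G_def f_def r' s' by (simp add: nn_integral_pair_pmf')
    also have "\<dots> \<le> mean CU (\<lambda>cu. mean CZ (\<lambda>cz. mean C1 (\<lambda>c1. mean C2 (\<lambda>c2. Phi j k a c p q cu cz c1 c2))))"
      by (intro nn_integral_pmf_mono code_error_le idx pq)
    also have "\<dots> \<le> err_bound p q" by (rule integral_Phi[OF idx pq])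
    finally show ?thesis by (simp add: s')
  qed
  have "mean G (\<lambda>g. mean RR (\<lambda>r. mean PS (\<lambda>s. f g r s)))
     = mean RR (\<lambda>r. mean G (\<lambda>g. mean PS (\<lambda>s. f g r s)))" by (rule nn_integral_pmf_swap)
  also have "\<dots> = mean RR (\<lambda>r. mean PS (\<lambda>s. mean G (\<lambda>g. f g r s)))"
    by (intro nn_integral_cong nn_integral_pmf_swap)
  also have "\<dots> \<le> mean RR (\<lambda>r. mean PS (\<lambda>s. err_bound (fst s) (snd s)))"
    by (intro nn_integral_pmf_mono 1)
  also have "\<dots> \<le> \<delta>" using \<delta>(1) by (simp add: nn_const)
  finally obtain g where g: "mean RR (\<lambda>r. mean PS (\<lambda>s. f g r s)) \<le> \<delta>"
    using exists_le_nn_integral_pmf[OF _ \<delta>(2)] by blast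
  obtain cu cz c1 c2 where g': "g = (cu, cz, c1, c2)" by (cases g) auto
  show ?thesis
  proof (intro exI conjI allI)
    show "fst (lsel cu j p) < L" for j p by (rule lsel_less)
    show "mean (pmf_of_set (indices J L A C)) (\<lambda>r. mean PS (\<lambda>s. (case r of (j, k, a, c) \<Rightarrow> case s of (p, q) \<Rightarrow>
        if read_crib cz j (zf (enc1 cu cz c1 j p k a) p) \<noteq> k then 1
        else emeasure (Wn (enc1 cu cz c1 j p k a) (enc2 cu c2 j (fst (lsel cu j p)) q c) p q)
          {y. decode cu cz c1 c2 y p q k \<noteq> (j, fst (lsel cu j p), a, c)}))) \<le> \<delta>"
      using g by (simp only: RR_def f_def g' prod.case code_error_def)
  qed
qed

end

subsection \<open>Exponents of likelihood-ratio tests\<close>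

lemma pmf_bind_map_pair: "pmf (bind_pmf N (\<lambda>v. map_pmf (\<lambda>x. (x, v)) (\<kappa> v))) (x, v) = pmf N v * pmf (\<kappa> v) x"
proof -
  have "pmf (map_pmf (\<lambda>x. (x, v')) (\<kappa> v')) (x, v) = indicator {v} v' * pmf (\<kappa> v) x" for v'
  proof (cases "v' = v")
    case True
    then show ?thesis using pmf_map_inj'[of "\<lambda>x. (x, v)" "\<kappa> v" x] by (simp add: inj_on_def)
  next
    case False
    then show ?thesis by (auto intro: pmf_map_outside)
  qed
  then show ?thesis by (simp add: pmf_bind measure_pmf_single)
qed

lemma kernel_positive:
  assumes P: "map_pmf (\<lambda>w. (X w, V w)) P = bind_pmf (map_pmf V P) (\<lambda>v. map_pmf (\<lambda>x. (x, v)) (\<kappa> v))"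
    and w: "w \<in> set_pmf P"
  shows "0 < pmf (\<kappa> (V w)) (X w)"
proof -
  have "(X w, V w) \<in> set_pmf (map_pmf (\<lambda>w. (X w, V w)) P)" using w by auto
  then have "X w \<in> set_pmf (\<kappa> (V w))" unfolding P by auto
  then show ?thesis by (rule pmf_positive)
qed

lemma hc_kernel_pmf:
  assumes fin: "finite (set_pmf P)"
    and P: "map_pmf (\<lambda>w. (X w, V w)) P = bind_pmf (map_pmf V P) (\<lambda>v. map_pmf (\<lambda>x. (x, v)) (\<kappa> v))"
  shows "hc (set_pmf P) (pmf P) X V = - measure_pmf.expectation P (\<lambda>w. log 2 (pmf (\<kappa> (V w)) (X w)))"
  unfolding expectation_finite_support[OF fin]
proof (rule hc_of_kernel[OF fin])
  show "mass (set_pmf P) (pmf P) (\<lambda>w. (X w, V w)) (X w, V w) = pmf (\<kappa> (V w)) (X w) * mass (set_pmf P) (pmf P) V (V w)" for w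
    unfolding mass_pmf[OF fin] P pmf_bind_map_pair by simp
qed simp

definition pw :: "nat \<Rightarrow> real \<Rightarrow> real" where "pw N x = 2 powr (real N * x)"

abbreviation epw :: "nat \<Rightarrow> real \<Rightarrow> ennreal" where "epw N x \<equiv> ennreal (pw N x)"

lemma pw_pos: "0 < pw N x" by (simp add: pw_def)
lemma pw_add: "pw N x * pw N y = pw N (x + y)" by (simp add: pw_def powr_add distrib_left)
lemma pw_mono: "x \<le> y \<Longrightarrow> pw N x \<le> pw N y" by (simp add: pw_def mult_left_mono)
lemma pw_inverse: "1 / pw N x = pw N (- x)" by (simp add: pw_def powr_minus divide_inverse)
lemma pw_0: "pw N 0 = 1" by (simp add: pw_def)
lemma pw_ge_1: "0 \<le> x \<Longrightarrow> 1 \<le> pw N x" using pw_mono[of 0 x N] by (simp add: pw_0)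

text \<open>The moment generating function is 1 at 0, where its derivative is a positive multiple of
  c minus the mean of \<open>f\<close>, hence negative. It is therefore below 1 at some small
  positive argument.\<close>

lemma chernoff_exponent:
  fixes f :: "'a \<Rightarrow> real"
  assumes fin: "finite (set_pmf P)" and c: "c < measure_pmf.expectation P f"
  shows "\<exists>l>0. measure_pmf.expectation P (\<lambda>w. 2 powr (l * (c - f w))) < 1"
proof -
  define g where "g w = ln 2 * (c - f w)" for w
  define \<phi> where "\<phi> l = (\<Sum>w\<in>set_pmf P. pmf P w * exp (l * g w))" for l
  have "DERIV \<phi> 0 :> (\<Sum>w\<in>set_pmf P. pmf P w * g w)"
    unfolding \<phi>_def by (auto intro!: derivative_eq_intros sum.cong)
  moreover have "(\<Sum>w\<in>set_pmf P. pmf P w * g w) = ln 2 * (c - measure_pmf.expectation P f)"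
    unfolding expectation_finite_support[OF fin] g_def
  proof -
    have "(\<Sum>w\<in>set_pmf P. pmf P w * (ln 2 * (c - f w))) = ln 2 * (c * (\<Sum>w\<in>set_pmf P. pmf P w) - (\<Sum>w\<in>set_pmf P. pmf P w * f w))"
      unfolding sum_distrib_left sum_subtractf[symmetric] by (intro sum.cong refl) (simp add: algebra_simps)
    then show "(\<Sum>w\<in>set_pmf P. pmf P w * (ln 2 * (c - f w))) = ln 2 * (c - (\<Sum>w\<in>set_pmf P. pmf P w * f w))"
      using sum_pmf_eq_1[OF fin order_refl] by simp
  qed
  moreover have "ln 2 * (c - measure_pmf.expectation P f) < 0" using c by (intro mult_pos_neg) auto
  ultimately obtain d where d: "0 < d" "\<And>h. 0 < h \<Longrightarrow> h < d \<Longrightarrow> \<phi> (0 + h) < \<phi> 0"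
    using DERIV_neg_dec_right[of \<phi> _ 0] by metis
  have "\<phi> (d / 2) < \<phi> 0" using d(2)[of "d / 2"] d(1) by simp
  moreover have "\<phi> 0 = 1" unfolding \<phi>_def using sum_pmf_eq_1[OF fin order_refl] by simp
  moreover have "\<phi> (d / 2) = measure_pmf.expectation P (\<lambda>w. 2 powr (d / 2 * (c - f w)))"
    unfolding \<phi>_def expectation_finite_support[OF fin] g_def by (simp add: powr_def mult_ac)
  ultimately show ?thesis using d(1) by (intro exI[of _ "d / 2"]) auto
qed

text \<open>Markov's inequality for a power of the likelihood ratio. The mean over one letter is
  some \<open>r < 1\<close>, and \<open>\<tau> = - log 2 r\<close> serves all block lengths.\<close>

lemma likelihood_tail:
  fixes num den :: "'a \<Rightarrow> real"
  assumes fin: "finite (set_pmf P)" and pos: "\<And>w. w \<in> set_pmf P \<Longrightarrow> 0 < num w" "\<And>w. w \<in> set_pmf P \<Longrightarrow> 0 < den w"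
    and c: "c < measure_pmf.expectation P (\<lambda>w. log 2 (num w / den w))"
  shows "\<exists>\<tau>>0. \<forall>N d. (mean (Pi_pmf {1..N} d (\<lambda>_. P)) (\<lambda>w. of_bool (\<not> (0 < (\<Prod>i\<in>{1..N}. num (w i)) \<and> pw N c * (\<Prod>i\<in>{1..N}. den (w i)) \<le> (\<Prod>i\<in>{1..N}. num (w i)))))) \<le> epw N (- \<tau>)"
proof -
  obtain l where l: "0 < l" "measure_pmf.expectation P (\<lambda>w. 2 powr (l * (c - log 2 (num w / den w)))) < 1"
    using chernoff_exponent[OF fin c] by blast
  define g where "g w = (2 powr c * (den w / num w)) powr l" for w
  have g: "2 powr (l * (c - log 2 (num w / den w))) = g w" if "w \<in> set_pmf P" for w
  proof -
    have "log 2 (den w / num w) = - log 2 (num w / den w)" using pos[OF that] by (simp add: log_divide)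
    then have "2 powr (c - log 2 (num w / den w)) = 2 powr c * 2 powr log 2 (den w / num w)" by (simp add: powr_add[symmetric])
    also have "\<dots> = 2 powr c * (den w / num w)" using pos[OF that] by simp
    finally have e: "2 powr (c - log 2 (num w / den w)) = 2 powr c * (den w / num w)" .
    have "2 powr (l * (c - log 2 (num w / den w))) = (2 powr (c - log 2 (num w / den w))) powr l"
      by (simp only: powr_powr mult.commute)
    then show ?thesis unfolding g_def e .
  qed
  define r where "r = measure_pmf.expectation P g"
  have rlt: "r < 1" using l(2) unfolding r_def expectation_finite_support[OF fin] by (simp add: g)
  have r0: "0 < r"
  proof -
    obtain w where w: "w \<in> set_pmf P" using set_pmf_not_empty[of P] by blast
    have "0 < pmf P w * g w" using w pos[OF w] unfolding g_def by (intro mult_pos_pos pmf_positive) auto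
    also have "\<dots> \<le> (\<Sum>w\<in>set_pmf P. pmf P w * g w)" using fin w by (intro member_le_sum) (auto simp: g_def)
    finally show ?thesis by (simp add: r_def expectation_finite_support[OF fin])
  qed
  have rN: "r ^ N = pw N (- (- log 2 r))" for N
    using r0 by (simp add: pw_def powr_powr[symmetric] mult.commute[of "real N"] powr_realpow)
  have intg: "mean P (\<lambda>w. ennreal (g w)) = ennreal r"
    unfolding r_def by (intro nn_integral_eq_integral integrable_measure_pmf_finite fin) (simp add: g_def)
  have "mean (Pi_pmf {1..N} d (\<lambda>_. P)) (\<lambda>w. of_bool (\<not> (0 < (\<Prod>i\<in>{1..N}. num (w i)) \<and> pw N c * (\<Prod>i\<in>{1..N}. den (w i)) \<le> (\<Prod>i\<in>{1..N}. num (w i))))) \<le> epw N (- (- log 2 r))" for N d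
  proof -
    have "mean (Pi_pmf {1..N} d (\<lambda>_. P)) (\<lambda>w. of_bool (\<not> (0 < (\<Prod>i\<in>{1..N}. num (w i)) \<and> pw N c * (\<Prod>i\<in>{1..N}. den (w i)) \<le> (\<Prod>i\<in>{1..N}. num (w i))))) \<le> mean (Pi_pmf {1..N} d (\<lambda>_. P)) (\<lambda>w. (\<Prod>i\<in>{1..N}. ennreal (g (w i))))"
    proof (rule nn_integral_pmf_mono)
      fix w assume "w \<in> set_pmf (Pi_pmf {1..N} d (\<lambda>_. P))"
      then have w: "w i \<in> set_pmf P" if "i \<in> {1..N}" for i using that by (auto simp: set_Pi_pmf PiE_dflt_def)
      have np: "0 < (\<Prod>i\<in>{1..N}. num (w i))" using pos(1)[OF w] by (intro prod_pos) auto
      have "1 \<le> (\<Prod>i\<in>{1..N}. g (w i))" if "(\<Prod>i\<in>{1..N}. num (w i)) < pw N c * (\<Prod>i\<in>{1..N}. den (w i))"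
      proof -
        have "(\<Prod>i\<in>{1..N}. g (w i)) = (\<Prod>i\<in>{1..N}. 2 powr c * (den (w i) / num (w i))) powr l"
          unfolding g_def using pos w by (subst prod_powr_distrib) (auto simp: less_imp_le)
        also have "(\<Prod>i\<in>{1..N}. 2 powr c * (den (w i) / num (w i))) = pw N c * (\<Prod>i\<in>{1..N}. den (w i)) / (\<Prod>i\<in>{1..N}. num (w i))"
          by (simp only: prod.distrib prod_dividef) (simp add: pw_def powr_powr[symmetric] mult.commute[of "real N"] powr_realpow)
        finally have e: "(\<Prod>i\<in>{1..N}. g (w i)) = (pw N c * (\<Prod>i\<in>{1..N}. den (w i)) / (\<Prod>i\<in>{1..N}. num (w i))) powr l" .
        show ?thesis unfolding e using that np l(1) by (intro ge_one_powr_ge_zero) auto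
      qed
      then show "of_bool (\<not> (0 < (\<Prod>i\<in>{1..N}. num (w i)) \<and> pw N c * (\<Prod>i\<in>{1..N}. den (w i)) \<le> (\<Prod>i\<in>{1..N}. num (w i))))
         \<le> (\<Prod>i\<in>{1..N}. ennreal (g (w i)))"
        using np by (subst prod_ennreal) (auto simp: g_def not_le)
    qed
    also have "\<dots> = (\<Prod>i\<in>{1..N}. mean P (\<lambda>w. ennreal (g w)))" by (rule nn_integral_prod_Pi_pmf) simp
    also have "\<dots> = ennreal (r ^ N)" using r0 by (simp add: intg ennreal_power)
    finally show ?thesis unfolding rN .
  qed
  moreover have "0 < - log 2 r" using rlt r0 by simp
  ultimately show ?thesis by blast
qed

lemma prod_mono_ennreal:
  fixes f g :: "'i \<Rightarrow> ennreal"
  assumes "finite I" "\<And>i. i \<in> I \<Longrightarrow> f i \<le> g i"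
  shows "prod f I \<le> prod g I"
  using assms by (induction I rule: finite_induct) (auto intro!: mult_mono)

text \<open>Markov's inequality for a product of independent factors with a threshold relative to
  the product of the mean bounds.\<close>

lemma markov_prod:
  fixes h :: "'i \<Rightarrow> 'a \<Rightarrow> real"
  assumes I: "finite I" and h0: "\<And>i x. i \<in> I \<Longrightarrow> 0 \<le> h i x" and m: "\<And>i. i \<in> I \<Longrightarrow> (mean (K i) (\<lambda>x. ennreal (h i x))) \<le> ennreal (m i)"
    and m0: "\<And>i. i \<in> I \<Longrightarrow> 0 \<le> m i" and c: "0 < c"
  shows "mean (Pi_pmf I d K) (\<lambda>x. of_bool (0 < (\<Prod>i\<in>I. h i (x i)) \<and> c * (\<Prod>i\<in>I. m i) \<le> (\<Prod>i\<in>I. h i (x i)))) \<le> ennreal (1 / c)"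
proof -
  have int: "mean (Pi_pmf I d K) (\<lambda>x. (\<Prod>i\<in>I. ennreal (h i (x i)))) \<le> ennreal (\<Prod>i\<in>I. m i)"
    unfolding nn_integral_prod_Pi_pmf[OF I, where f="\<lambda>i x. ennreal (h i x)"]
    using I m m0 by (subst prod_ennreal[symmetric]) (auto intro: prod_mono_ennreal)
  have mp: "0 \<le> (\<Prod>i\<in>I. m i)" using m0 by (rule prod_nonneg)
  show ?thesis
  proof (cases "(\<Prod>i\<in>I. m i) = 0")
    \<comment> \<open>If a mean bound is 0, the threshold is 0 as well, but then the product
      vanishes almost surely and the requirement that it be positive excludes the event.\<close>
    case True
    then have "mean (Pi_pmf I d K) (\<lambda>x. (\<Prod>i\<in>I. ennreal (h i (x i)))) = 0" using int by simp
    then have z: "\<And>x. x \<in> set_pmf (Pi_pmf I d K) \<Longrightarrow> (\<Prod>i\<in>I. ennreal (h i (x i))) = 0"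
      by (subst (asm) nn_integral_0_iff_AE) (auto simp: AE_measure_pmf_iff)
    have "mean (Pi_pmf I d K) (\<lambda>x. of_bool (0 < (\<Prod>i\<in>I. h i (x i)) \<and> c * (\<Prod>i\<in>I. m i) \<le> (\<Prod>i\<in>I. h i (x i)))) \<le> 0"
    proof (rule nn_le_const)
      fix x assume "x \<in> set_pmf (Pi_pmf I d K)"
      from z[OF this] have "ennreal (\<Prod>i\<in>I. h i (x i)) = 0" using h0 by (subst prod_ennreal[symmetric]) auto
      then have "(\<Prod>i\<in>I. h i (x i)) \<le> 0" by (simp add: ennreal_eq_0_iff)
      then show "of_bool (0 < (\<Prod>i\<in>I. h i (x i)) \<and> c * (\<Prod>i\<in>I. m i) \<le> (\<Prod>i\<in>I. h i (x i))) \<le> (0::ennreal)" by auto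
    qed
    then show ?thesis by simp
  next
    case False
    then have mpos: "0 < (\<Prod>i\<in>I. m i)" using mp by simp
    let ?k = "1 / (c * (\<Prod>i\<in>I. m i))"
    have k0: "0 \<le> ?k" using mpos c by simp
    have "mean (Pi_pmf I d K) (\<lambda>x. of_bool (0 < (\<Prod>i\<in>I. h i (x i)) \<and> c * (\<Prod>i\<in>I. m i) \<le> (\<Prod>i\<in>I. h i (x i))))
       \<le> mean (Pi_pmf I d K) (\<lambda>x. ennreal ?k * (\<Prod>i\<in>I. ennreal (h i (x i))))"
    proof (rule nn_integral_mono)
      fix x
      have p: "0 \<le> (\<Prod>i\<in>I. h i (x i))" using h0 by (rule prod_nonneg)
      have "ennreal ?k * (\<Prod>i\<in>I. ennreal (h i (x i))) = ennreal (?k * (\<Prod>i\<in>I. h i (x i)))"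
        unfolding ennreal_mult[OF k0 p] using h0 by (subst prod_ennreal) auto
      moreover have "1 \<le> ?k * (\<Prod>i\<in>I. h i (x i))" if "c * (\<Prod>i\<in>I. m i) \<le> (\<Prod>i\<in>I. h i (x i))"
        using that mpos c by (simp add: field_simps)
      ultimately show "of_bool (0 < (\<Prod>i\<in>I. h i (x i)) \<and> c * (\<Prod>i\<in>I. m i) \<le> (\<Prod>i\<in>I. h i (x i))) \<le> ennreal ?k * (\<Prod>i\<in>I. ennreal (h i (x i)))"
        by (auto simp del: ennreal_1 simp: ennreal_1[symmetric])
    qed
    also have "\<dots> \<le> ennreal ?k * ennreal (\<Prod>i\<in>I. m i)" unfolding nn_cmult by (intro mult_left_mono int) simp
    also have "\<dots> = ennreal (1 / c)" using mpos c k0 by (simp add: ennreal_mult[symmetric])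
    finally show ?thesis .
  qed
qed

text \<open>One draw is accepted with probability at least b times the ideal probability w of
  \<open>ok\<close>. If w is at least 1/2, then n failures have probability at most (1 - b/2)^n;
  otherwise twice the probability of not \<open>ok\<close> already exceeds 1.\<close>

lemma covering:
  assumes b: "0 \<le> b" and ok: "\<And>u. ok u \<Longrightarrow> acc u \<and> ennreal b * ennreal (pmf QU u) \<le> ennreal (pmf PU u)"
  shows "mean PU (\<lambda>u. of_bool (\<not> acc u)) ^ n \<le> ennreal (exp (- (real n * b / 2))) + 2 * mean QU (\<lambda>u. of_bool (\<not> ok u))"
proof -
  define x where "x = measure_pmf.prob PU {u. acc u}"
  define w where "w = measure_pmf.prob QU {u. ok u}"
  have i1: "mean PU (\<lambda>u. of_bool (\<not> acc u)) = ennreal (1 - x)"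
  proof -
    have "mean PU (\<lambda>u. of_bool (\<not> acc u)) = mean PU (\<lambda>u. indicator (- {u. acc u}) u)"
      by (intro nn_integral_cong) (simp add: indicator_def)
    also have "\<dots> = ennreal (measure_pmf.prob PU (- {u. acc u}))" by (simp add: measure_pmf.emeasure_eq_measure)
    also have "measure_pmf.prob PU (- {u. acc u}) = 1 - x" unfolding x_def using measure_pmf.prob_compl[of "{u. acc u}" PU] by (simp add: Compl_eq_Diff_UNIV)
    finally show ?thesis .
  qed
  have i2: "mean QU (\<lambda>u. of_bool (\<not> ok u)) = ennreal (1 - w)"
  proof -
    have "mean QU (\<lambda>u. of_bool (\<not> ok u)) = mean QU (\<lambda>u. indicator (- {u. ok u}) u)"
      by (intro nn_integral_cong) (simp add: indicator_def)
    also have "\<dots> = ennreal (measure_pmf.prob QU (- {u. ok u}))" by (simp add: measure_pmf.emeasure_eq_measure)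
    also have "measure_pmf.prob QU (- {u. ok u}) = 1 - w" unfolding w_def using measure_pmf.prob_compl[of "{u. ok u}" QU] by (simp add: Compl_eq_Diff_UNIV)
    finally show ?thesis .
  qed
  have x01: "0 \<le> x" "x \<le> 1" and w01: "0 \<le> w" "w \<le> 1" unfolding x_def w_def by auto
  have "ennreal (b * w) \<le> ennreal x"
  proof -
    have "ennreal (b * w) = ennreal b * mean QU (\<lambda>u. of_bool (ok u))"
    proof -
      have "mean QU (\<lambda>u. of_bool (ok u)) = mean QU (\<lambda>u. indicator {u. ok u} u)"
        by (intro nn_integral_cong) (simp add: indicator_def)
      then show ?thesis using b w01 by (simp add: ennreal_mult w_def measure_pmf.emeasure_eq_measure)
    qed
    also have "\<dots> = (\<integral>\<^sup>+u. ennreal b * ennreal (pmf QU u) * of_bool (ok u) \<partial>count_space UNIV)"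
      by (simp add: nn_integral_measure_pmf nn_integral_cmult[symmetric] mult.assoc)
    also have "\<dots> \<le> (\<integral>\<^sup>+u. ennreal (pmf PU u) * indicator {u. acc u} u \<partial>count_space UNIV)"
      by (intro nn_integral_mono) (use ok in \<open>auto simp: indicator_def\<close>)
    also have "\<dots> = ennreal x" unfolding x_def by (simp add: nn_integral_measure_pmf[symmetric] measure_pmf.emeasure_eq_measure)
    finally show ?thesis .
  qed
  then have bx: "b * w \<le> x" using x01 by (simp add: ennreal_le_iff)
  show ?thesis
  proof (cases "1 / 2 \<le> w")
    case True
    have "b / 2 \<le> b * w" using True b by (simp add: mult_left_mono[of "1/2" w b, simplified])
    then have "1 - x \<le> exp (- (b / 2))" using bx exp_ge_add_one_self[of "- (b / 2)"] by linarith
    then have "(1 - x) ^ n \<le> exp (- (b / 2)) ^ n" using x01 by (intro power_mono) auto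
    also have "\<dots> = exp (- (real n * b / 2))" by (simp add: exp_of_nat_mult[symmetric])
    finally have "mean PU (\<lambda>u. of_bool (\<not> acc u)) ^ n \<le> ennreal (exp (- (real n * b / 2)))"
      unfolding i1 using x01 by (simp add: ennreal_power ennreal_leI)
    then show ?thesis by (rule order_trans) simp
  next
    case False
    have "(1 - x) ^ n \<le> 1" using x01 by (intro power_le_one) auto
    also have "1 \<le> 2 * (1 - w)" using False by simp
    finally have "mean PU (\<lambda>u. of_bool (\<not> acc u)) ^ n \<le> ennreal (2 * (1 - w))"
      unfolding i1 using x01 by (simp add: ennreal_power ennreal_leI)
    also have "\<dots> = 2 * mean QU (\<lambda>u. of_bool (\<not> ok u))" unfolding i2 using w01 by (subst ennreal_mult) auto
    finally show ?thesis by (rule order_trans) simp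
  qed
qed

text \<open>Rounding up makes rate 0 mean exactly one codeword, and the number
  \<open>cnt N a - 1\<close> of competitors is at most \<open>pw N a\<close> without any
  constant.\<close>

definition cnt :: "nat \<Rightarrow> real \<Rightarrow> nat" where "cnt N a = nat \<lceil>pw N a\<rceil>"

lemma cnt_ge: "pw N a \<le> real (cnt N a)" unfolding cnt_def using pw_pos[of N a] by linarith
lemma cnt_pos: "0 < cnt N a" using cnt_ge[of N a] pw_pos[of N a] by (metis of_nat_0_less_iff order_less_le_trans)
lemma cnt_0: "cnt N 0 = 1" by (simp add: cnt_def pw_0)
lemma cnt_le: "0 \<le> a \<Longrightarrow> real (cnt N a) \<le> 2 * pw N a"
  unfolding cnt_def using pw_ge_1[of a N] by linarith
lemma cnt_diff_le: "real (cnt N a - 1) \<le> pw N a"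
  unfolding cnt_def using pw_pos[of N a] by linarith

text \<open>Only an inequality, because mass of \<open>q\<close> outside the support of
  \<open>p\<close> is lost.\<close>

lemma nn_integral_density_ratio: "mean p (\<lambda>x. ennreal (pmf q x / pmf p x)) \<le> 1"
proof -
  have "mean p (\<lambda>x. ennreal (pmf q x / pmf p x)) = (\<integral>\<^sup>+x. ennreal (pmf p x) * ennreal (pmf q x / pmf p x) \<partial>count_space UNIV)"
    by (rule nn_integral_measure_pmf)
  also have "\<dots> \<le> (\<integral>\<^sup>+x. ennreal (pmf q x) \<partial>count_space UNIV)"
    by (intro nn_integral_mono) (simp add: ennreal_mult'[symmetric])
  also have "\<dots> = 1" by (simp add: nn_integral_pmf)
  finally show ?thesis .
qed

lemma nn_integral_Pi_bind:
  assumes "finite A"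
  shows "mean (Pi_pmf A d (\<lambda>i. bind_pmf (p i) (q i))) (\<lambda>w. F w)
    = mean (Pi_pmf A d' p) (\<lambda>x. mean (Pi_pmf A d (\<lambda>i. q i (x i))) (\<lambda>w. F w))"
  using assms by (simp add: Pi_pmf_bind[where d'=d'])

text \<open>Likelihood-ratio test with exponent \<open>c\<close>. Without the positivity clause, a
  pair of vanishing likelihoods would pass.\<close>

definition test :: "nat \<Rightarrow> real \<Rightarrow> (nat \<Rightarrow> real) \<Rightarrow> (nat \<Rightarrow> real) \<Rightarrow> bool" where
  "test N c num den \<longleftrightarrow> 0 < (\<Prod>i\<in>{1..N}. num i) \<and> pw N c * (\<Prod>i\<in>{1..N}. den i) \<le> (\<Prod>i\<in>{1..N}. num i)"

lemma test_cong: "(\<And>i. i \<in> {1..N} \<Longrightarrow> num i = num' i) \<Longrightarrow> (\<And>i. i \<in> {1..N} \<Longrightarrow> den i = den' i) \<Longrightarrow> test N c num den = test N c num' den'"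
  unfolding test_def using prod.cong[of "{1..N}" "{1..N}" num num'] prod.cong[of "{1..N}" "{1..N}" den den'] by metis

text \<open>For a word drawn independently of \<open>y\<close>, the numerator has the denominator as
  its mean.\<close>

lemma test_markov:
  assumes "\<And>i. i \<in> {1..N} \<Longrightarrow> den i = pmf (bind_pmf (K i) (V i)) (y i)"
  shows "mean (Pi_pmf {1..N} d K) (\<lambda>x. of_bool (test N c (\<lambda>i. pmf (V i (x i)) (y i)) den)) \<le> epw N (- c)"
  using markov_prod[of "{1..N}" "\<lambda>i x. pmf (V i x) (y i)" K den "pw N c" d] assms
  unfolding test_def by (simp add: pw_pos pw_inverse ennreal_pmf_bind)

lemma test_ratio_markov:
  "mean (Pi_pmf {1..N} d p) (\<lambda>x. of_bool (test N c (\<lambda>i. pmf (q i) (x i)) (\<lambda>i. pmf (p i) (x i)))) \<le> epw N (- c)"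
proof -
  let ?h = "\<lambda>i x. pmf (q i) x / pmf (p i) x"
  have "mean (Pi_pmf {1..N} d p) (\<lambda>x. of_bool (test N c (\<lambda>i. pmf (q i) (x i)) (\<lambda>i. pmf (p i) (x i))))
    \<le> mean (Pi_pmf {1..N} d p) (\<lambda>x. of_bool (0 < (\<Prod>i\<in>{1..N}. ?h i (x i)) \<and> pw N c * (\<Prod>i\<in>{1..N}. 1) \<le> (\<Prod>i\<in>{1..N}. ?h i (x i))))"
  proof (rule nn_integral_pmf_mono)
    fix x assume "x \<in> set_pmf (Pi_pmf {1..N} d p)"
    then have x: "x i \<in> set_pmf (p i)" if "i \<in> {1..N}" for i using that by (auto simp: set_Pi_pmf PiE_dflt_def)
    have p: "0 < (\<Prod>i\<in>{1..N}. pmf (p i) (x i))" using x by (intro prod_pos) (auto intro: pmf_positive)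
    then show "of_bool (test N c (\<lambda>i. pmf (q i) (x i)) (\<lambda>i. pmf (p i) (x i)))
      \<le> (of_bool (0 < (\<Prod>i\<in>{1..N}. ?h i (x i)) \<and> pw N c * (\<Prod>i\<in>{1..N}. 1) \<le> (\<Prod>i\<in>{1..N}. ?h i (x i))) :: ennreal)"
      unfolding test_def prod_dividef by (auto simp: field_simps)
  qed
  also have "\<dots> \<le> ennreal (1 / pw N c)"
    by (rule markov_prod) (auto simp: pw_pos intro: nn_integral_density_ratio)
  finally show ?thesis by (simp add: pw_inverse)
qed

lemma test_dominates:
  assumes "test N c (\<lambda>i. pmf (q i) (x i)) (\<lambda>i. pmf (p i) (x i))"
  shows "ennreal (pmf (Pi_pmf {1..N} d p) x) \<le> epw N (- c) * ennreal (pmf (Pi_pmf {1..N} d q) x)"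
proof (cases "\<forall>i. i \<notin> {1..N} \<longrightarrow> x i = d")
  case True
  have "(\<Prod>i\<in>{1..N}. pmf (p i) (x i)) \<le> pw N (- c) * (\<Prod>i\<in>{1..N}. pmf (q i) (x i))"
    using assms pw_pos[of N c] unfolding test_def pw_inverse[symmetric] by (simp add: field_simps)
  then show ?thesis using True by (simp add: pmf_Pi ennreal_mult'[symmetric] less_imp_le[OF pw_pos] ennreal_leI)
next
  case False
  then have "pmf (Pi_pmf {1..N} d p) x = 0" by (subst pmf_Pi) auto
  then show ?thesis by simp
qed

text \<open>Single-letter data of a block code. \<open>cm1\<close> and \<open>cm2\<close> generate
  the codebook for U and agree on possible state pairs, so both encoders know them: in the main case
  both are the marginal of U, in the degenerate case the law of U given the own state.
  \<open>PZ\<close> generates the codebook for Z, and \<open>QU2\<close> is the law of U given S2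
  with which encoder 2 searches its bin.\<close>

locale coding = mac pS W z
  for pS :: "('s1::finite \<times> 's2::finite) pmf"
    and W :: "'x1::finite \<Rightarrow> 'x2::finite \<Rightarrow> 's1 \<Rightarrow> 's2 \<Rightarrow> 'y::finite pmf"
    and z :: "'x1 \<Rightarrow> 's1 \<Rightarrow> 'z::finite" +
  fixes QU :: "'s1 \<Rightarrow> nat pmf" and QZ :: "nat \<Rightarrow> 's1 \<Rightarrow> 'z pmf" and QX1 :: "nat \<Rightarrow> 's1 \<Rightarrow> 'z \<Rightarrow> 'x1 pmf"
    and QX2 :: "nat \<Rightarrow> 's2 \<Rightarrow> 'x2 pmf" and cm1 :: "'s1 \<Rightarrow> nat pmf" and cm2 :: "'s2 \<Rightarrow> nat pmf"
    and PZ :: "'z pmf" and QU2 :: "'s2 \<Rightarrow> nat pmf"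
  assumes fin: "\<And>s. finite (set_pmf (QU s))" "\<And>s. finite (set_pmf (cm1 s))"
    and common: "\<And>s1 s2. (s1, s2) \<in> set_pmf pS \<Longrightarrow> cm1 s1 = cm2 s2"
    and zf: "\<And>u s v x1. v \<in> set_pmf (QZ u s) \<Longrightarrow> x1 \<in> set_pmf (QX1 u s v) \<Longrightarrow> z x1 s = v"
    and abs_cont: "\<And>s1 s2 u. (s1, s2) \<in> set_pmf pS \<Longrightarrow> u \<in> set_pmf (QU s1) \<Longrightarrow> u \<in> set_pmf (cm1 s1) \<and> u \<in> set_pmf (QU2 s2)"
      "\<And>s1 s2 u v. (s1, s2) \<in> set_pmf pS \<Longrightarrow> u \<in> set_pmf (QU s1) \<Longrightarrow> v \<in> set_pmf (QZ u s1) \<Longrightarrow> v \<in> set_pmf PZ"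
begin

text \<open>Output laws after averaging over the words that a decoding error makes fresh. They are
  written as a single \<open>bind_pmf\<close>, the form of the denominator in
  \<open>test_markov\<close>.\<close>

definition "V1 u v x2 s = bind_pmf (QX1 u (fst s) v) (\<lambda>x1. W x1 x2 (fst s) (snd s))"
definition "V2 u x1 s = bind_pmf (QX2 u (snd s)) (\<lambda>x2. W x1 x2 (fst s) (snd s))"
definition "V3 u v s = bind_pmf (do { x1 \<leftarrow> QX1 u (fst s) v; x2 \<leftarrow> QX2 u (snd s); return_pmf (x1, x2) }) (\<lambda>(x1, x2). W x1 x2 (fst s) (snd s))"
definition "V5 s = bind_pmf (do { u \<leftarrow> QU (fst s); v \<leftarrow> QZ u (fst s); x1 \<leftarrow> QX1 u (fst s) v; x2 \<leftarrow> QX2 u (snd s); return_pmf (u, v, x1, x2) })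
   (\<lambda>(u, v, x1, x2). W x1 x2 (fst s) (snd s))"

definition SL :: "(('s1 \<times> 's2) \<times> nat \<times> 'z \<times> 'x1 \<times> 'x2 \<times> 'y) pmf" where
  "SL = do { s \<leftarrow> pS; u \<leftarrow> QU (fst s); v \<leftarrow> QZ u (fst s); x1 \<leftarrow> QX1 u (fst s) v; x2 \<leftarrow> QX2 u (snd s);
     y \<leftarrow> W x1 x2 (fst s) (snd s); return_pmf (s, u, v, x1, x2, y) }"

lemma finite_SL: "finite (set_pmf SL)"
  unfolding SL_def using fin by auto

abbreviation EN where "EN (N::nat) F \<equiv>
  (mean (seq_pmf N (\<lambda>_. pS)) (\<lambda>s. mean (seq_pmf N (\<lambda>i. QU (fst (s i)))) (\<lambda>u. mean (seq_pmf N (\<lambda>i. QZ (u i) (fst (s i)))) (\<lambda>v. mean (seq_pmf N (\<lambda>i. QX1 (u i) (fst (s i)) (v i))) (\<lambda>x1. mean (seq_pmf N (\<lambda>i. QX2 (u i) (snd (s i)))) (\<lambda>x2. mean (seq_pmf N (\<lambda>i. W (x1 i) (x2 i) (fst (s i)) (snd (s i)))) (\<lambda>y. F s u v x1 x2 y)))))))"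

lemma EN_eq: "EN N (\<lambda>s u v x1 x2 y. F (\<lambda>i. if i \<in> {1..N} then (s i, u i, v i, x1 i, x2 i, y i) else d)) = mean (Pi_pmf {1..N} d (\<lambda>_. SL)) (\<lambda>w. F w)"
  unfolding SL_def
  apply (rule sym)
  apply (rule trans[OF nn_integral_Pi_bind], simp, rule nn_integral_cong)+
  apply simp
  done

definition "expect f = measure_pmf.expectation SL (\<lambda>(s, u, v, x1, x2, y). f s u v x1 x2 y)"

lemma EN_tail:
  assumes pos: "\<And>s u v x1 x2 y. (s, u, v, x1, x2, y) \<in> set_pmf SL \<Longrightarrow> 0 < num s u v x1 x2 y \<and> 0 < den s u v x1 x2 y"
    and c: "c < expect (\<lambda>s u v x1 x2 y. log 2 (num s u v x1 x2 y / den s u v x1 x2 y))"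
  shows "\<exists>\<tau>>0. \<forall>N. EN N (\<lambda>s u v x1 x2 y. of_bool (\<not> test N c (\<lambda>i. num (s i) (u i) (v i) (x1 i) (x2 i) (y i)) (\<lambda>i. den (s i) (u i) (v i) (x1 i) (x2 i) (y i))))
     \<le> epw N (- \<tau>)"
proof -
  let ?n = "\<lambda>(s, u, v, x1, x2, y). num s u v x1 x2 y" and ?d = "\<lambda>(s, u, v, x1, x2, y). den s u v x1 x2 y"
  have "c < measure_pmf.expectation SL (\<lambda>w. log 2 (?n w / ?d w))" using c unfolding expect_def by (simp add: case_prod_unfold)
  then obtain \<tau> where \<tau>: "0 < \<tau>" "\<And>N d. (mean (Pi_pmf {1..N} d (\<lambda>_. SL)) (\<lambda>w. of_bool (\<not> test N c (\<lambda>i. ?n (w i)) (\<lambda>i. ?d (w i))))) \<le> epw N (- \<tau>)"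
    using likelihood_tail[OF finite_SL _ _ \<open>c < measure_pmf.expectation SL (\<lambda>w. log 2 (?n w / ?d w))\<close>, folded test_def] pos by (auto simp: test_def)
  have e: "EN N (\<lambda>s u v x1 x2 y. of_bool (\<not> test N c (\<lambda>i. num (s i) (u i) (v i) (x1 i) (x2 i) (y i)) (\<lambda>i. den (s i) (u i) (v i) (x1 i) (x2 i) (y i))))
     = mean (seq_pmf N (\<lambda>_. SL)) (\<lambda>w. of_bool (\<not> test N c (\<lambda>i. ?n (w i)) (\<lambda>i. ?d (w i))))" for N
    unfolding EN_eq[symmetric]
    by (intro nn_integral_cong arg_cong[where f=of_bool] arg_cong[where f=Not] test_cong) auto
  show ?thesis unfolding e using \<tau> by blast
qed

text \<open>Mean log-likelihood ratios. If the reference laws are marginals, the first four are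
  I(U;S1,S2), I(U;S2), I(Z;S1,U) and H(Z); the other four are the informations of the
  region.\<close>

definition "IU = expect (\<lambda>s u v x1 x2 y. log 2 (pmf (QU (fst s)) u / pmf (cm1 (fst s)) u))"
definition "IU2 = expect (\<lambda>s u v x1 x2 y. log 2 (pmf (QU2 (snd s)) u / pmf (cm2 (snd s)) u))"
definition "IZ = expect (\<lambda>s u v x1 x2 y. log 2 (pmf (QZ u (fst s)) v / pmf PZ v))"
definition "HZ = expect (\<lambda>s u v x1 x2 y. log 2 (1 / pmf PZ v))"
definition "I1 = expect (\<lambda>s u v x1 x2 y. log 2 (pmf (W x1 x2 (fst s) (snd s)) y / pmf (V1 u v x2 s) y))"
definition "I2 = expect (\<lambda>s u v x1 x2 y. log 2 (pmf (W x1 x2 (fst s) (snd s)) y / pmf (V2 u x1 s) y))"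
definition "I3 = expect (\<lambda>s u v x1 x2 y. log 2 (pmf (W x1 x2 (fst s) (snd s)) y / pmf (V3 u v s) y))"
definition "I5 = expect (\<lambda>s u v x1 x2 y. log 2 (pmf (W x1 x2 (fst s) (snd s)) y / pmf (V5 s) y))"

definition "accU N e u p = test N (IU - e) (\<lambda>i. pmf (QU (p i)) (u i)) (\<lambda>i. pmf (cm1 (p i)) (u i))"
text \<open>The reverse of \<open>accU\<close>: the ideal law does not exceed the codebook law by
  too much, which is the hypothesis of \<open>covering\<close>.\<close>

definition "lowU N e u p = test N (- IU - e) (\<lambda>i. pmf (cm1 (p i)) (u i)) (\<lambda>i. pmf (QU (p i)) (u i))"
definition "accZ N e u p v = test N (IZ - e) (\<lambda>i. pmf (QZ (u i) (p i)) (v i)) (\<lambda>i. pmf PZ (v i))"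
definition "lowZ N e u p v = test N (- IZ - e) (\<lambda>i. pmf PZ (v i)) (\<lambda>i. pmf (QZ (u i) (p i)) (v i))"
definition "T2 N e u q = test N (IU2 - e) (\<lambda>i. pmf (QU2 (q i)) (u i)) (\<lambda>i. pmf (cm2 (q i)) (u i))"
definition "TZ N e v = test N (HZ - e) (\<lambda>i. 1) (\<lambda>i. pmf PZ (v i))"
definition "dec1 N e p q u v x1 x2 y = test N (I1 - e) (\<lambda>i. pmf (W (x1 i) (x2 i) (p i) (q i)) (y i)) (\<lambda>i. pmf (V1 (u i) (v i) (x2 i) (p i, q i)) (y i))"
definition "dec2 N e p q u v x1 x2 y = test N (I2 - e) (\<lambda>i. pmf (W (x1 i) (x2 i) (p i) (q i)) (y i)) (\<lambda>i. pmf (V2 (u i) (x1 i) (p i, q i)) (y i))"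
definition "dec3 N e p q u v x1 x2 y = test N (I3 - e) (\<lambda>i. pmf (W (x1 i) (x2 i) (p i) (q i)) (y i)) (\<lambda>i. pmf (V3 (u i) (v i) (p i, q i)) (y i))"
definition "dec5 N e p q u v x1 x2 y = test N (I5 - e) (\<lambda>i. pmf (W (x1 i) (x2 i) (p i) (q i)) (y i)) (\<lambda>i. pmf (V5 (p i, q i)) (y i))"
definition "accept N e p q u v x1 x2 y \<longleftrightarrow> dec1 N e p q u v x1 x2 y \<and> dec2 N e p q u v x1 x2 y \<and> dec3 N e p q u v x1 x2 y \<and> dec5 N e p q u v x1 x2 y"

lemma SL_positive:
  assumes "(s, u, v, x1, x2, y) \<in> set_pmf SL"
  shows "0 < pmf (QU (fst s)) u" "0 < pmf (cm1 (fst s)) u" "0 < pmf (QU2 (snd s)) u" "0 < pmf (cm2 (snd s)) u"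
    "0 < pmf (QZ u (fst s)) v" "0 < pmf PZ v" "0 < pmf (W x1 x2 (fst s) (snd s)) y"
    "0 < pmf (V1 u v x2 s) y" "0 < pmf (V2 u x1 s) y" "0 < pmf (V3 u v s) y" "0 < pmf (V5 s) y"
proof -
  have m: "s \<in> set_pmf pS" "u \<in> set_pmf (QU (fst s))" "v \<in> set_pmf (QZ u (fst s))" "x1 \<in> set_pmf (QX1 u (fst s) v)"
    "x2 \<in> set_pmf (QX2 u (snd s))" "y \<in> set_pmf (W x1 x2 (fst s) (snd s))" using assms unfolding SL_def by auto
  have s: "(fst s, snd s) \<in> set_pmf pS" using m(1) by simp
  show "0 < pmf (QU (fst s)) u" "0 < pmf (QZ u (fst s)) v" "0 < pmf (W x1 x2 (fst s) (snd s)) y"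
    "0 < pmf (cm1 (fst s)) u" "0 < pmf (QU2 (snd s)) u" "0 < pmf PZ v"
    using m abs_cont(1)[OF s m(2)] abs_cont(2)[OF s m(2,3)] by (auto intro: pmf_positive)
  then show "0 < pmf (cm2 (snd s)) u" using common[OF s] by simp
  have "y \<in> set_pmf (V1 u v x2 s)" "y \<in> set_pmf (V2 u x1 s)" "y \<in> set_pmf (V3 u v s)" "y \<in> set_pmf (V5 s)"
    unfolding V1_def V2_def V3_def V5_def using m by (auto simp: bind_assoc_pmf bind_return_pmf)
  then show "0 < pmf (V1 u v x2 s) y" "0 < pmf (V2 u x1 s) y" "0 < pmf (V3 u v s) y" "0 < pmf (V5 s) y"
    by (auto intro: pmf_positive)
qed

lemma expect_log_swap:
  assumes "\<And>s u v x1 x2 y. (s, u, v, x1, x2, y) \<in> set_pmf SL \<Longrightarrow> 0 < f s u v x1 x2 y \<and> 0 < g s u v x1 x2 y"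
  shows "expect (\<lambda>s u v x1 x2 y. log 2 (g s u v x1 x2 y / f s u v x1 x2 y)) = - expect (\<lambda>s u v x1 x2 y. log 2 (f s u v x1 x2 y / g s u v x1 x2 y))"
  unfolding expect_def expectation_finite_support[OF finite_SL] sum_negf[symmetric]
proof (intro sum.cong refl)
  fix w assume w: "w \<in> set_pmf SL"
  obtain s u v x1 x2 y where e: "w = (s, u, v, x1, x2, y)" by (cases w) auto
  show "pmf SL w * (case w of (s, u, v, x1, x2, y) \<Rightarrow> log 2 (g s u v x1 x2 y / f s u v x1 x2 y))
    = - (pmf SL w * (case w of (s, u, v, x1, x2, y) \<Rightarrow> log 2 (f s u v x1 x2 y / g s u v x1 x2 y)))"
    using assms[of s u v x1 x2 y] w unfolding e by (simp add: log_divide algebra_simps)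
qed

lemma nn_or: "of_bool (\<not> (P \<and> Q)) \<le> of_bool (\<not> P) + (of_bool (\<not> Q) :: ennreal)" by auto

lemma EN_split:
  assumes "EN N (\<lambda>s u v x1 x2 y. of_bool (\<not> P s u v x1 x2 y)) \<le> a" "EN N (\<lambda>s u v x1 x2 y. of_bool (\<not> Q s u v x1 x2 y)) \<le> b"
  shows "EN N (\<lambda>s u v x1 x2 y. of_bool (\<not> (P s u v x1 x2 y \<and> Q s u v x1 x2 y))) \<le> a + b"
proof -
  have "EN N (\<lambda>s u v x1 x2 y. of_bool (\<not> (P s u v x1 x2 y \<and> Q s u v x1 x2 y)))
    \<le> EN N (\<lambda>s u v x1 x2 y. of_bool (\<not> P s u v x1 x2 y) + of_bool (\<not> Q s u v x1 x2 y))"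
    by (intro nn_integral_mono nn_or)
  also have "\<dots> \<le> a + b" unfolding nn_add by (intro add_mono assms)
  finally show ?thesis .
qed

lemma tail_U:
  assumes "0 < e"
  shows "\<exists>\<tau>>0. \<forall>N. EN N (\<lambda>s u v x1 x2 y. of_bool (\<not> (accU N e u (fst \<circ> s) \<and> lowU N e u (fst \<circ> s)))) \<le> ennreal (2 * pw N (- \<tau>))"
proof -
  have c: "- IU - e < expect (\<lambda>s u v x1 x2 y. log 2 (pmf (cm1 (fst s)) u / pmf (QU (fst s)) u))"
    using expect_log_swap[of "\<lambda>s u v x1 x2 y. pmf (QU (fst s)) u" "\<lambda>s u v x1 x2 y. pmf (cm1 (fst s)) u"] SL_positive assms
    by (auto simp: IU_def)
  obtain t1 where t1: "0 < t1" "\<And>N. EN N (\<lambda>s u v x1 x2 y. of_bool (\<not> accU N e u (fst \<circ> s))) \<le> epw N (- t1)"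
    using EN_tail[where num="\<lambda>s u v x1 x2 y. pmf (QU (fst s)) u" and den="\<lambda>s u v x1 x2 y. pmf (cm1 (fst s)) u" and c="IU - e"] SL_positive assms
    unfolding accU_def IU_def[symmetric] comp_def by force
  obtain t2 where t2: "0 < t2" "\<And>N. EN N (\<lambda>s u v x1 x2 y. of_bool (\<not> lowU N e u (fst \<circ> s))) \<le> epw N (- t2)"
    using EN_tail[where num="\<lambda>s u v x1 x2 y. pmf (cm1 (fst s)) u" and den="\<lambda>s u v x1 x2 y. pmf (QU (fst s)) u" and c="- IU - e", OF _ c] SL_positive
    unfolding lowU_def comp_def by force
  have "EN N (\<lambda>s u v x1 x2 y. of_bool (\<not> (accU N e u (fst \<circ> s) \<and> lowU N e u (fst \<circ> s)))) \<le> ennreal (2 * pw N (- min t1 t2))" for N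
  proof -
    have "EN N (\<lambda>s u v x1 x2 y. of_bool (\<not> (accU N e u (fst \<circ> s) \<and> lowU N e u (fst \<circ> s)))) \<le> epw N (- t1) + epw N (- t2)"
      by (intro EN_split t1(2) t2(2))
    also have "\<dots> = ennreal (pw N (- t1) + pw N (- t2))" by (simp add: less_imp_le[OF pw_pos])
    also have "\<dots> \<le> ennreal (2 * pw N (- min t1 t2))" using pw_mono[of "- t1" "- min t1 t2" N] pw_mono[of "- t2" "- min t1 t2" N] by (intro ennreal_leI) simp
    finally show ?thesis .
  qed
  then show ?thesis using t1(1) t2(1) by (intro exI[of _ "min t1 t2"]) auto
qed

lemma tail_Z:
  assumes "0 < e"
  shows "\<exists>\<tau>>0. \<forall>N. EN N (\<lambda>s u v x1 x2 y. of_bool (\<not> (accZ N e u (fst \<circ> s) v \<and> lowZ N e u (fst \<circ> s) v))) \<le> ennreal (2 * pw N (- \<tau>))"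
proof -
  have c: "- IZ - e < expect (\<lambda>s u v x1 x2 y. log 2 (pmf PZ v / pmf (QZ u (fst s)) v))"
    using expect_log_swap[of "\<lambda>s u v x1 x2 y. pmf (QZ u (fst s)) v" "\<lambda>s u v x1 x2 y. pmf PZ v"] SL_positive assms
    by (auto simp: IZ_def)
  obtain t1 where t1: "0 < t1" "\<And>N. EN N (\<lambda>s u v x1 x2 y. of_bool (\<not> accZ N e u (fst \<circ> s) v)) \<le> epw N (- t1)"
    using EN_tail[where num="\<lambda>s u v x1 x2 y. pmf (QZ u (fst s)) v" and den="\<lambda>s u v x1 x2 y. pmf PZ v" and c="IZ - e"] SL_positive assms
    unfolding accZ_def IZ_def[symmetric] comp_def by force
  obtain t2 where t2: "0 < t2" "\<And>N. EN N (\<lambda>s u v x1 x2 y. of_bool (\<not> lowZ N e u (fst \<circ> s) v)) \<le> epw N (- t2)"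
    using EN_tail[where num="\<lambda>s u v x1 x2 y. pmf PZ v" and den="\<lambda>s u v x1 x2 y. pmf (QZ u (fst s)) v" and c="- IZ - e", OF _ c] SL_positive
    unfolding lowZ_def comp_def by force
  have "EN N (\<lambda>s u v x1 x2 y. of_bool (\<not> (accZ N e u (fst \<circ> s) v \<and> lowZ N e u (fst \<circ> s) v))) \<le> ennreal (2 * pw N (- min t1 t2))" for N
  proof -
    have "EN N (\<lambda>s u v x1 x2 y. of_bool (\<not> (accZ N e u (fst \<circ> s) v \<and> lowZ N e u (fst \<circ> s) v))) \<le> epw N (- t1) + epw N (- t2)"
      by (intro EN_split t1(2) t2(2))
    also have "\<dots> = ennreal (pw N (- t1) + pw N (- t2))" by (simp add: less_imp_le[OF pw_pos])
    also have "\<dots> \<le> ennreal (2 * pw N (- min t1 t2))" using pw_mono[of "- t1" "- min t1 t2" N] pw_mono[of "- t2" "- min t1 t2" N] by (intro ennreal_leI) simp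
    finally show ?thesis .
  qed
  then show ?thesis using t1(1) t2(1) by (intro exI[of _ "min t1 t2"]) auto
qed

lemma tail_good:
  assumes "0 < e"
  shows "\<exists>\<tau>>0. \<forall>N. EN N (\<lambda>s u v x1 x2 y. of_bool (\<not> (T2 N e u (snd \<circ> s) \<and> TZ N e v \<and> accept N e (fst \<circ> s) (snd \<circ> s) u v x1 x2 y))) \<le> ennreal (6 * pw N (- \<tau>))"
proof -
  obtain t1 where t1: "0 < t1" "\<And>N. EN N (\<lambda>s u v x1 x2 y. of_bool (\<not> T2 N e u (snd \<circ> s))) \<le> epw N (- t1)"
    using EN_tail[where num="\<lambda>s u v x1 x2 y. pmf (QU2 (snd s)) u" and den="\<lambda>s u v x1 x2 y. pmf (cm2 (snd s)) u" and c="IU2 - e"] SL_positive assms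
    unfolding T2_def IU2_def[symmetric] comp_def by force
  obtain t2 where t2: "0 < t2" "\<And>N. EN N (\<lambda>s u v x1 x2 y. of_bool (\<not> TZ N e v)) \<le> epw N (- t2)"
    using EN_tail[where num="\<lambda>s u v x1 x2 y. 1" and den="\<lambda>s u v x1 x2 y. pmf PZ v" and c="HZ - e"] SL_positive assms
    unfolding TZ_def HZ_def[symmetric] comp_def by force
  obtain t3 where t3: "0 < t3" "\<And>N. EN N (\<lambda>s u v x1 x2 y. of_bool (\<not> dec1 N e (fst \<circ> s) (snd \<circ> s) u v x1 x2 y)) \<le> epw N (- t3)"
    using EN_tail[where num="\<lambda>s u v x1 x2 y. pmf (W x1 x2 (fst s) (snd s)) y" and den="\<lambda>s u v x1 x2 y. pmf (V1 u v x2 s) y" and c="I1 - e"] SL_positive assms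
    unfolding dec1_def I1_def[symmetric] comp_def prod.collapse by force
  obtain t4 where t4: "0 < t4" "\<And>N. EN N (\<lambda>s u v x1 x2 y. of_bool (\<not> dec2 N e (fst \<circ> s) (snd \<circ> s) u v x1 x2 y)) \<le> epw N (- t4)"
    using EN_tail[where num="\<lambda>s u v x1 x2 y. pmf (W x1 x2 (fst s) (snd s)) y" and den="\<lambda>s u v x1 x2 y. pmf (V2 u x1 s) y" and c="I2 - e"] SL_positive assms
    unfolding dec2_def I2_def[symmetric] comp_def prod.collapse by force
  obtain t5 where t5: "0 < t5" "\<And>N. EN N (\<lambda>s u v x1 x2 y. of_bool (\<not> dec3 N e (fst \<circ> s) (snd \<circ> s) u v x1 x2 y)) \<le> epw N (- t5)"
    using EN_tail[where num="\<lambda>s u v x1 x2 y. pmf (W x1 x2 (fst s) (snd s)) y" and den="\<lambda>s u v x1 x2 y. pmf (V3 u v s) y" and c="I3 - e"] SL_positive assms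
    unfolding dec3_def I3_def[symmetric] comp_def prod.collapse by force
  obtain t6 where t6: "0 < t6" "\<And>N. EN N (\<lambda>s u v x1 x2 y. of_bool (\<not> dec5 N e (fst \<circ> s) (snd \<circ> s) u v x1 x2 y)) \<le> epw N (- t6)"
    using EN_tail[where num="\<lambda>s u v x1 x2 y. pmf (W x1 x2 (fst s) (snd s)) y" and den="\<lambda>s u v x1 x2 y. pmf (V5 s) y" and c="I5 - e"] SL_positive assms
    unfolding dec5_def I5_def[symmetric] comp_def prod.collapse by force
  define t where "t = Min {t1, t2, t3, t4, t5, t6}"
  have t0: "0 < t" using t1 t2 t3 t4 t5 t6 by (simp add: t_def)
  have tle: "t \<le> t1" "t \<le> t2" "t \<le> t3" "t \<le> t4" "t \<le> t5" "t \<le> t6" by (simp_all add: t_def)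
  have le: "x \<le> epw N (- t')  \<Longrightarrow> t \<le> t' \<Longrightarrow> x \<le> epw N (- t)" for x t' N
    by (erule order_trans) (intro ennreal_leI pw_mono, simp)
  have "EN N (\<lambda>s u v x1 x2 y. of_bool (\<not> (T2 N e u (snd \<circ> s) \<and> TZ N e v \<and> accept N e (fst \<circ> s) (snd \<circ> s) u v x1 x2 y))) \<le> ennreal (6 * pw N (- t))" for N
  proof -
    let ?p = "epw N (- t)"
    have "EN N (\<lambda>s u v x1 x2 y. of_bool (\<not> (T2 N e u (snd \<circ> s) \<and> TZ N e v \<and> accept N e (fst \<circ> s) (snd \<circ> s) u v x1 x2 y)))
      \<le> ?p + (?p + (?p + (?p + (?p + ?p))))"
      unfolding accept_def
      by (intro EN_split le[OF t1(2) tle(1)] le[OF t2(2) tle(2)] le[OF t3(2) tle(3)] le[OF t4(2) tle(4)] le[OF t5(2) tle(5)] le[OF t6(2) tle(6)])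
    also have "\<dots> = ennreal (6 * pw N (- t))" by (simp add: less_imp_le[OF pw_pos] ennreal_plus[symmetric] del: ennreal_plus)
    finally show ?thesis .
  qed
  then show ?thesis using t0 by blast
qed

end

section \<open>The one-shot code applied to sequences of length N\<close>

context coding
begin

lemma decode_bound_1:
  "mean (Pi_pmf {1..N} d (\<lambda>i. QX1 (u i) (p i) (v i))) (\<lambda>x1. of_bool (accept N e p q u v x1 x2 y)) \<le> epw N (- (I1 - e))"
proof -
  have "mean (Pi_pmf {1..N} d (\<lambda>i. QX1 (u i) (p i) (v i))) (\<lambda>x1. of_bool (accept N e p q u v x1 x2 y))
    \<le> mean (Pi_pmf {1..N} d (\<lambda>i. QX1 (u i) (p i) (v i))) (\<lambda>x1. of_bool (dec1 N e p q u v x1 x2 y))"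
    by (intro nn_integral_mono) (simp add: accept_def)
  also have "\<dots> \<le> epw N (- (I1 - e))"
    unfolding dec1_def by (rule test_markov[where V="\<lambda>i x1. W x1 (x2 i) (p i) (q i)"]) (simp add: V1_def)
  finally show ?thesis .
qed

lemma decode_bound_2:
  "mean (Pi_pmf {1..N} d (\<lambda>i. QX2 (u i) (q i))) (\<lambda>x2. of_bool (accept N e p q u v x1 x2 y)) \<le> epw N (- (I2 - e))"
proof -
  have "mean (Pi_pmf {1..N} d (\<lambda>i. QX2 (u i) (q i))) (\<lambda>x2. of_bool (accept N e p q u v x1 x2 y))
    \<le> mean (Pi_pmf {1..N} d (\<lambda>i. QX2 (u i) (q i))) (\<lambda>x2. of_bool (dec2 N e p q u v x1 x2 y))"
    by (intro nn_integral_mono) (simp add: accept_def)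
  also have "\<dots> \<le> epw N (- (I2 - e))"
    unfolding dec2_def by (rule test_markov[where V="\<lambda>i x2. W (x1 i) x2 (p i) (q i)"]) (simp add: V2_def)
  finally show ?thesis .
qed

lemma decode_bound_3:
  "mean (seq_pmf N (\<lambda>i. QX1 (u i) (p i) (v i))) (\<lambda>x1. mean (seq_pmf N (\<lambda>i. QX2 (u i) (q i)))
     (\<lambda>x2. of_bool (accept N e p q u v x1 x2 y))) \<le> epw N (- (I3 - e))" (is "?E (accept N e p q u v) \<le> _")
proof -
  let ?K = "\<lambda>i. do { x1 \<leftarrow> QX1 (u i) (p i) (v i); x2 \<leftarrow> QX2 (u i) (q i); return_pmf (x1, x2) }"
  let ?V = "\<lambda>i (x1, x2). W x1 x2 (p i) (q i)"
  let ?F = "\<lambda>w. test N (I3 - e) (\<lambda>i. pmf (?V i (w i)) (y i)) (\<lambda>i. pmf (V3 (u i) (v i) (p i, q i)) (y i))"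
  have e: "dec3 N e p q u v x1 x2 y = ?F (\<lambda>i. if i \<in> {1..N} then (x1 i, x2 i) else undefined)" for x1 x2
    unfolding dec3_def by (rule test_cong) auto
  have "?E (accept N e p q u v) \<le> ?E (\<lambda>x1 x2 y. ?F (\<lambda>i. if i \<in> {1..N} then (x1 i, x2 i) else undefined))"
    by (intro nn_integral_mono) (simp only: accept_def e, simp)
  also have "\<dots> = mean (seq_pmf N ?K) (\<lambda>w. of_bool (?F w))"
    by (rule sym) ((rule trans[OF nn_integral_Pi_bind], simp, rule nn_integral_cong)+, simp)
  also have "\<dots> \<le> epw N (- (I3 - e))"
    by (rule test_markov[where V="?V"]) (simp add: V3_def)
  finally show ?thesis .
qed

lemma decode_bound_5:
  "mean (seq_pmf N (\<lambda>i. QU (p i))) (\<lambda>u. mean (seq_pmf N (\<lambda>i. QZ (u i) (p i))) (\<lambda>v. mean (seq_pmf N (\<lambda>i. QX1 (u i) (p i) (v i)))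
     (\<lambda>x1. mean (seq_pmf N (\<lambda>i. QX2 (u i) (q i))) (\<lambda>x2. of_bool (accept N e p q u v x1 x2 y))))) \<le> epw N (- (I5 - e))"
  (is "?E (accept N e p q) \<le> _")
proof -
  let ?K = "\<lambda>i. do { u \<leftarrow> QU (p i); v \<leftarrow> QZ u (p i); x1 \<leftarrow> QX1 u (p i) v; x2 \<leftarrow> QX2 u (q i); return_pmf (u, v, x1, x2) }"
  let ?V = "\<lambda>i (u, v, x1, x2). W x1 x2 (p i) (q i)"
  let ?F = "\<lambda>w. test N (I5 - e) (\<lambda>i. pmf (?V i (w i)) (y i)) (\<lambda>i. pmf (V5 (p i, q i)) (y i))"
  have e: "dec5 N e p q u v x1 x2 y = ?F (\<lambda>i. if i \<in> {1..N} then (u i, v i, x1 i, x2 i) else undefined)" for u v x1 x2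
    unfolding dec5_def by (rule test_cong) auto
  have "?E (accept N e p q) \<le> ?E (\<lambda>u v x1 x2 y. ?F (\<lambda>i. if i \<in> {1..N} then (u i, v i, x1 i, x2 i) else undefined))"
    by (intro nn_integral_mono) (simp only: accept_def e, simp)
  also have "\<dots> = mean (seq_pmf N ?K) (\<lambda>w. of_bool (?F w))"
    by (rule sym) ((rule trans[OF nn_integral_Pi_bind], simp, rule nn_integral_cong)+, simp)
  also have "\<dots> \<le> epw N (- (I5 - e))"
    by (rule test_markov[where V="?V"]) (simp add: V5_def)
  finally show ?thesis .
qed

definition "missU N e n = mean (seq_pmf N (\<lambda>_. pS)) (\<lambda>s. (mean (seq_pmf N (\<lambda>i. cm1 (fst (s i)))) (\<lambda>u. of_bool (\<not> accU N e u (fst \<circ> s)))) ^ n)"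
definition "missZ N e n = mean (seq_pmf N (\<lambda>_. pS)) (\<lambda>s. mean (seq_pmf N (\<lambda>i. QU (fst (s i)))) (\<lambda>u. (mean (seq_pmf N (\<lambda>_. PZ)) (\<lambda>v. of_bool (\<not> accZ N e u (fst \<circ> s) v))) ^ n))"
definition "miss N e = EN N (\<lambda>s u v x1 x2 y. of_bool (\<not> (T2 N e u (snd \<circ> s) \<and> TZ N e v \<and> accept N e (fst \<circ> s) (snd \<circ> s) u v x1 x2 y)))"

text \<open>Instantiates \<open>random_code\<close> with sequences as symbols. The slacks
  \<open>eU\<close>, \<open>eZ\<close> and \<open>e\<close> are kept apart because they will have to
  be of different sizes.\<close>

lemma block_code_exists:
  fixes N J L M T A C :: nat and eU eZ e :: real
  defines "fU \<equiv> of_nat (L * M) * epw N (- (IU - eU))" and "fZ \<equiv> of_nat T * epw N (- (IZ - eZ))"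
  assumes pos: "0 < J" "0 < L" "0 < M" "0 < T" "0 < A" "0 < C"
    and \<delta>: "missU N eU (L * M) + fU * missZ N eZ T + fU * of_nat (M - 1) * epw N (- (IU2 - e))
      + fU * fZ * (of_nat ((J * L - 1) * T) * epw N (- (HZ - e)) + miss N e + of_nat (A - 1) * epw N (- (I1 - e))
         + of_nat (C - 1) * epw N (- (I2 - e)) + of_nat ((A - 1) * (C - 1)) * epw N (- (I3 - e))
         + of_nat ((J - 1) * A * C) * (fU * fZ * epw N (- (I5 - e)))) \<le> \<delta>" "\<delta> < \<top>"
  shows "block_code N J L A C \<delta>"
proof -
  define PS where "PS = map_pmf (\<lambda>s. (fst \<circ> s, snd \<circ> s)) (seq_pmf N (\<lambda>_. pS))"
  \<comment> \<open>The labels must be equal as functions, so they are made constant outside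
    \<open>{1..N}\<close>, where the product law ignores them.\<close>
  define com1 where "com1 p = (\<lambda>i. if i \<in> {1..N} then cm1 (p i) else return_pmf 0)" for p :: "nat \<Rightarrow> 's1"
  define com2 where "com2 q = (\<lambda>i. if i \<in> {1..N} then cm2 (q i) else return_pmf 0)" for q :: "nat \<Rightarrow> 's2"
  have Pc1: "seq_pmf N (com1 p) = seq_pmf N (\<lambda>i. cm1 (p i))" for p
    by (rule Pi_pmf_cong) (auto simp: com1_def)
  have Pc2: "seq_pmf N (com2 q) = seq_pmf N (\<lambda>i. cm2 (q i))" for q
    by (rule Pi_pmf_cong) (auto simp: com2_def)
  interpret rc: random_code PS com1 com2 "\<lambda>l. seq_pmf N l" "seq_pmf N (\<lambda>_. PZ)"
    "\<lambda>p. seq_pmf N (\<lambda>i. QU (p i))" "\<lambda>u p. seq_pmf N (\<lambda>i. QZ (u i) (p i))"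
    "\<lambda>u p v. seq_pmf N (\<lambda>i. QX1 (u i) (p i) (v i))" "\<lambda>u q. seq_pmf N (\<lambda>i. QX2 (u i) (q i))"
    "\<lambda>x1 x2 p q. seq_pmf N (\<lambda>i. W (x1 i) (x2 i) (p i) (q i))" "\<lambda>x1 p. restrict (\<lambda>i. z (x1 i) (p i)) {1..N}"
    "accU N eU" "accZ N eZ" "T2 N e" "TZ N e" "accept N e" J L M T A C "epw N (- (IU - eU))" "epw N (- (IZ - eZ))"
    "epw N (- (IU2 - e))" "epw N (- (HZ - e))" "epw N (- (I1 - e))" "epw N (- (I2 - e))"
    "epw N (- (I3 - e))" "epw N (- (I5 - e))"
  proof
    show "finite (set_pmf PS)" unfolding PS_def by (auto intro!: finite_Pi_support)
    show "finite (set_pmf (seq_pmf N (com1 p)))" for p unfolding Pc1 by (intro finite_Pi_support fin) simp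
    show "finite (set_pmf (seq_pmf N (\<lambda>_. PZ)))" by (intro finite_Pi_support) auto
    show "com1 p = com2 q" if pq: "(p, q) \<in> set_pmf PS" for p q
    proof -
      obtain s where s: "s \<in> set_pmf (seq_pmf N (\<lambda>_. pS))" "p = fst \<circ> s" "q = snd \<circ> s" using pq by (auto simp: PS_def)
      have "(p i, q i) \<in> set_pmf pS" if "i \<in> {1..N}" for i using s that by (auto simp: set_Pi_pmf PiE_dflt_def)
      then show ?thesis unfolding com1_def com2_def using common by (auto simp: fun_eq_iff)
    qed
    show "restrict (\<lambda>i. z (x1 i) (p i)) {1..N} = v"
      if "u \<in> set_pmf (seq_pmf N (\<lambda>i. QU (p i)))" "v \<in> set_pmf (seq_pmf N (\<lambda>i. QZ (u i) (p i)))"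
        "x1 \<in> set_pmf (seq_pmf N (\<lambda>i. QX1 (u i) (p i) (v i)))" for u p v x1
    proof
      fix i show "restrict (\<lambda>i. z (x1 i) (p i)) {1..N} i = v i"
      proof (cases "i \<in> {1..N}")
        case True
        then have "v i \<in> set_pmf (QZ (u i) (p i))" "x1 i \<in> set_pmf (QX1 (u i) (p i) (v i))"
          using that by (auto simp: set_Pi_pmf PiE_dflt_def)
        then show ?thesis using True zf by simp
      next
        case False
        then have "v i = undefined" using that by (auto simp: set_Pi_pmf PiE_dflt_def)
        then show ?thesis using False by (simp only: restrict_def if_False)
      qed
    qed
    show "ennreal (pmf (seq_pmf N (com1 p)) u) \<le> epw N (- (IU - eU)) * ennreal (pmf (seq_pmf N (\<lambda>i. QU (p i))) u)"
      if "accU N eU u p" for u p using that unfolding Pc1 accU_def by (rule test_dominates)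
    show "ennreal (pmf (seq_pmf N (\<lambda>_. PZ)) v) \<le> epw N (- (IZ - eZ)) * ennreal (pmf (seq_pmf N (\<lambda>i. QZ (u i) (p i))) v)"
      if "accZ N eZ u p v" for u p v using that unfolding accZ_def by (rule test_dominates)
    show "mean (seq_pmf N (com2 q)) (\<lambda>u. of_bool (T2 N e u q)) \<le> epw N (- (IU2 - e))" for q
      unfolding Pc2 T2_def by (rule test_ratio_markov)
    show "ennreal (pmf (seq_pmf N (\<lambda>_. PZ)) v) \<le> epw N (- (HZ - e))" if "TZ N e v" for v
    proof -
      have "(\<Prod>i\<in>{1..N}. pmf PZ (v i)) \<le> pw N (- (HZ - e))"
        using that pw_pos[of N "HZ - e"] unfolding TZ_def test_def pw_inverse[symmetric] by (simp add: field_simps)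
      then have "pmf (seq_pmf N (\<lambda>_. PZ)) v \<le> pw N (- (HZ - e))"
        by (subst pmf_Pi) (use less_imp_le[OF pw_pos] in auto)
      then show ?thesis by (rule ennreal_leI)
    qed
  qed (rule pos decode_bound_1 decode_bound_2 decode_bound_3 decode_bound_5)+
  have "mean PS (\<lambda>s. rc.err_bound (fst s) (snd s)) \<le> \<delta>"
  proof -
    have "mean PS (\<lambda>s. rc.err_bound (fst s) (snd s)) = missU N eU (L * M) + fU * missZ N eZ T + fU * of_nat (M - 1) * epw N (- (IU2 - e))
      + fU * fZ * (of_nat ((J * L - 1) * T) * epw N (- (HZ - e)) + miss N e + of_nat (A - 1) * epw N (- (I1 - e))
         + of_nat (C - 1) * epw N (- (I2 - e)) + of_nat ((A - 1) * (C - 1)) * epw N (- (I3 - e))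
         + of_nat ((J - 1) * A * C) * (fU * fZ * epw N (- (I5 - e))))"
      unfolding PS_def rc.err_bound_def rc.naU_def rc.naZ_def rc.bad_def rc.good_def rc.cU_def rc.cZ_def rc.K_def
        fU_def[symmetric] fZ_def[symmetric] nn_integral_map_pmf nn_add nn_cmult nn_const Pc1 missU_def missZ_def miss_def
      by (simp only: fst_conv snd_conv comp_apply)
    then show ?thesis using \<delta>(1) by simp
  qed
  from rc.exists_code[OF this \<delta>(2)] obtain e1 bt e2 h dec where bt: "\<forall>j p. bt j p < L"
    and err: "mean (pmf_of_set (indices J L A C)) (\<lambda>r. mean PS (\<lambda>s. (case r of (j, k, a, c) \<Rightarrow> case s of (p, q) \<Rightarrow>
        if h j (restrict (\<lambda>i. z (e1 j p k a i) (p i)) {1..N}) \<noteq> k then 1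
        else emeasure (seq_pmf N (\<lambda>i. W (e1 j p k a i) (e2 j (bt j p) q c i) (p i) (q i))) {y. dec y p q k \<noteq> (j, bt j p, a, c)}))) \<le> \<delta>"
    by blast
  have "mean (pmf_of_set (indices J L A C)) (\<lambda>r. mean (seq_pmf N (\<lambda>_. pS)) (\<lambda>s. block_error N e1 bt e2 h dec r s)) \<le> \<delta>"
    using err by (simp only: PS_def nn_integral_map_pmf block_error_def Let_def prod.case)
  then show ?thesis unfolding block_code_def using bt pos by blast
qed

end

subsection \<open>Rates of block codes\<close>

text \<open>A calculus of exponential orders: constants and exponents are carried separately, so
  that the final comparison concerns exponents only.\<close>

definition bd :: "nat \<Rightarrow> ennreal \<Rightarrow> real \<Rightarrow> real \<Rightarrow> bool" where
  "bd N x c a \<longleftrightarrow> 0 \<le> c \<and> x \<le> ennreal (c * pw N a)"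

lemma bd_mult: "bd N x c a \<Longrightarrow> bd N y d b \<Longrightarrow> bd N (x * y) (c * d) (a + b)"
proof -
  assume x: "bd N x c a" and y: "bd N y d b"
  have "x * y \<le> ennreal (c * pw N a) * ennreal (d * pw N b)" using x y unfolding bd_def by (intro mult_mono) auto
  also have "\<dots> = ennreal (c * d * (pw N a * pw N b))"
    using x y less_imp_le[OF pw_pos] unfolding bd_def by (simp add: ennreal_mult'[symmetric] mult_ac)
  finally show ?thesis using x y unfolding bd_def pw_add by simp
qed

lemma bd_add: "bd N x c a \<Longrightarrow> bd N y d a \<Longrightarrow> bd N (x + y) (c + d) a"
  unfolding bd_def using less_imp_le[OF pw_pos[of N a]]
  by (auto simp: distrib_right ennreal_plus[symmetric] simp del: ennreal_plus intro: order_trans[OF add_mono])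

lemma bd_weaken: "bd N x c a \<Longrightarrow> a \<le> b \<Longrightarrow> bd N x c b"
  unfolding bd_def using pw_mono[of a b N] by (auto intro: order_trans ennreal_leI mult_left_mono)

lemma bd_pw: "bd N (epw N a) 1 a" by (simp add: bd_def)
lemma bd_zero: "0 \<le> c \<Longrightarrow> bd N 0 c a" by (simp add: bd_def)
lemma bd_cnt: "0 \<le> a \<Longrightarrow> bd N (of_nat (cnt N a)) 2 a"
  unfolding bd_def using cnt_le[of a N] by (simp add: ennreal_of_nat_eq_real_of_nat ennreal_leI)
lemma bd_cnt_diff: "bd N (of_nat (cnt N a - 1)) 1 a"
  unfolding bd_def using cnt_diff_le[of N a] by (simp add: ennreal_of_nat_eq_real_of_nat ennreal_leI)
lemma bd_mono: "x \<le> y \<Longrightarrow> bd N y c a \<Longrightarrow> bd N x c a" unfolding bd_def by auto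

text \<open>The doubly exponential decay is weakened to a simple exponential by exp(x / 2) >= x^2 /
  8, which is the origin of the 8.\<close>

lemma bd_exp: "bd N (ennreal (exp (- (pw N a / 2)))) 8 (- (2 * a))"
proof -
  define x where "x = pw N a"
  have x: "0 < x" by (simp add: x_def pw_pos)
  have "x\<^sup>2 / 8 \<le> exp (x / 2)" using exp_lower_Taylor_quadratic[of "x / 2"] x by (simp add: power2_eq_square)
  then have "exp (- (x / 2)) \<le> 8 * (1 / x\<^sup>2)" using x by (simp add: exp_minus field_simps)
  also have "1 / x\<^sup>2 = pw N (- (2 * a))" unfolding x_def power2_eq_square pw_add pw_inverse by simp
  finally show ?thesis unfolding bd_def x_def by (simp add: ennreal_leI)
qed

lemma pw_tendsto_0:
  assumes "0 < g"
  shows "(\<lambda>N. c * pw N (- g)) \<longlonglongrightarrow> 0"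
proof -
  have "(\<lambda>N. (2 powr (- g)) ^ N) \<longlonglongrightarrow> 0" using assms powr_less_mono[of "- g" 0 2] by (intro LIMSEQ_realpow_zero) auto
  moreover have "(2 powr (- g)) ^ N = pw N (- g)" for N
    by (simp only: pw_def powr_powr[symmetric] powr_realpow[symmetric] powr_gt_zero mult.commute[of "real N"])
  ultimately show ?thesis using tendsto_mult_right_zero[of "\<lambda>N. pw N (- g)" sequentially c] by simp
qed

text \<open>Of each gap of 20 \<open>g\<close>, the code sizes and the tests use up less than 10
  \<open>g\<close>; the rest pays for the change of measure in \<open>block_codes\<close>.\<close>

lemma common_slack:
  fixes S :: "real set"
  assumes "finite S"
  shows "\<exists>g>0. \<forall>x\<in>S. 0 < x \<longrightarrow> 20 * g \<le> x"
  using assms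
proof (induction S rule: finite_induct)
  case empty
  show ?case by (rule exI[of _ 1]) simp
next
  case (insert y S)
  then obtain g where g: "0 < g" "\<And>x. x \<in> S \<Longrightarrow> 0 < x \<Longrightarrow> 20 * g \<le> x" by blast
  define h where "h = (if 0 < y then min g (y / 20) else g)"
  have h: "0 < h" "h \<le> g" "0 < y \<Longrightarrow> 20 * h \<le> y" using g(1) by (auto simp: h_def)
  have "20 * h \<le> x" if "x \<in> insert y S" "0 < x" for x
    using that h g(2)[of x] by (cases "x = y") auto
  then show ?case using h(1) by blast
qed

context coding
begin

text \<open>\<open>lowU\<close> supplies the hypothesis of \<open>covering\<close> with b of
  exponent \<open>- IU - e\<close>.\<close>

lemma missU_le: "missU N e n \<le> ennreal (exp (- (real n * pw N (- IU - e) / 2))) + 2 * EN N (\<lambda>s u v x1 x2 y. of_bool (\<not> (accU N e u (fst \<circ> s) \<and> lowU N e u (fst \<circ> s))))"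
proof -
  have "missU N e n \<le> mean (seq_pmf N (\<lambda>_. pS)) (\<lambda>s. ennreal (exp (- (real n * pw N (- IU - e) / 2))) + 2 * mean (seq_pmf N (\<lambda>i. QU (fst (s i)))) (\<lambda>u. of_bool (\<not> (accU N e u (fst \<circ> s) \<and> lowU N e u (fst \<circ> s)))))"
    unfolding missU_def
  proof (rule nn_integral_mono, rule covering)
    fix s :: "nat \<Rightarrow> 's1 \<times> 's2" and u assume ok: "accU N e u (fst \<circ> s) \<and> lowU N e u (fst \<circ> s)"
    have "ennreal (pmf (seq_pmf N (\<lambda>i. QU (fst (s i)))) u)
       \<le> epw N (- (- IU - e)) * ennreal (pmf (seq_pmf N (\<lambda>i. cm1 (fst (s i)))) u)"
      using ok unfolding lowU_def comp_def by (intro test_dominates) simp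
    then have "epw N (- IU - e) * ennreal (pmf (seq_pmf N (\<lambda>i. QU (fst (s i)))) u)
       \<le> epw N (- IU - e) * (epw N (- (- IU - e)) * ennreal (pmf (seq_pmf N (\<lambda>i. cm1 (fst (s i)))) u))"
      by (rule mult_left_mono) simp
    also have "\<dots> = ennreal (pmf (seq_pmf N (\<lambda>i. cm1 (fst (s i)))) u)"
      by (simp add: mult.assoc[symmetric] ennreal_mult'[symmetric] less_imp_le[OF pw_pos] pw_add pw_0)
    finally show "accU N e u (fst \<circ> s) \<and> epw N (- IU - e) * ennreal (pmf (seq_pmf N (\<lambda>i. QU (fst (s i)))) u)
       \<le> ennreal (pmf (seq_pmf N (\<lambda>i. cm1 (fst (s i)))) u)" using ok by blast
  qed (rule less_imp_le[OF pw_pos])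
  then show ?thesis unfolding nn_add nn_cmult nn_const .
qed

lemma IU_zero:
  assumes "\<And>s. cm1 s = QU s"
  shows "IU = 0"
  unfolding IU_def expect_def expectation_finite_support[OF finite_SL]
proof (rule sum.neutral, rule ballI)
  fix w assume w: "w \<in> set_pmf SL"
  obtain s u v x1 x2 y where e: "w = (s, u, v, x1, x2, y)" by (cases w) auto
  show "pmf SL w * (case w of (s, u, v, x1, x2, y) \<Rightarrow> log 2 (pmf (QU (fst s)) u / pmf (cm1 (fst s)) u)) = 0"
    using SL_positive(1)[of s u v x1 x2 y] w unfolding e assms by simp
qed

text \<open>If the codebook law is the ideal law itself, the likelihood ratio is 1 and every draw is
  accepted.\<close>

lemma missU_zero:
  assumes "\<And>s. cm1 s = QU s" "0 \<le> e" "0 < n"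
  shows "missU N e n = 0"
proof -
  have IU0: "IU \<le> 0" using IU_zero[OF assms(1)] by simp
  have "mean (seq_pmf N (\<lambda>i. cm1 (fst (s i)))) (\<lambda>u. of_bool (\<not> accU N e u (fst \<circ> s))) \<le> 0" for s :: "nat \<Rightarrow> 's1 \<times> 's2"
  proof (rule nn_le_const)
    fix u assume "u \<in> set_pmf (seq_pmf N (\<lambda>i. cm1 (fst (s i))))"
    then have "0 < (\<Prod>i\<in>{1..N}. pmf (QU (fst (s i))) (u i))" using assms(1) by (intro prod_pos) (auto simp: set_Pi_pmf PiE_dflt_def intro: pmf_positive)
    moreover have "pw N (IU - e) \<le> 1" using pw_mono[of "IU - e" 0 N] IU0 assms(2) by (simp add: pw_0)
    ultimately have "accU N e u (fst \<circ> s)" unfolding accU_def test_def assms(1) comp_def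
      by (simp add: mult_left_le_one_le less_imp_le[OF pw_pos])
    then show "of_bool (\<not> accU N e u (fst \<circ> s)) \<le> (0::ennreal)" by simp
  qed
  then show ?thesis unfolding missU_def using assms(3) by (simp add: power_0_left)
qed

lemma missZ_le: "missZ N e n \<le> ennreal (exp (- (real n * pw N (- IZ - e) / 2))) + 2 * EN N (\<lambda>s u v x1 x2 y. of_bool (\<not> (accZ N e u (fst \<circ> s) v \<and> lowZ N e u (fst \<circ> s) v)))"
proof -
  have "missZ N e n \<le> mean (seq_pmf N (\<lambda>_. pS)) (\<lambda>s. mean (seq_pmf N (\<lambda>i. QU (fst (s i)))) (\<lambda>u. ennreal (exp (- (real n * pw N (- IZ - e) / 2))) + 2 * mean (seq_pmf N (\<lambda>i. QZ (u i) (fst (s i)))) (\<lambda>v. of_bool (\<not> (accZ N e u (fst \<circ> s) v \<and> lowZ N e u (fst \<circ> s) v)))))"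
    unfolding missZ_def
  proof (rule nn_integral_mono, rule nn_integral_mono, rule covering)
    fix s :: "nat \<Rightarrow> 's1 \<times> 's2" and u v assume ok: "accZ N e u (fst \<circ> s) v \<and> lowZ N e u (fst \<circ> s) v"
    have "ennreal (pmf (seq_pmf N (\<lambda>i. QZ (u i) (fst (s i)))) v)
       \<le> epw N (- (- IZ - e)) * ennreal (pmf (seq_pmf N (\<lambda>i. PZ)) v)"
      using ok unfolding lowZ_def comp_def by (intro test_dominates) simp
    then have "epw N (- IZ - e) * ennreal (pmf (seq_pmf N (\<lambda>i. QZ (u i) (fst (s i)))) v)
       \<le> epw N (- IZ - e) * (epw N (- (- IZ - e)) * ennreal (pmf (seq_pmf N (\<lambda>i. PZ)) v))"
      by (rule mult_left_mono) simp
    also have "\<dots> = ennreal (pmf (seq_pmf N (\<lambda>i. PZ)) v)"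
      by (simp add: mult.assoc[symmetric] ennreal_mult'[symmetric] less_imp_le[OF pw_pos] pw_add pw_0)
    finally show "accZ N e u (fst \<circ> s) v \<and> epw N (- IZ - e) * ennreal (pmf (seq_pmf N (\<lambda>i. QZ (u i) (fst (s i)))) v)
       \<le> ennreal (pmf (seq_pmf N (\<lambda>i. PZ)) v)" using ok by blast
  qed (rule less_imp_le[OF pw_pos])
  then show ?thesis unfolding nn_add nn_cmult nn_const .
qed

text \<open>The crib must carry \<open>aJ\<close> and the bin index on top of the covering of Z,
  hence the strict inequality with \<open>HZ\<close>. In the other alternative there is just one
  index and nothing has to be read. A rate 0 exempts from its inequality, since one codeword has no
  competitor.\<close>

theorem block_codes:
  assumes a: "0 \<le> aJ" "0 \<le> aA" "0 \<le> aC" and info: "0 \<le> IU2" "IU2 \<le> IU" "0 \<le> IZ"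
    and crib: "(aJ = 0 \<and> (\<forall>s. cm1 s = QU s)) \<or> aJ + (IU - IU2) + IZ < HZ"
    and rates: "aA = 0 \<or> aA < I1" "aC = 0 \<or> aC < I2" "aA = 0 \<or> aC = 0 \<or> aA + aC < I3" "aJ = 0 \<or> aJ + aA + aC < I5"
    and \<eta>: "0 < \<eta>"
  shows "\<exists>N0. \<forall>N\<ge>N0. \<exists>L. block_code N (cnt N aJ) L (cnt N aA) (cnt N aC) (ennreal \<eta>)"
proof -
  obtain g where g: "0 < g" and le: "\<And>x. x \<in> {HZ - (aJ + (IU - IU2) + IZ), I1 - aA, I2 - aC, I3 - (aA + aC), I5 - (aJ + aA + aC)} \<Longrightarrow> 0 < x \<Longrightarrow> 20 * g \<le> x"
    using common_slack[of "{HZ - (aJ + (IU - IU2) + IZ), I1 - aA, I2 - aC, I3 - (aA + aC), I5 - (aJ + aA + aC)}"] by blast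
  have slack: "(aJ = 0 \<and> (\<forall>s. cm1 s = QU s)) \<or> aJ + (IU - IU2) + IZ + 20 * g \<le> HZ"
     "aA = 0 \<or> aA + 20 * g \<le> I1" "aC = 0 \<or> aC + 20 * g \<le> I2" "aA = 0 \<or> aC = 0 \<or> aA + aC + 20 * g \<le> I3" "aJ = 0 \<or> aJ + aA + aC + 20 * g \<le> I5"
    using crib rates le[of "HZ - (aJ + (IU - IU2) + IZ)"] le[of "I1 - aA"] le[of "I2 - aC"] le[of "I3 - (aA + aC)"] le[of "I5 - (aJ + aA + aC)"]
    by auto
  obtain t1 where t1: "0 < t1" "\<And>N. miss N g \<le> ennreal (6 * pw N (- t1))" using tail_good[OF g] unfolding miss_def by blast
  \<comment> \<open>The slacks are chosen backwards. Changing the measure for Z and U costs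
    exponents \<open>3 * eZ\<close> and \<open>3 * eU\<close>, which must be small against the
    exponent \<open>t1\<close> of the final tests. Likewise \<open>eU\<close> must be small against
    \<open>eZ\<close> and \<open>t2\<close>, which govern the covering of Z.\<close>
  define eZ where "eZ = min g (t1 / 12)"
  have eZ: "0 < eZ" "eZ \<le> g" "eZ \<le> t1 / 12" using g t1 by (auto simp: eZ_def)
  obtain t2 where t2: "0 < t2" "\<And>N. EN N (\<lambda>s u v x1 x2 y. of_bool (\<not> (accZ N eZ u (fst \<circ> s) v \<and> lowZ N eZ u (fst \<circ> s) v))) \<le> ennreal (2 * pw N (- t2))"
    using tail_Z[OF eZ(1)] by blast
  define eU where "eU = min (eZ / 6) (t2 / 6)"
  have eU: "0 < eU" "eU \<le> eZ / 6" "eU \<le> t2 / 6" using eZ t2 by (auto simp: eU_def)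
  obtain t3 where t3: "0 < t3" "\<And>N. EN N (\<lambda>s u v x1 x2 y. of_bool (\<not> (accU N eU u (fst \<circ> s) \<and> lowU N eU u (fst \<circ> s)))) \<le> ennreal (2 * pw N (- t3))"
    using tail_U[OF eU(1)] by blast
  define triv where "triv \<longleftrightarrow> aJ = 0 \<and> (\<forall>s. cm1 s = QU s)"
  \<comment> \<open>The rate of words in a bin stays 3 \<open>g\<close> below \<open>IU2\<close>, so
    that encoder 2 finds no second candidate. The total rate \<open>aL + aM\<close> exceeds
    \<open>IU\<close> by \<open>2 * eU\<close>, enough for covering. In the degenerate case a single
    word suffices.\<close>
  define aM where "aM = (if triv then 0 else max 0 (IU2 - 3 * g))"
  define aL where "aL = (if triv then 0 else IU + 2 * eU - aM)"
  define aT where "aT = IZ + 2 * eZ"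
  define r where "r = Min {eU, eZ, t1 / 2, t2 / 2, t3, g}"
  have r: "0 < r" "r \<le> eU" "r \<le> eZ" "r \<le> t1 / 2" "r \<le> t2 / 2" "r \<le> t3" "r \<le> g"
    using eU eZ t1 t2 t3 g by (simp_all add: r_def)
  have aM0: "0 \<le> aM" by (simp add: aM_def)
  have aL0: "0 \<le> aL" using info eU g by (auto simp: aL_def aM_def)
  have aT0: "0 \<le> aT" using info eZ by (simp add: aT_def)
  have IU_triv: "IU = 0" if triv using that IU_zero unfolding triv_def by blast
  have aLM: "aL + aM - IU \<le> 2 * eU" using IU_triv eU unfolding aL_def aM_def by auto
  let ?err = "\<lambda>N fU fZ. missU N eU (cnt N aL * cnt N aM) + fU * missZ N eZ (cnt N aT) + fU * of_nat (cnt N aM - 1) * epw N (- (IU2 - g))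
      + fU * fZ * (of_nat ((cnt N aJ * cnt N aL - 1) * cnt N aT) * epw N (- (HZ - g)) + miss N g + of_nat (cnt N aA - 1) * epw N (- (I1 - g))
         + of_nat (cnt N aC - 1) * epw N (- (I2 - g)) + of_nat ((cnt N aA - 1) * (cnt N aC - 1)) * epw N (- (I3 - g))
         + of_nat ((cnt N aJ - 1) * cnt N aA * cnt N aC) * (fU * fZ * epw N (- (I5 - g))))"
  have bound: "bd N (?err N fU fZ)
      (12 + 4 * 12 + 4 + 8 * (8 + 6 + 1 + 1 + 1 + 4 * 8)) (- r)"
    if fU: "fU = of_nat (cnt N aL * cnt N aM) * epw N (- (IU - eU))" and fZ: "fZ = of_nat (cnt N aT) * epw N (- (IZ - eZ))" for N fU fZ
  proof -
    have bU: "bd N fU 4 (3 * eU)"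
    proof -
      have "bd N fU (2 * 2 * 1) (aL + aM + - (IU - eU))" unfolding fU of_nat_mult
        by (intro bd_mult bd_cnt aL0 aM0 bd_pw)
      then show ?thesis using aLM by (auto elim: bd_weaken)
    qed
    have bZ: "bd N fZ 2 (3 * eZ)"
    proof -
      have "bd N fZ (2 * 1) (aT + - (IZ - eZ))" unfolding fZ by (intro bd_mult bd_cnt aT0 bd_pw)
      then show ?thesis by (auto elim: bd_weaken simp: aT_def)
    qed
    have bUZ: "bd N (fU * fZ) 8 (3 * eU + 3 * eZ)" using bd_mult[OF bU bZ] by simp
    have b2: "bd N 2 2 0" by (simp add: bd_def pw_0)
    have bt: "bd N x c (- t)" if "x \<le> ennreal (c * pw N (- t))" "0 \<le> c" for x c t using that by (simp add: bd_def)
    have m1: "bd N (missU N eU (cnt N aL * cnt N aM)) 12 (- r)"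
    proof (cases triv)
      case True
      then have "missU N eU (cnt N aL * cnt N aM) = 0" using eU cnt_pos by (intro missU_zero) (auto simp: triv_def)
      then show ?thesis by (simp add: bd_zero)
    next
      case False
      \<comment> \<open>The list is longer by a factor of exponent \<open>eU\<close> than the
        inverse of the acceptance bound, so the probability of missing is doubly exponentially small
        apart from the tail term.\<close>
      have "pw N (IU + 2 * eU) = pw N aL * pw N aM" unfolding pw_add using False by (simp add: aL_def)
      also have "\<dots> \<le> real (cnt N aL) * real (cnt N aM)" by (intro mult_mono cnt_ge) (auto intro: less_imp_le[OF pw_pos])
      finally have "pw N (IU + 2 * eU) * pw N (- IU - eU) \<le> real (cnt N aL * cnt N aM) * pw N (- IU - eU)"
        by (intro mult_right_mono) (auto intro: less_imp_le[OF pw_pos])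
      then have "pw N eU \<le> real (cnt N aL * cnt N aM) * pw N (- IU - eU)" unfolding pw_add by simp
      then have "missU N eU (cnt N aL * cnt N aM) \<le> ennreal (exp (- (pw N eU / 2))) + 2 * EN N (\<lambda>s u v x1 x2 y. of_bool (\<not> (accU N eU u (fst \<circ> s) \<and> lowU N eU u (fst \<circ> s))))"
        by (intro order_trans[OF missU_le] add_mono ennreal_leI) auto
      moreover have "bd N (ennreal (exp (- (pw N eU / 2))) + 2 * EN N (\<lambda>s u v x1 x2 y. of_bool (\<not> (accU N eU u (fst \<circ> s) \<and> lowU N eU u (fst \<circ> s))))) (8 + 2 * 2) (- r)"
        by (intro bd_add bd_weaken[OF bd_exp] bd_weaken[OF bd_mult[OF b2 bt[OF t3(2)]]]) (use r eU in auto)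
      ultimately show ?thesis by (auto intro: bd_mono)
    qed
    have m2: "bd N (fU * missZ N eZ (cnt N aT)) (4 * 12) (- r)"
    proof -
      have "pw N (IZ + 2 * eZ) * pw N (- IZ - eZ) \<le> real (cnt N aT) * pw N (- IZ - eZ)"
        unfolding aT_def by (intro mult_right_mono cnt_ge) (auto intro: less_imp_le[OF pw_pos])
      then have "pw N eZ \<le> real (cnt N aT) * pw N (- IZ - eZ)" unfolding pw_add by simp
      then have "missZ N eZ (cnt N aT) \<le> ennreal (exp (- (pw N eZ / 2))) + 2 * EN N (\<lambda>s u v x1 x2 y. of_bool (\<not> (accZ N eZ u (fst \<circ> s) v \<and> lowZ N eZ u (fst \<circ> s) v)))"
        by (intro order_trans[OF missZ_le] add_mono ennreal_leI) auto
      moreover have "bd N (ennreal (exp (- (pw N eZ / 2))) + 2 * EN N (\<lambda>s u v x1 x2 y. of_bool (\<not> (accZ N eZ u (fst \<circ> s) v \<and> lowZ N eZ u (fst \<circ> s) v)))) (8 + 2 * 2) (max (- (2 * eZ)) (- t2))"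
        by (intro bd_add bd_weaken[OF bd_exp] bd_weaken[OF bd_mult[OF b2 bt[OF t2(2)]]]) auto
      ultimately have "bd N (missZ N eZ (cnt N aT)) 12 (max (- (2 * eZ)) (- t2))" by (auto intro: bd_mono)
      from bd_mult[OF bU this] show ?thesis by (rule bd_weaken) (use r eU eZ t2 in auto)
    qed
    have m3: "bd N (fU * of_nat (cnt N aM - 1) * epw N (- (IU2 - g))) 4 (- r)"
    proof (cases "aM = 0")
      case True
      then show ?thesis by (simp add: cnt_0 bd_zero)
    next
      case False
      then have "aM = IU2 - 3 * g" by (auto simp: aM_def split: if_splits)
      then show ?thesis
        using bd_weaken[OF bd_mult[OF bd_mult[OF bU bd_cnt_diff] bd_pw], of aM "- (IU2 - g)" "- r"] r eU eZ g by auto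
    qed
    have k: "bd N (of_nat ((cnt N aJ * cnt N aL - 1) * cnt N aT) * epw N (- (HZ - g))) 8 (- 10 * g)"
    proof (cases triv)
      case True
      then show ?thesis by (simp add: triv_def aL_def cnt_0 bd_zero)
    next
      case False
      then have s: "aJ + (IU - IU2) + IZ + 20 * g \<le> HZ" using slack(1) by (auto simp: triv_def)
      have aLle: "aL \<le> IU - IU2 + 3 * g + 2 * eU" using False by (auto simp: aL_def aM_def)
      have "of_nat ((cnt N aJ * cnt N aL - 1) * cnt N aT) \<le> (of_nat (cnt N aJ * cnt N aL * cnt N aT) :: ennreal)"
        by (intro of_nat_mono mult_right_mono) auto
      then have "of_nat ((cnt N aJ * cnt N aL - 1) * cnt N aT) * epw N (- (HZ - g)) \<le> of_nat (cnt N aJ * cnt N aL * cnt N aT) * epw N (- (HZ - g))"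
        by (rule mult_right_mono) simp
      moreover have "bd N (of_nat (cnt N aJ * cnt N aL * cnt N aT) * epw N (- (HZ - g))) (2 * 2 * 2 * 1) (aJ + aL + aT + - (HZ - g))"
        unfolding of_nat_mult by (intro bd_mult bd_cnt bd_pw a aL0 aT0)
      ultimately have "bd N (of_nat ((cnt N aJ * cnt N aL - 1) * cnt N aT) * epw N (- (HZ - g))) (2 * 2 * 2 * 1) (aJ + aL + aT + - (HZ - g))"
        by (rule bd_mono)
      then have "bd N (of_nat ((cnt N aJ * cnt N aL - 1) * cnt N aT) * epw N (- (HZ - g))) (2 * 2 * 2 * 1) (- 10 * g)"
        by (rule bd_weaken) (use s aLle eU eZ g in \<open>simp add: aT_def\<close>)
      then show ?thesis by simp
    qed
    have d1: "bd N (of_nat (cnt N x - 1) * epw N (- (I - g))) 1 (- 10 * g)" if "x = 0 \<or> x + 20 * g \<le> I" for x I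
    proof (cases "x = 0")
      case True then show ?thesis by (simp add: cnt_0 bd_zero)
    next
      case False
      then show ?thesis using bd_weaken[OF bd_mult[OF bd_cnt_diff bd_pw], of x "- (I - g)" "- 10 * g"] that g by auto
    qed
    have d3: "bd N (of_nat ((cnt N aA - 1) * (cnt N aC - 1)) * epw N (- (I3 - g))) 1 (- 10 * g)"
    proof (cases "aA = 0 \<or> aC = 0")
      case True then show ?thesis by (auto simp: cnt_0 bd_zero)
    next
      case False
      then show ?thesis using bd_weaken[OF bd_mult[OF bd_mult[OF bd_cnt_diff bd_cnt_diff] bd_pw], of aA aC "- (I3 - g)" "- 10 * g"] slack(4) g
        by auto
    qed
    have d5: "bd N (of_nat ((cnt N aJ - 1) * cnt N aA * cnt N aC) * (fU * fZ * epw N (- (I5 - g)))) (4 * 8) (- 10 * g)"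
    proof (cases "aJ = 0")
      case True then show ?thesis by (simp add: cnt_0 bd_zero)
    next
      case False
      have "bd N (of_nat ((cnt N aJ - 1) * cnt N aA * cnt N aC) * (fU * fZ * epw N (- (I5 - g)))) (1 * 2 * 2 * (8 * 1)) (aJ + aA + aC + (3 * eU + 3 * eZ + - (I5 - g)))"
        unfolding of_nat_mult by (intro bd_mult[OF _ bd_mult[OF bUZ bd_pw]] bd_mult bd_cnt bd_cnt_diff a)
      then have "bd N (of_nat ((cnt N aJ - 1) * cnt N aA * cnt N aC) * (fU * fZ * epw N (- (I5 - g)))) (1 * 2 * 2 * (8 * 1)) (- 10 * g)"
        by (rule bd_weaken) (use False slack(5) eU eZ g in auto)
      then show ?thesis by simp
    qed
    define w where "w = max (- 10 * g) (- t1)"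
    have inner: "bd N (of_nat ((cnt N aJ * cnt N aL - 1) * cnt N aT) * epw N (- (HZ - g)) + miss N g + of_nat (cnt N aA - 1) * epw N (- (I1 - g))
         + of_nat (cnt N aC - 1) * epw N (- (I2 - g)) + of_nat ((cnt N aA - 1) * (cnt N aC - 1)) * epw N (- (I3 - g))
         + of_nat ((cnt N aJ - 1) * cnt N aA * cnt N aC) * (fU * fZ * epw N (- (I5 - g)))) (8 + 6 + 1 + 1 + 1 + 4 * 8) w"
      by (intro bd_add bd_weaken[OF k] bd_weaken[OF bt[OF t1(2)]] bd_weaken[OF d1[OF slack(2)]] bd_weaken[OF d1[OF slack(3)]] bd_weaken[OF d3] bd_weaken[OF d5])
        (auto simp: w_def)
    show ?thesis
      by (intro bd_add m1 m2 m3 bd_weaken[OF bd_mult[OF bUZ inner]]) (use r eU eZ t1 g in \<open>auto simp: w_def\<close>)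
  qed
  define c where "c = (12 + 4 * 12 + 4 + 8 * (8 + 6 + 1 + 1 + 1 + 4 * 8) :: real)"
  have "eventually (\<lambda>N. c * pw N (- r) < \<eta>) sequentially"
    using order_tendstoD(2)[OF pw_tendsto_0[OF r(1)] \<eta>] .
  then obtain N0 where N0: "\<And>N. N \<ge> N0 \<Longrightarrow> c * pw N (- r) < \<eta>" unfolding eventually_sequentially by blast
  show ?thesis
  proof (rule exI[of _ N0], intro allI impI)
    fix N assume N: "N0 \<le> N"
    show "\<exists>L. block_code N (cnt N aJ) L (cnt N aA) (cnt N aC) (ennreal \<eta>)"
    proof (intro exI[of _ "cnt N aL"] block_code_exists[where M="cnt N aM" and T="cnt N aT" and eU=eU and eZ=eZ and e=g] cnt_pos)
      show "ennreal \<eta> < \<top>" by simp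
      show "?err N (of_nat (cnt N aL * cnt N aM) * epw N (- (IU - eU))) (of_nat (cnt N aT) * epw N (- (IZ - eZ))) \<le> ennreal \<eta>"
        using bound[OF refl refl, of N] N0[OF N] unfolding bd_def c_def[symmetric] by (meson ennreal_leI less_imp_le order_trans)
    qed
  qed
qed

end

subsection \<open>Achievability\<close>

text \<open>Conditioning on the second component; where this component has probability 0, the kernel
  may be anything.\<close>

lemma disintegration:
  fixes p :: "('a \<times> 'b) pmf"
  shows "\<exists>\<kappa>. p = bind_pmf (map_pmf snd p) (\<lambda>v. map_pmf (\<lambda>x. (x, v)) (\<kappa> v))"
proof -
  define \<kappa> where "\<kappa> v = map_pmf fst (cond_pmf p {w. snd w = v})" for v
  have "pmf p (x, v) = pmf (map_pmf snd p) v * pmf (\<kappa> v) x" for x v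
  proof (cases "v \<in> snd ` set_pmf p")
    case True
    then have ne: "set_pmf p \<inter> {w. snd w = v} \<noteq> {}" by auto
    have m: "measure_pmf.prob p {w. snd w = v} = pmf (map_pmf snd p) v" by (simp add: pmf_map vimage_def)
    have pos: "0 < pmf (map_pmf snd p) v" using True by (intro pmf_positive) auto
    have "pmf (\<kappa> v) x = pmf (cond_pmf p {w. snd w = v}) (x, v)"
    proof -
      have "pmf (\<kappa> v) x = measure_pmf.prob (cond_pmf p {w. snd w = v}) (fst -` {x})" unfolding \<kappa>_def by (rule pmf_map)
      also have "\<dots> = measure_pmf.prob (cond_pmf p {w. snd w = v}) {(x, v)}"
        by (rule measure_prob_cong_0) (auto simp: pmf_cond[OF ne] split: if_splits)
      finally show ?thesis by (simp add: measure_pmf_single)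
    qed
    also have "\<dots> = pmf p (x, v) / pmf (map_pmf snd p) v" by (simp add: pmf_cond[OF ne] m)
    finally show ?thesis using pos by simp
  next
    case False
    then have "(x, v) \<notin> set_pmf p" by force
    then have "pmf p (x, v) = 0" by (simp add: set_pmf_iff)
    moreover have "v \<notin> set_pmf (map_pmf snd p)" using False by simp
    then have "pmf (map_pmf snd p) v = 0" by (simp only: set_pmf_iff) simp
    ultimately show ?thesis by simp
  qed
  then have "p = bind_pmf (map_pmf snd p) (\<lambda>v. map_pmf (\<lambda>x. (x, v)) (\<kappa> v))"
    by (intro pmf_eqI) (auto simp: pmf_bind_map_pair split: prod.split)
  then show ?thesis by blast
qed

context mac
begin

text \<open>Block 0 carries no message, whence the factor (B - 1) / B. The union bound over the
  blocks is paid by asking each block for error \<open>\<epsilon> / B\<close>.\<close>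

lemma achievable_of_blocks:
  assumes a: "0 \<le> aJ" "0 \<le> aA" "0 \<le> aC" and B: "0 < B"
    and bc: "\<And>\<eta>. 0 < \<eta> \<Longrightarrow> \<exists>N0. \<forall>N\<ge>N0. \<exists>L. block_code N (cnt N aJ) L (cnt N aA) (cnt N aC) (ennreal \<eta>)"
  shows "achievable pS W z (real (B - 1) / real B * (aJ + aA)) (real (B - 1) / real B * aC)"
proof -
  let ?R1 = "real (B - 1) / real B * (aJ + aA)" and ?R2 = "real (B - 1) / real B * aC"
  have R: "0 \<le> ?R1" "0 \<le> ?R2" using a by auto
  have card: "card (messages (N * B) (real (B - 1) / real B * r)) \<le> m ^ (B - 1)" if "pw N r \<le> real m" for N r m
  proof -
    have "2 powr (real (N * B) * (real (B - 1) / real B * r)) = pw N r ^ (B - 1)"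
      using B by (simp add: pw_def powr_power mult_ac)
    also have "\<dots> \<le> real m ^ (B - 1)" using that less_imp_le[OF pw_pos] by (intro power_mono) auto
    finally have "2 powr (real (N * B) * (real (B - 1) / real B * r)) \<le> real (m ^ (B - 1))" by simp
    then show ?thesis unfolding card_messages by (simp only: nat_le_iff) linarith
  qed
  have "\<exists>n\<ge>N. \<exists>enc1 enc2 dec1 dec2. (\<forall>y s1 s2. dec1 y s1 s2 \<in> messages n ?R1 \<and> dec2 y s1 s2 \<in> messages n ?R2) \<and>
        measure_pmf.prob (transmission pS W z ?R1 ?R2 n enc1 enc2) (wrong dec1 dec2) \<le> \<epsilon>" if \<epsilon>: "0 < \<epsilon>" for \<epsilon> N
  proof -
    obtain N0 where N0: "\<And>N. N \<ge> N0 \<Longrightarrow> \<exists>L. block_code N (cnt N aJ) L (cnt N aA) (cnt N aC) (ennreal (\<epsilon> / B))"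
      using bc[of "\<epsilon> / B"] \<epsilon> B by auto
    define N1 where "N1 = max N0 N"
    obtain L where L: "block_code N1 (cnt N1 aJ) L (cnt N1 aA) (cnt N1 aC) (ennreal (\<epsilon> / B))" using N0[of N1] by (auto simp: N1_def)
    have "pw N1 (aJ + aA) \<le> real (cnt N1 aJ * cnt N1 aA)"
      unfolding pw_add[symmetric] of_nat_mult by (intro mult_mono cnt_ge) (auto intro: less_imp_le[OF pw_pos])
    from multiblock[OF L _ B R card[OF this] card[OF cnt_ge]]
    obtain enc1 enc2 dec1 dec2 where d: "\<And>y s1 s2. dec1 y s1 s2 \<in> messages (N1 * B) ?R1 \<and> dec2 y s1 s2 \<in> messages (N1 * B) ?R2"
      and em: "emeasure (transmission pS W z ?R1 ?R2 (N1 * B) enc1 enc2) (wrong dec1 dec2) \<le> of_nat B * ennreal (\<epsilon> / B)" by auto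
    have "of_nat B * ennreal (\<epsilon> / B) = ennreal \<epsilon>" using B \<epsilon> by (simp add: ennreal_of_nat_eq_real_of_nat ennreal_mult[symmetric])
    then have "measure_pmf.prob (transmission pS W z ?R1 ?R2 (N1 * B) enc1 enc2) (wrong dec1 dec2) \<le> \<epsilon>"
      using em \<epsilon> by (simp add: measure_pmf.emeasure_eq_measure)
    moreover have "N \<le> N1 * B" using B by (cases B) (auto simp: N1_def)
    ultimately show ?thesis using d by blast
  qed
  then show ?thesis unfolding achievable_def using R by blast
qed

text \<open>The capacity region is closed, so letting the number of blocks grow removes the rate
  loss.\<close>

lemma blocks_in_capacity_region:
  assumes a: "0 \<le> aJ" "0 \<le> aA" "0 \<le> aC"
    and bc: "\<And>\<eta>. 0 < \<eta> \<Longrightarrow> \<exists>N0. \<forall>N\<ge>N0. \<exists>L. block_code N (cnt N aJ) L (cnt N aA) (cnt N aC) (ennreal \<eta>)"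
  shows "(aJ + aA, aC) \<in> capacity_region pS W z"
  unfolding capacity_region_def closure_sequential
proof (intro exI conjI allI)
  let ?t = "\<lambda>b. real (Suc b - 1) / real (Suc b)"
  show "(?t b * (aJ + aA), ?t b * aC) \<in> {(R1, R2). achievable pS W z R1 R2}" for b
    using achievable_of_blocks[OF a _ bc, of "Suc b"] by simp
  have "?t \<longlonglongrightarrow> 1" by simp real_asymp
  then have "(\<lambda>b. (?t b * (aJ + aA), ?t b * aC)) \<longlonglongrightarrow> (1 * (aJ + aA), 1 * aC)" by (intro tendsto_intros)
  then show "(\<lambda>b. (?t b * (aJ + aA), ?t b * aC)) \<longlonglongrightarrow> (aJ + aA, aC)" by simp
qed

lemma capacity_region_limit:
  assumes "\<And>\<eta>. 0 < \<eta> \<Longrightarrow> (max 0 (R1 - \<eta>), max 0 (R2 - \<eta>)) \<in> capacity_region pS W z" and "0 \<le> R1" "0 \<le> R2"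
  shows "(R1, R2) \<in> capacity_region pS W z"
proof -
  have "(\<lambda>b. 1 / real (Suc b)) \<longlonglongrightarrow> 0" by real_asymp
  then have "(\<lambda>b. (max 0 (R1 - 1 / real (Suc b)), max 0 (R2 - 1 / real (Suc b)))) \<longlonglongrightarrow> (max 0 (R1 - 0), max 0 (R2 - 0))"
    by (intro tendsto_intros)
  moreover have "closed (capacity_region pS W z)" unfolding capacity_region_def by simp
  ultimately have "(max 0 (R1 - 0), max 0 (R2 - 0)) \<in> capacity_region pS W z"
    by (rule closed_sequentially[rotated 2]) (auto intro: assms(1))
  then show ?thesis using assms(2,3) by simp
qed

end

context coding
begin

abbreviation "cY \<equiv> \<lambda>(s, u, v, x1, x2, y). y"
abbreviation "cU \<equiv> \<lambda>(s, u, v, x1, x2, y). u"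
abbreviation "cV \<equiv> \<lambda>(s, u, v, x1, x2, y). v"
abbreviation "cS \<equiv> \<lambda>(s, u, v, x1, x2, y). s"
abbreviation "cS2 \<equiv> \<lambda>(s, u, v, x1, x2, y). snd s"
abbreviation "cS1U \<equiv> \<lambda>(s, u, v, x1, x2, y). (fst s, u)"
abbreviation "c0 \<equiv> \<lambda>(s, u, v, x1, x2, y). ()"
abbreviation "hS \<equiv> hc (set_pmf SL) (pmf SL)"

lemma expect_log_ratio:
  assumes "\<And>s u v x1 x2 y. (s, u, v, x1, x2, y) \<in> set_pmf SL \<Longrightarrow> 0 < f s u v x1 x2 y \<and> 0 < g s u v x1 x2 y"
  shows "expect (\<lambda>s u v x1 x2 y. log 2 (f s u v x1 x2 y / g s u v x1 x2 y)) = expect (\<lambda>s u v x1 x2 y. log 2 (f s u v x1 x2 y)) - expect (\<lambda>s u v x1 x2 y. log 2 (g s u v x1 x2 y))"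
  unfolding expect_def expectation_finite_support[OF finite_SL] sum_subtractf[symmetric]
proof (intro sum.cong refl)
  fix w assume w: "w \<in> set_pmf SL"
  obtain s u v x1 x2 y where e: "w = (s, u, v, x1, x2, y)" by (cases w) auto
  show "pmf SL w * (case w of (s, u, v, x1, x2, y) \<Rightarrow> log 2 (f s u v x1 x2 y / g s u v x1 x2 y))
    = pmf SL w * (case w of (s, u, v, x1, x2, y) \<Rightarrow> log 2 (f s u v x1 x2 y)) - pmf SL w * (case w of (s, u, v, x1, x2, y) \<Rightarrow> log 2 (g s u v x1 x2 y))"
    using assms[of s u v x1 x2 y] w unfolding e by (simp add: log_divide algebra_simps)
qed

lemma hS_kernel:
  assumes "map_pmf (\<lambda>(s, u, v, x1, x2, y). (X s u v x1 x2 y, V s u v x1 x2 y)) SL = bind_pmf (map_pmf (\<lambda>(s, u, v, x1, x2, y). V s u v x1 x2 y) SL) (\<lambda>v. map_pmf (\<lambda>x. (x, v)) (\<kappa> v))"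
  shows "hS (\<lambda>(s, u, v, x1, x2, y). X s u v x1 x2 y) (\<lambda>(s, u, v, x1, x2, y). V s u v x1 x2 y) = - expect (\<lambda>s u v x1 x2 y. log 2 (pmf (\<kappa> (V s u v x1 x2 y)) (X s u v x1 x2 y)))"
  using hc_kernel_pmf[OF finite_SL, of "\<lambda>(s, u, v, x1, x2, y). X s u v x1 x2 y" "\<lambda>(s, u, v, x1, x2, y). V s u v x1 x2 y" \<kappa>] assms
  unfolding expect_def by (simp add: case_prod_unfold)

lemmas pmf_simps = SL_def map_pmf_def bind_assoc_pmf bind_return_pmf

lemma hS_y: "hS cY (\<lambda>(s, u, v, x1, x2, y). (s, u, v, x1, x2)) = - expect (\<lambda>s u v x1 x2 y. log 2 (pmf (W x1 x2 (fst s) (snd s)) y))"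
  by (subst hS_kernel[where \<kappa>="\<lambda>(s, u, v, x1, x2). W x1 x2 (fst s) (snd s)"]) (simp_all add: pmf_simps)

lemma hS_y': "hS cY (\<lambda>(s, u, v, x1, x2, y). (s, x1, x2)) = - expect (\<lambda>s u v x1 x2 y. log 2 (pmf (W x1 x2 (fst s) (snd s)) y))"
  by (subst hS_kernel[where \<kappa>="\<lambda>(s, x1, x2). W x1 x2 (fst s) (snd s)"]) (simp_all add: pmf_simps)

lemma hS_V2: "hS cY (\<lambda>(s, u, v, x1, x2, y). (s, u, x1)) = - expect (\<lambda>s u v x1 x2 y. log 2 (pmf (V2 u x1 s) y))"
  by (subst hS_kernel[where \<kappa>="\<lambda>(s, u, x1). V2 u x1 s"]) (simp_all add: pmf_simps V2_def)

lemma hS_V3: "hS cY (\<lambda>(s, u, v, x1, x2, y). (s, u, v)) = - expect (\<lambda>s u v x1 x2 y. log 2 (pmf (V3 u v s) y))"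
  by (subst hS_kernel[where \<kappa>="\<lambda>(s, u, v). V3 u v s"]) (simp_all add: pmf_simps V3_def)

lemma hS_V5: "hS cY cS = - expect (\<lambda>s u v x1 x2 y. log 2 (pmf (V5 s) y))"
  by (subst hS_kernel[where \<kappa>="V5"]) (simp_all add: pmf_simps V5_def)

lemma hS_V1: "hS cY (\<lambda>(s, u, v, x1, x2, y). (s, u, v, x2)) = - expect (\<lambda>s u v x1 x2 y. log 2 (pmf (V1 u v x2 s) y))"
proof (subst hS_kernel[where \<kappa>="\<lambda>(s, u, v, x2). V1 u v x2 s"])
  show "map_pmf (\<lambda>(s, u, v, x1, x2, y). (y, s, u, v, x2)) SL = map_pmf (\<lambda>(s, u, v, x1, x2, y). (s, u, v, x2)) SL \<bind> (\<lambda>v. map_pmf (\<lambda>x. (x, v)) (case v of (s, u, v, x2) \<Rightarrow> V1 u v x2 s))"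
    by (simp add: pmf_simps V1_def) (subst bind_commute_pmf, rule refl)
qed simp

lemma hS_QU: "hS cU cS = - expect (\<lambda>s u v x1 x2 y. log 2 (pmf (QU (fst s)) u))"
  by (subst hS_kernel[where \<kappa>="\<lambda>s. QU (fst s)"]) (simp_all add: pmf_simps)

lemma hS_QZ: "hS cV cS1U = - expect (\<lambda>s u v x1 x2 y. log 2 (pmf (QZ u (fst s)) v))"
  by (subst hS_kernel[where \<kappa>="\<lambda>(s, u). QZ u s"]) (simp_all add: pmf_simps)

lemma I1_eq: "I1 = hS cY (\<lambda>(s, u, v, x1, x2, y). (s, u, v, x2)) - hS cY (\<lambda>(s, u, v, x1, x2, y). (s, u, v, x1, x2))"
  unfolding I1_def hS_V1 hS_y by (subst expect_log_ratio) (auto intro: SL_positive)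
lemma I2_eq: "I2 = hS cY (\<lambda>(s, u, v, x1, x2, y). (s, u, x1)) - hS cY (\<lambda>(s, u, v, x1, x2, y). (s, u, v, x1, x2))"
  unfolding I2_def hS_V2 hS_y by (subst expect_log_ratio) (auto intro: SL_positive)
lemma I3_eq: "I3 = hS cY (\<lambda>(s, u, v, x1, x2, y). (s, u, v)) - hS cY (\<lambda>(s, u, v, x1, x2, y). (s, u, v, x1, x2))"
  unfolding I3_def hS_V3 hS_y by (subst expect_log_ratio) (auto intro: SL_positive)
lemma I5_eq: "I5 = hS cY cS - hS cY (\<lambda>(s, u, v, x1, x2, y). (s, x1, x2))"
  unfolding I5_def hS_V5 hS_y' by (subst expect_log_ratio) (auto intro: SL_positive)

end

text \<open>Names for the coordinate patterns in the theorem, so that the unfolded region can be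
  folded into readable terms.\<close>

definition jS1 :: "'s1 \<times> 's2 \<times> nat \<times> 'x1 \<times> 'x2 \<times> 'y \<Rightarrow> 's1" where "jS1 = (\<lambda>(s1, s2, u, x1, x2, y). s1)"
definition jS2 :: "'s1 \<times> 's2 \<times> nat \<times> 'x1 \<times> 'x2 \<times> 'y \<Rightarrow> 's2" where "jS2 = (\<lambda>(s1, s2, u, x1, x2, y). s2)"
definition jU :: "'s1 \<times> 's2 \<times> nat \<times> 'x1 \<times> 'x2 \<times> 'y \<Rightarrow> nat" where "jU = (\<lambda>(s1, s2, u, x1, x2, y). u)"
definition jX1 :: "'s1 \<times> 's2 \<times> nat \<times> 'x1 \<times> 'x2 \<times> 'y \<Rightarrow> 'x1" where "jX1 = (\<lambda>(s1, s2, u, x1, x2, y). x1)"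
definition jX2 :: "'s1 \<times> 's2 \<times> nat \<times> 'x1 \<times> 'x2 \<times> 'y \<Rightarrow> 'x2" where "jX2 = (\<lambda>(s1, s2, u, x1, x2, y). x2)"
definition jY :: "'s1 \<times> 's2 \<times> nat \<times> 'x1 \<times> 'x2 \<times> 'y \<Rightarrow> 'y" where "jY = (\<lambda>(s1, s2, u, x1, x2, y). y)"
lemmas j_defs = jS1_def jS2_def jU_def jX1_def jX2_def jY_def

text \<open>As much of message 1 as the crib can carry goes into \<open>aJ\<close>, up to
  \<open>f - \<eta> / 2\<close>; the rest is \<open>aA\<close>. Lowering both rates by
  \<open>\<eta>\<close> leaves every bound strict unless the rate concerned is 0.\<close>

lemma split_rates:
  fixes f R1 R2 \<eta> :: real
  assumes "0 \<le> R1" "0 \<le> R2" "0 < f" "R1 \<le> I1 + f" "R2 \<le> I2" "R1 + R2 \<le> I3 + f" "R1 + R2 \<le> I5" "0 < \<eta>"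
  shows "\<exists>aJ aA aC. 0 \<le> aJ \<and> 0 \<le> aA \<and> 0 \<le> aC \<and> aJ + aA = max 0 (R1 - \<eta>) \<and> aC = max 0 (R2 - \<eta>) \<and> aJ < f \<and>
    (aA = 0 \<or> aA < I1) \<and> (aC = 0 \<or> aC < I2) \<and> (aA = 0 \<or> aC = 0 \<or> aA + aC < I3) \<and> (aJ = 0 \<or> aJ + aA + aC < I5)"
proof -
  define aJ where "aJ = min (max 0 (R1 - \<eta>)) (max 0 (f - \<eta> / 2))"
  define aA where "aA = max 0 (R1 - \<eta>) - aJ"
  define aC where "aC = max 0 (R2 - \<eta>)"
  show ?thesis
    by (rule exI[of _ aJ], rule exI[of _ aA], rule exI[of _ aC]) (use assms in \<open>auto simp: aJ_def aA_def aC_def min_def max_def split: if_splits\<close>)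
qed

text \<open>The class of \<open>w0\<close> under \<open>V\<close> contains the weight of
  \<open>w1\<close>, its class under (X, V) does not; so the conditional probability at
  \<open>w0\<close> is below 1.\<close>

lemma hc_pos:
  assumes A: "finite A" and \<mu>: "\<forall>w\<in>A. 0 \<le> \<mu> w" and w: "w0 \<in> A" "w1 \<in> A" "0 < \<mu> w0" "0 < \<mu> w1" "V w0 = V w1" "X w0 \<noteq> X w1"
  shows "0 < hc A \<mu> X V"
proof -
  let ?r = "\<lambda>w. mass A \<mu> (\<lambda>w. (X w, V w)) (X w, V w) / mass A \<mu> V (V w)"
  have t: "\<mu> w * log 2 (?r w) \<le> 0" if w: "w \<in> A" for w
  proof (cases "\<mu> w = 0")
    case False
    then have "0 < \<mu> w" using \<mu> w by (auto simp: less_le)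
    then have "0 < mass A \<mu> (\<lambda>w. (X w, V w)) (X w, V w)" using mass_ge[OF A \<mu> w, of "\<lambda>w. (X w, V w)"] by linarith
    moreover have "mass A \<mu> (\<lambda>w. (X w, V w)) (X w, V w) \<le> mass A \<mu> V (V w)"
      using mass_mono[OF A \<mu> w, of "\<lambda>w. (X w, V w)" V] by auto
    ultimately have "log 2 (?r w) \<le> 0" by simp
    then show ?thesis using \<open>0 < \<mu> w\<close> by (simp add: mult_nonneg_nonpos)
  qed simp
  have m: "mass A \<mu> (\<lambda>w. (X w, V w)) (X w0, V w0) + \<mu> w1 \<le> mass A \<mu> V (V w0)"
  proof -
    have "mass A \<mu> (\<lambda>w. (X w, V w)) (X w0, V w0) + \<mu> w1 = (\<Sum>w\<in>insert w1 {w \<in> A. (X w, V w) = (X w0, V w0)}. \<mu> w)"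
      using A w by (subst sum.insert) (auto simp: mass_def)
    also have "\<dots> \<le> mass A \<mu> V (V w0)" unfolding mass_def using A \<mu> w by (intro sum_mono2) auto
    finally show ?thesis .
  qed
  have p: "0 < mass A \<mu> (\<lambda>w. (X w, V w)) (X w0, V w0)" using mass_ge[OF A \<mu> w(1), of "\<lambda>w. (X w, V w)"] w(3) by linarith
  have "?r w0 < 1" "0 < ?r w0" using m p w(4) by (auto simp: field_simps)
  then have "\<mu> w0 * log 2 (?r w0) < 0" using w(3) by (intro mult_pos_neg) auto
  then have "(\<Sum>w\<in>A. \<mu> w * log 2 (?r w)) < (\<Sum>w\<in>A. 0)"
    using t w(1) by (intro sum_strict_mono_ex1[OF A]) auto
  then show ?thesis unfolding hc_eq_sum[OF A \<mu>] by simp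
qed

text \<open>Equality case of Gibbs' inequality. The ratio of the coarse to the fine conditional
  probability has mean at most 1, and by \<open>le\<close> its logarithm has nonnegative mean. Since
  ln t <= t - 1 with equality only at t = 1, the ratio is 1 on the support.\<close>

lemma kernels_agree:
  assumes fin: "finite (set_pmf P)"
    and \<kappa>: "map_pmf (\<lambda>w. (X w, V w)) P = bind_pmf (map_pmf V P) (\<lambda>v. map_pmf (\<lambda>x. (x, v)) (\<kappa> v))"
    and \<kappa>': "map_pmf (\<lambda>w. (X w, g (V w))) P = bind_pmf (map_pmf (\<lambda>w. g (V w)) P) (\<lambda>v. map_pmf (\<lambda>x. (x, v)) (\<kappa>' v))"
    and le: "hc (set_pmf P) (pmf P) X (\<lambda>w. g (V w)) \<le> hc (set_pmf P) (pmf P) X V" and w: "w \<in> set_pmf P"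
  shows "\<kappa> (V w) = \<kappa>' (g (V w))"
proof -
  define a where "a w = pmf (\<kappa> (V w)) (X w)" for w
  define b where "b w = pmf (\<kappa>' (g (V w))) (X w)" for w
  have pos: "0 < a w" "0 < b w" if "w \<in> set_pmf P" for w
    using kernel_positive[OF \<kappa> that] kernel_positive[OF \<kappa>' that] by (auto simp: a_def b_def)
  have "mean P (\<lambda>w. ennreal (b w / a w)) = mean (map_pmf (\<lambda>w. (X w, V w)) P) (\<lambda>u. ennreal (pmf (\<kappa>' (g (snd u))) (fst u) / pmf (\<kappa> (snd u)) (fst u)))"
    by (simp add: a_def b_def)
  also have "\<dots> = mean (map_pmf V P) (\<lambda>v. mean (\<kappa> v) (\<lambda>x. ennreal (pmf (\<kappa>' (g v)) x / pmf (\<kappa> v) x)))"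
    unfolding \<kappa> by simp
  also have "\<dots> \<le> 1" by (intro nn_le_const nn_integral_density_ratio)
  finally have "mean P (\<lambda>w. ennreal (b w / a w)) \<le> 1" .
  moreover have "mean P (\<lambda>w. ennreal (b w / a w)) = ennreal (\<Sum>w\<in>set_pmf P. pmf P w * (b w / a w))"
    unfolding expectation_finite_support[OF fin, symmetric]
    by (intro nn_integral_eq_integral integrable_measure_pmf_finite fin) (simp add: a_def b_def)
  ultimately have 1: "(\<Sum>w\<in>set_pmf P. pmf P w * (b w / a w)) \<le> 1" by simp
  have "(\<Sum>w\<in>set_pmf P. pmf P w * log 2 (a w)) \<le> (\<Sum>w\<in>set_pmf P. pmf P w * log 2 (b w))"
    using le unfolding hc_kernel_pmf[OF fin \<kappa>] hc_kernel_pmf[OF fin \<kappa>'] expectation_finite_support[OF fin] a_def b_def by simp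
  moreover have "(\<Sum>w\<in>set_pmf P. pmf P w * log 2 (f w)) = (\<Sum>w\<in>set_pmf P. pmf P w * ln (f w)) / ln 2" for f
    by (simp add: log_def sum_divide_distrib)
  ultimately have 2: "(\<Sum>w\<in>set_pmf P. pmf P w * ln (a w)) \<le> (\<Sum>w\<in>set_pmf P. pmf P w * ln (b w))"
    by (simp add: divide_le_cancel)
  have t: "0 \<le> pmf P w * (b w / a w - 1 - ln (b w / a w))" if "w \<in> set_pmf P" for w
    using ln_le_minus_one[of "b w / a w"] pos[OF that] by (intro mult_nonneg_nonneg) auto
  have "(\<Sum>w\<in>set_pmf P. pmf P w * (b w / a w - 1 - ln (b w / a w)))
     = (\<Sum>w\<in>set_pmf P. pmf P w * (b w / a w) - pmf P w + (pmf P w * ln (a w) - pmf P w * ln (b w)))"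
  proof (intro sum.cong refl)
    fix w assume "w \<in> set_pmf P"
    note p = pos[OF this]
    have l: "ln (b w / a w) = ln (b w) - ln (a w)" using p by (simp add: ln_div)
    show "pmf P w * (b w / a w - 1 - ln (b w / a w)) = pmf P w * (b w / a w) - pmf P w + (pmf P w * ln (a w) - pmf P w * ln (b w))"
      unfolding l by (simp only: right_diff_distrib mult_1_right)
  qed
  also have "\<dots> = (\<Sum>w\<in>set_pmf P. pmf P w * (b w / a w)) - 1 + ((\<Sum>w\<in>set_pmf P. pmf P w * ln (a w)) - (\<Sum>w\<in>set_pmf P. pmf P w * ln (b w)))"
    using sum_pmf_eq_1[OF fin order_refl] by (simp only: sum.distrib sum_subtractf)
  also have "\<dots> \<le> 0" using 1 2 by simp
  finally have s0: "(\<Sum>w\<in>set_pmf P. pmf P w * (b w / a w - 1 - ln (b w / a w))) = 0" by (intro antisym sum_nonneg t)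
  have ab: "a w = b w" if w: "w \<in> set_pmf P" for w
  proof -
    have "pmf P w * (b w / a w - 1 - ln (b w / a w)) = 0" using s0 sum_nonneg_eq_0_iff[where f="\<lambda>w. pmf P w * (b w / a w - 1 - ln (b w / a w))", OF fin t] w by blast
    then have "ln (b w / a w) = b w / a w - 1" using pmf_positive[OF w] by simp
    then have "b w / a w = 1" using ln_eq_minus_one[of "b w / a w"] pos[OF w] by simp
    then show ?thesis using pos[OF w] by (simp add: field_simps)
  qed
  have e: "pmf (\<kappa> (V w)) x = pmf (\<kappa>' (g (V w))) x" if x: "x \<in> set_pmf (\<kappa> (V w))" for x
  proof -
    have "(x, V w) \<in> set_pmf (map_pmf (\<lambda>w. (X w, V w)) P)" unfolding \<kappa> using w x by auto
    then obtain w' where "w' \<in> set_pmf P" "X w' = x" "V w' = V w" by auto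
    then show ?thesis using ab[of w'] by (simp add: a_def b_def)
  qed
  have sub: "set_pmf (\<kappa> (V w)) \<subseteq> X ` set_pmf P"
  proof
    fix x assume "x \<in> set_pmf (\<kappa> (V w))"
    then have "(x, V w) \<in> set_pmf (map_pmf (\<lambda>w. (X w, V w)) P)" unfolding \<kappa> using w by auto
    then show "x \<in> X ` set_pmf P" by auto
  qed
  then have f: "finite (set_pmf (\<kappa> (V w)))" using fin by (auto intro: finite_subset)
  \<comment> \<open>The two kernels agree on the support of the fine one, which thereby has full
    mass under the coarse one; so they agree everywhere.\<close>
  have "measure_pmf.prob (\<kappa>' (g (V w))) (set_pmf (\<kappa> (V w))) = (\<Sum>x\<in>set_pmf (\<kappa> (V w)). pmf (\<kappa> (V w)) x)"
    using f e by (simp add: measure_measure_pmf_finite)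
  also have "\<dots> = 1" by (rule sum_pmf_eq_1[OF f order_refl])
  finally have "set_pmf (\<kappa>' (g (V w))) \<subseteq> set_pmf (\<kappa> (V w))" by (simp add: measure_pmf.prob_eq_1 AE_measure_pmf_iff subset_iff)
  then show ?thesis by (intro pmf_eqI) (metis e set_pmf_iff subset_iff)
qed

context mac
begin

lemma kap_add: "kap (\<lambda>w. \<mu> w + \<nu> w) = kap \<mu> + kap \<nu>"
  unfolding kap_def by (simp add: distrib_right sum.distrib)

lemma i5_add_ge:
  assumes "\<And>w. 0 \<le> \<mu> w" "\<And>w. 0 \<le> \<nu> w"
  shows "i5 \<mu> + i5 \<nu> \<le> i5 (\<lambda>w. \<mu> w + \<nu> w)"
  using hc_add_ge[of UNIV \<mu> \<nu> tY "\<lambda>w. (tS1 w, tS2 w)"] assms unfolding i5_def kap_add by simp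

lemma i5_scale:
  assumes "\<And>w. 0 \<le> \<mu> w" "0 \<le> c"
  shows "i5 (\<lambda>w. c * \<mu> w) = c * i5 \<mu>"
  unfolding i5_def kap_scale using hc_scale[of UNIV \<mu> c tY "\<lambda>w. (tS1 w, tS2 w)"] assms by (simp add: right_diff_distrib)

lemma info_nonneg:
  assumes q: "\<And>s x. 0 \<le> q s x" and t: "\<And>s x. 0 \<le> t s x"
  shows "0 \<le> i1 (atom q t)" "0 \<le> i2 (atom q t)" "0 \<le> i3 (atom q t)" "0 \<le> i5 (atom q t)"
proof -
  have n: "\<forall>w\<in>UNIV. 0 \<le> atom q t w" using atom_nonneg q t by blast
  have k: "hc UNIV (atom q t) tY (\<lambda>w. (tX1 w, tX2 w, tS1 w, tS2 w)) = kap (atom q t)"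
    by (rule hc_channel[OF atom_tuple]) (use q t in simp)
  show "0 \<le> i1 (atom q t)" "0 \<le> i2 (atom q t)" "0 \<le> i3 (atom q t)" "0 \<le> i5 (atom q t)"
    unfolding i1_def i2_def i3_def i5_def k[symmetric]
    unfolding diff_ge_0_iff_ge by (rule hc_mono[OF _ n]; auto simp: tZ_def)+
qed

context
  fixes Q :: "'s1 \<Rightarrow> ('x1 \<times> nat) pmf" and T :: "nat \<Rightarrow> 's2 \<Rightarrow> 'x2 pmf" and k :: nat
  assumes supp: "\<And>s1. snd ` set_pmf (Q s1) \<subseteq> {..<k}"
begin

abbreviation "JP \<equiv> joint_pmf pS Q T W"
abbreviation "hJ \<equiv> hc (set_pmf JP) (pmf JP)"

lemma crib_joint:
  "hJ (\<lambda>w. z (jX1 w) (jS1 w)) (\<lambda>w. (jS1 w, jU w)) = (\<Sum>a<k. hc UNIV (atom (qof Q a) (tof T a)) tZ tS1)"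
  "hJ jS1 (\<lambda>w. (jU w, jS2 w)) = (\<Sum>a<k. hc UNIV (atom (qof Q a) (tof T a)) tS1 tS2)"
  "hJ jS1 jS2 = H0"
proof -
  show "hJ (\<lambda>w. z (jX1 w) (jS1 w)) (\<lambda>w. (jS1 w, jU w)) = (\<Sum>a<k. hc UNIV (atom (qof Q a) (tof T a)) tZ tS1)"
    by (rule hc_joint'[OF supp]) (auto simp: j_defs emb_def tZ_def)
  show "hJ jS1 (\<lambda>w. (jU w, jS2 w)) = (\<Sum>a<k. hc UNIV (atom (qof Q a) (tof T a)) tS1 tS2)"
    by (rule hc_joint'[OF supp]) (auto simp: j_defs emb_def)
  have "H0 = hc (set_pmf (map_pmf (\<lambda>\<omega>. (jS1 \<omega>, jS2 \<omega>)) JP)) (pmf (map_pmf (\<lambda>\<omega>. (jS1 \<omega>, jS2 \<omega>)) JP)) fst snd"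
    using map_joint_states[OF supp] unfolding H0_def jS1_def jS2_def case_prod_unfold by simp
  then show "hJ jS1 jS2 = H0" unfolding hc_map_pmf[OF joint_finite[OF supp]] by simp
qed

text \<open>I(U;S1|S2) is turned round into H(U|S2) - H(U|S1,S2), the form in which
  \<open>IU - IU2\<close> appears.\<close>

lemma feas_joint:
  assumes "feas {..<k} (\<lambda>a. atom (qof Q a) (tof T a)) R1 R2"
  defines "f \<equiv> (\<Sum>a<k. crib (atom (qof Q a) (tof T a))) - H0"
  shows "f = hJ (\<lambda>w. z (jX1 w) (jS1 w)) (\<lambda>w. (jS1 w, jU w)) - (hJ jU jS2 - hJ jU (\<lambda>w. (jS1 w, jS2 w)))"
    and "R1 \<le> hJ jY (\<lambda>w. (jX2 w, z (jX1 w) (jS1 w), jS1 w, jS2 w, jU w)) - hJ jY (\<lambda>w. (jX1 w, jX2 w, z (jX1 w) (jS1 w), jS1 w, jS2 w, jU w)) + f"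
    and "R2 \<le> hJ jY (\<lambda>w. (jX1 w, jS1 w, jS2 w, jU w)) - hJ jY (\<lambda>w. (jX2 w, jX1 w, jS1 w, jS2 w, jU w))"
    and "R1 + R2 \<le> hJ jY (\<lambda>w. (z (jX1 w) (jS1 w), jS1 w, jS2 w, jU w)) - hJ jY (\<lambda>w. ((jX1 w, jX2 w), z (jX1 w) (jS1 w), jS1 w, jS2 w, jU w)) + f"
    and "R1 + R2 \<le> hJ jY (\<lambda>w. (jS1 w, jS2 w)) - hJ jY (\<lambda>w. ((jX1 w, jX2 w), jS1 w, jS2 w))"
proof -
  let ?IU = "hJ jS1 jS2 - hJ jS1 (\<lambda>w. (jU w, jS2 w))"
  show f: "f = hJ (\<lambda>w. z (jX1 w) (jS1 w)) (\<lambda>w. (jS1 w, jU w)) - (hJ jU jS2 - hJ jU (\<lambda>w. (jS1 w, jS2 w)))"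
    unfolding f_def crib_def sum.distrib crib_joint[symmetric] using hc_swap[of "set_pmf JP" "pmf JP" jS1 jS2 jU] by simp
  note r = iffD2[OF region_iff_feas[OF supp] assms(1), unfolded Let_def j_defs[symmetric] cond_mutual_info_hc[OF joint_finite[OF supp]]
      cond_entropy_hc[OF joint_finite[OF supp]]]
  have "?IU = hJ jU jS2 - hJ jU (\<lambda>w. (jS1 w, jS2 w))" by (rule hc_swap)
  then have f': "f = hJ (\<lambda>w. z (jX1 w) (jS1 w)) (\<lambda>w. (jS1 w, jU w)) - ?IU" unfolding f by simp
  show "R1 \<le> hJ jY (\<lambda>w. (jX2 w, z (jX1 w) (jS1 w), jS1 w, jS2 w, jU w)) - hJ jY (\<lambda>w. (jX1 w, jX2 w, z (jX1 w) (jS1 w), jS1 w, jS2 w, jU w)) + f"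
    "R2 \<le> hJ jY (\<lambda>w. (jX1 w, jS1 w, jS2 w, jU w)) - hJ jY (\<lambda>w. (jX2 w, jX1 w, jS1 w, jS2 w, jU w))"
    "R1 + R2 \<le> hJ jY (\<lambda>w. (z (jX1 w) (jS1 w), jS1 w, jS2 w, jU w)) - hJ jY (\<lambda>w. ((jX1 w, jX2 w), z (jX1 w) (jS1 w), jS1 w, jS2 w, jU w)) + f"
    "R1 + R2 \<le> hJ jY (\<lambda>w. (jS1 w, jS2 w)) - hJ jY (\<lambda>w. ((jX1 w, jX2 w), jS1 w, jS2 w))"
    using r unfolding f' by linarith+
qed

end

end

context coding
begin

context
  fixes Q :: "'s1 \<Rightarrow> ('x1 \<times> nat) pmf"
  assumes Q: "\<And>s. Q s = do { u \<leftarrow> QU s; v \<leftarrow> QZ u s; x1 \<leftarrow> QX1 u s v; return_pmf (x1, u) }"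
begin

lemma joint_SL: "joint_pmf pS Q QX2 W = map_pmf (\<lambda>(s, u, v, x1, x2, y). (fst s, snd s, u, x1, x2, y)) SL"
  unfolding joint_pmf_def SL_def Q by (simp add: map_bind_pmf bind_assoc_pmf bind_return_pmf case_prod_unfold)

lemma hJ_SL: "hc (set_pmf (joint_pmf pS Q QX2 W)) (pmf (joint_pmf pS Q QX2 W)) X V
  = hS (\<lambda>(s, u, v, x1, x2, y). X (fst s, snd s, u, x1, x2, y)) (\<lambda>(s, u, v, x1, x2, y). V (fst s, snd s, u, x1, x2, y))"
  unfolding joint_SL hc_map_pmf[OF finite_SL] by (simp add: case_prod_unfold)

lemma SL_crib: "(s, u, v, x1, x2, y) \<in> set_pmf SL \<Longrightarrow> v = z x1 (fst s)"
  unfolding SL_def using zf by auto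

abbreviation "hQ \<equiv> hc (set_pmf (joint_pmf pS Q QX2 W)) (pmf (joint_pmf pS Q QX2 W))"

text \<open>On the support \<open>v\<close> equals z of \<open>x1\<close> and the first state, so
  the conditions of both sides induce the same partition.\<close>

lemma joint_infos:
  shows "I1 = hQ jY (\<lambda>w. (jX2 w, z (jX1 w) (jS1 w), jS1 w, jS2 w, jU w)) - hQ jY (\<lambda>w. (jX1 w, jX2 w, z (jX1 w) (jS1 w), jS1 w, jS2 w, jU w))"
    and "I2 = hQ jY (\<lambda>w. (jX1 w, jS1 w, jS2 w, jU w)) - hQ jY (\<lambda>w. (jX2 w, jX1 w, jS1 w, jS2 w, jU w))"
    and "I3 = hQ jY (\<lambda>w. (z (jX1 w) (jS1 w), jS1 w, jS2 w, jU w)) - hQ jY (\<lambda>w. ((jX1 w, jX2 w), z (jX1 w) (jS1 w), jS1 w, jS2 w, jU w))"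
    and "I5 = hQ jY (\<lambda>w. (jS1 w, jS2 w)) - hQ jY (\<lambda>w. ((jX1 w, jX2 w), jS1 w, jS2 w))"
    and "hQ (\<lambda>w. z (jX1 w) (jS1 w)) (\<lambda>w. (jS1 w, jU w)) = hS cV cS1U"
    and "hQ jU jS2 = hS cU cS2"
    and "hQ jU (\<lambda>w. (jS1 w, jS2 w)) = hS cU cS"
proof goal_cases
  case 1 show ?case unfolding hJ_SL I1_eq
    by (rule arg_cong2[where f=minus]; rule hc_kernel_cong; auto simp: j_defs prod_eq_iff dest!: SL_crib)
next
  case 2 show ?case unfolding hJ_SL I2_eq
    by (rule arg_cong2[where f=minus]; rule hc_kernel_cong; auto simp: j_defs prod_eq_iff dest!: SL_crib)
next
  case 3 show ?case unfolding hJ_SL I3_eq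
    by (rule arg_cong2[where f=minus]; rule hc_kernel_cong; auto simp: j_defs prod_eq_iff dest!: SL_crib)
next
  case 4 show ?case unfolding hJ_SL I5_eq
    by (rule arg_cong2[where f=minus]; rule hc_kernel_cong; auto simp: j_defs prod_eq_iff)
qed (unfold hJ_SL, (rule hc_kernel_cong; auto simp: j_defs prod_eq_iff dest!: SL_crib)+)

end

lemma hS_const:
  assumes "map_pmf (\<lambda>(s, u, v, x1, x2, y). X s u v x1 x2 y) SL = p"
  shows "hS (\<lambda>(s, u, v, x1, x2, y). X s u v x1 x2 y) c0 = - expect (\<lambda>s u v x1 x2 y. log 2 (pmf p (X s u v x1 x2 y)))"
proof (subst hS_kernel[where \<kappa>="\<lambda>_. p"])
  show "map_pmf (\<lambda>(s, u, v, x1, x2, y). (X s u v x1 x2 y, ())) SL = map_pmf c0 SL \<bind> (\<lambda>v. map_pmf (\<lambda>x. (x, v)) p)"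
    unfolding assms[symmetric] by (simp add: case_prod_unfold map_pmf_comp bind_map_pmf)
qed simp

lemma HZ_eq:
  assumes "PZ = do { s \<leftarrow> pS; u \<leftarrow> QU (fst s); QZ u (fst s) }"
  shows "HZ = hS cV c0"
    and "IZ = hS cV c0 - hS cV cS1U"
proof -
  have p: "map_pmf cV SL = PZ"
    unfolding assms by (simp add: pmf_simps bind_return_pmf')
  have one: "expect (\<lambda>s u v x1 x2 y. log 2 1) = 0" by (simp add: expect_def case_prod_unfold)
  show "HZ = hS cV c0"
    unfolding HZ_def hS_const[OF p] by (subst expect_log_ratio) (auto intro: SL_positive simp: one[simplified])
  show "IZ = hS cV c0 - hS cV cS1U"
    unfolding IZ_def hS_const[OF p] hS_QZ by (subst expect_log_ratio) (auto intro: SL_positive)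
qed

lemma IU_eq:
  assumes cm: "\<And>s. cm1 s = p" "\<And>s. cm2 s = p" and p: "p = do { s \<leftarrow> pS; QU (fst s) }"
    and QU2: "law_US2 pS QU = bind_pmf (map_pmf snd pS) (\<lambda>s2. map_pmf (\<lambda>u. (u, s2)) (QU2 s2))"
  shows "IU = hS cU c0 - hS cU cS"
    and "IU2 = hS cU c0 - hS cU cS2"
proof -
  have m: "map_pmf cU SL = p"
    unfolding p by (simp add: pmf_simps bind_return_pmf')
  have k: "hS cU cS2 = - expect (\<lambda>s u v x1 x2 y. log 2 (pmf (QU2 (snd s)) u))"
  proof (subst hS_kernel[where \<kappa>=QU2])
    have "map_pmf (\<lambda>(s, u, v, x1, x2, y). (u, snd s)) SL = law_US2 pS QU"
      by (simp add: pmf_simps)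
    moreover have "map_pmf cS2 SL = map_pmf snd pS" by (simp add: pmf_simps)
    ultimately show "map_pmf (\<lambda>(s, u, v, x1, x2, y). (u, snd s)) SL = map_pmf cS2 SL \<bind> (\<lambda>v. map_pmf (\<lambda>x. (x, v)) (QU2 v))"
      using QU2 by simp
  qed simp
  have pp: "(s, u, v, x1, x2, y) \<in> set_pmf SL \<Longrightarrow> 0 < pmf p u" for s u v x1 x2 y using SL_positive(2)[of s u v x1 x2 y] cm by simp
  show "IU = hS cU c0 - hS cU cS"
    unfolding IU_def hS_const[OF m] hS_QU cm by (subst expect_log_ratio) (auto intro: SL_positive pp)
  show "IU2 = hS cU c0 - hS cU cS2"
    unfolding IU2_def hS_const[OF m] k cm by (subst expect_log_ratio) (auto intro: SL_positive pp)
qed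

end

context mac
begin

lemma state_coupling_kernel:
  fixes QU :: "'s1 \<Rightarrow> nat pmf"
  shows "\<exists>QU2. law_US2 pS QU = bind_pmf (map_pmf snd pS) (\<lambda>s2. map_pmf (\<lambda>u. (u, s2)) (QU2 s2))"
proof -
  let ?N = "law_US2 pS QU"
  have "map_pmf snd ?N = map_pmf snd pS" by (simp add: map_pmf_def bind_assoc_pmf bind_return_pmf)
  then show ?thesis using disintegration[of ?N] by simp
qed

lemma state_coupling_support:
  assumes "law_US2 pS QU = bind_pmf (map_pmf snd pS) (\<lambda>s2. map_pmf (\<lambda>u. (u, s2)) (QU2 s2))"
    and "(s1, s2) \<in> set_pmf pS" "u \<in> set_pmf (QU s1)"
  shows "u \<in> set_pmf (QU2 s2)"
proof -
  have "(u, s2) \<in> set_pmf (law_US2 pS QU)" using assms(2,3) by force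
  then show ?thesis unfolding assms(1) by auto
qed

text \<open>With marginals as codebook laws, the slack of the cribbing constraint equals
  \<open>HZ - IZ - (IU - IU2)\<close>, the rate left in the crib for message 1. Strictness makes it
  positive, which \<open>split_rates\<close> needs.\<close>

lemma achievable_strict:
  fixes Q :: "'s1 \<Rightarrow> ('x1 \<times> nat) pmf" and T :: "nat \<Rightarrow> 's2 \<Rightarrow> 'x2 pmf" and k :: nat
  assumes supp: "\<And>s1. snd ` set_pmf (Q s1) \<subseteq> {..<k}"
    and feas: "feas {..<k} (\<lambda>a. atom (qof Q a) (tof T a)) R1 R2" and R: "0 \<le> R1" "0 \<le> R2"
    and crib: "H0 < (\<Sum>a<k. crib (atom (qof Q a) (tof T a)))"
  shows "(R1, R2) \<in> capacity_region pS W z"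
proof -
  define QU where "QU s = map_pmf snd (Q s)" for s
  have "\<forall>s. \<exists>\<kappa>. Q s = bind_pmf (QU s) (\<lambda>u. map_pmf (\<lambda>x. (x, u)) (\<kappa> u))" unfolding QU_def using disintegration by blast
  then obtain QX where QX: "\<And>s. Q s = bind_pmf (QU s) (\<lambda>u. map_pmf (\<lambda>x. (x, u)) (QX s u))" unfolding choice_iff by blast
  define QZ where "QZ u s = map_pmf (\<lambda>x. z x s) (QX s u)" for u s
  \<comment> \<open>X1 is drawn after Z: splitting its law along the value of \<open>z\<close> gives
    the superposition of X1 on the words for U and Z.\<close>
  have "\<forall>u s. \<exists>\<kappa>. map_pmf (\<lambda>x. (x, z x s)) (QX s u) = bind_pmf (QZ u s) (\<lambda>v. map_pmf (\<lambda>x. (x, v)) (\<kappa> v))"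
  proof (intro allI)
    fix u s
    have "map_pmf snd (map_pmf (\<lambda>x. (x, z x s)) (QX s u)) = QZ u s" by (simp add: QZ_def map_pmf_comp)
    then show "\<exists>\<kappa>. map_pmf (\<lambda>x. (x, z x s)) (QX s u) = bind_pmf (QZ u s) (\<lambda>v. map_pmf (\<lambda>x. (x, v)) (\<kappa> v))"
      using disintegration[of "map_pmf (\<lambda>x. (x, z x s)) (QX s u)"] by simp
  qed
  then obtain QX1 where QX1: "\<And>u s. map_pmf (\<lambda>x. (x, z x s)) (QX s u) = bind_pmf (QZ u s) (\<lambda>v. map_pmf (\<lambda>x. (x, v)) (QX1 u s v))"
    unfolding choice_iff by blast
  define p where "p = do { s \<leftarrow> pS; QU (fst s) }"
  define PZ where "PZ = do { s \<leftarrow> pS; u \<leftarrow> QU (fst s); QZ u (fst s) }"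
  obtain QU2 where QU2: "law_US2 pS QU = bind_pmf (map_pmf snd pS) (\<lambda>s2. map_pmf (\<lambda>u. (u, s2)) (QU2 s2))"
    using state_coupling_kernel[of QU] by blast
  have QUfin: "finite (set_pmf (QU s))" for s using supp[of s] unfolding QU_def by (auto intro: finite_subset)
  interpret coding pS W z QU QZ QX1 T "\<lambda>_. p" "\<lambda>_. p" PZ QU2
  proof
    show "finite (set_pmf (QU s))" for s by (rule QUfin)
    show "finite (set_pmf p)" unfolding p_def using QUfin by auto
    show "z x1 s = v" if "v \<in> set_pmf (QZ u s)" "x1 \<in> set_pmf (QX1 u s v)" for u s v x1
    proof -
      have "(x1, v) \<in> set_pmf (map_pmf (\<lambda>x. (x, z x s)) (QX s u))" unfolding QX1 using that by auto
      then show ?thesis by auto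
    qed
    show "u \<in> set_pmf p \<and> u \<in> set_pmf (QU2 s2)" if "(s1, s2) \<in> set_pmf pS" "u \<in> set_pmf (QU s1)" for s1 s2 u
      using that state_coupling_support[OF QU2 that] unfolding p_def by force
    show "v \<in> set_pmf PZ" if "(s1, s2) \<in> set_pmf pS" "u \<in> set_pmf (QU s1)" "v \<in> set_pmf (QZ u s1)" for s1 s2 u v
      using that unfolding PZ_def by force
  qed simp
  have Q: "Q s = do { u \<leftarrow> QU s; v \<leftarrow> QZ u s; x1 \<leftarrow> QX1 u s v; return_pmf (x1, u) }" for s
  proof -
    have "do { v \<leftarrow> QZ u s; x1 \<leftarrow> QX1 u s v; return_pmf (x1, u) } = map_pmf (\<lambda>x. (x, u)) (QX s u)" for u
    proof -
      have "do { v \<leftarrow> QZ u s; x1 \<leftarrow> QX1 u s v; return_pmf (x1, u) } = map_pmf (\<lambda>w. (fst w, u)) (bind_pmf (QZ u s) (\<lambda>v. map_pmf (\<lambda>x. (x, v)) (QX1 u s v)))"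
        by (simp add: map_bind_pmf map_pmf_comp) (simp add: map_pmf_def)
      then show ?thesis unfolding QX1[symmetric] by (simp add: map_pmf_comp)
    qed
    then show ?thesis by (simp add: QX[of s])
  qed
  note F = feas_joint[OF supp feas]
  note JI = joint_infos[OF Q]
  note HZe = HZ_eq[OF PZ_def]
  note IUe = IU_eq[OF refl refl p_def QU2]
  have n: "\<forall>w\<in>set_pmf SL. 0 \<le> pmf SL w" by simp
  have info: "0 \<le> IU2" "IU2 \<le> IU" "0 \<le> IZ"
    unfolding IUe HZe using hc_mono[OF finite_SL n, where V="\<lambda>(s, u, v, x1, x2, y). snd s" and U="\<lambda>(s, u, v, x1, x2, y). ()" and X="\<lambda>(s, u, v, x1, x2, y). u"]
      hc_mono[OF finite_SL n, where V="\<lambda>(s, u, v, x1, x2, y). s" and U="\<lambda>(s, u, v, x1, x2, y). snd s" and X="\<lambda>(s, u, v, x1, x2, y). u"]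
      hc_mono[OF finite_SL n, where V="\<lambda>(s, u, v, x1, x2, y). (fst s, u)" and U="\<lambda>(s, u, v, x1, x2, y). ()" and X="\<lambda>(s, u, v, x1, x2, y). v"]
    by (auto simp: case_prod_unfold)
  define f where "f = HZ - IZ - (IU - IU2)"
  have f: "f = (\<Sum>a<k. crib (atom (qof Q a) (tof T a))) - H0"
    unfolding F(1) JI(5,6,7) f_def IUe HZe by simp
  have fpos: "0 < f" using crib unfolding f by simp
  have ineq: "R1 \<le> I1 + f" "R2 \<le> I2" "R1 + R2 \<le> I3 + f" "R1 + R2 \<le> I5"
    using F(2-5) unfolding JI(1-4) f by simp_all
  show ?thesis
  proof (rule capacity_region_limit[OF _ R])
    fix \<eta> :: real assume "0 < \<eta>"
    from split_rates[OF R fpos ineq this] obtain aJ aA aC where a: "0 \<le> aJ" "0 \<le> aA" "0 \<le> aC"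
      and s: "aJ + aA = max 0 (R1 - \<eta>)" "aC = max 0 (R2 - \<eta>)" and c: "aJ < f" "aA = 0 \<or> aA < I1" "aC = 0 \<or> aC < I2"
        "aA = 0 \<or> aC = 0 \<or> aA + aC < I3" "aJ = 0 \<or> aJ + aA + aC < I5" by blast
    have "(aJ + aA, aC) \<in> capacity_region pS W z"
      by (rule blocks_in_capacity_region[OF a], rule block_codes[OF a info _ c(2-5)]) (use c(1) in \<open>auto simp: f_def\<close>)
    then show "(max 0 (R1 - \<eta>), max 0 (R2 - \<eta>)) \<in> capacity_region pS W z" using s by simp
  qed
qed

end

text \<open>Encoder 2 can replace the crib it receives by the constant one.\<close>

lemma capacity_region_constant_crib: "capacity_region pS W (\<lambda>_ _. undefined :: 'z) \<subseteq> capacity_region pS W (z :: 'x1 \<Rightarrow> 's1 \<Rightarrow> 'z)"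
proof -
  have "achievable pS W z R1 R2" if ach: "achievable pS W (\<lambda>_ _. undefined :: 'z) R1 R2" for R1 R2
    unfolding achievable_def
  proof (intro conjI allI impI)
    show "0 \<le> R1" "0 \<le> R2" using ach by (auto simp: achievable_def)
    fix \<epsilon> :: real and N :: nat assume "0 < \<epsilon>"
    then obtain n enc1 enc2 dec1 dec2 where n: "N \<le> n" and d: "\<forall>y s1 s2. dec1 y s1 s2 \<in> messages n R1 \<and> dec2 y s1 s2 \<in> messages n R2"
      and e: "measure_pmf.prob (transmission pS W (\<lambda>_ _. undefined :: 'z) R1 R2 n enc1 enc2) (wrong dec1 dec2) \<le> \<epsilon>"
      using ach unfolding achievable_def by blast
    define enc2' where "enc2' i m s2 zs = enc2 i m s2 (restrict (\<lambda>_. undefined :: 'z) {1..<i})" for i m s2 and zs :: "nat \<Rightarrow> 'z"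
    have t: "transmission pS W z R1 R2 n enc1 enc2' = transmission pS W (\<lambda>_ _. undefined :: 'z) R1 R2 n enc1 enc2"
      unfolding transmission_def input2_def enc2'_def ..
    show "\<exists>n\<ge>N. \<exists>enc1 enc2 dec1 dec2. (\<forall>y s1 s2. dec1 y s1 s2 \<in> messages n R1 \<and> dec2 y s1 s2 \<in> messages n R2) \<and>
        measure_pmf.prob (transmission pS W z R1 R2 n enc1 enc2) (wrong dec1 dec2) \<le> \<epsilon>"
      by (rule exI[of _ n], rule conjI[OF n], rule exI[of _ enc1], rule exI[of _ enc2'], rule exI[of _ dec1], rule exI[of _ dec2]) (use d e t in simp)
  qed
  then show ?thesis unfolding capacity_region_def by (intro closure_mono) auto
qed

context coding
begin

lemma expect_log_one:
  assumes "\<And>s u v x1 x2 y. (s, u, v, x1, x2, y) \<in> set_pmf SL \<Longrightarrow> f s u v x1 x2 y = 1"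
  shows "expect (\<lambda>s u v x1 x2 y. log 2 (f s u v x1 x2 y)) = 0"
  unfolding expect_def expectation_finite_support[OF finite_SL]
proof (rule sum.neutral, rule ballI)
  fix w assume w: "w \<in> set_pmf SL"
  obtain s u v x1 x2 y where e: "w = (s, u, v, x1, x2, y)" by (cases w) auto
  show "pmf SL w * (case w of (s, u, v, x1, x2, y) \<Rightarrow> log 2 (f s u v x1 x2 y)) = 0"
    using assms[of s u v x1 x2 y] w unfolding e by simp
qed

lemma IU2_zero: "(\<And>s. cm2 s = QU2 s) \<Longrightarrow> IU2 = 0"
  unfolding IU2_def by (rule expect_log_one) (auto dest: SL_positive(3))

lemma IZ_zero: "(\<And>u s. QZ u s = PZ) \<Longrightarrow> IZ = 0"
  unfolding IZ_def by (rule expect_log_one) (auto dest: SL_positive(6))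

end

context mac
begin

lemma joint_states: "w \<in> set_pmf (joint_pmf pS Q T W) \<Longrightarrow> (jS1 w, jS2 w) \<in> set_pmf pS"
  unfolding joint_pmf_def by (auto simp: j_defs)

text \<open>As the crib is a function of a possible first state, the constraint forces H(U|S2) =
  H(U|S1,S2). The equality case in \<open>kernels_agree\<close> then gives one law of U computable
  from either state. Using it as codebook law makes \<open>IU\<close>, \<open>IU2\<close> and
  \<open>IZ\<close> vanish, and rate \<open>aJ = 0\<close> meets the degenerate alternative of
  \<open>block_codes\<close>.\<close>

lemma achievable_degenerate:
  fixes Q :: "'s1 \<Rightarrow> ('x1 \<times> nat) pmf" and T :: "nat \<Rightarrow> 's2 \<Rightarrow> 'x2 pmf" and k :: nat
  assumes supp: "\<And>s1. snd ` set_pmf (Q s1) \<subseteq> {..<k}"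
    and feas: "feas {..<k} (\<lambda>a. atom (qof Q a) (tof T a)) R1 R2" and R: "0 \<le> R1" "0 \<le> R2"
    and const: "\<And>s1 s2 x x'. (s1, s2) \<in> set_pmf pS \<Longrightarrow> z x s1 = z x' s1"
  shows "(R1, R2) \<in> capacity_region pS W z"
proof -
  let ?J = "joint_pmf pS Q T W"
  let ?h = "hc (set_pmf ?J) (pmf ?J)"
  define QU where "QU s = map_pmf snd (Q s)" for s
  have "\<forall>s. \<exists>\<kappa>. Q s = bind_pmf (QU s) (\<lambda>u. map_pmf (\<lambda>x. (x, u)) (\<kappa> u))" unfolding QU_def using disintegration by blast
  then obtain QX where QX: "\<And>s. Q s = bind_pmf (QU s) (\<lambda>u. map_pmf (\<lambda>x. (x, u)) (QX s u))" unfolding choice_iff by blast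
  obtain QU2 where QU2: "law_US2 pS QU = bind_pmf (map_pmf snd pS) (\<lambda>s2. map_pmf (\<lambda>u. (u, s2)) (QU2 s2))"
    using state_coupling_kernel[of QU] by blast
  have QUfin: "finite (set_pmf (QU s))" for s using supp[of s] unfolding QU_def by (auto intro: finite_subset)
  have finJ: "finite (set_pmf ?J)" by (rule joint_finite[OF supp])
  have n: "\<forall>w\<in>set_pmf ?J. 0 \<le> pmf ?J w" by simp
  note F = feas_joint[OF supp feas]
  have Zc: "z (jX1 w) (jS1 w) = z (jX1 w') (jS1 w')" if "w \<in> set_pmf ?J" "w' \<in> set_pmf ?J" "jS1 w = jS1 w'" for w w'
    using const[OF joint_states[OF that(1)], of "jX1 w" "jX1 w'"] that(3) by simp
  have HZ0: "?h (\<lambda>w. z (jX1 w) (jS1 w)) (\<lambda>w. (jS1 w, jU w)) = 0"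
    by (rule hc_determined) (rule Zc, assumption+, simp)
  have "?h jU (\<lambda>w. (jS1 w, jS2 w)) \<le> ?h jU jS2" by (rule hc_mono[OF finJ n]) auto
  moreover have "0 \<le> (\<Sum>a<k. crib (atom (qof Q a) (tof T a))) - H0" using feas unfolding feas_def by simp
  ultimately have f0: "(\<Sum>a<k. crib (atom (qof Q a) (tof T a))) - H0 = 0" and le: "?h jU jS2 \<le> ?h jU (\<lambda>w. (jS1 w, jS2 w))"
    unfolding F(1) HZ0 by simp_all
  have agree: "QU s1 = QU2 s2" if s: "(s1, s2) \<in> set_pmf pS" for s1 s2
  proof -
    have "(s1, s2) \<in> set_pmf (map_pmf (\<lambda>(s1, s2, u, x1, x2, y). (s1, s2)) ?J)" using map_joint_states[OF supp] s by simp
    then obtain w where w: "w \<in> set_pmf ?J" "jS1 w = s1" "jS2 w = s2" by (auto simp: j_defs)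
    have k1: "map_pmf (\<lambda>w. (jU w, (jS1 w, jS2 w))) ?J = bind_pmf (map_pmf (\<lambda>w. (jS1 w, jS2 w)) ?J) (\<lambda>v. map_pmf (\<lambda>x. (x, v)) (QU (fst v)))"
      unfolding joint_pmf_def QU_def by (simp add: map_pmf_def bind_assoc_pmf bind_return_pmf case_prod_unfold j_defs)
    have k2: "map_pmf (\<lambda>w. (jU w, snd (jS1 w, jS2 w))) ?J = bind_pmf (map_pmf (\<lambda>w. snd (jS1 w, jS2 w)) ?J) (\<lambda>v. map_pmf (\<lambda>x. (x, v)) (QU2 v))"
    proof -
      have "map_pmf (\<lambda>w. (jU w, snd (jS1 w, jS2 w))) ?J = law_US2 pS QU"
        unfolding joint_pmf_def QU_def by (simp add: map_pmf_def bind_assoc_pmf bind_return_pmf case_prod_unfold j_defs)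
      moreover have "map_pmf (\<lambda>w. snd (jS1 w, jS2 w)) ?J = map_pmf snd pS"
        unfolding joint_pmf_def by (simp add: map_pmf_def bind_assoc_pmf bind_return_pmf case_prod_unfold j_defs)
      ultimately show ?thesis using QU2 by simp
    qed
    from kernels_agree[OF finJ k1 k2 _ w(1)] le w show ?thesis by simp
  qed
  \<comment> \<open>The crib is replaced by a constant, so that the codebook for Z consists of a
    single value; encoder 2 loses nothing by this.\<close>
  interpret c: coding pS W "\<lambda>_ _. undefined :: 'z" QU "\<lambda>_ _. return_pmf undefined" "\<lambda>u s v. QX s u" T QU QU2 "return_pmf undefined" QU2
  proof
    show "QU s1 = QU2 s2" if "(s1, s2) \<in> set_pmf pS" for s1 s2 by (rule agree[OF that])
    show "u \<in> set_pmf (QU s1) \<and> u \<in> set_pmf (QU2 s2)" if "(s1, s2) \<in> set_pmf pS" "u \<in> set_pmf (QU s1)" for s1 s2 u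
      using that(2) agree[OF that(1)] by simp
  qed (simp_all add: QUfin)
  have Q: "Q s = do { u \<leftarrow> QU s; v \<leftarrow> return_pmf (undefined :: 'z); x1 \<leftarrow> QX s u; return_pmf (x1, u) }" for s
    unfolding QX[of s] by (simp add: map_pmf_def bind_return_pmf)
  note JI = c.joint_infos[OF Q]
  have ineq: "R1 \<le> c.I1" "R2 \<le> c.I2" "R1 + R2 \<le> c.I3" "R1 + R2 \<le> c.I5"
  proof -
    have e: "?h jY (\<lambda>w. (jX2 w, z (jX1 w) (jS1 w), jS1 w, jS2 w, jU w)) = ?h jY (\<lambda>w. (jX2 w, undefined :: 'z, jS1 w, jS2 w, jU w))"
      "?h jY (\<lambda>w. (jX1 w, jX2 w, z (jX1 w) (jS1 w), jS1 w, jS2 w, jU w)) = ?h jY (\<lambda>w. (jX1 w, jX2 w, undefined :: 'z, jS1 w, jS2 w, jU w))"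
      "?h jY (\<lambda>w. (z (jX1 w) (jS1 w), jS1 w, jS2 w, jU w)) = ?h jY (\<lambda>w. (undefined :: 'z, jS1 w, jS2 w, jU w))"
      "?h jY (\<lambda>w. ((jX1 w, jX2 w), z (jX1 w) (jS1 w), jS1 w, jS2 w, jU w)) = ?h jY (\<lambda>w. ((jX1 w, jX2 w), undefined :: 'z, jS1 w, jS2 w, jU w))"
      by (rule hc_kernel_cong; auto intro: Zc)+
    show "R1 \<le> c.I1" "R2 \<le> c.I2" "R1 + R2 \<le> c.I3" "R1 + R2 \<le> c.I5"
      using F(2-5) unfolding JI(1-4) f0 e by simp_all
  qed
  have info: "0 \<le> c.IU2" "c.IU2 \<le> c.IU" "0 \<le> c.IZ" using c.IU_zero c.IU2_zero c.IZ_zero by simp_all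
  have "(R1, R2) \<in> capacity_region pS W (\<lambda>_ _. undefined :: 'z)"
  proof (rule mac.capacity_region_limit[OF _ R])
    fix \<eta> :: real assume \<eta>: "0 < \<eta>"
    let ?a = "max 0 (R1 - \<eta>)" and ?c = "max 0 (R2 - \<eta>)"
    have rates: "?a = 0 \<or> ?a < c.I1" "?c = 0 \<or> ?c < c.I2" "?a = 0 \<or> ?c = 0 \<or> ?a + ?c < c.I3" "(0::real) = 0 \<or> 0 + ?a + ?c < c.I5"
      using ineq \<eta> by (auto simp: max_def)
    have "(0 + ?a, ?c) \<in> capacity_region pS W (\<lambda>_ _. undefined :: 'z)"
      by (rule mac.blocks_in_capacity_region[OF order_refl max.cobounded1 max.cobounded1],
          rule c.block_codes[OF order_refl max.cobounded1 max.cobounded1 info _ rates]) auto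
    then show "(?a, ?c) \<in> capacity_region pS W (\<lambda>_ _. undefined :: 'z)" by simp
  qed
  then show ?thesis using capacity_region_constant_crib by blast
qed

lemma feas_cong:
  assumes "\<And>a. a \<in> A \<Longrightarrow> \<mu> a = \<nu> a"
  shows "feas A \<mu> R1 R2 \<longleftrightarrow> feas A \<nu> R1 R2"
  unfolding feas_def using assms by (simp cong: sum.cong)

lemma atom_scale: "atom (\<lambda>s x. c * q s x) t = (\<lambda>w. c * atom q t w)"
  unfolding atom_def by (simp add: fun_eq_iff mult_ac)

definition "unif_atom = atom (\<lambda>_ _. 1 / real CARD('x1)) (\<lambda>_ _. 1 / real CARD('x2))"

text \<open>With a constant U the term H(S1|S2,U) is all of \<open>H0\<close>, and uniform inputs
  give H(Z|S1) > 0 as soon as \<open>z\<close> varies with the input at some possible state.\<close>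

lemma crib_unif_atom:
  assumes s: "(s1, s2) \<in> set_pmf pS" and x: "z x s1 \<noteq> z x' s1"
  shows "H0 < crib unif_atom"
proof -
  \<comment> \<open>The uniform atom is realised as a joint law whose auxiliary variable is always
    0, to read off its state entropy from \<open>crib_joint\<close>.\<close>
  define Q where "Q = (\<lambda>_ :: 's1. map_pmf (\<lambda>x :: 'x1. (x, 0 :: nat)) (pmf_of_set UNIV))"
  define T where "T = (\<lambda>(_ :: nat) (_ :: 's2). pmf_of_set (UNIV :: 'x2 set))"
  have supp: "snd ` set_pmf (Q s) \<subseteq> {..<1}" for s by (auto simp: Q_def)
  have a: "atom (qof Q 0) (tof T 0) = unif_atom"
  proof -
    have "qof Q 0 = (\<lambda>_ _. 1 / real CARD('x1))"
      unfolding Q_def using pmf_map_inj'[of "\<lambda>x :: 'x1. (x, 0 :: nat)" "pmf_of_set UNIV"] by (auto simp: fun_eq_iff inj_on_def)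
    then show ?thesis unfolding unif_atom_def T_def by simp
  qed
  have "jU w = 0" if "w \<in> set_pmf (joint_pmf pS Q T W)" for w
    using that unfolding joint_pmf_def Q_def by (auto simp: j_defs)
  then have "hc (set_pmf (joint_pmf pS Q T W)) (pmf (joint_pmf pS Q T W)) jS1 (\<lambda>w. (jU w, jS2 w))
     = hc (set_pmf (joint_pmf pS Q T W)) (pmf (joint_pmf pS Q T W)) jS1 jS2"
    by (intro hc_kernel_cong) auto
  then have h: "hc UNIV unif_atom tS1 tS2 = H0"
    using crib_joint(2,3)[OF supp, where T=T] by (simp add: a lessThan_Suc)
  have n: "\<forall>w\<in>UNIV. 0 \<le> unif_atom w" unfolding unif_atom_def by (auto intro: atom_nonneg)
  obtain x2 :: 'x2 where True by simp
  obtain y where y: "y \<in> set_pmf (W x x2 s1 s2)" using set_pmf_not_empty[of "W x x2 s1 s2"] by blast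
  obtain y' where y': "y' \<in> set_pmf (W x' x2 s1 s2)" using set_pmf_not_empty[of "W x' x2 s1 s2"] by blast
  have "0 < hc UNIV unif_atom tZ tS1"
    by (rule hc_pos[OF _ n, of "(s1, s2, x, x2, y)" "(s1, s2, x', x2, y')"])
      (use s x y y' in \<open>auto simp: unif_atom_def atom_def chan_def tZ_def intro!: divide_pos_pos mult_pos_pos pmf_positive\<close>)
  then show ?thesis unfolding crib_def h by simp
qed

text \<open>U receives one more value, taken with probability \<open>\<theta>\<close> independently
  of the states. The sums over atoms are homogeneous and gain a nonnegative share, \<open>i5\<close>
  is handled by concavity, and the slack of the constraint gains a positive share.\<close>

lemma mix_unif_atom:
  assumes fam: "fam {..<k::nat} q t" and feas: "feas {..<k} (\<lambda>a. atom (q a) (t a)) R1 R2" and \<theta>: "0 < \<theta>" "\<theta> < 1"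
    and s: "(s1, s2) \<in> set_pmf pS" and x: "z x s1 \<noteq> z x' s1"
  shows "\<exists>q' t'. fam {..<Suc k} q' t' \<and> feas {..<Suc k} (\<lambda>a. atom (q' a) (t' a)) ((1 - \<theta>) * R1) ((1 - \<theta>) * R2)
     \<and> H0 < (\<Sum>a<Suc k. crib (atom (q' a) (t' a)))"
proof -
  define q' where "q' a = (if a < k then (\<lambda>s x. (1 - \<theta>) * q a s x) else (\<lambda>_ _. \<theta> * (1 / real CARD('x1))))" for a
  define t' where "t' a = (if a < k then t a else (\<lambda>_ _. 1 / real CARD('x2)))" for a
  let ?\<mu> = "\<lambda>a. atom (q a) (t a)" and ?\<nu> = "\<lambda>a. atom (q' a) (t' a)"
  have fam': "fam {..<Suc k} q' t'"
  proof -
    have "(\<Sum>a<k. \<Sum>x\<in>UNIV. (1 - \<theta>) * q a s x) = 1 - \<theta>" for s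
    proof -
      have "(\<Sum>a<k. \<Sum>x\<in>UNIV. (1 - \<theta>) * q a s x) = (1 - \<theta>) * (\<Sum>a<k. \<Sum>x\<in>UNIV. q a s x)"
        by (simp only: sum_distrib_left)
      then show ?thesis using fam by (simp add: fam_def)
    qed
    then show ?thesis using fam \<theta> unfolding fam_def q'_def t'_def by auto
  qed
  have q0: "0 \<le> q a s x" "0 \<le> t a s' x'" if "a < k" for a s x s' x' using fam that unfolding fam_def by auto
  have n\<mu>: "0 \<le> ?\<mu> a w" if "a < k" for a w using q0[OF that] by (intro atom_nonneg)
  have nu: "0 \<le> unif_atom w" for w unfolding unif_atom_def by (rule atom_nonneg) auto
  have \<nu>: "?\<nu> a = (\<lambda>w. (1 - \<theta>) * ?\<mu> a w)" if "a < k" for a using that by (simp add: q'_def t'_def atom_scale)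
  have \<nu>k: "?\<nu> k = (\<lambda>w. \<theta> * unif_atom w)"
    unfolding unif_atom_def atom_scale[symmetric] by (simp add: q'_def t'_def)
  have sm: "(\<Sum>a<Suc k. F (?\<nu> a)) = (1 - \<theta>) * (\<Sum>a<k. F (?\<mu> a)) + \<theta> * F unif_atom"
    if F: "\<And>\<mu> c. (\<And>w. 0 \<le> \<mu> w) \<Longrightarrow> 0 \<le> c \<Longrightarrow> F (\<lambda>w. c * \<mu> w) = c * F \<mu>" for F :: "_ \<Rightarrow> real"
    using \<theta> n\<mu> nu by (simp add: \<nu> \<nu>k F sum_distrib_left)
  have u: "0 \<le> \<theta> * i1 unif_atom" "0 \<le> \<theta> * i2 unif_atom" "0 \<le> \<theta> * i3 unif_atom" "0 \<le> \<theta> * i5 unif_atom"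
    using \<theta> unfolding unif_atom_def by (auto intro!: mult_nonneg_nonneg info_nonneg)
  have c: "0 < \<theta> * (crib unif_atom - H0)" using crib_unif_atom[OF s x] \<theta> by simp
  define S1 S2 S3 C where "S1 = (\<Sum>a<k. i1 (?\<mu> a))" and "S2 = (\<Sum>a<k. i2 (?\<mu> a))" and "S3 = (\<Sum>a<k. i3 (?\<mu> a))" and "C = (\<Sum>a<k. crib (?\<mu> a)) - H0"
  have s5: "(1 - \<theta>) * i5 (\<lambda>w. \<Sum>a<k. ?\<mu> a w) \<le> i5 (\<lambda>w. \<Sum>a<Suc k. ?\<nu> a w)"
  proof -
    have n: "0 \<le> (\<Sum>a<k. ?\<mu> a w)" for w using n\<mu> by (intro sum_nonneg) auto
    have "(\<Sum>a<Suc k. ?\<nu> a w) = (1 - \<theta>) * (\<Sum>a<k. ?\<mu> a w) + \<theta> * unif_atom w" for w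
      by (simp add: \<nu> \<nu>k sum_distrib_left)
    moreover have "i5 (\<lambda>w. (1 - \<theta>) * (\<Sum>a<k. ?\<mu> a w)) + i5 (\<lambda>w. \<theta> * unif_atom w) \<le> i5 (\<lambda>w. (1 - \<theta>) * (\<Sum>a<k. ?\<mu> a w) + \<theta> * unif_atom w)"
      using n nu \<theta> by (intro i5_add_ge) auto
    moreover have "i5 (\<lambda>w. \<theta> * unif_atom w) = \<theta> * i5 unif_atom" using nu \<theta> by (intro i5_scale) auto
    moreover have "i5 (\<lambda>w. (1 - \<theta>) * (\<Sum>a<k. ?\<mu> a w)) = (1 - \<theta>) * i5 (\<lambda>w. \<Sum>a<k. ?\<mu> a w)" using n \<theta> by (intro i5_scale) auto
    ultimately show ?thesis using u(4) by simp
  qed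
  have f: "R1 \<le> S1 + C" "R2 \<le> S2" "R1 + R2 \<le> S3 + C" "R1 + R2 \<le> i5 (\<lambda>w. \<Sum>a<k. ?\<mu> a w)" "0 \<le> C"
    using feas unfolding feas_def S1_def S2_def S3_def C_def by auto
  have m: "(1 - \<theta>) * a \<le> (1 - \<theta>) * b" if "a \<le> b" for a b using that \<theta> by (intro mult_left_mono) auto
  note M = m[OF f(1)] m[OF f(2)] m[OF f(3)] m[OF f(4)] m[OF f(5)]
  have T: "(\<Sum>a<Suc k. i1 (?\<nu> a)) = (1 - \<theta>) * S1 + \<theta> * i1 unif_atom" "(\<Sum>a<Suc k. i2 (?\<nu> a)) = (1 - \<theta>) * S2 + \<theta> * i2 unif_atom"
    "(\<Sum>a<Suc k. i3 (?\<nu> a)) = (1 - \<theta>) * S3 + \<theta> * i3 unif_atom"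
    "(\<Sum>a<Suc k. crib (?\<nu> a)) - H0 = (1 - \<theta>) * C + \<theta> * (crib unif_atom - H0)"
    unfolding S1_def S2_def S3_def C_def by (subst sm; simp add: scale algebra_simps)+
  have "feas {..<Suc k} ?\<nu> ((1 - \<theta>) * R1) ((1 - \<theta>) * R2)"
    unfolding feas_def T using M u c s5 by (simp only: distrib_left mult_zero_right) linarith
  moreover have "H0 < (\<Sum>a<Suc k. crib (?\<nu> a))" using T(4) c M(5) by simp
  ultimately show ?thesis using fam' by blast
qed

theorem achievability:
  fixes Q :: "'s1 \<Rightarrow> ('x1 \<times> nat) pmf" and T :: "nat \<Rightarrow> 's2 \<Rightarrow> 'x2 pmf" and k :: nat
  assumes supp: "\<And>s1. snd ` set_pmf (Q s1) \<subseteq> {..<k}"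
    and feas: "feas {..<k} (\<lambda>a. atom (qof Q a) (tof T a)) R1 R2" and R: "0 \<le> R1" "0 \<le> R2"
  shows "(R1, R2) \<in> capacity_region pS W z"
proof (cases "\<forall>s1 s2 x x'. (s1, s2) \<in> set_pmf pS \<longrightarrow> z x s1 = z x' s1")
  case True
  then show ?thesis by (intro achievable_degenerate[OF supp feas R]) blast
next
  case False
  then obtain s1 s2 x x' where s: "(s1, s2) \<in> set_pmf pS" "z x s1 \<noteq> z x' s1" by blast
  have mem: "((1 - \<theta>) * R1, (1 - \<theta>) * R2) \<in> capacity_region pS W z" if \<theta>: "0 < \<theta>" "\<theta> < 1" for \<theta>
  proof -
    obtain q' t' where fam: "fam {..<Suc k} q' t'" and f: "feas {..<Suc k} (\<lambda>a. atom (q' a) (t' a)) ((1 - \<theta>) * R1) ((1 - \<theta>) * R2)"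
      and c: "H0 < (\<Sum>a<Suc k. crib (atom (q' a) (t' a)))"
      using mix_unif_atom[OF fam_joint[OF supp] feas \<theta> s] by blast
    obtain Q' T' where Q': "\<And>s1. snd ` set_pmf (Q' s1) \<subseteq> {..<Suc k}" and a: "\<And>a. a < Suc k \<Longrightarrow> atom (qof Q' a) (tof T' a) = atom (q' a) (t' a)"
      using fam_to_pmfs[OF fam] by blast
    have "feas {..<Suc k} (\<lambda>a. atom (qof Q' a) (tof T' a)) ((1 - \<theta>) * R1) ((1 - \<theta>) * R2)"
      using f feas_cong[of "{..<Suc k}" "\<lambda>a. atom (qof Q' a) (tof T' a)" "\<lambda>a. atom (q' a) (t' a)"] a by simp
    moreover have "H0 < (\<Sum>a<Suc k. crib (atom (qof Q' a) (tof T' a)))"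
    proof -
      have "(\<Sum>a<Suc k. crib (atom (qof Q' a) (tof T' a))) = (\<Sum>a<Suc k. crib (atom (q' a) (t' a)))"
        by (rule sum.cong[OF refl], subst a) auto
      then show ?thesis using c by simp
    qed
    ultimately show ?thesis using \<theta> R by (intro achievable_strict[OF Q']) auto
  qed
  \<comment> \<open>The shift by 2 keeps the share strictly between 0 and 1 from the first term
    on.\<close>
  have "(\<lambda>n. ((1 - 1 / real (n + 2)) * R1, (1 - 1 / real (n + 2)) * R2)) \<longlonglongrightarrow> ((1 - 0) * R1, (1 - 0) * R2)"
  proof -
    have "(\<lambda>n. 1 / real (n + 2)) \<longlonglongrightarrow> 0" by real_asymp
    then show ?thesis by (intro tendsto_intros)
  qed
  moreover have "closed (capacity_region pS W z)" unfolding capacity_region_def by simp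
  ultimately have "((1 - 0) * R1, (1 - 0) * R2) \<in> capacity_region pS W z"
    by (rule closed_sequentially[rotated 2]) (auto intro!: mem)
  then show ?thesis by simp
qed

theorem converse_region:
  assumes R: "(R1, R2) \<in> capacity_region pS W z"
    and k: "k = min (CARD('s2) * CARD('s1) * CARD('x1) * CARD('x2) + 2) (CARD('s1) * CARD('s2) * CARD('y) + 3)"
  shows "0 \<le> R1" "0 \<le> R2" "\<exists>q t. fam {..<k} q t \<and> feas {..<k} (\<lambda>a. atom (q a) (t a)) R1 R2"
proof -
  have "capacity_region pS W z \<subseteq> {0..} \<times> {0..}"
    unfolding capacity_region_def by (intro closure_minimal closed_Times) (auto simp: achievable_def)
  then show "0 \<le> R1" "0 \<le> R2" using R by auto
  show "\<exists>q t. fam {..<k} q t \<and> feas {..<k} (\<lambda>a. atom (q a) (t a)) R1 R2"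
  proof (rule feasible_limit)
    fix \<eta> :: real assume \<eta>: "0 < \<eta>"
    \<comment> \<open>Half of \<open>\<eta>\<close> pays for the distance from a limit point to an
      achievable pair, the other half for the loss in \<open>converse\<close>.\<close>
    then obtain r where r: "r \<in> {(R1, R2). achievable pS W z R1 R2}" "dist r (R1, R2) < \<eta> / 2"
      using R closure_approachableD[of "(R1, R2)" _ "\<eta> / 2"] unfolding capacity_region_def by (metis dist_commute half_gt_zero)
    obtain r1 r2 where e: "r = (r1, r2)" by (cases r)
    have "dist r1 R1 < \<eta> / 2" "dist r2 R2 < \<eta> / 2"
      using r(2) dist_fst_le[of r "(R1, R2)"] dist_snd_le[of r "(R1, R2)"] unfolding e by auto
    then have le: "R1 - \<eta> \<le> r1 - \<eta> / 2" "R2 - \<eta> \<le> r2 - \<eta> / 2" unfolding dist_real_def by linarith+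
    have "achievable pS W z r1 r2" using r(1) by (simp add: e)
    then obtain A :: "(nat \<times> (nat \<Rightarrow> 'z) \<times> (nat \<Rightarrow> 's2)) set" and q t where fam: "fam A q t"
      and "feas A (\<lambda>a. atom (q a) (t a)) (r1 - \<eta> / 2) (r2 - \<eta> / 2)" using converse[of r1 r2 "\<eta> / 2"] \<eta> by auto
    then have feas: "feas A (\<lambda>a. atom (q a) (t a)) (R1 - \<eta>) (R2 - \<eta>)" using le unfolding feas_def by linarith
    show "\<exists>q t. fam {..<k} q t \<and> feas {..<k} (\<lambda>a. atom (q a) (t a)) (R1 - \<eta>) (R2 - \<eta>)"
    proof -
      \<comment> \<open>The minimum is attained by one of the two bounds, and the matching reduction
        is applied.\<close>
      have "CARD('s2) * CARD('s1) * CARD('x1) * CARD('x2) + 2 \<le> k \<or> CARD('s1) * CARD('s2) * CARD('y) + 3 \<le> k"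
        unfolding k min_def by auto
      then show ?thesis using cardinality_x[OF fam feas, of k] cardinality_y[OF fam feas, of k] by blast
    qed
  qed
qed

end

theorem theorem2:
  fixes pS :: "('s1::finite \<times> 's2::finite) pmf"
    and W :: "'x1::finite \<Rightarrow> 'x2::finite \<Rightarrow> 's1 \<Rightarrow> 's2 \<Rightarrow> 'y::finite pmf"
    and z :: "'x1 \<Rightarrow> 's1 \<Rightarrow> 'z::finite"
  shows "capacity_region pS W z =
    {(R1, R2). 0 \<le> R1 \<and> 0 \<le> R2 \<and>
      (\<exists>(k::nat) (Q :: 's1 \<Rightarrow> ('x1 \<times> nat) pmf) (T :: nat \<Rightarrow> 's2 \<Rightarrow> 'x2 pmf).
        k \<le> min (CARD('s2) * CARD('s1) * CARD('x1) * CARD('x2) + 2)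
                (CARD('s1) * CARD('s2) * CARD('y) + 3) \<and>
        (\<forall>s1. snd ` set_pmf (Q s1) \<subseteq> {..<k}) \<and>
        (let P = joint_pmf pS Q T W;
             S1 = (\<lambda>(s1, s2, u, x1, x2, y). s1);
             S2 = (\<lambda>(s1, s2, u, x1, x2, y). s2);
             U = (\<lambda>(s1, s2, u, x1, x2, y). u);
             X1 = (\<lambda>(s1, s2, u, x1, x2, y). x1);
             X2 = (\<lambda>(s1, s2, u, x1, x2, y). x2);
             Y = (\<lambda>(s1, s2, u, x1, x2, y). y);
             Z = (\<lambda>\<omega>. z (X1 \<omega>) (S1 \<omega>));
             I_U = cond_mutual_info P U S1 S2;
             H_Z = cond_entropy P Z (\<lambda>\<omega>. (S1 \<omega>, U \<omega>))
         in R1 \<le> cond_mutual_info P X1 Y (\<lambda>\<omega>. (X2 \<omega>, Z \<omega>, S1 \<omega>, S2 \<omega>, U \<omega>)) + H_Z - I_U \<and>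
            R2 \<le> cond_mutual_info P X2 Y (\<lambda>\<omega>. (X1 \<omega>, S1 \<omega>, S2 \<omega>, U \<omega>)) \<and>
            R1 + R2 \<le> cond_mutual_info P (\<lambda>\<omega>. (X1 \<omega>, X2 \<omega>)) Y (\<lambda>\<omega>. (Z \<omega>, S1 \<omega>, S2 \<omega>, U \<omega>))
                        + H_Z - I_U \<and>
            R1 + R2 \<le> cond_mutual_info P (\<lambda>\<omega>. (X1 \<omega>, X2 \<omega>)) Y (\<lambda>\<omega>. (S1 \<omega>, S2 \<omega>)) \<and>
            I_U \<le> H_Z))}"
  (is "_ = {(R1, R2). 0 \<le> R1 \<and> 0 \<le> R2 \<and> (\<exists>k Q T. k \<le> ?K \<and> ?supp k Q \<and> ?region Q T R1 R2)}")
proof -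
  interpret mac pS W z .
  have 1: "0 \<le> R1 \<and> 0 \<le> R2 \<and> (\<exists>k Q T. k \<le> ?K \<and> ?supp k Q \<and> ?region Q T R1 R2)"
    if R: "(R1, R2) \<in> capacity_region pS W z" for R1 R2
  proof -
    obtain q t where fam: "fam {..<?K} q t" and feas: "feas {..<?K} (\<lambda>a. atom (q a) (t a)) R1 R2"
      using converse_region(3)[OF R refl] by blast
    obtain Q T where Q: "\<And>s1. snd ` set_pmf (Q s1) \<subseteq> {..<?K}" and a: "\<And>a. a < ?K \<Longrightarrow> atom (qof Q a) (tof T a) = atom (q a) (t a)"
      using fam_to_pmfs[OF fam] by blast
    have "feas {..<?K} (\<lambda>a. atom (qof Q a) (tof T a)) R1 R2" using feas feas_cong[of "{..<?K}" "\<lambda>a. atom (qof Q a) (tof T a)" "\<lambda>a. atom (q a) (t a)"] a by blast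
    then have "?region Q T R1 R2" by (rule iffD2[OF region_iff_feas[OF Q]])
    then show ?thesis using Q converse_region(1,2)[OF R refl] by blast
  qed
  have 2: "(R1, R2) \<in> capacity_region pS W z" if R: "0 \<le> R1" "0 \<le> R2" and Q: "?supp k Q" and reg: "?region Q T R1 R2" for R1 R2 k Q T
  proof -
    have supp: "\<And>s1. snd ` set_pmf (Q s1) \<subseteq> {..<k}" using Q by blast
    show ?thesis by (rule achievability[OF supp iffD1[OF region_iff_feas[OF supp] reg] R])
  qed
  show ?thesis
  proof (rule set_eqI)
    fix r :: "real \<times> real"
    obtain R1 R2 where r: "r = (R1, R2)" by (cases r)
    show "r \<in> capacity_region pS W z \<longleftrightarrow> r \<in> {(R1, R2). 0 \<le> R1 \<and> 0 \<le> R2 \<and> (\<exists>k Q T. k \<le> ?K \<and> ?supp k Q \<and> ?region Q T R1 R2)}"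
      unfolding r mem_Collect_eq prod.case using 1[of R1 R2] 2[of R1 R2] by (intro iffI) blast+
  qed
qed

end
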